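(* Work in the generalised semi-varying coefficient model with the notation of the context. Assume the following. (1) The kernel $K(\cdot)$ is a continuous and symmetric probability density function with compact support. (2a) $\mathsf E(Q_{i1}\mid X_i,U_i)=0$ a.s., $u\mapsto\mathsf E(Q_{i1}^2\mid U_i=u)$ is continuous for $u\in[0,1]$, and for some $m_0>2$, uniformly for $u\in[0,1]$, $$\max_{1\le j\le d_n}\mathsf E[|Q_{i1}x_{ij}|^{m_0}\mid U_i=u]+\max_{1\le j,k\le d_n}\mathsf E[|Q_{i2}x_{ij}x_{ik}|^{m_0}\mid U_i=u]<\infty\quad\text{a.s.}$$ (2b) $q_2(s,y)<0$ for all $s\in\mathbb R$ and all $y$ in the range of the response variable; and there exists $M(X,U,y)>0$ such that, with $r(X,U)=\sum_{j=1}^{d_n}a_j(U)x_j$, $|q_2[r(X,U)+\delta_*,y]-q_2[r(X,U),y]|\le M(X,U,y)|\delta_*|$ and, uniformly for $u\in[0,1]$, $\max_{1\le j,k,l\le d_n}\mathsf E[|x_{ij}x_{ik}x_{il}M(X_i,U_i,y_i)|^{m_0}\mid U_i=u]<\infty$ a.s. (2c) There exist constants $0<\rho_1\le\rho_2<\infty$ such that, with probability approaching one, $$\rho_1\le\inf_{u\in[0,1]}\inf_{\mathbf v\in\boldsymbol\Omega_0(b)}\mathbf v^{\mathrm T}[-\ddot{\mathcal L}_n(u)]\mathbf v\le\sup_{u\in[0,1]}\sup_{\mathbf v\in\boldsymbol\Omega_0(b)}\mathbf v^{\mathrm T}[-\ddot{\mathcal L}_n(u)]\mathbf v\le\rho_2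 .$$ (3) The density $f_U(\cdot)$ of $U$ has a continuous second-order derivative, and $f_U(u)$ is bounded away from zero and infinity for $u\in[0,1]$. (4) The functional coefficients $a_j(\cdot)$ have continuous second-order derivatives for $j=1,\ldots,d_n$. (5) $d_n\propto n^{\tau_1}$ with $0\le\tau_1<\infty$; $\frac{nh}{(nd_n^3)^{2/m_0}\log h^{-1}}\to\infty$; $h\propto n^{-\delta_1}$ with $0<\delta_1<1$; $s_{n2}h^2+\left(\frac{\log h^{-1}}{nh}\right)^{1/2}=o(\lambda_1)$; $\lambda_1\propto\lambda_2$; and $s_{n2}\lambda_1^2h^{-2}+s_{n2}^2\lambda_1=o(1)$. (6a) $s_{n2}h^2\propto(nh)^{-1/2}$, $\lambda_4\sim\lambda_4^\ast$, $\lambda_4=o(n^{1/2})$, and $h^{-1/2}\left[(\log h^{-1})^{1/2}+s_{n2}^{1/2}(1+\lambda_1\sqrt{nh})\right]=o(\lambda_4)$. (6b) There exists a constant $b_\diamond>0$ such that, with probability approaching one, $\min_{1\le j\le s_{n2}}\|\boldsymbol\alpha_{j0}\|\ge b_\diamond n^{1/2}$ and $\min_{1\le j\le s_{n1}}D_j\ge b_\diamond n^{1/2}$. Furthermore, uniformly for $k=s_{n2}+1,\ldots,d_n,d_n+s_{n1}+1,\ldots,2d_n$, $$\sup_{u\in[0,1]}\sup_{\|\mathbf w^o\|=1}\left|\ddot{\mathcal L}_n(u\mid k)\,\mathbf w^o\right|=O_P(1),$$ where $\ddot{\mathcal L}_n(u\mid k)$ is the $k$th row of $\ddot{\mathcal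 L}_n(u)$ and $\mathbf w^o=[(\mathbf w_1^o)^{\mathrm T},(\mathbf w_2^o)^{\mathrm T}]^{\mathrm T}$ ranges over unit vectors such that $\mathbf w_1^o,\mathbf w_2^o\in\mathbb R^{d_n}$, the last $d_n-s_{n2}$ elements of $\mathbf w_1^o$ are zero and the last $d_n-s_{n1}$ elements of $\mathbf w_2^o$ are zero. Then, with probability approaching one, the maximiser $(\overline{\mathcal A}_n,\overline{\mathcal B}_n)$ of the group-SCAD objective function $\mathcal Q_n^2(\cdot,\cdot)$ exists and equals the biased oracle estimator $(\overline{\mathcal A}_n^{bo},\overline{\mathcal B}_n^{bo})$. Furthermore, $$\frac1n\left\|\overline{\mathcal A}_n^{bo}-\mathcal A_0\right\|^2=O_P\!\left(\frac{s_{n2}}{nh}\right),\qquad\frac1n\left\|\overline{\mathcal B}_n^{bo}-\mathcal B_0\right\|^2=O_P\!\left(\frac{s_{n2}}{nh^3}\right).$$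
   Context: Conventions: limits are as $n\to\infty$; $\alpha_n\propto\beta_n$ means $c_1\beta_n\le\alpha_n\le c_2\beta_n$ for all sufficiently large $n$, for some constants $0<c_1\le c_2<\infty$; $\alpha_n\sim\beta_n$ means $\alpha_n/\beta_n\to1$; $\|\mathbf u\|^2=\mathbf u^{\mathrm T}\mathbf u$; $\dot f,\ddot f$ denote first and second derivatives of a function $f$ of one variable; $z_+=\max(z,0)$. Model. $(U_i,X_i,y_i)$, $i=1,\ldots,n$, is an independent and identically distributed sample, where $X_i=(x_{i1},\ldots,x_{id_n})^{\mathrm T}$ is a vector of covariates whose dimension $d_n$ depends on $n$ with $d_n\to\infty$ (possibly larger than $n$), the index variable $U$ has support $[0,1]$, and $y$ is the response. With $m(U,X)=\mathsf E(y\mid U,X)$, the log conditional density (or log probability mass function) of $y$ given $(U,X)$ is $\ell(m(U,X),y)$ with $g(m(U,X))=\sum_{j=1}^{d_n}a_j(U)x_j$, where $\ell$ and the link $g$ are known and the functional coefficients $a_j(\cdot)$ are unknown. There are integers $1\le s_{n1}<s_{n2}<d_n$ such that $a_j(\cdot)$ is non-constant for $1\le j\le s_{n1}$, $a_j(\cdot)\equiv c_j$ is a nonzero constant for $s_{n1}+1\le j\le s_{n2}$, and $a_j(\cdot)\equiv0$ for $s_{n2}+1\le j\le d_n$; $s_{n2}$ may diverge with $n$ but is much smaller than $n$ and $d_n$. Put $\mathbf a_{k0}=[a_1(U_k),\ldots,a_{d_n}(U_k)]^{\mathrm T}$, $\mathbf b_{k0}=[\dot a_1(U_k),\ldots,\dot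 a_{d_n}(U_k)]^{\mathrm T}$, $\mathcal A_0=(\mathbf a_{10}^{\mathrm T},\ldots,\mathbf a_{n0}^{\mathrm T})^{\mathrm T}$, $\mathcal B_0=(\mathbf b_{10}^{\mathrm T},\ldots,\mathbf b_{n0}^{\mathrm T})^{\mathrm T}$, $\boldsymbol\alpha_{j0}=[a_j(U_1),\ldots,a_j(U_n)]^{\mathrm T}$, and $D_j=\{\sum_{k=1}^n[a_j(U_k)-\frac1n\sum_{l=1}^na_j(U_l)]^2\}^{1/2}$. Derivatives of the log-likelihood. $q_1(s,y)=\partial\ell[g^{-1}(s),y]/\partial s$, $q_2(s,y)=\partial^2\ell[g^{-1}(s),y]/\partial s^2$, $Q_{i1}=q_1[\sum_{j=1}^{d_n}a_j(U_i)x_{ij},y_i]$, $Q_{i2}=q_2[\sum_{j=1}^{d_n}a_j(U_i)x_{ij},y_i]$. Preliminary estimator. With kernel $K$, bandwidth $h$, $K_h(\cdot)=h^{-1}K(\cdot/h)$, $\mathbf a_k=(\alpha_{1k},\ldots,\alpha_{d_nk})^{\mathrm T}$ and $\mathbf b_k=(\beta_{1k},\ldots,\beta_{d_nk})^{\mathrm T}$, let $$\mathcal L_{nk}(\mathbf a_k,\mathbf b_k)=\frac1n\sum_{i=1}^n\ell\Big(g^{-1}\Big\{\sum_{j=1}^{d_n}[\alpha_{jk}+\beta_{jk}(U_i-U_k)]x_{ij}\Big\},y_i\Big)K_h(U_i-U_k).$$ $(\widetilde{\mathbf a}_k,\widetilde{\mathbf b}_k)$ is the maximiser of $\mathcal L_{nk}(\mathbf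 a_k,\mathbf b_k)-\lambda_1\sum_{j=1}^{d_n}|\alpha_{jk}|-\lambda_2\sum_{j=1}^{d_n}h|\beta_{jk}|$, with tuning parameters $\lambda_1,\lambda_2$. Write $\widetilde{\mathbf a}_k=[\widetilde a_1(U_k),\ldots,\widetilde a_{d_n}(U_k)]^{\mathrm T}$, $\widetilde{\mathcal A}_n=(\widetilde{\mathbf a}_1^{\mathrm T},\ldots,\widetilde{\mathbf a}_n^{\mathrm T})^{\mathrm T}$, $\widetilde{\mathcal B}_n=(\widetilde{\mathbf b}_1^{\mathrm T},\ldots,\widetilde{\mathbf b}_n^{\mathrm T})^{\mathrm T}$, $\widetilde{\boldsymbol\alpha}_j=[\widetilde a_j(U_1),\ldots,\widetilde a_j(U_n)]^{\mathrm T}$, and $\widetilde D_j=\{\sum_{k=1}^n[\widetilde a_j(U_k)-\frac1n\sum_{l=1}^n\widetilde a_j(U_l)]^2\}^{1/2}$. Quadratic approximation. For $\mathcal A=(\mathbf a_1^{\mathrm T},\ldots,\mathbf a_n^{\mathrm T})^{\mathrm T}$, $\mathcal B=(\mathbf b_1^{\mathrm T},\ldots,\mathbf b_n^{\mathrm T})^{\mathrm T}$, let $\mathcal L_n(\mathcal A,\mathcal B)=\sum_{k=1}^n\mathcal L_{nk}(\mathbf a_k,\mathbf b_k)$, $\mathcal V_n(\mathcal A,h\mathcal B)=(\mathbf a_1^{\mathrm T},h\mathbf b_1^{\mathrm T},\ldots,\mathbf a_n^{\mathrm T},h\mathbf b_n^{\mathrm T})^{\mathrm T}$, $\boldsymbol\beta_j=(\beta_{j1},\ldots,\beta_{jn})^{\mathrm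 T}$, $\boldsymbol\alpha_j=(\alpha_{j1},\ldots,\alpha_{jn})^{\mathrm T}$, $$\dot{\mathcal L}_{nk}(\mathbf a_k,\mathbf b_k)=\frac1n\sum_{i=1}^nq_1\Big\{\sum_{j=1}^{d_n}[\alpha_{jk}+\beta_{jk}(U_i-U_k)]x_{ij},y_i\Big\}\begin{pmatrix}X_i\\ \frac{U_i-U_k}{h}X_i\end{pmatrix}K_h(U_i-U_k),$$ $$\ddot{\mathcal L}_{nk}(\mathbf a_k,\mathbf b_k,l)=\frac1n\sum_{i=1}^nq_2\Big\{\sum_{j=1}^{d_n}[\alpha_{jk}+\beta_{jk}(U_i-U_k)]x_{ij},y_i\Big\}\Big(\frac{U_i-U_k}{h}\Big)^lX_iX_i^{\mathrm T}K_h(U_i-U_k),\quad l=0,1,2,$$ $$\ddot{\mathcal L}_{nk}(\mathbf a_k,\mathbf b_k)=\begin{pmatrix}\ddot{\mathcal L}_{nk}(\mathbf a_k,\mathbf b_k,0)&\ddot{\mathcal L}_{nk}(\mathbf a_k,\mathbf b_k,1)\\ \ddot{\mathcal L}_{nk}(\mathbf a_k,\mathbf b_k,1)&\ddot{\mathcal L}_{nk}(\mathbf a_k,\mathbf b_k,2)\end{pmatrix},$$ $\dot{\mathcal L}_n(\mathcal A,\mathcal B)=[\dot{\mathcal L}_{n1}^{\mathrm T}(\mathbf a_1,\mathbf b_1),\ldots,\dot{\mathcal L}_{nn}^{\mathrm T}(\mathbf a_n,\mathbf b_n)]^{\mathrm T}$, and $\ddot{\mathcal L}_n(\mathcal A,\mathcal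 B)$ the block-diagonal matrix with diagonal blocks $\ddot{\mathcal L}_{n1}(\mathbf a_1,\mathbf b_1),\ldots,\ddot{\mathcal L}_{nn}(\mathbf a_n,\mathbf b_n)$. With $\Delta=\mathcal V_n(\mathcal A,h\mathcal B)-\mathcal V_n(\widetilde{\mathcal A}_n,h\widetilde{\mathcal B}_n)$, set $$\mathcal L_n^\diamond(\mathcal A,\mathcal B)=\mathcal L_n(\widetilde{\mathcal A}_n,\widetilde{\mathcal B}_n)+\Delta^{\mathrm T}\dot{\mathcal L}_n(\widetilde{\mathcal A}_n,\widetilde{\mathcal B}_n)+\tfrac12\Delta^{\mathrm T}\ddot{\mathcal L}_n(\widetilde{\mathcal A}_n,\widetilde{\mathcal B}_n)\Delta .$$ Group-SCAD objective. For a tuning parameter $\lambda>0$ and $z\ge0$, the SCAD derivative is $\dot p_\lambda(z)=\lambda\big[I(z\le\lambda)+\frac{(a_0\lambda-z)_+}{(a_0-1)\lambda}I(z>\lambda)\big]$ with $a_0=3.7$. With tuning parameters $\lambda_4,\lambda_4^\ast$, $$\mathcal Q_n^2(\mathcal A,\mathcal B)=\mathcal L_n^\diamond(\mathcal A,\mathcal B)-\sum_{j=1}^{d_n}\dot p_{\lambda_4}(\|\widetilde{\boldsymbol\alpha}_j\|)\|\boldsymbol\alpha_j\|-\sum_{j=1}^{d_n}\dot p_{\lambda_4^\ast}(\widetilde D_j)\|h\boldsymbol\beta_j\|.$$ $(\overline{\mathcal A}_n,\overline{\mathcal B}_n)$ denotes the maximiser of $\mathcal Q_n^2$ over all $(\mathcal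 A,\mathcal B)$. Biased oracle estimator. $(\overline{\mathcal A}_n^{bo},\overline{\mathcal B}_n^{bo})$ denotes the maximiser of $\mathcal Q_n^2(\mathcal A^o,\mathcal B^o)$ over all $\mathcal A^o=[(\mathbf a_1^o)^{\mathrm T},\ldots,(\mathbf a_n^o)^{\mathrm T}]^{\mathrm T}$ and $\mathcal B^o=[(\mathbf b_1^o)^{\mathrm T},\ldots,(\mathbf b_n^o)^{\mathrm T}]^{\mathrm T}$ where each $\mathbf a_k^o\in\mathbb R^{d_n}$ has its last $d_n-s_{n2}$ elements equal to zero and each $\mathbf b_k^o\in\mathbb R^{d_n}$ has its last $d_n-s_{n1}$ elements equal to zero. Objects in the restricted eigenvalue condition. $\ddot{\mathcal L}_n(u)$ (one argument $u\in[0,1]$) is the $2d_n\times2d_n$ matrix $$\ddot{\mathcal L}_n(u)=\begin{pmatrix}\ddot{\mathcal L}_n(u,0)&\ddot{\mathcal L}_n(u,1)\\ \ddot{\mathcal L}_n(u,1)&\ddot{\mathcal L}_n(u,2)\end{pmatrix},\qquad \ddot{\mathcal L}_n(u,l)=\frac1n\sum_{i=1}^nq_2\Big[\sum_{j=1}^{d_n}a_j(U_i)x_{ij},y_i\Big]X_iX_i^{\mathrm T}\Big(\frac{U_i-u}{h}\Big)^lK_h(U_i-u).$$ $b=\max\{\lambda_1/\lambda_2,\lambda_2/\lambda_1\}+\delta$ for any $\delta>0$, and $$\boldsymbol\Omega_0(b)=\Big\{\mathbf v=(v_{11},\ldots,v_{1d_n},v_{21},\ldots,v_{2d_n})^{\mathrm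 T}:\|\mathbf v\|=1,\ \sum_{j=1}^{d_n}(|v_{1j}|+|v_{2j}|)\le2(1+b)\sum_{j=1}^{s_{n2}}(|v_{1j}|+|v_{2j}|)\Big\}.$$
   Formalization: In condition (4) the second derivatives of the coefficients a_j are assumed bounded by one constant for all j≤d_n and all n; without this, coefficients oscillating faster as n grows violate the stated rates. The moment bounds in (2a), (2b) are read as uniform in n. *)

theory Defs
  imports "HOL-Probability.Probability" "HOL-Library.Landau_Symbols"
begin

text \<open>
  Vectors in $\mathbb{R}^m$ are functions on the index set \<open>{1..m}\<close>, and the Euclidean norm is
  \<open>L2_set v {1..m}\<close>.  A pair $(\mathcal A,\mathcal B)$ is a pair of functions
  \<open>A k j\<close>, \<open>B k j\<close> with \<open>k\<close> the observation and \<open>j\<close> the covariate, so that the vector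
  $\mathbf a_k$ is \<open>A k\<close> and the vector $\boldsymbol\alpha_j$ is \<open>\<lambda>k. A k j\<close>.
\<close>

section \<open>Asymptotic notions\<close>

definition prop_to :: "(nat \<Rightarrow> real) \<Rightarrow> (nat \<Rightarrow> real) \<Rightarrow> bool"  (infix "\<propto>" 50) where
  "\<alpha> \<propto> \<beta> \<longleftrightarrow>
    (\<exists>c1 c2. 0 < c1 \<and> c1 \<le> c2 \<and> (\<forall>\<^sub>F n in sequentially. c1 * \<beta> n \<le> \<alpha> n \<and> \<alpha> n \<le> c2 * \<beta> n))"

text \<open>
  Each sample size \<open>n\<close> has its own probability space \<open>M n\<close>.  The events of interest involve
  suprema over uncountable sets and arbitrary choices of maximisers, so they need not be
  measurable; probabilities are therefore bounded through measurable subevents (for measurable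
  events this is the usual notion).
\<close>

definition wp_to_1 :: "(nat \<Rightarrow> 'w measure) \<Rightarrow> (nat \<Rightarrow> 'w \<Rightarrow> bool) \<Rightarrow> bool" where
  "wp_to_1 M P \<longleftrightarrow>
    (\<exists>E. (\<forall>n. E n \<in> sets (M n) \<and> (\<forall>\<omega>\<in>E n. P n \<omega>)) \<and> (\<lambda>n. measure (M n) (E n)) \<longlonglongrightarrow> 1)"

definition bigO_P :: "(nat \<Rightarrow> 'w measure) \<Rightarrow> (nat \<Rightarrow> 'w \<Rightarrow> ereal) \<Rightarrow> (nat \<Rightarrow> real) \<Rightarrow> bool" where
  "bigO_P M Z r \<longleftrightarrow>
    (\<forall>\<epsilon>>0. \<exists>C. \<forall>\<^sub>F n in sequentially.
       \<exists>E\<in>sets (M n). measure (M n) E \<ge> 1 - \<epsilon> \<and> (\<forall>\<omega>\<in>E. \<bar>Z n \<omega>\<bar> \<le> ereal (C * r n)))"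

section \<open>Model\<close>

definition sigma_of :: "'w measure \<Rightarrow> ('w \<Rightarrow> 'b) \<Rightarrow> 'b measure \<Rightarrow> 'w measure" where
  "sigma_of M f N = vimage_algebra (space M) f N"

definition covariate_space :: "nat \<Rightarrow> (real \<times> (nat \<Rightarrow> real)) measure" where
  "covariate_space d = borel \<Otimes>\<^sub>M (\<Pi>\<^sub>M j\<in>{1..d}. borel)"

definition obs_space :: "nat \<Rightarrow> ((real \<times> (nat \<Rightarrow> real)) \<times> real) measure" where
  "obs_space d = covariate_space d \<Otimes>\<^sub>M borel"

text \<open>
  The conditional law of the response is given by a density on its range \<open>Y\<close> or by a
  probability mass function on the countable range \<open>Y\<close>; \<open>\<nu>\<close> is the dominating measure.
\<close>

definition response_measure :: "real set \<Rightarrow> real measure \<Rightarrow> bool" where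
  "response_measure Y \<nu> \<longleftrightarrow>
     Y \<in> sets borel \<and> \<nu> = density lborel (indicator Y) \<or>
     countable Y \<and> \<nu> = distr (count_space Y) borel id"

definition D1 :: "(real \<Rightarrow> real) \<Rightarrow> real \<Rightarrow> real" where
  "D1 f u = vector_derivative f (at u within {0..1})"

definition C2_unit :: "(real \<Rightarrow> real) \<Rightarrow> bool" where
  "C2_unit f \<longleftrightarrow> f differentiable_on {0..1} \<and> D1 f differentiable_on {0..1} \<and>
     continuous_on {0..1} (D1 (D1 f))"

text \<open>In \<open>q1\<close> and \<open>q2\<close>, the argument \<open>L s y\<close> stands for $\ell(g^{-1}(s),y)$.\<close>

definition q1 :: "(real \<Rightarrow> real \<Rightarrow> real) \<Rightarrow> real \<Rightarrow> real \<Rightarrow> real" where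
  "q1 L s y = deriv (\<lambda>t. L t y) s"

definition q2 :: "(real \<Rightarrow> real \<Rightarrow> real) \<Rightarrow> real \<Rightarrow> real \<Rightarrow> real" where
  "q2 L s y = deriv (\<lambda>t. q1 L t y) s"

section \<open>Local likelihood\<close>

text \<open>
  The realised sample together with everything the criteria depend on; \<open>ll s y\<close> is
  $\ell(g^{-1}(s),y)$.
\<close>

record fitdata =
  nobs :: nat
  ncov :: nat
  bw :: real
  kern :: "real \<Rightarrow> real"
  ll :: "real \<Rightarrow> real \<Rightarrow> real"
  idx :: "nat \<Rightarrow> real"
  cov :: "nat \<Rightarrow> nat \<Rightarrow> real"
  resp :: "nat \<Rightarrow> real"

definition Kh :: "fitdata \<Rightarrow> real \<Rightarrow> real" where
  "Kh D z = kern D (z / bw D) / bw D"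

definition lin_pred :: "fitdata \<Rightarrow> nat \<Rightarrow> (nat \<Rightarrow> real) \<Rightarrow> (nat \<Rightarrow> real) \<Rightarrow> nat \<Rightarrow> real" where
  "lin_pred D k \<alpha> \<beta> i = (\<Sum>j=1..ncov D. (\<alpha> j + \<beta> j * (idx D i - idx D k)) * cov D i j)"

definition true_pred :: "fitdata \<Rightarrow> (nat \<Rightarrow> real \<Rightarrow> real) \<Rightarrow> nat \<Rightarrow> real" where
  "true_pred D a i = (\<Sum>j=1..ncov D. a j (idx D i) * cov D i j)"

definition loc_lik :: "fitdata \<Rightarrow> nat \<Rightarrow> (nat \<Rightarrow> real) \<Rightarrow> (nat \<Rightarrow> real) \<Rightarrow> real" where
  "loc_lik D k \<alpha> \<beta> =
    (1 / real (nobs D)) *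
    (\<Sum>i=1..nobs D. ll D (lin_pred D k \<alpha> \<beta> i) (resp D i) * Kh D (idx D i - idx D k))"

definition prelim_obj ::
  "fitdata \<Rightarrow> real \<Rightarrow> real \<Rightarrow> nat \<Rightarrow> (nat \<Rightarrow> real) \<times> (nat \<Rightarrow> real) \<Rightarrow> real" where
  "prelim_obj D l1 l2 k = (\<lambda>(\<alpha>, \<beta>).
     loc_lik D k \<alpha> \<beta> - l1 * (\<Sum>j=1..ncov D. \<bar>\<alpha> j\<bar>) - l2 * (\<Sum>j=1..ncov D. bw D * \<bar>\<beta> j\<bar>))"

text \<open>Block vectors and matrices of size \<open>2 * d\<close>, indexed by \<open>{1..2*d}\<close>.\<close>

definition stack :: "nat \<Rightarrow> (nat \<Rightarrow> real) \<Rightarrow> (nat \<Rightarrow> real) \<Rightarrow> nat \<Rightarrow> real" where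
  "stack d v w p = (if p \<le> d then v p else w (p - d))"

definition block_matrix ::
  "nat \<Rightarrow> (nat \<Rightarrow> nat \<Rightarrow> real) \<Rightarrow> (nat \<Rightarrow> nat \<Rightarrow> real) \<Rightarrow> (nat \<Rightarrow> nat \<Rightarrow> real) \<Rightarrow>
   (nat \<Rightarrow> nat \<Rightarrow> real) \<Rightarrow> nat \<Rightarrow> nat \<Rightarrow> real" where
  "block_matrix d P Q R S p q =
    (if p \<le> d then (if q \<le> d then P p q else Q p (q - d))
     else (if q \<le> d then R (p - d) q else S (p - d) (q - d)))"

definition quad_form :: "nat \<Rightarrow> (nat \<Rightarrow> nat \<Rightarrow> real) \<Rightarrow> (nat \<Rightarrow> real) \<Rightarrow> real" where
  "quad_form m H v = (\<Sum>p=1..m. \<Sum>q=1..m. v p * H p q * v q)"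

definition loc_score :: "fitdata \<Rightarrow> nat \<Rightarrow> (nat \<Rightarrow> real) \<Rightarrow> (nat \<Rightarrow> real) \<Rightarrow> nat \<Rightarrow> real" where
  "loc_score D k \<alpha> \<beta> p =
    (1 / real (nobs D)) *
    (\<Sum>i=1..nobs D. q1 (ll D) (lin_pred D k \<alpha> \<beta> i) (resp D i) *
       stack (ncov D) (cov D i) (\<lambda>j. (idx D i - idx D k) / bw D * cov D i j) p *
       Kh D (idx D i - idx D k))"

text \<open>
  The matrices $\ddot{\mathcal L}_{nk}(\mathbf a_k,\mathbf b_k)$ and $\ddot{\mathcal L}_n(u)$
  differ only in the predictor values \<open>\<eta> i\<close> at which the second derivative is taken
  and in the centre \<open>u\<close>.
\<close>

definition hess_block :: "fitdata \<Rightarrow> (nat \<Rightarrow> real) \<Rightarrow> real \<Rightarrow> nat \<Rightarrow> nat \<Rightarrow> nat \<Rightarrow> real" where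
  "hess_block D \<eta> u l j j' =
    (1 / real (nobs D)) *
    (\<Sum>i=1..nobs D. q2 (ll D) (\<eta> i) (resp D i) * ((idx D i - u) / bw D) ^ l *
       (cov D i j * cov D i j') * Kh D (idx D i - u))"

definition hess :: "fitdata \<Rightarrow> (nat \<Rightarrow> real) \<Rightarrow> real \<Rightarrow> nat \<Rightarrow> nat \<Rightarrow> real" where
  "hess D \<eta> u =
    block_matrix (ncov D) (hess_block D \<eta> u 0) (hess_block D \<eta> u 1)
                          (hess_block D \<eta> u 1) (hess_block D \<eta> u 2)"

definition loc_hess ::
  "fitdata \<Rightarrow> nat \<Rightarrow> (nat \<Rightarrow> real) \<Rightarrow> (nat \<Rightarrow> real) \<Rightarrow> nat \<Rightarrow> nat \<Rightarrow> real" where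
  "loc_hess D k \<alpha> \<beta> = hess D (lin_pred D k \<alpha> \<beta>) (idx D k)"

definition true_hess :: "fitdata \<Rightarrow> (nat \<Rightarrow> real \<Rightarrow> real) \<Rightarrow> real \<Rightarrow> nat \<Rightarrow> nat \<Rightarrow> real" where
  "true_hess D a u = hess D (true_pred D a) u"

section \<open>Group-SCAD objective\<close>

definition big_lik :: "fitdata \<Rightarrow> (nat \<Rightarrow> nat \<Rightarrow> real) \<Rightarrow> (nat \<Rightarrow> nat \<Rightarrow> real) \<Rightarrow> real" where
  "big_lik D A B = (\<Sum>k=1..nobs D. loc_lik D k (A k) (B k))"

text \<open>
  $\mathcal V_n(\mathcal A,h\mathcal B)$, with its entries indexed by the block \<open>k\<close> and the
  position \<open>p\<close> in \<open>{1..2*d}\<close> inside it.  In these coordinates the quadratic form of the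
  block-diagonal matrix $\ddot{\mathcal L}_n$ is the sum of those of its blocks.
\<close>

definition big_vec ::
  "fitdata \<Rightarrow> (nat \<Rightarrow> nat \<Rightarrow> real) \<Rightarrow> (nat \<Rightarrow> nat \<Rightarrow> real) \<Rightarrow> nat \<Rightarrow> nat \<Rightarrow> real" where
  "big_vec D A B k = stack (ncov D) (A k) (\<lambda>j. bw D * B k j)"

definition quad_lik ::
  "fitdata \<Rightarrow> (nat \<Rightarrow> nat \<Rightarrow> real) \<Rightarrow> (nat \<Rightarrow> nat \<Rightarrow> real) \<Rightarrow>
   (nat \<Rightarrow> nat \<Rightarrow> real) \<Rightarrow> (nat \<Rightarrow> nat \<Rightarrow> real) \<Rightarrow> real" where
  "quad_lik D At Bt A B =
    (let \<Delta> = (\<lambda>k p. big_vec D A B k p - big_vec D At Bt k p) in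
     big_lik D At Bt
     + (\<Sum>k=1..nobs D. \<Sum>p=1..2 * ncov D. \<Delta> k p * loc_score D k (At k) (Bt k) p)
     + 1 / 2 * (\<Sum>k=1..nobs D. quad_form (2 * ncov D) (loc_hess D k (At k) (Bt k)) (\<Delta> k)))"

definition scad_deriv :: "real \<Rightarrow> real \<Rightarrow> real" where
  "scad_deriv l z =
    (let a0 = 3.7 in
     l * (of_bool (z \<le> l) + max (a0 * l - z) 0 / ((a0 - 1) * l) * of_bool (z > l)))"

definition centred_norm :: "nat \<Rightarrow> (nat \<Rightarrow> real) \<Rightarrow> real" where
  "centred_norm n f = L2_set (\<lambda>k. f k - (1 / real n) * (\<Sum>l=1..n. f l)) {1..n}"

definition scad_obj ::
  "fitdata \<Rightarrow> (nat \<Rightarrow> nat \<Rightarrow> real) \<Rightarrow> (nat \<Rightarrow> nat \<Rightarrow> real) \<Rightarrow> real \<Rightarrow> real \<Rightarrow>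
   (nat \<Rightarrow> nat \<Rightarrow> real) \<times> (nat \<Rightarrow> nat \<Rightarrow> real) \<Rightarrow> real" where
  "scad_obj D At Bt l4 l4s = (\<lambda>(A, B).
     quad_lik D At Bt A B
     - (\<Sum>j=1..ncov D. scad_deriv l4 (L2_set (\<lambda>k. At k j) {1..nobs D})
                        * L2_set (\<lambda>k. A k j) {1..nobs D})
     - (\<Sum>j=1..ncov D. scad_deriv l4s (centred_norm (nobs D) (\<lambda>k. At k j))
                        * L2_set (\<lambda>k. bw D * B k j) {1..nobs D}))"

text \<open>
  The domains of the criteria.  Extensional functions make the coefficient arrays on the
  relevant indices unique as functions, so that equality of maximisers is plain equality.
\<close>

definition vecs :: "nat \<Rightarrow> (nat \<Rightarrow> real) set" where
  "vecs m = {1..m} \<rightarrow>\<^sub>E UNIV"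

definition arrays :: "nat \<Rightarrow> nat \<Rightarrow> (nat \<Rightarrow> nat \<Rightarrow> real) set" where
  "arrays n d = {1..n} \<rightarrow>\<^sub>E vecs d"

definition oracle_arrays ::
  "nat \<Rightarrow> nat \<Rightarrow> nat \<Rightarrow> nat \<Rightarrow> ((nat \<Rightarrow> nat \<Rightarrow> real) \<times> (nat \<Rightarrow> nat \<Rightarrow> real)) set" where
  "oracle_arrays n d s1 s2 =
    {(A, B). A \<in> arrays n d \<and> B \<in> arrays n d \<and>
       (\<forall>k\<in>{1..n}. (\<forall>j\<in>{s2+1..d}. A k j = 0) \<and> (\<forall>j\<in>{s1+1..d}. B k j = 0))}"

text \<open>
  \<open>arg_max\<close> picks some maximiser; where it is used below, existence and uniqueness are part of
  the claim (with probability approaching one).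
\<close>

definition scad_est ::
  "fitdata \<Rightarrow> (nat \<Rightarrow> nat \<Rightarrow> real) \<Rightarrow> (nat \<Rightarrow> nat \<Rightarrow> real) \<Rightarrow> real \<Rightarrow> real \<Rightarrow>
   (nat \<Rightarrow> nat \<Rightarrow> real) \<times> (nat \<Rightarrow> nat \<Rightarrow> real)" where
  "scad_est D At Bt l4 l4s =
    arg_max (scad_obj D At Bt l4 l4s)
      (\<lambda>p. p \<in> arrays (nobs D) (ncov D) \<times> arrays (nobs D) (ncov D))"

definition oracle_est ::
  "fitdata \<Rightarrow> nat \<Rightarrow> nat \<Rightarrow> (nat \<Rightarrow> nat \<Rightarrow> real) \<Rightarrow> (nat \<Rightarrow> nat \<Rightarrow> real) \<Rightarrow> real \<Rightarrow> real \<Rightarrow>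
   (nat \<Rightarrow> nat \<Rightarrow> real) \<times> (nat \<Rightarrow> nat \<Rightarrow> real)" where
  "oracle_est D s1 s2 At Bt l4 l4s =
    arg_max (scad_obj D At Bt l4 l4s) (\<lambda>p. p \<in> oracle_arrays (nobs D) (ncov D) s1 s2)"

definition array_norm :: "nat \<Rightarrow> nat \<Rightarrow> (nat \<Rightarrow> nat \<Rightarrow> real) \<Rightarrow> real" where
  "array_norm n d A = L2_set (\<lambda>(k, j). A k j) ({1..n} \<times> {1..d})"

section \<open>Objects in the restricted eigenvalue and irrelevant-row conditions\<close>

definition Omega0 :: "nat \<Rightarrow> nat \<Rightarrow> real \<Rightarrow> (nat \<Rightarrow> real) set" where
  "Omega0 d s2 b =
    {v \<in> vecs (2 * d). L2_set v {1..2 * d} = 1 \<and>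
       (\<Sum>j=1..d. \<bar>v j\<bar> + \<bar>v (d + j)\<bar>) \<le> 2 * (1 + b) * (\<Sum>j=1..s2. \<bar>v j\<bar> + \<bar>v (d + j)\<bar>)}"

definition noise_idx :: "nat \<Rightarrow> nat \<Rightarrow> nat \<Rightarrow> nat set" where
  "noise_idx d s1 s2 = {s2+1..d} \<union> {d+s1+1..2 * d}"

definition oracle_sphere :: "nat \<Rightarrow> nat \<Rightarrow> nat \<Rightarrow> (nat \<Rightarrow> real) set" where
  "oracle_sphere d s1 s2 =
    {w \<in> vecs (2 * d). L2_set w {1..2 * d} = 1 \<and> (\<forall>q\<in>noise_idx d s1 s2. w q = 0)}"

end

theory Submission
  imports Defs
begin

text \<open>
  Everything reduces to deterministic inequalities on a good event.  There the local score at the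
  true coefficients is of order $(\log h^{-1}/(nh))^{1/2}$ uniformly, so each local lasso error lies
  in the cone of the restricted eigenvalue condition; the quadratic form controls it up to a cubic
  term, which the Lipschitz bound on $q_2$ and $s_{n2}^2\lambda_1 = o(1)$ make negligible.  Hence the
  SCAD weights vanish on the signal groups and equal $\lambda_4$, $\lambda_4^\ast$ on the noise
  groups.  The oracle problem is then an unpenalised strictly concave quadratic in each observation,
  and its critical point satisfies the group Karush-Kuhn-Tucker conditions strictly on the noise
  groups; concavity makes it the unique maximiser of the full objective.  Its error is bounded by the
  summed squared score over the $s_{n1} + s_{n2}$ oracle coordinates, a second-moment quantity of
  order $s_{n2}/h$.

  For the good event, a sum localised at $U_k$ is split into the \<open>k\<close>-th term and the others,
  which given $U_k$ are independent; truncation at a level allowed by the $m_0$-th moments and the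
  Chernoff method give tails that survive the union bound over \<open>n d\<^sup>3\<close> sums.
\<close>

section \<open>Sums over finite sets\<close>

text \<open>The obstacle is the expansion point. The quadratic likelihood is expanded at the
  preliminary estimate, whose error per observation is of order \<open>sqrt s2 * lam1\<close>,
  larger than the oracle rate \<open>sqrt (s2 / (n * h))\<close>. The oracle maximiser is
  nevertheless accurate because it is one Newton step: at the true coefficients the gradient of the
  expansion differs from the true score only by the local-linear bias, of order
  \<open>s2 * h^2\<close>, and by the square of the preliminary l1 error, of order
  \<open>(s2 * lam1)^2\<close>. The latter is \<open>(s2 * lam1^2 / h^2) * (s2 * h^2)\<close>, so
  \<open>c5\<close> and \<open>c6a\<close> bring both to order \<open>(n * h) powr (-1/2)\<close>,
  the size of one score coordinate. Slopes are carried as \<open>h\<close> times the derivative.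
  This puts both halves of the design on one scale, makes the preliminary estimator a weighted
  lasso, and produces the additional \<open>h^2\<close> in the rate for the slopes. Remainders are
  measured in l1 norms against coordinatewise moment bounds, so the dimension \<open>d\<close>
  enters only through the union bound.\<close>

lemma sum_abs_le_L2_set:
  "(\<Sum>p\<in>A. \<bar>v p\<bar>) \<le> sqrt (real (card A)) * L2_set v A"
proof -
  have "(\<Sum>p\<in>A. \<bar>1\<bar> * \<bar>v p\<bar>) \<le> L2_set (\<lambda>_. 1) A * L2_set v A"
    by (rule L2_set_mult_ineq)
  then show ?thesis by (simp add: L2_set_constant)
qed

lemma abs_sum_mult_le_L2_set: "\<bar>\<Sum>p\<in>A. f p * g p\<bar> \<le> L2_set f A * L2_set g A"
  using L2_set_mult_ineq[of f g A] sum_abs[of "\<lambda>p. f p * g p" A] by (simp add: abs_mult)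

lemma L2_set_mono_set:
  assumes "finite B" "A \<subseteq> B"
  shows "L2_set f A \<le> L2_set f B"
  unfolding L2_set_def using assms by (intro real_sqrt_le_mono sum_mono2) auto

lemma power2_L2_set: "(L2_set f A)\<^sup>2 = (\<Sum>i\<in>A. (f i)\<^sup>2)"
  by (simp add: L2_set_def sum_nonneg)

text \<open>Exchanging the two sums reduces the claim to one coordinate at a time. This is how a
  bound that is uniform over coordinates becomes a bound by an l1 norm, with no factor for the
  number of coordinates.\<close>

lemma weighted_sum_bound:
  fixes c :: "'p \<Rightarrow> real"
  assumes "\<And>p. p \<in> P \<Longrightarrow> (\<Sum>i\<in>I. g i * a i p) \<le> C" "\<And>p. p \<in> P \<Longrightarrow> 0 \<le> c p"
  shows "(\<Sum>i\<in>I. g i * (\<Sum>p\<in>P. c p * a i p)) \<le> C * (\<Sum>p\<in>P. c p)"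
proof -
  have "(\<Sum>i\<in>I. g i * (\<Sum>p\<in>P. c p * a i p)) = (\<Sum>i\<in>I. \<Sum>p\<in>P. c p * (g i * a i p))"
    by (simp add: sum_distrib_left algebra_simps)
  also have "\<dots> = (\<Sum>p\<in>P. c p * (\<Sum>i\<in>I. g i * a i p))"
    by (subst sum.swap) (simp add: sum_distrib_left)
  also have "\<dots> \<le> (\<Sum>p\<in>P. c p * C)"
    using assms by (intro sum_mono mult_left_mono) auto
  finally show ?thesis by (simp add: sum_distrib_left sum_distrib_right mult.commute)
qed

text \<open>Gaussian elimination by induction on the index set. The pivot is positive by testing
  with a unit vector, and the Schur complement \<open>A'\<close> inherits positivity: its form at
  \<open>v\<close> is the form of \<open>A\<close> at the extension of \<open>v\<close> for which
  row \<open>x\<close> of the product vanishes.\<close>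

lemma posdef_solve:
  fixes A :: "'p \<Rightarrow> 'p \<Rightarrow> real"
  assumes "finite S"
    and "\<And>v. \<exists>p\<in>S. v p \<noteq> 0 \<Longrightarrow> (\<Sum>p\<in>S. \<Sum>q\<in>S. v p * A p q * v q) > 0"
  shows "\<exists>v. \<forall>p\<in>S. (\<Sum>q\<in>S. A p q * v q) = b p"
  using assms
proof (induction S arbitrary: A b rule: finite_induct)
  case empty
  then show ?case by simp
next
  case (insert x S)
  define \<alpha> where "\<alpha> = A x x"
  have \<alpha>: "\<alpha> > 0"
  proof -
    have "0 < (\<Sum>p\<in>insert x S. \<Sum>q\<in>insert x S.
        (if p = x then 1 else 0) * A p q * (if q = x then 1 else 0))"
      by (rule insert.prems) auto
    also have "\<dots> = (\<Sum>p\<in>insert x S. if p = x then A x x else 0)"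
    proof (rule sum.cong[OF refl])
      fix p assume "p \<in> insert x S"
      have "(\<Sum>q\<in>insert x S. (if p = x then 1 else 0) * A p q * (if q = x then 1 else 0))
          = (\<Sum>q\<in>insert x S. if q = x then (if p = x then A x x else 0) else 0)"
        by (intro sum.cong) auto
      also have "\<dots> = (if p = x then A x x else 0)"
        using insert.hyps by simp
      finally show "(\<Sum>q\<in>insert x S. (if p = x then 1 else 0) * A p q * (if q = x then 1 else 0))
          = (if p = x then A x x else 0)" .
    qed
    also have "\<dots> = \<alpha>" using insert.hyps by (simp add: \<alpha>_def)
    finally show ?thesis .
  qed
  define A' where "A' p q = A p q - A p x * A x q / \<alpha>" for p q
  have "\<exists>v. \<forall>p\<in>S. (\<Sum>q\<in>S. A' p q * v q) = b p - A p x * b x / \<alpha>"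
  proof (rule insert.IH)
    fix v assume v: "\<exists>p\<in>S. v p \<noteq> (0::real)"
    define c where "c = (\<Sum>q\<in>S. A x q * v q)"
    define e where "e = (\<Sum>p\<in>S. v p * A p x)"
    define u where "u = v(x := - c / \<alpha>)"
    have ux: "u x = - c / \<alpha>" and uS: "\<And>p. p \<in> S \<Longrightarrow> u p = v p"
      using insert.hyps by (auto simp: u_def)
    have "0 < (\<Sum>p\<in>insert x S. \<Sum>q\<in>insert x S. u p * A p q * u q)"
      by (rule insert.prems) (use v uS in auto)
    also have "\<dots> = u x * \<alpha> * u x + u x * (\<Sum>q\<in>S. A x q * u q)
        + (\<Sum>p\<in>S. u p * A p x * u x + (\<Sum>q\<in>S. u p * A p q * u q))"
      using insert.hyps by (simp add: \<alpha>_def sum_distrib_left algebra_simps)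
    also have "\<dots> = u x * \<alpha> * u x + u x * c + e * u x + (\<Sum>p\<in>S. \<Sum>q\<in>S. v p * A p q * v q)"
      by (simp add: c_def e_def uS sum.distrib sum_distrib_right cong: sum.cong)
    also have "\<dots> = (\<Sum>p\<in>S. \<Sum>q\<in>S. v p * A p q * v q) - e * c / \<alpha>"
      using \<alpha> by (simp add: ux field_simps)
    also have "e * c / \<alpha> = (\<Sum>p\<in>S. \<Sum>q\<in>S. v p * (A p x * A x q / \<alpha>) * v q)"
      by (simp add: e_def c_def sum_product sum_divide_distrib algebra_simps)
    also have "(\<Sum>p\<in>S. \<Sum>q\<in>S. v p * A p q * v q) - \<dots>
        = (\<Sum>p\<in>S. \<Sum>q\<in>S. v p * A' p q * v q)"
      by (simp add: A'_def sum_subtractf[symmetric] algebra_simps)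
    finally show "0 < (\<Sum>p\<in>S. \<Sum>q\<in>S. v p * A' p q * v q)" .
  qed
  then obtain v where v: "\<And>p. p \<in> S \<Longrightarrow> (\<Sum>q\<in>S. A' p q * v q) = b p - A p x * b x / \<alpha>"
    by blast
  define c where "c = (\<Sum>q\<in>S. A x q * v q)"
  \<comment> \<open>Back-substitution: row \<open>x\<close> is solved for its own unknown, and the
    other rows then follow from the reduced system.\<close>
  define u where "u = v(x := (b x - c) / \<alpha>)"
  have ux: "u x = (b x - c) / \<alpha>" and uS: "\<And>p. p \<in> S \<Longrightarrow> u p = v p"
    using insert.hyps by (auto simp: u_def)
  have "(\<Sum>q\<in>insert x S. A p q * u q) = b p" if p: "p \<in> insert x S" for p
  proof -
    have eq: "(\<Sum>q\<in>insert x S. A p q * u q) = A p x * u x + (\<Sum>q\<in>S. A p q * v q)" for p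
      using insert.hyps by (simp add: uS)
    show ?thesis
    proof (cases "p = x")
      case True
      then show ?thesis using \<alpha> eq[of x] by (simp add: c_def[symmetric] ux \<alpha>_def[symmetric])
    next
      case False
      with p have pS: "p \<in> S" by simp
      have "(\<Sum>q\<in>S. A' p q * v q) = (\<Sum>q\<in>S. A p q * v q) - A p x * c / \<alpha>"
        by (simp add: A'_def c_def algebra_simps sum_subtractf sum_distrib_left sum_divide_distrib)
      with v[OF pS] have "(\<Sum>q\<in>S. A p q * v q) = b p - A p x * b x / \<alpha> + A p x * c / \<alpha>" by simp
      then show ?thesis unfolding eq ux by (simp add: diff_divide_distrib right_diff_distrib)
    qed
  qed
  then show ?case by blast
qed

section \<open>A weighted likelihood with Lipschitz second derivative\<close>

text \<open>One localisation point is frozen: \<open>i\<close> runs over the sample,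
  \<open>p\<close> over the stacked level and slope coordinates, \<open>w\<close> is the kernel
  weight and \<phi> the local-linear design. The true predictor \<eta> is not exactly linear in
  \<theta>0; \<open>e\<close> distributes the Taylor remainder over the coordinates. The Lipschitz
  bound holds only with base point \<eta>, so every comparison of second derivatives has to pass
  through \<eta>.\<close>

locale local_fit =
  fixes P :: "'p set" and I :: "'i set" and w :: "'i \<Rightarrow> real" and \<phi> :: "'i \<Rightarrow> 'p \<Rightarrow> real"
    and f f1 f2 :: "'i \<Rightarrow> real \<Rightarrow> real" and \<eta> m :: "'i \<Rightarrow> real"
    and \<theta>0 e :: "'p \<Rightarrow> real" and C2 C3 :: real
  assumes finP: "finite P" and finI: "finite I"
    and w_nonneg: "\<And>i. i \<in> I \<Longrightarrow> 0 \<le> w i"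
    and m_nonneg: "\<And>i. i \<in> I \<Longrightarrow> 0 \<le> m i"
    and e_nonneg: "\<And>p. p \<in> P \<Longrightarrow> 0 \<le> e p"
    and df: "\<And>i s. i \<in> I \<Longrightarrow> (f i has_real_derivative f1 i s) (at s)"
    and df1: "\<And>i s. i \<in> I \<Longrightarrow> (f1 i has_real_derivative f2 i s) (at s)"
    and f2_neg: "\<And>i s. i \<in> I \<Longrightarrow> f2 i s < 0"
    and lip: "\<And>i t. i \<in> I \<Longrightarrow> \<bar>f2 i (\<eta> i + t) - f2 i (\<eta> i)\<bar> \<le> m i * \<bar>t\<bar>"
    and approx: "\<And>i. i \<in> I \<Longrightarrow> w i \<noteq> 0 \<Longrightarrow>
      \<bar>(\<Sum>p\<in>P. \<theta>0 p * \<phi> i p) - \<eta> i\<bar> \<le> (\<Sum>p\<in>P. e p * \<bar>\<phi> i p\<bar>)"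
    and C2: "\<And>p q. p \<in> P \<Longrightarrow> q \<in> P \<Longrightarrow>
      (\<Sum>i\<in>I. w i * \<bar>f2 i (\<eta> i)\<bar> * \<bar>\<phi> i p\<bar> * \<bar>\<phi> i q\<bar>) \<le> C2"
    and C3: "\<And>p q r. p \<in> P \<Longrightarrow> q \<in> P \<Longrightarrow> r \<in> P \<Longrightarrow>
      (\<Sum>i\<in>I. w i * m i * \<bar>\<phi> i p\<bar> * \<bar>\<phi> i q\<bar> * \<bar>\<phi> i r\<bar>) \<le> C3"
begin

definition pred :: "('p \<Rightarrow> real) \<Rightarrow> 'i \<Rightarrow> real" where
  "pred \<theta> i = (\<Sum>p\<in>P. \<theta> p * \<phi> i p)"

definition lik :: "('p \<Rightarrow> real) \<Rightarrow> real" where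
  "lik \<theta> = (\<Sum>i\<in>I. w i * f i (pred \<theta> i))"

definition score :: "('i \<Rightarrow> real) \<Rightarrow> 'p \<Rightarrow> real" where
  "score s p = (\<Sum>i\<in>I. w i * f1 i (s i) * \<phi> i p)"

definition hss :: "('i \<Rightarrow> real) \<Rightarrow> 'p \<Rightarrow> 'p \<Rightarrow> real" where
  "hss s p q = (\<Sum>i\<in>I. w i * f2 i (s i) * \<phi> i p * \<phi> i q)"

text \<open>Bias and estimation error are merged coordinatewise, so that the single l1 quantity
  \<open>dev\<close> controls the distance of any predictor from the true one.\<close>

definition cvec :: "('p \<Rightarrow> real) \<Rightarrow> 'p \<Rightarrow> real" where
  "cvec \<theta> p = e p + \<bar>\<theta> p - \<theta>0 p\<bar>"

definition eps :: real where "eps = (\<Sum>p\<in>P. e p)"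

definition dev :: "('p \<Rightarrow> real) \<Rightarrow> real" where
  "dev \<theta> = (\<Sum>p\<in>P. cvec \<theta> p)"

lemma dev_eq: "dev \<theta> = eps + (\<Sum>p\<in>P. \<bar>\<theta> p - \<theta>0 p\<bar>)"
  by (simp add: dev_def eps_def cvec_def sum.distrib)

lemma cvec_nonneg: "p \<in> P \<Longrightarrow> 0 \<le> cvec \<theta> p"
  using e_nonneg by (simp add: cvec_def)

lemma eps_nonneg: "0 \<le> eps"
  unfolding eps_def using e_nonneg by (rule sum_nonneg)

lemma dev_nonneg: "0 \<le> dev \<theta>"
  unfolding dev_def using cvec_nonneg by (rule sum_nonneg)

lemma pred_diff: "pred \<theta> i - pred \<theta>' i = (\<Sum>p\<in>P. (\<theta> p - \<theta>' p) * \<phi> i p)"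
  by (simp add: pred_def sum_subtractf algebra_simps)

lemma pred_dev:
  assumes "i \<in> I" "w i \<noteq> 0"
  shows "\<bar>pred \<theta> i - \<eta> i\<bar> \<le> (\<Sum>p\<in>P. cvec \<theta> p * \<bar>\<phi> i p\<bar>)"
proof -
  have "\<bar>pred \<theta> i - \<eta> i\<bar> \<le> \<bar>pred \<theta>0 i - \<eta> i\<bar> + \<bar>pred \<theta> i - pred \<theta>0 i\<bar>" by linarith
  also have "\<dots> \<le> (\<Sum>p\<in>P. e p * \<bar>\<phi> i p\<bar>) + (\<Sum>p\<in>P. \<bar>\<theta> p - \<theta>0 p\<bar> * \<bar>\<phi> i p\<bar>)"
    using approx[OF assms] sum_abs[of "\<lambda>p. (\<theta> p - \<theta>0 p) * \<phi> i p" P]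
    by (simp add: pred_diff[of \<theta> _ \<theta>0] abs_mult) (simp add: pred_def)
  also have "\<dots> = (\<Sum>p\<in>P. cvec \<theta> p * \<bar>\<phi> i p\<bar>)"
    by (simp add: cvec_def sum.distrib algebra_simps)
  finally show ?thesis .
qed

lemma lip': "i \<in> I \<Longrightarrow> \<bar>f2 i s - f2 i (\<eta> i)\<bar> \<le> m i * \<bar>s - \<eta> i\<bar>"
  using lip[of i "s - \<eta> i"] by simp

text \<open>Three applications of \<open>weighted_sum_bound\<close>, peeling off one linear factor
  at a time and starting from the triple-moment bound \<open>C3\<close>.\<close>

lemma C3_sum:
  assumes "\<And>p. p \<in> P \<Longrightarrow> 0 \<le> a p" "\<And>p. p \<in> P \<Longrightarrow> 0 \<le> b p" "\<And>p. p \<in> P \<Longrightarrow> 0 \<le> c p"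
  shows "(\<Sum>i\<in>I. w i * m i * (\<Sum>p\<in>P. a p * \<bar>\<phi> i p\<bar>) * (\<Sum>p\<in>P. b p * \<bar>\<phi> i p\<bar>)
           * (\<Sum>p\<in>P. c p * \<bar>\<phi> i p\<bar>)) \<le> C3 * sum c P * sum b P * sum a P"
proof -
  have 1: "(\<Sum>i\<in>I. w i * m i * \<bar>\<phi> i p\<bar> * \<bar>\<phi> i q\<bar> * (\<Sum>p\<in>P. c p * \<bar>\<phi> i p\<bar>)) \<le> C3 * sum c P"
    if "p \<in> P" "q \<in> P" for p q
    using that assms by (intro weighted_sum_bound C3) auto
  have 2: "(\<Sum>i\<in>I. (w i * m i * \<bar>\<phi> i p\<bar> * (\<Sum>p\<in>P. c p * \<bar>\<phi> i p\<bar>)) * (\<Sum>q\<in>P. b q * \<bar>\<phi> i q\<bar>))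
      \<le> C3 * sum c P * sum b P" if "p \<in> P" for p
    by (rule weighted_sum_bound) (use 1[OF that] assms in \<open>auto simp: mult_ac\<close>)
  have "(\<Sum>i\<in>I. (w i * m i * (\<Sum>p\<in>P. c p * \<bar>\<phi> i p\<bar>) * (\<Sum>q\<in>P. b q * \<bar>\<phi> i q\<bar>))
      * (\<Sum>p\<in>P. a p * \<bar>\<phi> i p\<bar>)) \<le> C3 * sum c P * sum b P * sum a P"
    by (rule weighted_sum_bound) (use 2 assms in \<open>auto simp: mult_ac\<close>)
  then show ?thesis by (simp add: mult_ac)
qed

lemma delta_sum: "p \<in> P \<Longrightarrow> (\<Sum>q\<in>P. of_bool (q = p) * g q) = (g p :: real)"
proof -
  assume p: "p \<in> P"
  have "(\<Sum>q\<in>P. of_bool (q = p) * g q) = (\<Sum>q\<in>P. if q = p then g p else 0)"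
    by (intro sum.cong) auto
  then show ?thesis using p finP by simp
qed

section \<open>Linearisation of score and Hessian around the true predictor\<close>

lemma f1_mvt:
  assumes "i \<in> I"
  obtains z where "f1 i a - f1 i b = f2 i z * (a - b)" "\<bar>z - b\<bar> \<le> \<bar>a - b\<bar>" "\<bar>z - a\<bar> \<le> \<bar>a - b\<bar>"
proof (cases a b rule: linorder_cases)
  case equal
  then show ?thesis by (intro that[of b]) auto
next
  case less
  obtain z where "a < z" "z < b" "f1 i b - f1 i a = (b - a) * f2 i z"
    using MVT2[OF less, of "f1 i" "f2 i"] df1[OF assms] by blast
  then show ?thesis by (intro that[of z]) (auto simp: algebra_simps)
next
  case greater
  obtain z where "b < z" "z < a" "f1 i a - f1 i b = (a - b) * f2 i z"
    using MVT2[OF greater, of "f1 i" "f2 i"] df1[OF assms] by blast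
  then show ?thesis by (intro that[of z]) (auto simp: algebra_simps)
qed

text \<open>The left-hand side is the error of one Newton step from \<theta>, seen at the truth. The
  terms linear in the estimation error cancel between the score and the Hessian correction. What
  survives is the bias weighted by the second derivative, and increments of \<open>f2\<close>
  multiplied by predictor errors, which are quadratic in \<open>dev\<close>.\<close>

lemma grad_approx:
  assumes p: "p \<in> P"
  shows "\<bar>score (pred \<theta>) p + (\<Sum>q\<in>P. hss (pred \<theta>) p q * (\<theta>0 q - \<theta> q)) - score \<eta> p\<bar>
    \<le> C2 * eps + 3 * C3 * (dev \<theta>)\<^sup>2"
proof -
  define R where "R i = (\<Sum>p\<in>P. cvec \<theta> p * \<bar>\<phi> i p\<bar>)" for i
  define E where "E i = (\<Sum>p\<in>P. e p * \<bar>\<phi> i p\<bar>)" for i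
  define T where "T i = f1 i (pred \<theta> i) + f2 i (pred \<theta> i) * (pred \<theta>0 i - pred \<theta> i) - f1 i (\<eta> i)" for i
  have ER: "0 \<le> E i" "E i \<le> R i" for i
    unfolding E_def R_def using e_nonneg
    by (auto intro!: sum_nonneg sum_mono mult_right_mono simp: cvec_def)
  have "(\<Sum>q\<in>P. hss (pred \<theta>) p q * (\<theta>0 q - \<theta> q))
      = (\<Sum>q\<in>P. \<Sum>i\<in>I. w i * f2 i (pred \<theta> i) * \<phi> i p * ((\<theta>0 q - \<theta> q) * \<phi> i q))"
    by (simp add: hss_def sum_distrib_left sum_distrib_right mult_ac)
  also have "\<dots> = (\<Sum>i\<in>I. w i * f2 i (pred \<theta> i) * \<phi> i p * (pred \<theta>0 i - pred \<theta> i))"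
    by (subst sum.swap) (simp add: sum_distrib_left[symmetric] pred_diff)
  finally have eq: "score (pred \<theta>) p + (\<Sum>q\<in>P. hss (pred \<theta>) p q * (\<theta>0 q - \<theta> q)) - score \<eta> p
      = (\<Sum>i\<in>I. w i * T i * \<phi> i p)"
    by (simp add: score_def T_def algebra_simps sum.distrib sum_subtractf)
  have T: "\<bar>w i * T i * \<phi> i p\<bar> \<le> w i * \<bar>f2 i (\<eta> i)\<bar> * \<bar>\<phi> i p\<bar> * E i + 3 * (w i * m i * \<bar>\<phi> i p\<bar> * R i * R i)"
    if i: "i \<in> I" for i
  proof (cases "w i = 0")
    case False
    obtain z where z: "f1 i (pred \<theta> i) - f1 i (\<eta> i) = f2 i z * (pred \<theta> i - \<eta> i)"
        "\<bar>z - \<eta> i\<bar> \<le> \<bar>pred \<theta> i - \<eta> i\<bar>" "\<bar>z - pred \<theta> i\<bar> \<le> \<bar>pred \<theta> i - \<eta> i\<bar>"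
      by (rule f1_mvt[OF i, of "pred \<theta> i" "\<eta> i"])
    have R: "\<bar>pred \<theta> i - \<eta> i\<bar> \<le> R i" unfolding R_def by (rule pred_dev[OF i False])
    have E: "\<bar>pred \<theta>0 i - \<eta> i\<bar> \<le> E i" unfolding E_def pred_def by (rule approx[OF i False])
    \<comment> \<open>With \<open>z\<close> from the mean value theorem, all increments of
      \<open>f2\<close> are rewritten with base point \<eta>. The first three products are each at
      most the Lipschitz constant times \<open>R i * R i\<close>, which is the origin of the factor
      3; the fourth carries the bias.\<close>
    have T_eq: "T i = (f2 i z - f2 i (\<eta> i)) * (pred \<theta> i - \<eta> i) - (f2 i (pred \<theta> i) - f2 i (\<eta> i)) * (pred \<theta> i - \<eta> i)
        + (f2 i (pred \<theta> i) - f2 i (\<eta> i)) * (pred \<theta>0 i - \<eta> i) + f2 i (\<eta> i) * (pred \<theta>0 i - \<eta> i)"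
      unfolding T_def using z(1) by (simp add: algebra_simps)
    have mi: "0 \<le> m i" by (rule m_nonneg[OF i])
    have a: "\<bar>f2 i z - f2 i (\<eta> i)\<bar> \<le> m i * R i"
      using lip'[OF i, of z] mult_left_mono[OF order_trans[OF z(2) R] mi] by linarith
    have b: "\<bar>f2 i (pred \<theta> i) - f2 i (\<eta> i)\<bar> \<le> m i * R i"
      using lip'[OF i, of "pred \<theta> i"] mult_left_mono[OF R mi] by linarith
    have mR: "0 \<le> m i * R i" using a by linarith
    have 1: "\<bar>(f2 i z - f2 i (\<eta> i)) * (pred \<theta> i - \<eta> i)\<bar> \<le> m i * R i * R i"
      unfolding abs_mult by (intro mult_mono a R mR) auto
    have 2: "\<bar>(f2 i (pred \<theta> i) - f2 i (\<eta> i)) * (pred \<theta> i - \<eta> i)\<bar> \<le> m i * R i * R i"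
      unfolding abs_mult by (intro mult_mono b R mR) auto
    have 3: "\<bar>(f2 i (pred \<theta> i) - f2 i (\<eta> i)) * (pred \<theta>0 i - \<eta> i)\<bar> \<le> m i * R i * R i"
      unfolding abs_mult using E ER[of i] by (intro mult_mono b mR) auto
    have 4: "\<bar>f2 i (\<eta> i) * (pred \<theta>0 i - \<eta> i)\<bar> \<le> \<bar>f2 i (\<eta> i)\<bar> * E i"
      unfolding abs_mult by (intro mult_left_mono E) auto
    have "\<bar>T i\<bar> \<le> \<bar>f2 i (\<eta> i)\<bar> * E i + 3 * (m i * R i * R i)"
      unfolding T_eq using 1 2 3 4 by linarith
    then have "w i * \<bar>\<phi> i p\<bar> * \<bar>T i\<bar> \<le> w i * \<bar>\<phi> i p\<bar> * (\<bar>f2 i (\<eta> i)\<bar> * E i + 3 * (m i * R i * R i))"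
      using w_nonneg[OF i] by (intro mult_left_mono) auto
    then show ?thesis using w_nonneg[OF i] by (simp add: abs_mult algebra_simps)
  qed auto
  have "\<bar>\<Sum>i\<in>I. w i * T i * \<phi> i p\<bar> \<le> (\<Sum>i\<in>I. w i * \<bar>f2 i (\<eta> i)\<bar> * \<bar>\<phi> i p\<bar> * E i
      + 3 * (w i * m i * \<bar>\<phi> i p\<bar> * R i * R i))"
    by (rule order_trans[OF sum_abs sum_mono]) (rule T)
  also have "\<dots> = (\<Sum>i\<in>I. w i * \<bar>f2 i (\<eta> i)\<bar> * \<bar>\<phi> i p\<bar> * E i)
      + 3 * (\<Sum>i\<in>I. w i * m i * \<bar>\<phi> i p\<bar> * R i * R i)"
    by (simp add: sum.distrib sum_distrib_left)
  also have "(\<Sum>i\<in>I. w i * \<bar>f2 i (\<eta> i)\<bar> * \<bar>\<phi> i p\<bar> * E i) \<le> C2 * eps"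
    unfolding E_def eps_def using p by (intro weighted_sum_bound C2 e_nonneg)
  also have "(\<Sum>i\<in>I. w i * m i * \<bar>\<phi> i p\<bar> * R i * R i) \<le> C3 * dev \<theta> * dev \<theta>"
    \<comment> \<open>A unit vector in the first slot singles out coordinate \<open>p\<close>; its
      l1 norm is 1.\<close>
    using C3_sum[of "\<lambda>q. of_bool (q = p)" "cvec \<theta>" "cvec \<theta>"] cvec_nonneg p finP
      delta_sum[OF p, of "\<lambda>_. 1"]
    by (simp add: delta_sum[OF p] R_def dev_def)
  finally show ?thesis by (simp add: eq power2_eq_square mult.assoc)
qed

lemma hss_bilinear:
  "(\<Sum>p\<in>P. \<Sum>q\<in>P. u p * hss s p q * v q)
     = (\<Sum>i\<in>I. w i * f2 i (s i) * (\<Sum>p\<in>P. u p * \<phi> i p) * (\<Sum>p\<in>P. v p * \<phi> i p))"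
proof -
  have "(\<Sum>p\<in>P. \<Sum>q\<in>P. u p * hss s p q * v q)
      = (\<Sum>p\<in>P. \<Sum>q\<in>P. \<Sum>i\<in>I. w i * f2 i (s i) * (u p * \<phi> i p) * (v q * \<phi> i q))"
    by (simp add: hss_def sum_distrib_left sum_distrib_right mult_ac)
  also have "\<dots> = (\<Sum>p\<in>P. \<Sum>i\<in>I. \<Sum>q\<in>P. w i * f2 i (s i) * (u p * \<phi> i p) * (v q * \<phi> i q))"
    by (rule sum.cong[OF refl]) (rule sum.swap)
  also have "\<dots> = (\<Sum>i\<in>I. \<Sum>p\<in>P. \<Sum>q\<in>P. w i * f2 i (s i) * (u p * \<phi> i p) * (v q * \<phi> i q))"
    by (rule sum.swap)
  also have "\<dots> = (\<Sum>i\<in>I. w i * f2 i (s i) * (\<Sum>p\<in>P. u p * \<phi> i p) * (\<Sum>p\<in>P. v p * \<phi> i p))"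
    by (simp add: sum_distrib_left sum_distrib_right mult_ac)
  finally show ?thesis .
qed

lemma hss_nsd: "(\<Sum>p\<in>P. \<Sum>q\<in>P. v p * hss s p q * v q) \<le> 0"
  unfolding hss_bilinear
proof (rule sum_nonpos)
  fix i assume i: "i \<in> I"
  have "w i * f2 i (s i) * ((\<Sum>p\<in>P. v p * \<phi> i p))\<^sup>2 \<le> 0"
    using w_nonneg[OF i] f2_neg[OF i, of "s i"]
    by (intro mult_nonpos_nonneg mult_nonneg_nonpos) auto
  then show "w i * f2 i (s i) * (\<Sum>p\<in>P. v p * \<phi> i p) * (\<Sum>p\<in>P. v p * \<phi> i p) \<le> 0"
    by (simp add: power2_eq_square mult.assoc)
qed

lemma abs_lincomb_le: "\<bar>\<Sum>p\<in>P. v p * \<phi> i p\<bar> \<le> (\<Sum>p\<in>P. \<bar>v p\<bar> * \<bar>\<phi> i p\<bar>)"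
  using sum_abs[of "\<lambda>p. v p * \<phi> i p" P] by (simp add: abs_mult)

text \<open>In the bilinear form each direction contributes its l1 norm, and the Lipschitz bound
  turns the change of \<open>f2\<close> into a third linear factor, the predictor error, whose l1
  majorant is \<open>dev\<close>.\<close>

lemma hess_approx:
  "\<bar>(\<Sum>p\<in>P. \<Sum>q\<in>P. u p * hss (pred \<theta>) p q * v q) - (\<Sum>p\<in>P. \<Sum>q\<in>P. u p * hss \<eta> p q * v q)\<bar>
    \<le> C3 * dev \<theta> * (\<Sum>p\<in>P. \<bar>u p\<bar>) * (\<Sum>p\<in>P. \<bar>v p\<bar>)"
proof -
  define a where "a i = (\<Sum>p\<in>P. u p * \<phi> i p)" for i
  define b where "b i = (\<Sum>p\<in>P. v p * \<phi> i p)" for i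
  define R where "R i = (\<Sum>p\<in>P. cvec \<theta> p * \<bar>\<phi> i p\<bar>)" for i
  have "\<bar>(\<Sum>i\<in>I. w i * f2 i (pred \<theta> i) * a i * b i) - (\<Sum>i\<in>I. w i * f2 i (\<eta> i) * a i * b i)\<bar>
      = \<bar>\<Sum>i\<in>I. w i * (f2 i (pred \<theta> i) - f2 i (\<eta> i)) * a i * b i\<bar>"
    by (simp add: sum_subtractf[symmetric] algebra_simps)
  also have "\<dots> \<le> (\<Sum>i\<in>I. w i * m i * (\<Sum>p\<in>P. \<bar>v p\<bar> * \<bar>\<phi> i p\<bar>) * (\<Sum>p\<in>P. \<bar>u p\<bar> * \<bar>\<phi> i p\<bar>) * R i)"
  proof (rule order_trans[OF sum_abs sum_mono])
    fix i assume i: "i \<in> I"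
    show "\<bar>w i * (f2 i (pred \<theta> i) - f2 i (\<eta> i)) * a i * b i\<bar>
      \<le> w i * m i * (\<Sum>p\<in>P. \<bar>v p\<bar> * \<bar>\<phi> i p\<bar>) * (\<Sum>p\<in>P. \<bar>u p\<bar> * \<bar>\<phi> i p\<bar>) * R i"
    proof (cases "w i = 0")
      case False
      have R: "\<bar>pred \<theta> i - \<eta> i\<bar> \<le> R i" unfolding R_def by (rule pred_dev[OF i False])
      have "\<bar>f2 i (pred \<theta> i) - f2 i (\<eta> i)\<bar> \<le> m i * R i"
        using lip'[OF i, of "pred \<theta> i"] mult_left_mono[OF R m_nonneg[OF i]] by linarith
      then have "w i * \<bar>f2 i (pred \<theta> i) - f2 i (\<eta> i)\<bar> * \<bar>a i\<bar> * \<bar>b i\<bar>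
          \<le> w i * (m i * R i) * (\<Sum>p\<in>P. \<bar>u p\<bar> * \<bar>\<phi> i p\<bar>) * (\<Sum>p\<in>P. \<bar>v p\<bar> * \<bar>\<phi> i p\<bar>)"
        unfolding a_def b_def using w_nonneg[OF i] m_nonneg[OF i] R
        by (intro mult_mono abs_lincomb_le mult_nonneg_nonneg) (auto intro!: sum_nonneg)
      then show ?thesis using w_nonneg[OF i] by (simp add: abs_mult mult_ac)
    qed auto
  qed
  also have "\<dots> \<le> C3 * dev \<theta> * (\<Sum>p\<in>P. \<bar>u p\<bar>) * (\<Sum>p\<in>P. \<bar>v p\<bar>)"
    unfolding R_def dev_def using C3_sum[of "\<lambda>p. \<bar>v p\<bar>" "\<lambda>p. \<bar>u p\<bar>" "cvec \<theta>"] cvec_nonneg by simp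
  finally show ?thesis unfolding hss_bilinear a_def b_def .
qed

lemma score_approx:
  assumes p: "p \<in> P"
  shows "\<bar>score (pred \<theta>0) p - score \<eta> p\<bar> \<le> C2 * eps + 3 * C3 * eps\<^sup>2"
  using grad_approx[OF p, of \<theta>0] by (simp add: dev_eq)

section \<open>Concavity of the local likelihood and the lasso error bound\<close>

lemma f_taylor:
  assumes i: "i \<in> I"
  obtains z where "f i (s + t) = f i s + f1 i s * t + f2 i z * t\<^sup>2 / 2" "\<bar>z - s\<bar> \<le> \<bar>t\<bar>"
proof (cases "t = 0")
  case True
  then show ?thesis by (intro that[of s]) auto
next
  case False
  define diff where "diff k = (if k = 0 then f i else if k = 1 then f1 i else f2 i)" for k :: nat
  have "\<exists>z. (if s + t < s then s + t < z \<and> z < s else s < z \<and> z < s + t) \<and>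
      f i (s + t) = (\<Sum>k<2. diff k s / fact k * (s + t - s) ^ k) + diff 2 z / fact 2 * (s + t - s) ^ 2"
  proof (rule Taylor[where a = "s - \<bar>t\<bar>" and b = "s + \<bar>t\<bar>"])
    show "\<forall>k z. k < 2 \<and> s - \<bar>t\<bar> \<le> z \<and> z \<le> s + \<bar>t\<bar> \<longrightarrow>
        (diff k has_real_derivative diff (Suc k) z) (at z)"
      using df[OF i] df1[OF i] by (auto simp: diff_def)
  qed (use False in \<open>auto simp: diff_def\<close>)
  then obtain z where "if s + t < s then s + t < z \<and> z < s else s < z \<and> z < s + t"
      "f i (s + t) = f i s + f1 i s * t + f2 i z * t\<^sup>2 / 2"
    by (auto simp: diff_def numeral_2_eq_2)
  then show ?thesis by (intro that[of z]) (auto split: if_splits)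
qed

lemma f_tangent:
  assumes i: "i \<in> I"
  shows "f i s' \<le> f i s + f1 i s * (s' - s)"
proof -
  obtain z where "f i (s + (s' - s)) = f i s + f1 i s * (s' - s) + f2 i z * (s' - s)\<^sup>2 / 2"
    by (rule f_taylor[OF i])
  moreover have "f2 i z * (s' - s)\<^sup>2 \<le> 0"
    using f2_neg[OF i, of z] by (intro mult_nonpos_nonneg) auto
  ultimately show ?thesis by simp
qed

lemma score_lincomb: "(\<Sum>p\<in>P. score s p * v p) = (\<Sum>i\<in>I. w i * f1 i (s i) * (\<Sum>p\<in>P. v p * \<phi> i p))"
proof -
  have "(\<Sum>p\<in>P. score s p * v p) = (\<Sum>p\<in>P. \<Sum>i\<in>I. w i * f1 i (s i) * (v p * \<phi> i p))"
    by (simp add: score_def sum_distrib_left sum_distrib_right mult_ac)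
  then show ?thesis by (subst (asm) sum.swap) (simp add: sum_distrib_left)
qed

lemma pred_add: "pred (\<lambda>p. \<theta> p + v p) i = pred \<theta> i + (\<Sum>p\<in>P. v p * \<phi> i p)"
  by (simp add: pred_def sum.distrib algebra_simps)

lemma lik_tangent: "lik (\<lambda>p. \<theta> p + v p) \<le> lik \<theta> + (\<Sum>p\<in>P. score (pred \<theta>) p * v p)"
proof -
  have "w i * f i (pred (\<lambda>p. \<theta> p + v p) i)
      \<le> w i * f i (pred \<theta> i) + w i * f1 i (pred \<theta> i) * (\<Sum>p\<in>P. v p * \<phi> i p)" if "i \<in> I" for i
    using mult_left_mono[OF f_tangent[OF that, of "pred (\<lambda>p. \<theta> p + v p) i" "pred \<theta> i"] w_nonneg[OF that]]
    by (simp add: pred_add algebra_simps)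
  then show ?thesis
    unfolding lik_def score_lincomb by (simp add: sum.distrib[symmetric] sum_mono)
qed

text \<open>The tangent at the intermediate point lies above the likelihood at both ends. Weighting
  the two inequalities by \<open>1 - t\<close> and \<open>t\<close> cancels the gradient
  term.\<close>

lemma lik_concave:
  assumes t: "0 \<le> t" "t \<le> 1"
  shows "(1 - t) * lik \<theta> + t * lik (\<lambda>p. \<theta> p + v p) \<le> lik (\<lambda>p. \<theta> p + t * v p)"
proof -
  let ?m = "\<lambda>p. \<theta> p + t * v p"
  let ?g = "\<Sum>p\<in>P. score (pred ?m) p * v p"
  have "lik \<theta> \<le> lik ?m + (\<Sum>p\<in>P. score (pred ?m) p * (- t * v p))"
    using lik_tangent[of ?m "\<lambda>p. - t * v p"] by simp
  also have "\<dots> = lik ?m - t * ?g"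
    by (simp add: sum_distrib_left sum_negf[symmetric] mult_ac)
  finally have 1: "lik \<theta> \<le> lik ?m - t * ?g" .
  have "lik (\<lambda>p. \<theta> p + v p) \<le> lik ?m + (\<Sum>p\<in>P. score (pred ?m) p * ((1 - t) * v p))"
    using lik_tangent[of ?m "\<lambda>p. (1 - t) * v p"] by (simp add: algebra_simps)
  also have "\<dots> = lik ?m + (1 - t) * ?g"
    by (simp add: sum_distrib_left mult_ac)
  finally have 2: "lik (\<lambda>p. \<theta> p + v p) \<le> lik ?m + (1 - t) * ?g" .
  show ?thesis
    using mult_left_mono[OF 1, of "1 - t"] mult_left_mono[OF 2, of t] t by (simp add: algebra_simps)
qed

text \<open>The expansion is around \<theta>0, but its curvature is that at the true predictor
  \<eta>, because only there is the restricted eigenvalue condition available. Moving the second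
  derivative from the Taylor point to \<eta> costs the cubic term, in which the bias
  \<open>eps\<close> also appears.\<close>

lemma lik_curvature:
  "lik (\<lambda>p. \<theta>0 p + v p) \<le> lik \<theta>0 + (\<Sum>p\<in>P. score (pred \<theta>0) p * v p)
     + (\<Sum>p\<in>P. \<Sum>q\<in>P. v p * hss \<eta> p q * v q) / 2
     + C3 * (eps + (\<Sum>p\<in>P. \<bar>v p\<bar>)) * (\<Sum>p\<in>P. \<bar>v p\<bar>)\<^sup>2 / 2"
proof -
  define a where "a i = (\<Sum>p\<in>P. v p * \<phi> i p)" for i
  define A where "A i = (\<Sum>p\<in>P. \<bar>v p\<bar> * \<bar>\<phi> i p\<bar>)" for i
  let ?c = "\<lambda>p. e p + \<bar>v p\<bar>"
  define R where "R i = (\<Sum>p\<in>P. ?c p * \<bar>\<phi> i p\<bar>)" for i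
  have "w i * f i (pred \<theta>0 i + a i) \<le> w i * f i (pred \<theta>0 i) + w i * f1 i (pred \<theta>0 i) * a i
      + (w i * f2 i (\<eta> i) * a i * a i) / 2 + (w i * m i * A i * A i * R i) / 2" if i: "i \<in> I" for i
  proof (cases "w i = 0")
    case False
    obtain z where z: "f i (pred \<theta>0 i + a i) = f i (pred \<theta>0 i) + f1 i (pred \<theta>0 i) * a i + f2 i z * (a i)\<^sup>2 / 2"
        "\<bar>z - pred \<theta>0 i\<bar> \<le> \<bar>a i\<bar>" by (rule f_taylor[OF i])
    have aA: "\<bar>a i\<bar> \<le> A i" unfolding a_def A_def by (rule abs_lincomb_le)
    have "\<bar>z - \<eta> i\<bar> \<le> \<bar>pred \<theta>0 i - \<eta> i\<bar> + A i" using z(2) aA by linarith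
    also have "\<dots> \<le> R i" using approx[OF i False]
      by (simp add: R_def A_def pred_def sum.distrib algebra_simps)
    finally have zR: "\<bar>z - \<eta> i\<bar> \<le> R i" .
    have "f2 i z \<le> f2 i (\<eta> i) + m i * R i"
      using lip'[OF i, of z] mult_left_mono[OF zR m_nonneg[OF i]] by linarith
    then have "f2 i z * (a i)\<^sup>2 \<le> f2 i (\<eta> i) * (a i)\<^sup>2 + m i * R i * (a i)\<^sup>2"
      by (metis distrib_right mult_right_mono zero_le_power2)
    also have "m i * R i * (a i)\<^sup>2 \<le> m i * R i * (A i)\<^sup>2"
      using aA m_nonneg[OF i] zR by (intro mult_left_mono abs_le_square_iff[THEN iffD1]) auto
    finally have "f i (pred \<theta>0 i + a i) \<le> f i (pred \<theta>0 i) + f1 i (pred \<theta>0 i) * a i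
        + (f2 i (\<eta> i) * (a i)\<^sup>2 + m i * R i * (A i)\<^sup>2) / 2" using z(1) by simp
    from mult_left_mono[OF this w_nonneg[OF i]] show ?thesis
      by (simp add: power2_eq_square algebra_simps add_divide_distrib)
  qed auto
  then have "lik (\<lambda>p. \<theta>0 p + v p) \<le> (\<Sum>i\<in>I. w i * f i (pred \<theta>0 i) + w i * f1 i (pred \<theta>0 i) * a i
      + (w i * f2 i (\<eta> i) * a i * a i) / 2 + (w i * m i * A i * A i * R i) / 2)"
    unfolding lik_def pred_add a_def[symmetric] by (rule sum_mono)
  also have "\<dots> = lik \<theta>0 + (\<Sum>p\<in>P. score (pred \<theta>0) p * v p)
      + (\<Sum>p\<in>P. \<Sum>q\<in>P. v p * hss \<eta> p q * v q) / 2 + (\<Sum>i\<in>I. w i * m i * A i * A i * R i) / 2"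
    unfolding score_lincomb hss_bilinear lik_def a_def[symmetric]
    by (simp add: sum.distrib sum_divide_distrib)
  also have "(\<Sum>i\<in>I. w i * m i * A i * A i * R i) \<le> C3 * (\<Sum>p\<in>P. ?c p) * (\<Sum>p\<in>P. \<bar>v p\<bar>) * (\<Sum>p\<in>P. \<bar>v p\<bar>)"
    unfolding A_def R_def using e_nonneg
    by (intro C3_sum[of "\<lambda>p. \<bar>v p\<bar>" "\<lambda>p. \<bar>v p\<bar>" ?c]) auto
  finally show ?thesis by (simp add: eps_def sum.distrib power2_eq_square mult.assoc)
qed

text \<open>The optimality of \<open>\<theta>\<close> puts \<open>\<theta> - \<theta>0\<close> into the cone.  By concavity, the segment from \<open>\<theta>0\<close>
  to \<open>\<theta>\<close> may be cut at radius \<open>R\<close>, where the cubic error is dominated by the curvature.\<close>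

lemma lasso_rate:
  fixes \<theta> :: "'p \<Rightarrow> real"
  defines "\<delta> \<equiv> \<lambda>p. \<theta> p - \<theta>0 p"
  assumes S: "S \<subseteq> P" "S \<noteq> {}" "\<And>p. p \<in> P - S \<Longrightarrow> \<theta>0 p = 0"
    and \<kappa>: "\<And>p. p \<in> P \<Longrightarrow> \<kappa>min \<le> \<kappa> p" "\<And>p. p \<in> P \<Longrightarrow> \<kappa> p \<le> \<kappa>max" "0 < \<kappa>min" "\<kappa>max \<le> b * \<kappa>min"
    and opt: "\<And>\<theta>'. lik \<theta>' - (\<Sum>p\<in>P. \<kappa> p * \<bar>\<theta>' p\<bar>) \<le> lik \<theta> - (\<Sum>p\<in>P. \<kappa> p * \<bar>\<theta> p\<bar>)"
    and sc: "\<And>p. p \<in> P \<Longrightarrow> \<bar>score (pred \<theta>0) p\<bar> \<le> \<kappa>min / 4"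
    and RE: "\<And>v. (\<Sum>p\<in>P. \<bar>v p\<bar>) \<le> 2 * (1 + b) * (\<Sum>p\<in>S. \<bar>v p\<bar>) \<Longrightarrow>
      \<rho> * (\<Sum>p\<in>P. (v p)\<^sup>2) \<le> - (\<Sum>p\<in>P. \<Sum>q\<in>P. v p * hss \<eta> p q * v q)"
    and \<rho>: "0 < \<rho>"
    and R: "R = 8 * \<kappa>max * (2 * (1 + b) + 1) * sqrt (card S) / \<rho>"
    and C3_nonneg: "0 \<le> C3"
    and small: "C3 * (eps + 2 * (1 + b) * sqrt (card S) * R) * ((2 * (1 + b))\<^sup>2 * card S) \<le> \<rho> / 2"
  shows "L2_set \<delta> P \<le> R" "(\<Sum>p\<in>P. \<bar>\<delta> p\<bar>) \<le> 2 * (1 + b) * sqrt (card S) * R"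
proof -
  define c where "c = 2 * (1 + b)"
  define s where "s = sqrt (card S)"
  have finS: "finite S" using S(1) finP finite_subset by blast
  have s: "s \<ge> 1" using finS S(2) by (simp add: s_def card_gt_0_iff Suc_le_eq)
  have min_max: "\<kappa>min \<le> \<kappa>max" using S \<kappa>(1,2) by (meson all_not_in_conv order_trans subsetD)
  have b: "b \<ge> 1"
  proof (rule ccontr)
    assume "\<not> b \<ge> 1"
    then have "b * \<kappa>min < 1 * \<kappa>min" using \<kappa>(3) by (intro mult_strict_right_mono) auto
    then show False using \<kappa>(4) min_max by simp
  qed
  have c: "c \<ge> 4" using b by (simp add: c_def)
  have R_pos: "R > 0" unfolding R c_def[symmetric] s_def[symmetric]
    using \<rho> c s \<kappa>(3) min_max by (intro divide_pos_pos mult_pos_pos) auto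
  have split: "(\<Sum>p\<in>P. g p) = (\<Sum>p\<in>S. g p) + (\<Sum>p\<in>P - S. g p)" for g :: "'p \<Rightarrow> real"
    using sum.subset_diff[OF S(1) finP, of g] by simp
  have score_le: "(\<Sum>p\<in>P. score (pred \<theta>0) p * v p) \<le> \<kappa>min / 4 * (\<Sum>p\<in>P. \<bar>v p\<bar>)" for v
  proof -
    have "(\<Sum>p\<in>P. score (pred \<theta>0) p * v p) \<le> (\<Sum>p\<in>P. \<kappa>min / 4 * \<bar>v p\<bar>)"
    proof (rule sum_mono)
      fix p assume p: "p \<in> P"
      have "score (pred \<theta>0) p * v p \<le> \<bar>score (pred \<theta>0) p\<bar> * \<bar>v p\<bar>"
        by (metis abs_ge_self abs_mult)
      also have "\<dots> \<le> \<kappa>min / 4 * \<bar>v p\<bar>" using sc[OF p] by (intro mult_right_mono) auto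
      finally show "score (pred \<theta>0) p * v p \<le> \<kappa>min / 4 * \<bar>v p\<bar>" .
    qed
    then show ?thesis by (simp add: sum_distrib_left)
  qed
  have pen: "(\<Sum>p\<in>P. \<kappa> p * \<bar>\<theta>0 p\<bar>) - (\<Sum>p\<in>P. \<kappa> p * \<bar>\<theta>0 p + v p\<bar>)
      \<le> \<kappa>max * (\<Sum>p\<in>S. \<bar>v p\<bar>) - \<kappa>min * (\<Sum>p\<in>P - S. \<bar>v p\<bar>)" for v
  proof -
    have "(\<Sum>p\<in>P. \<kappa> p * \<bar>\<theta>0 p\<bar>) - (\<Sum>p\<in>P. \<kappa> p * \<bar>\<theta>0 p + v p\<bar>)
        = (\<Sum>p\<in>S. \<kappa> p * (\<bar>\<theta>0 p\<bar> - \<bar>\<theta>0 p + v p\<bar>)) + (\<Sum>p\<in>P - S. \<kappa> p * (\<bar>\<theta>0 p\<bar> - \<bar>\<theta>0 p + v p\<bar>))"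
      by (simp add: split[symmetric] sum_subtractf[symmetric] algebra_simps)
    also have "\<dots> \<le> (\<Sum>p\<in>S. \<kappa>max * \<bar>v p\<bar>) + (\<Sum>p\<in>P - S. - (\<kappa>min * \<bar>v p\<bar>))"
    proof (intro add_mono sum_mono)
      fix p assume "p \<in> S"
      then have p: "p \<in> P" using S by auto
      have "\<kappa> p * (\<bar>\<theta>0 p\<bar> - \<bar>\<theta>0 p + v p\<bar>) \<le> \<kappa> p * \<bar>v p\<bar>"
        using \<kappa>(1)[OF p] \<kappa>(3) by (intro mult_left_mono) auto
      also have "\<dots> \<le> \<kappa>max * \<bar>v p\<bar>" using \<kappa>(2)[OF p] by (intro mult_right_mono) auto
      finally show "\<kappa> p * (\<bar>\<theta>0 p\<bar> - \<bar>\<theta>0 p + v p\<bar>) \<le> \<kappa>max * \<bar>v p\<bar>" .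
    next
      fix p assume p: "p \<in> P - S"
      then show "\<kappa> p * (\<bar>\<theta>0 p\<bar> - \<bar>\<theta>0 p + v p\<bar>) \<le> - (\<kappa>min * \<bar>v p\<bar>)"
        using S(3)[OF p] mult_right_mono[OF \<kappa>(1), of p "\<bar>v p\<bar>"] by simp
    qed
    finally show ?thesis by (simp add: sum_distrib_left sum_negf)
  qed
  have opt': "lik \<theta>0 - (\<Sum>p\<in>P. \<kappa> p * \<bar>\<theta>0 p\<bar>)
      \<le> lik (\<lambda>p. \<theta>0 p + \<delta> p) - (\<Sum>p\<in>P. \<kappa> p * \<bar>\<theta>0 p + \<delta> p\<bar>)"
    using opt[of \<theta>0] by (simp add: \<delta>_def)
  have cone: "(\<Sum>p\<in>P. \<bar>\<delta> p\<bar>) \<le> c * (\<Sum>p\<in>S. \<bar>\<delta> p\<bar>)"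
  proof -
    let ?S = "\<Sum>p\<in>S. \<bar>\<delta> p\<bar>" and ?N = "\<Sum>p\<in>P - S. \<bar>\<delta> p\<bar>"
    have "lik (\<lambda>p. \<theta>0 p + \<delta> p) \<le> lik \<theta>0 + (\<Sum>p\<in>P. score (pred \<theta>0) p * \<delta> p)"
      by (rule lik_tangent)
    then have "\<kappa>min * ?N \<le> \<kappa>max * ?S + \<kappa>min / 4 * (?S + ?N)"
      using score_le[of \<delta>] pen[of \<delta>] opt' by (simp add: split[of "\<lambda>p. \<bar>\<delta> p\<bar>"])
    also have "\<dots> \<le> b * \<kappa>min * ?S + \<kappa>min / 4 * (?S + ?N)"
      by (intro add_right_mono mult_right_mono \<kappa>(4) sum_nonneg) auto
    finally have "\<kappa>min * ?N \<le> \<kappa>min * (b * ?S + (?S + ?N) / 4)" by (simp add: algebra_simps add_divide_distrib)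
    then have "?N \<le> b * ?S + (?S + ?N) / 4" using \<kappa>(3) by simp
    moreover have "0 \<le> ?S" by (simp add: sum_nonneg)
    moreover have "?S \<le> b * ?S" using mult_right_mono[OF b \<open>0 \<le> ?S\<close>] by simp
    moreover have "n \<le> u + 2 * v" if "n \<le> v + (u + n) / 4" "0 \<le> u" "u \<le> v" for n u v :: real
      using that by (simp add: field_simps)
    \<comment> \<open>The score uses up a quarter of the smallest penalty, so three quarters of
      \<open>?N\<close> are left on one side. Adding \<open>?S\<close> to the bound for
      \<open>?N\<close> gives exactly the constant \<open>2 * (1 + b)\<close> of the cone.\<close>
    ultimately have "?N \<le> ?S + 2 * (b * ?S)" by blast
    then show ?thesis by (simp add: split[of "\<lambda>p. \<bar>\<delta> p\<bar>"] c_def algebra_simps)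
  qed
  define t where "t = (if L2_set \<delta> P \<le> R then 1 else R / L2_set \<delta> P)"
  have t: "0 < t" "t \<le> 1" using R_pos by (auto simp: t_def)
  define v where "v p = t * \<delta> p" for p
  define N where "N = L2_set v P"
  have N_eq: "N = t * L2_set \<delta> P"
    unfolding N_def v_def using t L2_set_right_distrib[of t \<delta> P] by simp
  have N_le: "N \<le> R" unfolding N_eq t_def using R_pos by auto
  have N0: "0 \<le> N" by (simp add: N_def)
  have cone_v: "(\<Sum>p\<in>P. \<bar>v p\<bar>) \<le> c * (\<Sum>p\<in>S. \<bar>v p\<bar>)"
    using mult_left_mono[OF cone, of t] t
    by (simp add: v_def abs_mult sum_distrib_left mult_ac)
  have vS: "(\<Sum>p\<in>S. \<bar>v p\<bar>) \<le> s * N"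
    unfolding N_def s_def
    by (rule order_trans[OF sum_abs_le_L2_set mult_left_mono[OF L2_set_mono_set]]) (use finP S in auto)
  have vP: "(\<Sum>p\<in>P. \<bar>v p\<bar>) \<le> c * s * N"
  proof -
    have "c * (\<Sum>p\<in>S. \<bar>v p\<bar>) \<le> c * (s * N)" using c by (intro mult_left_mono vS) auto
    with cone_v show ?thesis by (simp add: mult.assoc)
  qed
  have "c * s * N \<le> c * s * R" using c s by (intro mult_left_mono N_le) auto
  with vP have vR: "(\<Sum>p\<in>P. \<bar>v p\<bar>) \<le> c * s * R" by linarith
  have "lik \<theta>0 - (\<Sum>p\<in>P. \<kappa> p * \<bar>\<theta>0 p\<bar>) \<le> lik (\<lambda>p. \<theta>0 p + v p) - (\<Sum>p\<in>P. \<kappa> p * \<bar>\<theta>0 p + v p\<bar>)"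
  proof -
    have "(\<Sum>p\<in>P. \<kappa> p * \<bar>\<theta>0 p + v p\<bar>) \<le> (\<Sum>p\<in>P. (1 - t) * (\<kappa> p * \<bar>\<theta>0 p\<bar>) + t * (\<kappa> p * \<bar>\<theta>0 p + \<delta> p\<bar>))"
    proof (rule sum_mono)
      fix p assume p: "p \<in> P"
      have "\<theta>0 p + v p = (1 - t) * \<theta>0 p + t * (\<theta>0 p + \<delta> p)" by (simp add: v_def algebra_simps)
      then have "\<bar>\<theta>0 p + v p\<bar> \<le> (1 - t) * \<bar>\<theta>0 p\<bar> + t * \<bar>\<theta>0 p + \<delta> p\<bar>"
        using t by (metis abs_mult abs_of_nonneg abs_triangle_ineq diff_ge_0_iff_ge less_imp_le)
      from mult_left_mono[OF this, of "\<kappa> p"] \<kappa>(1)[OF p] \<kappa>(3)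
      show "\<kappa> p * \<bar>\<theta>0 p + v p\<bar> \<le> (1 - t) * (\<kappa> p * \<bar>\<theta>0 p\<bar>) + t * (\<kappa> p * \<bar>\<theta>0 p + \<delta> p\<bar>)"
        by (simp add: algebra_simps)
    qed
    also have "\<dots> = (1 - t) * (\<Sum>p\<in>P. \<kappa> p * \<bar>\<theta>0 p\<bar>) + t * (\<Sum>p\<in>P. \<kappa> p * \<bar>\<theta>0 p + \<delta> p\<bar>)"
      by (simp add: sum.distrib sum_distrib_left)
    finally show ?thesis
      using lik_concave[of t \<theta>0 \<delta>] t mult_left_mono[OF opt', of t]
      by (simp add: v_def[symmetric] algebra_simps)
  qed
  moreover have "0 \<le> \<kappa>min * (\<Sum>p\<in>P - S. \<bar>v p\<bar>)"
    using \<kappa>(3) by (intro mult_nonneg_nonneg sum_nonneg) auto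
  ultimately have "0 \<le> lik (\<lambda>p. \<theta>0 p + v p) - lik \<theta>0 + \<kappa>max * (\<Sum>p\<in>S. \<bar>v p\<bar>)"
    using pen[of v] by linarith
  also have "lik (\<lambda>p. \<theta>0 p + v p) - lik \<theta>0 \<le> \<kappa>min / 4 * (\<Sum>p\<in>P. \<bar>v p\<bar>) - \<rho> * N\<^sup>2 / 2 + \<rho> / 2 * N\<^sup>2 / 2"
  proof -
    have 1: "(\<Sum>p\<in>P. \<Sum>q\<in>P. v p * hss \<eta> p q * v q) \<le> - (\<rho> * N\<^sup>2)"
      using RE[of v] cone_v by (simp add: N_def power2_L2_set c_def)
    have sq: "(\<Sum>p\<in>P. \<bar>v p\<bar>)\<^sup>2 \<le> (c * s * N)\<^sup>2"
      using vP by (intro power_mono) (auto simp: sum_nonneg)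
    have "C3 * (eps + (\<Sum>p\<in>P. \<bar>v p\<bar>)) * (\<Sum>p\<in>P. \<bar>v p\<bar>)\<^sup>2 \<le> C3 * (eps + c * s * R) * (c * s * N)\<^sup>2"
      using C3_nonneg eps_nonneg vR c s R_pos
      by (intro mult_mono sq mult_left_mono mult_nonneg_nonneg add_nonneg_nonneg sum_nonneg) auto
    also have "\<dots> = C3 * (eps + c * s * R) * (c\<^sup>2 * card S) * N\<^sup>2"
      by (simp add: power_mult_distrib s_def)
    \<comment> \<open>Half of the curvature is given away to the cubic error; \<open>small\<close>
      says that at radius \<open>R\<close> this suffices.\<close>
    also have "\<dots> \<le> \<rho> / 2 * N\<^sup>2"
      using small by (intro mult_right_mono) (simp_all add: c_def s_def)
    finally show ?thesis using lik_curvature[of v] score_le[of v] 1 by argo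
  qed
  finally have "\<rho> / 4 * N\<^sup>2 \<le> \<kappa>min / 4 * (\<Sum>p\<in>P. \<bar>v p\<bar>) + \<kappa>max * (\<Sum>p\<in>S. \<bar>v p\<bar>)" by simp
  also have "\<dots> \<le> \<kappa>max * (c * s * N) + \<kappa>max * (s * N)"
    using \<kappa>(3) min_max vP vS by (intro add_mono mult_mono) (auto simp: sum_nonneg)
  \<comment> \<open>The factor 8 in \<open>R\<close> is made for this identity. It leaves room for
    \<open>N\<close> to be at most half of \<open>R\<close>.\<close>
  also have "\<dots> = \<rho> / 4 * (R / 2 * N)" unfolding R c_def[symmetric] s_def[symmetric] using \<rho>
    by (simp add: field_simps)
  finally have "\<rho> / 4 * (N * N) \<le> \<rho> / 4 * (R / 2 * N)" by (simp only: power2_eq_square)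
  then have "N * N \<le> R / 2 * N" using \<rho> by (subst (asm) mult_le_cancel_left_pos) auto
  \<comment> \<open>A proper cut of the segment would give \<open>N = R\<close>, so the strict
    inequality shows that nothing was cut and \<open>v\<close> is the whole error.\<close>
  then have "N < R" using R_pos N0 by (cases "N = 0") auto
  then have "t = 1" using R_pos by (auto simp: N_eq t_def split: if_splits)
  then have v: "v = \<delta>" by (simp add: v_def fun_eq_iff)
  show "L2_set \<delta> P \<le> R" using N_le by (simp add: N_def v)
  show "(\<Sum>p\<in>P. \<bar>\<delta> p\<bar>) \<le> 2 * (1 + b) * sqrt (card S) * R"
    using vR by (simp add: v c_def s_def)
qed

section \<open>The Newton step from the preliminary estimate on the oracle coordinates\<close>

definition grad :: "('p \<Rightarrow> real) \<Rightarrow> ('p \<Rightarrow> real) \<Rightarrow> 'p \<Rightarrow> real" where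
  "grad \<theta> \<theta>' p = score (pred \<theta>) p + (\<Sum>q\<in>P. hss (pred \<theta>) p q * (\<theta>' q - \<theta> q))"

lemma grad_diff: "grad \<theta> \<theta>' p - grad \<theta> \<theta>'' p = (\<Sum>q\<in>P. hss (pred \<theta>) p q * (\<theta>' q - \<theta>'' q))"
  by (simp add: grad_def sum_subtractf[symmetric] algebra_simps)

text \<open>\<open>grad \<theta> \<theta>'\<close> is the gradient at \<theta>' of the quadratic
  expansion around \<theta>. Stationarity on \<open>S\<close> is a linear system for the
  displacement from \<theta>0, with positive definite matrix. Pairing the system with its solution
  and using Cauchy-Schwarz bounds the displacement by the gradient at \<theta>0, so its size is
  decided at the truth and not at \<theta>.\<close>

lemma oracle_critical_point:
  assumes S: "S \<subseteq> P" "\<And>p. p \<in> P - S \<Longrightarrow> \<theta>0 p = 0"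
    and nd: "\<And>v. (\<And>p. p \<in> P - S \<Longrightarrow> v p = 0) \<Longrightarrow>
      \<rho> * (\<Sum>p\<in>P. (v p)\<^sup>2) \<le> - (\<Sum>p\<in>P. \<Sum>q\<in>P. v p * hss (pred \<theta>) p q * v q)"
    and \<rho>: "0 < \<rho>"
  obtains \<theta>s where "\<And>p. p \<in> P - S \<Longrightarrow> \<theta>s p = 0" "\<And>p. p \<in> S \<Longrightarrow> grad \<theta> \<theta>s p = 0"
    "\<rho> * L2_set (\<lambda>p. \<theta>s p - \<theta>0 p) P \<le> L2_set (grad \<theta> \<theta>0) S"
proof -
  have finS: "finite S" using S(1) finP finite_subset by blast
  have restr: "(\<Sum>p\<in>P. g p) = (\<Sum>p\<in>S. g p)" if "\<And>p. p \<in> P - S \<Longrightarrow> g p = 0" for g :: "'p \<Rightarrow> real"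
    using that S(1) finP by (intro sum.mono_neutral_right) auto
  have "\<exists>v. \<forall>p\<in>S. (\<Sum>q\<in>S. - hss (pred \<theta>) p q * v q) = grad \<theta> \<theta>0 p"
  proof (rule posdef_solve[OF finS])
    fix v :: "'p \<Rightarrow> real" assume v: "\<exists>p\<in>S. v p \<noteq> 0"
    define u where "u p = (if p \<in> S then v p else 0)" for p
    have "0 < (\<Sum>p\<in>S. (u p)\<^sup>2)"
      using v finS by (auto simp: u_def sum_nonneg_eq_0_iff less_le intro!: sum_nonneg)
    also have "(\<Sum>p\<in>S. (u p)\<^sup>2) = (\<Sum>p\<in>P. (u p)\<^sup>2)" by (rule restr[symmetric]) (simp add: u_def)
    finally have "0 < \<rho> * (\<Sum>p\<in>P. (u p)\<^sup>2)" using \<rho> by simp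
    also have "\<dots> \<le> - (\<Sum>p\<in>P. \<Sum>q\<in>P. u p * hss (pred \<theta>) p q * u q)"
      by (rule nd) (simp add: u_def)
    also have "(\<Sum>p\<in>P. \<Sum>q\<in>P. u p * hss (pred \<theta>) p q * u q) = (\<Sum>p\<in>S. \<Sum>q\<in>P. u p * hss (pred \<theta>) p q * u q)"
      by (rule restr) (simp add: u_def)
    also have "\<dots> = (\<Sum>p\<in>S. \<Sum>q\<in>S. u p * hss (pred \<theta>) p q * u q)"
      by (intro sum.cong[OF refl] restr) (simp add: u_def)
    also have "- \<dots> = (\<Sum>p\<in>S. \<Sum>q\<in>S. v p * - hss (pred \<theta>) p q * v q)"
      by (simp add: u_def sum_negf cong: sum.cong)
    finally show "0 < (\<Sum>p\<in>S. \<Sum>q\<in>S. v p * - hss (pred \<theta>) p q * v q)" .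
  qed
  then obtain v0 where v0: "\<And>p. p \<in> S \<Longrightarrow> (\<Sum>q\<in>S. - hss (pred \<theta>) p q * v0 q) = grad \<theta> \<theta>0 p"
    by blast
  define v where "v p = (if p \<in> S then v0 p else 0)" for p
  define \<theta>s where "\<theta>s p = \<theta>0 p + v p" for p
  have vN: "v p = 0" if "p \<in> P - S" for p using that by (simp add: v_def)
  have Hv: "(\<Sum>q\<in>P. hss (pred \<theta>) p q * v q) = - grad \<theta> \<theta>0 p" if "p \<in> S" for p
  proof -
    have "(\<Sum>q\<in>P. hss (pred \<theta>) p q * v q) = (\<Sum>q\<in>S. hss (pred \<theta>) p q * v q)"
      by (rule restr) (simp add: vN)
    then show ?thesis using v0[OF that] by (simp add: v_def sum_negf cong: sum.cong)
  qed
  show ?thesis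
  proof (rule that[of \<theta>s])
    show "\<theta>s p = 0" if "p \<in> P - S" for p using vN[OF that] S(2)[OF that] by (simp add: \<theta>s_def)
    show "grad \<theta> \<theta>s p = 0" if "p \<in> S" for p
      using grad_diff[of \<theta> \<theta>s p \<theta>0] Hv[OF that] by (simp add: \<theta>s_def)
    have "\<rho> * (L2_set v P)\<^sup>2 \<le> - (\<Sum>p\<in>P. \<Sum>q\<in>P. v p * hss (pred \<theta>) p q * v q)"
      unfolding power2_L2_set by (rule nd) (rule vN)
    also have "\<dots> = - (\<Sum>p\<in>P. v p * (\<Sum>q\<in>P. hss (pred \<theta>) p q * v q))"
      by (simp add: sum_distrib_left mult.assoc)
    also have "\<dots> = - (\<Sum>p\<in>S. v p * (\<Sum>q\<in>P. hss (pred \<theta>) p q * v q))"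
      by (subst restr) (auto simp: vN)
    also have "\<dots> = (\<Sum>p\<in>S. v p * grad \<theta> \<theta>0 p)" by (simp add: Hv sum_negf)
    also have "\<dots> \<le> L2_set v S * L2_set (grad \<theta> \<theta>0) S"
      using abs_sum_mult_le_L2_set[of v "grad \<theta> \<theta>0" S] by linarith
    also have "\<dots> \<le> L2_set v P * L2_set (grad \<theta> \<theta>0) S"
      by (intro mult_right_mono L2_set_mono_set finP S) auto
    finally have "L2_set v P * (\<rho> * L2_set v P) \<le> L2_set v P * L2_set (grad \<theta> \<theta>0) S"
      by (simp add: power2_eq_square mult_ac)
    then have "\<rho> * L2_set v P \<le> L2_set (grad \<theta> \<theta>0) S"
      by (cases "L2_set v P = 0") (auto simp: less_le[of 0])
    then show "\<rho> * L2_set (\<lambda>p. \<theta>s p - \<theta>0 p) P \<le> L2_set (grad \<theta> \<theta>0) S"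
      by (simp add: \<theta>s_def)
  qed
qed

text \<open>\<open>hess_approx\<close> with a unit vector as first direction; it is needed on the
  noise rows, where only a bound for the true Hessian is assumed.\<close>

lemma hss_row_approx:
  assumes p: "p \<in> P"
  shows "\<bar>(\<Sum>q\<in>P. hss (pred \<theta>) p q * v q) - (\<Sum>q\<in>P. hss \<eta> p q * v q)\<bar> \<le> C3 * dev \<theta> * (\<Sum>q\<in>P. \<bar>v q\<bar>)"
proof -
  have row: "(\<Sum>r\<in>P. \<Sum>q\<in>P. of_bool (r = p) * hss s r q * v q) = (\<Sum>q\<in>P. hss s p q * v q)" for s
    using delta_sum[OF p, of "\<lambda>r. \<Sum>q\<in>P. hss s r q * v q"] by (simp add: sum_distrib_left mult.assoc)
  have "(\<Sum>r\<in>P. \<bar>of_bool (r = p)\<bar> :: real) = 1" using delta_sum[OF p, of "\<lambda>_. 1"] by simp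
  then show ?thesis using hess_approx[of "\<lambda>r. of_bool (r = p)" \<theta> v] unfolding row by simp
qed

end

section \<open>Group-penalised concave quadratics\<close>

lemma sum_nonpos_eq_0D:
  fixes f :: "'a \<Rightarrow> real"
  assumes "finite A" "\<And>x. x \<in> A \<Longrightarrow> f x \<le> 0" "sum f A = 0" "x \<in> A"
  shows "f x = 0"
  using sum_nonneg_eq_0_iff[of A "\<lambda>x. - f x"] assms by (simp add: sum_negf)

text \<open>Expanding around \<open>\<Theta>s\<close> removes the gradient on \<open>S\<close>, and
  on a noise group Cauchy-Schwarz bounds the linear term by strictly less than the penalty. The
  curvature is only semidefinite in all coordinates, so uniqueness comes in two stages: the strict
  inequalities force the noise groups of a competing maximiser to vanish, and on what remains the
  form is strictly negative.\<close>

lemma kkt_unique_max: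
  fixes N :: "'k set" and P S :: "'p set" and H :: "'k \<Rightarrow> 'p \<Rightarrow> 'p \<Rightarrow> real" and s \<Theta>t \<Theta>s :: "'k \<Rightarrow> 'p \<Rightarrow> real" and \<mu> :: "'p \<Rightarrow> real"
  defines "F \<equiv> \<lambda>\<Theta>. (\<Sum>k\<in>N. \<Sum>p\<in>P. (\<Theta> k p - \<Theta>t k p) * s k p)
      + 1 / 2 * (\<Sum>k\<in>N. \<Sum>p\<in>P. \<Sum>q\<in>P. (\<Theta> k p - \<Theta>t k p) * H k p q * (\<Theta> k q - \<Theta>t k q))
      - (\<Sum>p\<in>P. \<mu> p * L2_set (\<lambda>k. \<Theta> k p) N)"
    and "g \<equiv> \<lambda>k p. s k p + (\<Sum>q\<in>P. H k p q * (\<Theta>s k q - \<Theta>t k q))"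
  assumes fin: "finite N" "finite P" and S: "S \<subseteq> P"
    and sym: "\<And>k p q. H k p q = H k q p"
    and crit: "\<And>k p. k \<in> N \<Longrightarrow> p \<in> S \<Longrightarrow> g k p = 0"
    and \<mu>0: "\<And>p. p \<in> S \<Longrightarrow> \<mu> p = 0"
    and noise: "\<And>p. p \<in> P - S \<Longrightarrow> L2_set (\<lambda>k. g k p) N < \<mu> p"
    and supp: "\<And>k p. k \<in> N \<Longrightarrow> p \<in> P - S \<Longrightarrow> \<Theta>s k p = 0"
    and nsd: "\<And>k v. k \<in> N \<Longrightarrow> (\<Sum>p\<in>P. \<Sum>q\<in>P. v p * H k p q * v q) \<le> 0"
    and nd: "\<And>k v p. k \<in> N \<Longrightarrow> (\<And>p. p \<in> P - S \<Longrightarrow> v p = 0) \<Longrightarrow> p \<in> P \<Longrightarrow> v p \<noteq> 0 \<Longrightarrow>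
       (\<Sum>p\<in>P. \<Sum>q\<in>P. v p * H k p q * v q) < 0"
  shows "F \<Theta> \<le> F \<Theta>s" "F \<Theta>s \<le> F \<Theta> \<Longrightarrow> k \<in> N \<Longrightarrow> p \<in> P \<Longrightarrow> \<Theta> k p = \<Theta>s k p"
proof -
  define V where "V k p = \<Theta> k p - \<Theta>s k p" for k p
  define Q where "Q k = (\<Sum>p\<in>P. \<Sum>q\<in>P. V k p * H k p q * V k q)" for k
  let ?D = "\<lambda>k p. \<Theta>s k p - \<Theta>t k p"
  \<comment> \<open>Exact second-order expansion of a quadratic around \<open>\<Theta>s\<close>; the
    symmetry of \<open>H\<close> merges the two cross terms into the gradient
    \<open>g\<close>.\<close>
  have local: "(\<Sum>p\<in>P. (\<Theta> k p - \<Theta>t k p) * s k p)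
        + 1 / 2 * (\<Sum>p\<in>P. \<Sum>q\<in>P. (\<Theta> k p - \<Theta>t k p) * H k p q * (\<Theta> k q - \<Theta>t k q))
      = (\<Sum>p\<in>P. ?D k p * s k p) + 1 / 2 * (\<Sum>p\<in>P. \<Sum>q\<in>P. ?D k p * H k p q * ?D k q)
        + (\<Sum>p\<in>P. V k p * g k p) + 1 / 2 * Q k" for k
  proof -
    define d where "d p = ?D k p" for p
    have e: "\<Theta> k p - \<Theta>t k p = V k p + d p" for p by (simp add: V_def d_def)
    have "(\<Sum>p\<in>P. \<Sum>q\<in>P. d p * H k p q * V k q) = (\<Sum>p\<in>P. \<Sum>q\<in>P. V k p * H k p q * d q)"
      by (subst sum.swap) (simp add: sym[of k] mult_ac)
    then have quad: "(\<Sum>p\<in>P. \<Sum>q\<in>P. (V k p + d p) * H k p q * (V k q + d q))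
        = Q k + 2 * (\<Sum>p\<in>P. \<Sum>q\<in>P. V k p * H k p q * d q) + (\<Sum>p\<in>P. \<Sum>q\<in>P. d p * H k p q * d q)"
      by (simp add: Q_def distrib_left distrib_right sum.distrib)
    have gr: "(\<Sum>p\<in>P. V k p * g k p) = (\<Sum>p\<in>P. V k p * s k p) + (\<Sum>p\<in>P. \<Sum>q\<in>P. V k p * H k p q * d q)"
      by (simp add: g_def d_def distrib_left sum.distrib sum_distrib_left mult.assoc)
    show ?thesis unfolding e d_def[symmetric] quad gr
      by (simp add: distrib_right sum.distrib)
  qed
  \<comment> \<open>The candidate pays no penalty: on \<open>S\<close> the weight is zero, off
    \<open>S\<close> the coefficients are.\<close>
  have pens: "(\<Sum>p\<in>P. \<mu> p * L2_set (\<lambda>k. \<Theta>s k p) N) = 0"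
    using \<mu>0 supp fin(1) by (intro sum.neutral) (auto simp: L2_set_eq_0_iff)
  have split: "(\<Sum>p\<in>P. h p) = (\<Sum>p\<in>P - S. h p)" if "\<And>p. p \<in> S \<Longrightarrow> h p = 0" for h :: "'p \<Rightarrow> real"
    using that S fin(2) by (intro sum.mono_neutral_right) auto
  have eq: "F \<Theta> - F \<Theta>s = (\<Sum>p\<in>P - S. (\<Sum>k\<in>N. V k p * g k p) - \<mu> p * L2_set (\<lambda>k. \<Theta> k p) N)
      + 1 / 2 * (\<Sum>k\<in>N. Q k)"
  proof -
    have "F \<Theta> - F \<Theta>s = (\<Sum>k\<in>N. \<Sum>p\<in>P. V k p * g k p) + 1 / 2 * (\<Sum>k\<in>N. Q k)
        - (\<Sum>p\<in>P. \<mu> p * L2_set (\<lambda>k. \<Theta> k p) N)"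
    proof -
      have "(\<Sum>k\<in>N. (\<Sum>p\<in>P. (\<Theta> k p - \<Theta>t k p) * s k p)
          + 1 / 2 * (\<Sum>p\<in>P. \<Sum>q\<in>P. (\<Theta> k p - \<Theta>t k p) * H k p q * (\<Theta> k q - \<Theta>t k q)))
        = (\<Sum>k\<in>N. (\<Sum>p\<in>P. ?D k p * s k p) + 1 / 2 * (\<Sum>p\<in>P. \<Sum>q\<in>P. ?D k p * H k p q * ?D k q)
        + (\<Sum>p\<in>P. V k p * g k p) + 1 / 2 * Q k)"
        using local by simp
      then show ?thesis unfolding F_def pens
        by (simp add: sum.distrib sum_distrib_left)
    qed
    also have "(\<Sum>k\<in>N. \<Sum>p\<in>P. V k p * g k p) = (\<Sum>p\<in>P. \<Sum>k\<in>N. V k p * g k p)" by (rule sum.swap)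
    also have "\<dots> = (\<Sum>p\<in>P - S. \<Sum>k\<in>N. V k p * g k p)"
      using crit by (intro split sum.neutral) auto
    also have "(\<Sum>p\<in>P. \<mu> p * L2_set (\<lambda>k. \<Theta> k p) N) = (\<Sum>p\<in>P - S. \<mu> p * L2_set (\<lambda>k. \<Theta> k p) N)"
      using \<mu>0 by (intro split) auto
    finally show ?thesis by (simp add: sum_subtractf)
  qed
  have group: "(\<Sum>k\<in>N. V k p * g k p) - \<mu> p * L2_set (\<lambda>k. \<Theta> k p) N
      \<le> (L2_set (\<lambda>k. g k p) N - \<mu> p) * L2_set (\<lambda>k. \<Theta> k p) N" if p: "p \<in> P - S" for p
  proof -
    have "(\<Sum>k\<in>N. V k p * g k p) = (\<Sum>k\<in>N. \<Theta> k p * g k p)"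
      using supp[OF _ p] by (simp add: V_def)
    also have "\<dots> \<le> L2_set (\<lambda>k. \<Theta> k p) N * L2_set (\<lambda>k. g k p) N"
      using abs_sum_mult_le_L2_set[of "\<lambda>k. \<Theta> k p" "\<lambda>k. g k p" N] by linarith
    finally show ?thesis by (simp add: algebra_simps)
  qed
  have group0: "(L2_set (\<lambda>k. g k p) N - \<mu> p) * L2_set (\<lambda>k. \<Theta> k p) N \<le> 0" if p: "p \<in> P - S" for p
    using noise[OF p] by (intro mult_nonpos_nonneg) auto
  have Q0: "Q k \<le> 0" if "k \<in> N" for k unfolding Q_def using that by (rule nsd)
  have sumQ: "(\<Sum>k\<in>N. Q k) \<le> 0" using Q0 by (rule sum_nonpos)
  have le: "(\<Sum>p\<in>P - S. (\<Sum>k\<in>N. V k p * g k p) - \<mu> p * L2_set (\<lambda>k. \<Theta> k p) N) \<le> 0"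
    by (rule sum_nonpos) (use group group0 order_trans in blast)
  show "F \<Theta> \<le> F \<Theta>s" using eq le sumQ by linarith
  assume F: "F \<Theta>s \<le> F \<Theta>" and k: "k \<in> N" and p: "p \<in> P"
  have "(\<Sum>p\<in>P - S. (\<Sum>k\<in>N. V k p * g k p) - \<mu> p * L2_set (\<lambda>k. \<Theta> k p) N) = 0"
    using F eq le sumQ by linarith
  then have "(\<Sum>k\<in>N. V k p * g k p) - \<mu> p * L2_set (\<lambda>k. \<Theta> k p) N = 0" if "p \<in> P - S" for p
    using fin that by (intro sum_nonpos_eq_0D[of "P - S" "\<lambda>p. (\<Sum>k\<in>N. V k p * g k p) - \<mu> p * L2_set (\<lambda>k. \<Theta> k p) N"])
      (use group group0 order_trans in blast)+
  then have "0 \<le> (L2_set (\<lambda>k. g k p) N - \<mu> p) * L2_set (\<lambda>k. \<Theta> k p) N" if "p \<in> P - S" for p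
    using group[OF that] that by simp
  then have "L2_set (\<lambda>k. \<Theta> k p) N = 0" if "p \<in> P - S" for p
    using noise[OF that] that
    by (metis L2_set_nonneg diff_less_0_iff_less less_le mult_neg_pos not_less)
  then have VN: "V k p = 0" if "p \<in> P - S" for p
    using that k supp fin(1) by (auto simp: L2_set_eq_0_iff V_def)
  have "(\<Sum>k\<in>N. Q k) = 0" using F eq le sumQ by linarith
  then have "Q k = 0" using sum_nonpos_eq_0D[OF fin(1), of Q] Q0 k by blast
  then have "V k p = 0" using nd[OF k VN p] unfolding Q_def by force
  then show "\<Theta> k p = \<Theta>s k p" by (simp add: V_def)
qed

section \<open>The local likelihood as a weighted likelihood\<close>

lemma sum_double:
  fixes F :: "nat \<Rightarrow> real"
  shows "(\<Sum>p=1..2 * d. F p) = (\<Sum>j=1..d. F j) + (\<Sum>j=1..d. F (d + j))"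
proof -
  have "{1..2 * d} = {1..d} \<union> {1 + d..d + d}" by auto
  then have "(\<Sum>p=1..2 * d. F p) = sum F ({1..d} \<union> {1 + d..d + d})" by (rule arg_cong)
  also have "\<dots> = (\<Sum>p=1..d. F p) + (\<Sum>p=1 + d..d + d. F p)"
    by (rule sum.union_disjoint) simp_all
  also have "(\<Sum>p=1 + d..d + d. F p) = (\<Sum>j=1..d. F (j + d))"
    using sum.shift_bounds_cl_nat_ivl[of F 1 d d] by simp
  finally show ?thesis by (simp add: add.commute)
qed

lemma stack_lo: "j \<le> d \<Longrightarrow> stack d v w j = v j"
  and stack_hi: "0 < j \<Longrightarrow> stack d v w (d + j) = w j"
  by (auto simp: stack_def)

lemma sum_stack:
  "(\<Sum>p=1..2 * d. stack d v w p * stack d v' w' p) = (\<Sum>j=1..d. v j * v' j) + (\<Sum>j=1..d. w j * w' j)"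
  unfolding sum_double by (simp add: stack_lo stack_hi cong: sum.cong_simp)

text \<open>The slope columns are divided by \<open>h\<close> because the slope parameters are
  stored multiplied by \<open>h\<close>. Inside the kernel window both halves are then of the size
  of the covariates.\<close>

definition design :: "fitdata \<Rightarrow> real \<Rightarrow> nat \<Rightarrow> nat \<Rightarrow> real" where
  "design D u i = stack (ncov D) (cov D i) (\<lambda>j. (idx D i - u) / bw D * cov D i j)"

definition wt :: "fitdata \<Rightarrow> real \<Rightarrow> nat \<Rightarrow> real" where
  "wt D u i = Kh D (idx D i - u) / real (nobs D)"

lemma lin_pred_eq:
  assumes "bw D \<noteq> 0"
  shows "lin_pred D k \<alpha> \<beta> i
    = (\<Sum>p=1..2 * ncov D. stack (ncov D) \<alpha> (\<lambda>j. bw D * \<beta> j) p * design D (idx D k) i p)"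
  using assms unfolding design_def sum_stack lin_pred_def sum.distrib[symmetric]
  by (intro sum.cong) (auto simp: field_simps)

lemma hess_eq: "hess D \<eta> u p q
    = (\<Sum>i=1..nobs D. wt D u i * q2 (ll D) (\<eta> i) (resp D i) * design D u i p * design D u i q)"
  by (auto simp: hess_def block_matrix_def hess_block_def wt_def design_def stack_def
      sum_distrib_left power2_eq_square mult_ac intro!: sum.cong)

lemma loc_score_eq: "loc_score D k \<alpha> \<beta> p
    = (\<Sum>i=1..nobs D. wt D (idx D k) i * q1 (ll D) (lin_pred D k \<alpha> \<beta> i) (resp D i) * design D (idx D k) i p)"
  by (simp add: loc_score_def wt_def design_def sum_distrib_left mult_ac)

lemma loc_lik_eq: "loc_lik D k \<alpha> \<beta>
    = (\<Sum>i=1..nobs D. wt D (idx D k) i * ll D (lin_pred D k \<alpha> \<beta> i) (resp D i))"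
  by (simp add: loc_lik_def wt_def sum_distrib_left mult_ac)

text \<open>The local score is taken at the true predictor, not at its local-linear approximation:
  only then do its summands have conditional mean zero.\<close>

definition true_score :: "fitdata \<Rightarrow> (nat \<Rightarrow> real \<Rightarrow> real) \<Rightarrow> nat \<Rightarrow> nat \<Rightarrow> real" where
  "true_score D a k p = (\<Sum>i=1..nobs D. wt D (idx D k) i * q1 (ll D) (true_pred D a i) (resp D i)
     * design D (idx D k) i p)"

section \<open>Centred norms and the two flat pieces of the SCAD derivative\<close>

lemma centred_norm_le: "centred_norm n f \<le> L2_set f {1..n}"
proof (cases "n = 0")
  case False
  define c where "c = (1 / real n) * (\<Sum>l=1..n. f l)"
  have c: "(\<Sum>l=1..n. f l) = real n * c" using False by (simp add: c_def)
  \<comment> \<open>Stated for an arbitrary \<open>c\<close>, so that the induction on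
    \<open>n\<close> does not change the mean; the mean is inserted afterwards.\<close>
  have "(\<Sum>k=1..n. (f k - c)\<^sup>2) = (\<Sum>k=1..n. (f k)\<^sup>2) - 2 * c * (\<Sum>k=1..n. f k) + real n * c\<^sup>2"
    by (induction n) (simp_all add: power2_diff algebra_simps)
  also have "\<dots> = (\<Sum>k=1..n. (f k)\<^sup>2) - real n * c\<^sup>2" unfolding c by (simp add: power2_eq_square)
  also have "\<dots> \<le> (\<Sum>k=1..n. (f k)\<^sup>2)" by simp
  finally show ?thesis unfolding centred_norm_def L2_set_def c_def[symmetric]
    by (rule real_sqrt_le_mono)
qed (simp add: centred_norm_def)

lemma centred_norm_triangle:
  "centred_norm n f \<le> centred_norm n g + L2_set (\<lambda>k. f k - g k) {1..n}"
proof -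
  have "centred_norm n f
      \<le> centred_norm n g + centred_norm n (\<lambda>k. f k - g k)"
    unfolding centred_norm_def
    by (rule order_trans[OF _ L2_set_triangle_ineq])
       (simp add: sum_subtractf algebra_simps)
  then show ?thesis using centred_norm_le[of n "\<lambda>k. f k - g k"] by linarith
qed

lemma L2_set_diff_triangle: "L2_set f A \<le> L2_set g A + L2_set (\<lambda>k. f k - g k) A"
  using L2_set_triangle_ineq[of g "\<lambda>k. f k - g k" A] by simp

lemma centred_norm_const:
  assumes "\<And>k. k \<in> {1..n} \<Longrightarrow> f k = c"
  shows "centred_norm n f = 0"
  using assms unfolding centred_norm_def by (intro L2_set_0') (cases "n = 0"; simp)

lemma scad_deriv_small: "z \<le> l \<Longrightarrow> scad_deriv l z = l"
  by (simp add: scad_deriv_def)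

lemma scad_deriv_large: "0 < l \<Longrightarrow> 3.7 * l \<le> z \<Longrightarrow> scad_deriv l z = 0"
  by (auto simp: scad_deriv_def Let_def)

text \<open>\<open>Cs\<close>, \<open>Csq\<close>, \<open>C2x\<close>, \<open>C3x\<close>, \<open>Crow\<close> bound the random quantities on the good event;
  \<open>\<kappa>\<close> is the radius of the support of the kernel.\<close>

locale scad_fit =
  fixes D :: fitdata and a :: "nat \<Rightarrow> real \<Rightarrow> real" and m :: "nat \<Rightarrow> real"
    and At Bt :: "nat \<Rightarrow> nat \<Rightarrow> real" and s1 s2 :: nat
    and l1 l2 l4 l4s b \<kappa> Ca C2x C3x Cs Csq Crow \<rho> bd :: real
  assumes h: "0 < bw D" and n: "1 \<le> nobs D"
    and s: "1 \<le> s1" "s1 < s2" "s2 < ncov D"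
    and U: "\<And>i. i \<in> {1..nobs D} \<Longrightarrow> idx D i \<in> {0..1}"
    and dL: "\<And>i t. i \<in> {1..nobs D} \<Longrightarrow>
        ((\<lambda>r. ll D r (resp D i)) has_real_derivative q1 (ll D) t (resp D i)) (at t)"
    and dL1: "\<And>i t. i \<in> {1..nobs D} \<Longrightarrow>
        ((\<lambda>r. q1 (ll D) r (resp D i)) has_real_derivative q2 (ll D) t (resp D i)) (at t)"
    and neg: "\<And>i t. i \<in> {1..nobs D} \<Longrightarrow> q2 (ll D) t (resp D i) < 0"
    and m0: "\<And>i. i \<in> {1..nobs D} \<Longrightarrow> 0 \<le> m i"
    and lipschitz: "\<And>i t. i \<in> {1..nobs D} \<Longrightarrow> \<bar>q2 (ll D) (true_pred D a i + t) (resp D i)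
          - q2 (ll D) (true_pred D a i) (resp D i)\<bar> \<le> m i * \<bar>t\<bar>"
    and K0: "\<And>z. 0 \<le> kern D z" and K_supp: "\<And>z. kern D z \<noteq> 0 \<Longrightarrow> \<bar>z\<bar> \<le> \<kappa>" and \<kappa>: "1 \<le> \<kappa>"
    and Ca: "0 \<le> Ca"
    and smooth: "\<And>j u v. j \<in> {1..ncov D} \<Longrightarrow> u \<in> {0..1} \<Longrightarrow> v \<in> {0..1} \<Longrightarrow>
        \<bar>a j u - a j v - D1 (a j) v * (u - v)\<bar> \<le> Ca * (u - v)\<^sup>2"
    and const: "\<And>j u. j \<in> {s1 + 1..ncov D} \<Longrightarrow> u \<in> {0..1} \<Longrightarrow> D1 (a j) u = 0"
      "\<And>j. j \<in> {s1 + 1..ncov D} \<Longrightarrow> \<exists>c. \<forall>u\<in>{0..1}. a j u = c"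
    and zero: "\<And>j u. j \<in> {s2 + 1..ncov D} \<Longrightarrow> u \<in> {0..1} \<Longrightarrow> a j u = 0"
    and C2x: "\<And>k j j'. k \<in> {1..nobs D} \<Longrightarrow> j \<in> {1..ncov D} \<Longrightarrow> j' \<in> {1..ncov D} \<Longrightarrow>
        (\<Sum>i=1..nobs D. wt D (idx D k) i * \<bar>q2 (ll D) (true_pred D a i) (resp D i)\<bar>
            * \<bar>cov D i j\<bar> * \<bar>cov D i j'\<bar>) \<le> C2x"
    and C3x: "\<And>k j j' j''. k \<in> {1..nobs D} \<Longrightarrow> j \<in> {1..ncov D} \<Longrightarrow> j' \<in> {1..ncov D} \<Longrightarrow>
        j'' \<in> {1..ncov D} \<Longrightarrow>
        (\<Sum>i=1..nobs D. wt D (idx D k) i * m i * \<bar>cov D i j\<bar> * \<bar>cov D i j'\<bar> * \<bar>cov D i j''\<bar>) \<le> C3x"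
    and prelim: "\<And>k. k \<in> {1..nobs D} \<Longrightarrow> is_arg_max (prelim_obj D l1 l2 k)
          (\<lambda>p. p \<in> vecs (ncov D) \<times> vecs (ncov D)) (At k, Bt k)"
    and l: "0 < l1" "0 < l2" "0 < l4" "0 < l4s"
    and b: "max (l1 / l2) (l2 / l1) \<le> b"
    and RE: "\<And>u v. u \<in> {0..1} \<Longrightarrow> v \<in> Omega0 (ncov D) s2 b \<Longrightarrow>
        \<rho> \<le> quad_form (2 * ncov D) (\<lambda>p q. - true_hess D a u p q) v"
    and \<rho>: "0 < \<rho>"
    and Cs: "\<And>k p. k \<in> {1..nobs D} \<Longrightarrow> p \<in> {1..2 * ncov D} \<Longrightarrow> \<bar>true_score D a k p\<bar> \<le> Cs"
    and Csq: "(\<Sum>k=1..nobs D. \<Sum>p\<in>{1..2 * ncov D} - noise_idx (ncov D) s1 s2. (true_score D a k p)\<^sup>2) \<le> Csq"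
    and Crow: "\<And>k u w. k \<in> noise_idx (ncov D) s1 s2 \<Longrightarrow> u \<in> {0..1} \<Longrightarrow>
        w \<in> oracle_sphere (ncov D) s1 s2 \<Longrightarrow> \<bar>\<Sum>q=1..2 * ncov D. true_hess D a u k q * w q\<bar> \<le> Crow"
    and signal: "\<And>j. j \<in> {1..s2} \<Longrightarrow> bd * sqrt (nobs D) \<le> L2_set (\<lambda>k. a j (idx D k)) {1..nobs D}"
      "\<And>j. j \<in> {1..s1} \<Longrightarrow> bd * sqrt (nobs D) \<le> centred_norm (nobs D) (\<lambda>k. a j (idx D k))"
begin

section \<open>Deterministic bounds on one realised sample\<close>

definition "P = {1..2 * ncov D}"
definition "S = P - noise_idx (ncov D) s1 s2"
text \<open>The cone of \<open>Omega0\<close> treats levels and slopes alike up to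
  \<open>s2\<close>, so the lasso step works with this symmetric superset of the oracle coordinates
  \<open>S\<close>.\<close>

definition "S2 = {1..s2} \<union> {ncov D + 1..ncov D + s2}"
text \<open>The Taylor remainder of the j-th coefficient multiplies the j-th covariate, which is the
  j-th level column of the design. Hence the bias sits on level coordinates only, and only on the
  first \<open>s2\<close>.\<close>

definition "e p = (if p \<le> s2 then Ca * \<kappa>\<^sup>2 * (bw D)\<^sup>2 else 0)"
definition "A0 k j = a j (idx D k)"
definition "B0 k j = D1 (a j) (idx D k)"
definition "C2' = \<kappa>\<^sup>2 * C2x"
definition "C3' = \<kappa> ^ 3 * C3x"
definition "ep = real s2 * Ca * \<kappa>\<^sup>2 * (bw D)\<^sup>2"
definition "R = 8 * max l1 l2 * (2 * (1 + b) + 1) * sqrt (2 * s2) / \<rho>"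
text \<open>Bias plus the l1 radius that \<open>lasso_rate\<close> yields on \<open>S2\<close>; the
  square of \<open>dv\<close> is the Newton error inside \<open>Err\<close>.\<close>

definition "dv = ep + 2 * (1 + b) * sqrt (2 * s2) * R"
definition "Err = C2' * ep + 3 * C3' * dv\<^sup>2"
text \<open>Bound for the squared oracle errors summed over all observations. The eigenvalue
  \<rho>/2 at the preliminary estimate gives \<open>4 / \<rho>\<^sup>2\<close>; the bracket comes
  from splitting the square of score plus \<open>Err\<close> over at most \<open>2 * s2\<close>
  coordinates.\<close>

definition "VV = (4 / \<rho>\<^sup>2) * (2 * Csq + 4 * real (nobs D) * real s2 * Err\<^sup>2)"

lemma wt_nonneg: "0 \<le> wt D u i"
  using K0 h by (simp add: wt_def Kh_def)

lemma near: "wt D u i \<noteq> 0 \<Longrightarrow> \<bar>(idx D i - u) / bw D\<bar> \<le> \<kappa>"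
  using K_supp[of "(idx D i - u) / bw D"] by (auto simp: wt_def Kh_def)

lemma design_le:
  assumes "wt D u i \<noteq> 0" "p \<in> P"
  shows "\<bar>design D u i p\<bar> \<le> \<kappa> * \<bar>cov D i (if p \<le> ncov D then p else p - ncov D)\<bar>"
proof (cases "p \<le> ncov D")
  case True
  then show ?thesis using \<kappa> mult_right_mono[of 1 \<kappa> "\<bar>cov D i p\<bar>"] by (simp add: design_def stack_def)
next
  case False
  have "\<bar>(idx D i - u) / bw D\<bar> * \<bar>cov D i (p - ncov D)\<bar> \<le> \<kappa> * \<bar>cov D i (p - ncov D)\<bar>"
    by (intro mult_right_mono near assms) auto
  then show ?thesis using False by (simp add: design_def stack_def abs_mult)
qed

lemma col_in: "p \<in> P \<Longrightarrow> (if p \<le> ncov D then p else p - ncov D) \<in> {1..ncov D}"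
  by (auto simp: P_def)

lemma e_sum: "(\<Sum>p\<in>P. e p) = ep"
proof -
  have "(\<Sum>p\<in>P. e p) = (\<Sum>p=1..s2. e p)"
    unfolding P_def using s by (intro sum.mono_neutral_right) (auto simp: e_def)
  also have "\<dots> = ep" by (simp add: e_def ep_def)
  finally show ?thesis .
qed

text \<open>A nonzero kernel weight forces the distance of the index values below \<kappa> times the
  bandwidth, where the Taylor remainder is quadratic. Coefficients beyond \<open>s2\<close> vanish
  identically, so the total bias is proportional to \<open>s2\<close> and not to the
  dimension.\<close>

lemma truth_approx:
  assumes k: "k \<in> {1..nobs D}" and i: "i \<in> {1..nobs D}" and w: "wt D (idx D k) i \<noteq> 0"
  shows "\<bar>(\<Sum>p\<in>P. big_vec D A0 B0 k p * design D (idx D k) i p) - true_pred D a i\<bar>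
    \<le> (\<Sum>p\<in>P. e p * \<bar>design D (idx D k) i p\<bar>)"
proof -
  let ?u = "idx D i" and ?v = "idx D k"
  have dist: "(?u - ?v)\<^sup>2 \<le> \<kappa>\<^sup>2 * (bw D)\<^sup>2"
  proof -
    have "\<bar>?u - ?v\<bar> \<le> \<kappa> * bw D" using near[OF w] h by (simp add: pos_divide_le_eq)
    then have "\<bar>?u - ?v\<bar>\<^sup>2 \<le> (\<kappa> * bw D)\<^sup>2" by (intro power_mono) auto
    then show ?thesis by (simp add: power_mult_distrib)
  qed
  have "(\<Sum>p\<in>P. big_vec D A0 B0 k p * design D ?v i p) = lin_pred D k (A0 k) (B0 k) i"
    using h by (simp add: lin_pred_eq big_vec_def P_def)
  then have "\<bar>(\<Sum>p\<in>P. big_vec D A0 B0 k p * design D ?v i p) - true_pred D a i\<bar>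
      = \<bar>\<Sum>j=1..ncov D. (a j ?v + D1 (a j) ?v * (?u - ?v) - a j ?u) * cov D i j\<bar>"
    by (simp add: lin_pred_def true_pred_def A0_def B0_def sum_subtractf[symmetric] left_diff_distrib)
  also have "\<dots> \<le> (\<Sum>j=1..ncov D. e j * \<bar>cov D i j\<bar>)"
  proof (rule order_trans[OF sum_abs sum_mono])
    fix j assume j: "j \<in> {1..ncov D}"
    have "\<bar>a j ?v + D1 (a j) ?v * (?u - ?v) - a j ?u\<bar> \<le> e j"
    proof (cases "j \<le> s2")
      case True
      have "\<bar>a j ?v + D1 (a j) ?v * (?u - ?v) - a j ?u\<bar> \<le> Ca * (?u - ?v)\<^sup>2"
        using smooth[OF j U[OF i] U[OF k]] by linarith
      also have "\<dots> \<le> Ca * (\<kappa>\<^sup>2 * (bw D)\<^sup>2)" using dist Ca by (rule mult_left_mono)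
      finally show ?thesis using True by (simp add: e_def mult_ac)
    next
      case False
      then show ?thesis
        using zero[of j] const(1)[of j] j s U[OF i] U[OF k] by (simp add: e_def)
    qed
    then show "\<bar>(a j ?v + D1 (a j) ?v * (?u - ?v) - a j ?u) * cov D i j\<bar> \<le> e j * \<bar>cov D i j\<bar>"
      unfolding abs_mult by (intro mult_right_mono) auto
  qed
  also have "\<dots> = (\<Sum>p=1..ncov D. e p * \<bar>design D ?v i p\<bar>)" by (simp add: design_def stack_lo cong: sum.cong_simp)
  also have "\<dots> \<le> (\<Sum>p\<in>P. e p * \<bar>design D ?v i p\<bar>)"
    unfolding P_def using Ca by (intro sum_mono2) (auto simp: e_def)
  finally show ?thesis .
qed

text \<open>The abstract fit is instantiated once for each localisation point. Inside the kernel
  window a design entry is at most \<kappa> times a covariate, so the moment bounds for the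
  covariates acquire the factors \<kappa> squared and \<kappa> cubed.\<close>

lemma local_fit_k:
  assumes k: "k \<in> {1..nobs D}"
  shows "local_fit P {1..nobs D} (wt D (idx D k)) (design D (idx D k)) (\<lambda>i t. ll D t (resp D i))
    (\<lambda>i t. q1 (ll D) t (resp D i)) (\<lambda>i t. q2 (ll D) t (resp D i)) (true_pred D a) m
    (big_vec D A0 B0 k) e C2' C3'"
proof
  show "\<And>p. p \<in> P \<Longrightarrow> 0 \<le> e p" using Ca by (simp add: e_def)
  let ?w = "wt D (idx D k)" and ?x = "design D (idx D k)"
  let ?c = "\<lambda>p. if p \<le> ncov D then p else p - ncov D"
  fix p q r assume p: "p \<in> P" and q: "q \<in> P"
  have "(\<Sum>i=1..nobs D. ?w i * \<bar>q2 (ll D) (true_pred D a i) (resp D i)\<bar> * \<bar>?x i p\<bar> * \<bar>?x i q\<bar>)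
      \<le> (\<Sum>i=1..nobs D. \<kappa>\<^sup>2 * (?w i * \<bar>q2 (ll D) (true_pred D a i) (resp D i)\<bar>
          * \<bar>cov D i (?c p)\<bar> * \<bar>cov D i (?c q)\<bar>))"
  proof (rule sum_mono)
    fix i
    show "?w i * \<bar>q2 (ll D) (true_pred D a i) (resp D i)\<bar> * \<bar>?x i p\<bar> * \<bar>?x i q\<bar>
      \<le> \<kappa>\<^sup>2 * (?w i * \<bar>q2 (ll D) (true_pred D a i) (resp D i)\<bar> * \<bar>cov D i (?c p)\<bar> * \<bar>cov D i (?c q)\<bar>)"
    proof (cases "?w i = 0")
      case False
      have "?w i * \<bar>q2 (ll D) (true_pred D a i) (resp D i)\<bar> * \<bar>?x i p\<bar> * \<bar>?x i q\<bar>
          \<le> ?w i * \<bar>q2 (ll D) (true_pred D a i) (resp D i)\<bar>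
            * (\<kappa> * \<bar>cov D i (?c p)\<bar>) * (\<kappa> * \<bar>cov D i (?c q)\<bar>)"
        using wt_nonneg[of "idx D k" i] \<kappa>
        by (intro mult_mono design_le[OF False] p q order_refl mult_nonneg_nonneg) auto
      then show ?thesis by (simp add: power2_eq_square mult_ac)
    qed simp
  qed
  also have "\<dots> \<le> C2'"
    unfolding sum_distrib_left[symmetric] C2'_def
    by (intro mult_left_mono C2x k col_in p q) auto
  finally show "(\<Sum>i=1..nobs D. ?w i * \<bar>q2 (ll D) (true_pred D a i) (resp D i)\<bar> * \<bar>?x i p\<bar> * \<bar>?x i q\<bar>) \<le> C2'" .
  assume r: "r \<in> P"
  have "(\<Sum>i=1..nobs D. ?w i * m i * \<bar>?x i p\<bar> * \<bar>?x i q\<bar> * \<bar>?x i r\<bar>)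
      \<le> (\<Sum>i=1..nobs D. \<kappa> ^ 3 * (?w i * m i * \<bar>cov D i (?c p)\<bar> * \<bar>cov D i (?c q)\<bar> * \<bar>cov D i (?c r)\<bar>))"
  proof (rule sum_mono)
    fix i assume i: "i \<in> {1..nobs D}"
    show "?w i * m i * \<bar>?x i p\<bar> * \<bar>?x i q\<bar> * \<bar>?x i r\<bar>
      \<le> \<kappa> ^ 3 * (?w i * m i * \<bar>cov D i (?c p)\<bar> * \<bar>cov D i (?c q)\<bar> * \<bar>cov D i (?c r)\<bar>)"
    proof (cases "?w i = 0")
      case False
      have "\<bar>?x i p\<bar> * \<bar>?x i q\<bar> * \<bar>?x i r\<bar>
          \<le> (\<kappa> * \<bar>cov D i (?c p)\<bar>) * (\<kappa> * \<bar>cov D i (?c q)\<bar>) * (\<kappa> * \<bar>cov D i (?c r)\<bar>)"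
        using \<kappa> by (intro mult_mono design_le[OF False] p q r mult_nonneg_nonneg) auto
      from mult_left_mono[OF this mult_nonneg_nonneg[OF wt_nonneg[of "idx D k" i] m0[OF i]]]
      have "?w i * m i * \<bar>?x i p\<bar> * \<bar>?x i q\<bar> * \<bar>?x i r\<bar>
          \<le> ?w i * m i * (\<kappa> * \<bar>cov D i (?c p)\<bar>) * (\<kappa> * \<bar>cov D i (?c q)\<bar>) * (\<kappa> * \<bar>cov D i (?c r)\<bar>)"
        by (simp only: mult.assoc)
      moreover have "u * v * (\<kappa> * x) * (\<kappa> * y) * (\<kappa> * z) = \<kappa> ^ 3 * (u * v * x * y * z)" for u v x y z
        by (simp add: power3_eq_cube)
      ultimately show ?thesis by (simp only:)
    qed simp
  qed
  also have "\<dots> \<le> C3'"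
    unfolding sum_distrib_left[symmetric] C3'_def using \<kappa>
    by (intro mult_left_mono C3x k col_in p q r) auto
  finally show "(\<Sum>i=1..nobs D. ?w i * m i * \<bar>?x i p\<bar> * \<bar>?x i q\<bar> * \<bar>?x i r\<bar>) \<le> C3'" .
qed (use wt_nonneg m0 dL dL1 neg lipschitz truth_approx[OF k] in \<open>auto simp: P_def\<close>)

lemma S_sub: "S \<subseteq> P" by (auto simp: S_def)

lemma S2_sub: "S2 \<subseteq> P" using s by (auto simp: S2_def P_def)

lemma S_S2: "S \<subseteq> S2" using s by (auto simp: S2_def S_def P_def noise_idx_def)

lemma finP: "finite P" by (simp add: P_def)

lemma card_S2: "card S2 = 2 * s2"
  unfolding S2_def using s by (subst card_Un_disjoint) auto

lemma b1: "1 \<le> b"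
proof (cases "l1 \<le> l2")
  case True
  then have "1 \<le> l2 / l1" using l by simp
  then show ?thesis using b by simp
next
  case False
  then have "1 \<le> l1 / l2" using l by simp
  then show ?thesis using b by simp
qed

lemma truth_zero:
  assumes k: "k \<in> {1..nobs D}" and p: "p \<in> P - S"
  shows "big_vec D A0 B0 k p = 0"
proof (cases "p \<le> ncov D")
  case True
  then have "p \<in> {s2 + 1..ncov D}" using p by (auto simp: S_def noise_idx_def P_def)
  then show ?thesis using zero[OF _ U[OF k]] True by (simp add: big_vec_def stack_def A0_def)
next
  case False
  then have "p - ncov D \<in> {s1 + 1..ncov D}" using p s by (auto simp: S_def noise_idx_def P_def)
  then show ?thesis using const(1)[OF _ U[OF k]] False by (simp add: big_vec_def stack_def B0_def)
qed

text \<open>The condition is assumed for unit vectors; homogeneity extends it to the whole cone,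
  with the zero vector treated separately.\<close>

lemma RE': 
  assumes k: "k \<in> {1..nobs D}" and cone: "(\<Sum>p\<in>P. \<bar>v p\<bar>) \<le> 2 * (1 + b) * (\<Sum>p\<in>S2. \<bar>v p\<bar>)"
  shows "\<rho> * (\<Sum>p\<in>P. (v p)\<^sup>2) \<le> - (\<Sum>p\<in>P. \<Sum>q\<in>P. v p * true_hess D a (idx D k) p q * v q)"
proof (cases "L2_set v P = 0")
  case True
  then have "v p = 0" if "p \<in> P" for p using that by (simp add: L2_set_eq_0_iff finP)
  then show ?thesis by simp
next
  case False
  define c where "c = L2_set v P"
  have c: "0 < c" using False L2_set_nonneg[of v P] by (simp add: c_def less_le)
  \<comment> \<open>The restricted abstraction makes the normalised vector extensional, as
    membership in \<open>Omega0\<close> demands.\<close>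
  define w where "w = (\<lambda>p\<in>P. v p / c)"
  have wP: "w p = v p / c" if "p \<in> P" for p using that by (simp add: w_def)
  have abs_w: "(\<Sum>p\<in>A. \<bar>w p\<bar>) = (\<Sum>p\<in>A. \<bar>v p\<bar>) / c" if "A \<subseteq> P" for A
    using that c wP by (simp add: sum_divide_distrib subset_iff cong: sum.cong)
  have "w \<in> Omega0 (ncov D) s2 b"
  proof -
    have "L2_set w P = L2_set (\<lambda>p. (1 / c) * v p) P" by (intro L2_set_cong) (auto simp: wP)
    also have "\<dots> = 1" using c L2_set_right_distrib[of "1 / c" v P] by (simp add: c_def[symmetric])
    finally have 1: "L2_set w P = 1" .
    have "(\<Sum>j=1..ncov D. \<bar>w j\<bar> + \<bar>w (ncov D + j)\<bar>) = (\<Sum>p\<in>P. \<bar>w p\<bar>)"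
      unfolding P_def sum_double by (rule sum.distrib)
    also have "\<dots> = (\<Sum>p\<in>P. \<bar>v p\<bar>) / c" by (rule abs_w) simp
    also have "\<dots> \<le> 2 * (1 + b) * (\<Sum>p\<in>S2. \<bar>v p\<bar>) / c" using cone c by (intro divide_right_mono) auto
    also have "\<dots> = 2 * (1 + b) * (\<Sum>p\<in>S2. \<bar>w p\<bar>)" by (simp add: abs_w[OF S2_sub])
    also have "(\<Sum>p\<in>S2. \<bar>w p\<bar>) = (\<Sum>j=1..s2. \<bar>w j\<bar>) + (\<Sum>p=1 + ncov D..s2 + ncov D. \<bar>w p\<bar>)"
      unfolding S2_def using s by (subst sum.union_disjoint) (auto simp: add.commute)
    also have "(\<Sum>p=1 + ncov D..s2 + ncov D. \<bar>w p\<bar>) = (\<Sum>j=1..s2. \<bar>w (ncov D + j)\<bar>)"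
      using sum.shift_bounds_cl_nat_ivl[of "\<lambda>p. \<bar>w p\<bar>" 1 "ncov D" s2] by (simp add: add.commute)
    finally show ?thesis
      using 1 by (simp add: Omega0_def vecs_def w_def P_def sum.distrib)
  qed
  from RE[OF U[OF k] this] have "\<rho> \<le> - (\<Sum>p\<in>P. \<Sum>q\<in>P. w p * true_hess D a (idx D k) p q * w q)"
    by (simp add: quad_form_def P_def sum_negf)
  also have "(\<Sum>p\<in>P. \<Sum>q\<in>P. w p * true_hess D a (idx D k) p q * w q)
      = (\<Sum>p\<in>P. \<Sum>q\<in>P. v p * true_hess D a (idx D k) p q * v q) / c\<^sup>2"
    using wP by (simp add: sum_divide_distrib power2_eq_square cong: sum.cong)
  finally have "\<rho> \<le> - (\<Sum>p\<in>P. \<Sum>q\<in>P. v p * true_hess D a (idx D k) p q * v q) / c\<^sup>2"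
    by simp
  then have "\<rho> * c\<^sup>2 \<le> - (\<Sum>p\<in>P. \<Sum>q\<in>P. v p * true_hess D a (idx D k) p q * v q)"
    using c by (simp only: pos_le_divide_eq zero_less_power)
  then show ?thesis by (simp add: c_def power2_L2_set)
qed

text \<open>Vectors supported on \<open>S\<close> lie in the cone automatically. Therefore the
  restricted eigenvalue condition also provides the strict concavity of the oracle problem.\<close>

lemma S_cone:
  assumes "\<And>p. p \<in> P - S \<Longrightarrow> v p = 0"
  shows "(\<Sum>p\<in>P. \<bar>v p\<bar>) = (\<Sum>p\<in>S. \<bar>v p\<bar>)" "(\<Sum>p\<in>P. \<bar>v p\<bar>) \<le> 2 * (1 + b) * (\<Sum>p\<in>S2. \<bar>v p\<bar>)"
    "(\<Sum>p\<in>P. \<bar>v p\<bar>) \<le> sqrt (2 * s2) * L2_set v P"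
proof -
  show 1: "(\<Sum>p\<in>P. \<bar>v p\<bar>) = (\<Sum>p\<in>S. \<bar>v p\<bar>)"
    using assms S_sub finP by (intro sum.mono_neutral_right) auto
  have 2: "(\<Sum>p\<in>S. \<bar>v p\<bar>) \<le> (\<Sum>p\<in>S2. \<bar>v p\<bar>)"
    using S_S2 by (intro sum_mono2) (auto simp: S2_def)
  also have "\<dots> \<le> 2 * (1 + b) * (\<Sum>p\<in>S2. \<bar>v p\<bar>)"
    using b1 mult_right_mono[of 1 "2 * (1 + b)" "\<Sum>p\<in>S2. \<bar>v p\<bar>"] by (simp add: sum_nonneg)
  finally show "(\<Sum>p\<in>P. \<bar>v p\<bar>) \<le> 2 * (1 + b) * (\<Sum>p\<in>S2. \<bar>v p\<bar>)" using 1 by simp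
  have "(\<Sum>p\<in>S2. \<bar>v p\<bar>) \<le> sqrt (card S2) * L2_set v S2" by (rule sum_abs_le_L2_set)
  also have "\<dots> \<le> sqrt (card S2) * L2_set v P" by (intro mult_left_mono L2_set_mono_set finP S2_sub) auto
  finally show "(\<Sum>p\<in>P. \<bar>v p\<bar>) \<le> sqrt (2 * s2) * L2_set v P" using 1 2 by (simp add: card_S2)
qed

lemma row_bound:
  assumes k: "k \<in> {1..nobs D}" and p: "p \<in> P - S" and v: "\<And>p. p \<in> P - S \<Longrightarrow> v p = 0"
  shows "\<bar>\<Sum>q\<in>P. true_hess D a (idx D k) p q * v q\<bar> \<le> Crow * L2_set v P"
proof (cases "L2_set v P = 0")
  case True
  then have "v p = 0" if "p \<in> P" for p using that by (simp add: L2_set_eq_0_iff finP)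
  then show ?thesis by (simp add: True)
next
  case False
  define c where "c = L2_set v P"
  have c: "0 < c" using False L2_set_nonneg[of v P] by (simp add: c_def less_le)
  define w where "w = (\<lambda>p\<in>P. v p / c)"
  have wP: "w p = v p / c" if "p \<in> P" for p using that by (simp add: w_def)
  have "L2_set w P = L2_set (\<lambda>p. (1 / c) * v p) P" by (intro L2_set_cong) (auto simp: wP)
  also have "\<dots> = 1" using c L2_set_right_distrib[of "1 / c" v P] by (simp add: c_def[symmetric])
  finally have "L2_set w P = 1" .
  moreover have "w q = 0" if "q \<in> noise_idx (ncov D) s1 s2" for q
  proof -
    have q: "q \<in> P - S" using that by (auto simp: noise_idx_def P_def S_def)
    then show ?thesis using v[OF q] by (simp add: w_def)
  qed
  moreover have "w \<in> vecs (2 * ncov D)" by (simp add: vecs_def w_def P_def)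
  ultimately have "w \<in> oracle_sphere (ncov D) s1 s2" by (simp add: oracle_sphere_def P_def)
  then have "\<bar>\<Sum>q=1..2 * ncov D. true_hess D a (idx D k) p q * w q\<bar> \<le> Crow"
    using p by (intro Crow U k) (auto simp: S_def)
  also have "(\<Sum>q=1..2 * ncov D. true_hess D a (idx D k) p q * w q)
      = (\<Sum>q\<in>P. true_hess D a (idx D k) p q * v q) / c"
    unfolding P_def[symmetric] using wP by (simp add: sum_divide_distrib cong: sum.cong)
  finally show ?thesis using c by (simp add: pos_divide_le_eq c_def[symmetric])
qed

declare One_nat_def [simp del]

section \<open>From single observations to the group-penalised objective\<close>

definition G :: "nat \<Rightarrow> (nat \<Rightarrow> real) \<Rightarrow> nat \<Rightarrow> real" where
  "G k \<theta> p = loc_score D k (At k) (Bt k) p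
     + (\<Sum>q\<in>P. loc_hess D k (At k) (Bt k) p q * (\<theta> q - big_vec D At Bt k q))"

lemma C3'_nonneg: "0 \<le> C3'"
proof -
  have "0 \<le> (\<Sum>i=1..nobs D. wt D (idx D 1) i * m i * \<bar>cov D i 1\<bar> * \<bar>cov D i 1\<bar> * \<bar>cov D i 1\<bar>)"
    by (intro sum_nonneg mult_nonneg_nonneg wt_nonneg m0) auto
  also have "\<dots> \<le> C3x" using n s by (intro C3x) auto
  finally show ?thesis using \<kappa> by (simp add: C3'_def)
qed

lemma C2'_nonneg: "0 \<le> C2'"
proof -
  have "0 \<le> (\<Sum>i=1..nobs D. wt D (idx D 1) i * \<bar>q2 (ll D) (true_pred D a i) (resp D i)\<bar>
      * \<bar>cov D i 1\<bar> * \<bar>cov D i 1\<bar>)"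
    by (intro sum_nonneg mult_nonneg_nonneg wt_nonneg) auto
  also have "\<dots> \<le> C2x" using n s by (intro C2x) auto
  finally show ?thesis by (simp add: C2'_def)
qed

lemma ep_nonneg: "0 \<le> ep" using Ca by (simp add: ep_def)

lemma R_nonneg: "0 \<le> R" using l b1 \<rho> by (simp add: R_def)

lemma ep_le_dv: "ep \<le> dv" using R_nonneg b1 by (simp add: dv_def)

lemma Err_nonneg: "0 \<le> Err"
  using C2'_nonneg C3'_nonneg ep_nonneg by (simp add: Err_def)

lemma lin_pred_cong:
  "lin_pred D k \<alpha> \<beta> i = (\<Sum>p\<in>P. stack (ncov D) \<alpha> (\<lambda>j. bw D * \<beta> j) p * design D (idx D k) i p)"
  using h by (simp add: lin_pred_eq P_def)

text \<open>The factor \<open>h\<close> in the slope penalty is absorbed by the scaling of the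
  slopes, so the preliminary criterion is a lasso with the weights \<open>l1\<close> and
  \<open>l2\<close> on the two halves.\<close>

lemma prelim_obj_eq:
  "prelim_obj D l1 l2 k (\<alpha>, \<beta>) =
    (\<Sum>i=1..nobs D. wt D (idx D k) i *
       ll D (\<Sum>p\<in>P. stack (ncov D) \<alpha> (\<lambda>j. bw D * \<beta> j) p * design D (idx D k) i p) (resp D i))
    - (\<Sum>p\<in>P. stack (ncov D) (\<lambda>_. l1) (\<lambda>_. l2) p * \<bar>stack (ncov D) \<alpha> (\<lambda>j. bw D * \<beta> j) p\<bar>)"
proof -
  have "(\<Sum>p\<in>P. stack (ncov D) (\<lambda>_. l1) (\<lambda>_. l2) p * \<bar>stack (ncov D) \<alpha> (\<lambda>j. bw D * \<beta> j) p\<bar>)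
      = (\<Sum>p\<in>P. stack (ncov D) (\<lambda>_. l1) (\<lambda>_. l2) p
          * stack (ncov D) (\<lambda>j. \<bar>\<alpha> j\<bar>) (\<lambda>j. bw D * \<bar>\<beta> j\<bar>) p)"
    using h by (intro sum.cong) (auto simp: stack_def abs_mult)
  also have "\<dots> = (\<Sum>j=1..ncov D. l1 * \<bar>\<alpha> j\<bar>) + (\<Sum>j=1..ncov D. l2 * (bw D * \<bar>\<beta> j\<bar>))"
    unfolding P_def by (rule sum_stack)
  finally show ?thesis
    by (simp add: prelim_obj_def loc_lik_eq lin_pred_cong sum_distrib_left)
qed

text \<open>\<open>N1\<close> puts the score at the local-linear truth below a quarter of the
  smaller penalty, and \<open>N2\<close> is the smallness needed for the cubic term. The constant
  \<open>b\<close> bounds the ratio of the two penalties, which is why the lasso cone matches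
  \<open>Omega0\<close>.\<close>

lemma prelim_rate:
  assumes N1: "Cs + C2' * ep + 3 * C3' * ep\<^sup>2 \<le> min l1 l2 / 4"
    and N2: "C3' * dv * ((2 * (1 + b))\<^sup>2 * (2 * real s2)) \<le> \<rho> / 2"
    and k: "k \<in> {1..nobs D}"
  shows "L2_set (\<lambda>p. big_vec D At Bt k p - big_vec D A0 B0 k p) P \<le> R"
    "ep + (\<Sum>p\<in>P. \<bar>big_vec D At Bt k p - big_vec D A0 B0 k p\<bar>) \<le> dv"
proof -
  interpret L: local_fit P "{1..nobs D}" "wt D (idx D k)" "design D (idx D k)"
    "\<lambda>i t. ll D t (resp D i)" "\<lambda>i t. q1 (ll D) t (resp D i)" "\<lambda>i t. q2 (ll D) t (resp D i)"
    "true_pred D a" m "big_vec D A0 B0 k" e C2' C3'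
    by (rule local_fit_k[OF k])
  have eps: "L.eps = ep" by (simp add: L.eps_def e_sum)
  define \<theta> where "\<theta> = big_vec D At Bt k"
  define \<kappa>' where "\<kappa>' = stack (ncov D) (\<lambda>_. l1) (\<lambda>_. l2)"
  have opt: "L.lik \<theta>' - (\<Sum>p\<in>P. \<kappa>' p * \<bar>\<theta>' p\<bar>) \<le> L.lik \<theta> - (\<Sum>p\<in>P. \<kappa>' p * \<bar>\<theta> p\<bar>)" for \<theta>'
  proof -
    \<comment> \<open>Every vector in stacked coordinates comes from admissible parameters, since
      the bandwidth is nonzero; thus optimality over arrays is optimality over all vectors.\<close>
    define \<alpha> where "\<alpha> = (\<lambda>j\<in>{1..ncov D}. \<theta>' j)"
    define \<beta> where "\<beta> = (\<lambda>j\<in>{1..ncov D}. \<theta>' (ncov D + j) / bw D)"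
    have st: "stack (ncov D) \<alpha> (\<lambda>j. bw D * \<beta> j) p = \<theta>' p" if "p \<in> P" for p
      using that h by (auto simp: stack_def \<alpha>_def \<beta>_def P_def)
    have "prelim_obj D l1 l2 k (\<alpha>, \<beta>) \<le> prelim_obj D l1 l2 k (At k, Bt k)"
      using prelim[OF k] by (auto simp: is_arg_max_linorder vecs_def \<alpha>_def \<beta>_def)
    moreover have "prelim_obj D l1 l2 k (\<alpha>, \<beta>) = L.lik \<theta>' - (\<Sum>p\<in>P. \<kappa>' p * \<bar>\<theta>' p\<bar>)"
      unfolding prelim_obj_eq L.lik_def L.pred_def \<kappa>'_def by (simp add: st cong: sum.cong)
    moreover have "prelim_obj D l1 l2 k (At k, Bt k) = L.lik \<theta> - (\<Sum>p\<in>P. \<kappa>' p * \<bar>\<theta> p\<bar>)"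
      unfolding prelim_obj_eq L.lik_def L.pred_def \<kappa>'_def \<theta>_def big_vec_def ..
    ultimately show ?thesis by simp
  qed
  have ratio: "max l1 l2 \<le> b * min l1 l2"
  proof (cases "l1 \<le> l2")
    case True
    then have "l2 / l1 \<le> b" using b by simp
    then show ?thesis using True l by (simp add: pos_divide_le_eq)
  next
    case False
    then have "l1 / l2 \<le> b" using b by simp
    then show ?thesis using False l by (simp add: pos_divide_le_eq)
  qed
  have sc: "\<bar>L.score (L.pred (big_vec D A0 B0 k)) p\<bar> \<le> min l1 l2 / 4" if p: "p \<in> P" for p
  proof -
    have "L.score (true_pred D a) p = true_score D a k p"
      by (simp add: L.score_def true_score_def)
    then have "\<bar>L.score (true_pred D a) p\<bar> \<le> Cs" using Cs[OF k, of p] p by (simp add: P_def)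
    then show ?thesis using L.score_approx[OF p, unfolded eps] N1 by linarith
  qed
  have hss: "L.hss (true_pred D a) p q = true_hess D a (idx D k) p q" for p q
    by (simp add: L.hss_def true_hess_def hess_eq)
  have cS: "sqrt (real (card S2)) = sqrt (2 * s2)" by (simp add: card_S2)
  have ne: "S2 \<noteq> {}" using s by (auto simp: S2_def)
  have tz: "\<And>p. p \<in> P - S2 \<Longrightarrow> big_vec D A0 B0 k p = 0" using truth_zero[OF k] S_S2 by blast
  have lo: "\<And>p. p \<in> P \<Longrightarrow> min l1 l2 \<le> \<kappa>' p" and hi: "\<And>p. p \<in> P \<Longrightarrow> \<kappa>' p \<le> max l1 l2"
    by (auto simp: \<kappa>'_def stack_def)
  have RE2: "\<rho> * (\<Sum>p\<in>P. (v p)\<^sup>2) \<le> - (\<Sum>p\<in>P. \<Sum>q\<in>P. v p * L.hss (true_pred D a) p q * v q)"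
    if "(\<Sum>p\<in>P. \<bar>v p\<bar>) \<le> 2 * (1 + b) * (\<Sum>p\<in>S2. \<bar>v p\<bar>)" for v
    unfolding hss using RE'[OF k that] .
  have R_eq: "R = 8 * max l1 l2 * (2 * (1 + b) + 1) * sqrt (real (card S2)) / \<rho>" by (simp add: R_def cS)
  have sm: "C3' * (L.eps + 2 * (1 + b) * sqrt (real (card S2)) * R) * ((2 * (1 + b))\<^sup>2 * real (card S2)) \<le> \<rho> / 2"
    using N2 by (simp add: eps cS card_S2 dv_def)
  have lpos: "0 < min l1 l2" using l by simp
  note rate = L.lasso_rate[OF S2_sub ne tz lo hi lpos ratio opt sc RE2 \<rho> R_eq C3'_nonneg sm]
  show "L2_set (\<lambda>p. big_vec D At Bt k p - big_vec D A0 B0 k p) P \<le> R" using rate(1) by (simp add: \<theta>_def)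
  show "ep + (\<Sum>p\<in>P. \<bar>big_vec D At Bt k p - big_vec D A0 B0 k p\<bar>) \<le> dv"
    using rate(2) by (simp add: \<theta>_def dv_def cS)
qed

text \<open>All that the global argument needs from one observation. The Hessian at the preliminary
  estimate keeps half of the eigenvalue. The gradient on a noise coordinate splits into the true
  score, the Newton error at the truth, and a Hessian row applied to the oracle error; the row is
  controlled by \<open>Crow\<close> up to the Lipschitz correction.\<close>

lemma oracle_k:
  assumes N1: "Cs + C2' * ep + 3 * C3' * ep\<^sup>2 \<le> min l1 l2 / 4"
    and N2: "C3' * dv * ((2 * (1 + b))\<^sup>2 * (2 * real s2)) \<le> \<rho> / 2"
    and k: "k \<in> {1..nobs D}"
  shows nd_k: "\<And>v. (\<And>p. p \<in> P - S \<Longrightarrow> v p = 0) \<Longrightarrow> \<rho> / 2 * (\<Sum>p\<in>P. (v p)\<^sup>2)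
      \<le> - (\<Sum>p\<in>P. \<Sum>q\<in>P. v p * loc_hess D k (At k) (Bt k) p q * v q)"
    and nsd_k: "\<And>v. (\<Sum>p\<in>P. \<Sum>q\<in>P. v p * loc_hess D k (At k) (Bt k) p q * v q) \<le> 0"
    and ex_k: "\<exists>\<theta>s. (\<forall>p\<in>P - S. \<theta>s p = 0) \<and> (\<forall>p\<in>S. G k \<theta>s p = 0)
      \<and> (L2_set (\<lambda>p. \<theta>s p - big_vec D A0 B0 k p) P)\<^sup>2
         \<le> 4 / \<rho>\<^sup>2 * (2 * (\<Sum>p\<in>S. (true_score D a k p)\<^sup>2) + 4 * real s2 * Err\<^sup>2)
      \<and> (\<forall>p\<in>P - S. \<bar>G k \<theta>s p\<bar> \<le> (Cs + Err)
           + (Crow + C3' * dv * sqrt (2 * s2)) * L2_set (\<lambda>p. \<theta>s p - big_vec D A0 B0 k p) P)"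
proof -
  let ?tr = "big_vec D A0 B0 k" and ?\<theta> = "big_vec D At Bt k"
  interpret L: local_fit P "{1..nobs D}" "wt D (idx D k)" "design D (idx D k)"
    "\<lambda>i t. ll D t (resp D i)" "\<lambda>i t. q1 (ll D) t (resp D i)" "\<lambda>i t. q2 (ll D) t (resp D i)"
    "true_pred D a" m ?tr e C2' C3'
    by (rule local_fit_k[OF k])
  have eps: "L.eps = ep" by (simp add: L.eps_def e_sum)
  have dev: "L.dev ?\<theta> \<le> dv" using prelim_rate(2)[OF N1 N2 k] by (simp add: L.dev_eq eps)
  have hss: "L.hss (true_pred D a) p q = true_hess D a (idx D k) p q" for p q
    by (simp add: L.hss_def true_hess_def hess_eq)
  have pred: "L.pred ?\<theta> = lin_pred D k (At k) (Bt k)"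
    by (rule ext) (simp add: L.pred_def lin_pred_cong big_vec_def)
  have hss': "L.hss (L.pred ?\<theta>) p q = loc_hess D k (At k) (Bt k) p q" for p q
    by (simp add: pred L.hss_def loc_hess_def hess_eq)
  have score': "L.score (L.pred ?\<theta>) p = loc_score D k (At k) (Bt k) p" for p
    by (simp add: pred L.score_def loc_score_eq)
  have score: "L.score (true_pred D a) p = true_score D a k p" for p
    by (simp add: L.score_def true_score_def)
  have grad: "L.grad ?\<theta> \<theta> p = G k \<theta> p" for \<theta> p
    by (simp add: L.grad_def G_def hss' score')
  show nsd: "(\<Sum>p\<in>P. \<Sum>q\<in>P. v p * loc_hess D k (At k) (Bt k) p q * v q) \<le> 0" for v
    using L.hss_nsd[of v "L.pred ?\<theta>"] by (simp add: hss')
  show nd: "\<rho> / 2 * (\<Sum>p\<in>P. (v p)\<^sup>2) \<le> - (\<Sum>p\<in>P. \<Sum>q\<in>P. v p * loc_hess D k (At k) (Bt k) p q * v q)"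
    if v: "\<And>p. p \<in> P - S \<Longrightarrow> v p = 0" for v
  proof -
    let ?a = "\<Sum>p\<in>P. \<bar>v p\<bar>"
    have "\<rho> * (\<Sum>p\<in>P. (v p)\<^sup>2) \<le> - (\<Sum>p\<in>P. \<Sum>q\<in>P. v p * true_hess D a (idx D k) p q * v q)"
      using RE'[OF k] S_cone(2) v by blast
    moreover have "\<bar>(\<Sum>p\<in>P. \<Sum>q\<in>P. v p * loc_hess D k (At k) (Bt k) p q * v q)
        - (\<Sum>p\<in>P. \<Sum>q\<in>P. v p * true_hess D a (idx D k) p q * v q)\<bar> \<le> C3' * L.dev ?\<theta> * ?a * ?a"
      using L.hess_approx[of v ?\<theta> v] by (simp add: hss hss')
    moreover have "C3' * L.dev ?\<theta> * ?a * ?a \<le> \<rho> / 2 * (\<Sum>p\<in>P. (v p)\<^sup>2)"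
    proof -
      have a: "?a \<le> sqrt (2 * s2) * L2_set v P" using S_cone(3) v by blast
      have "C3' * L.dev ?\<theta> * ?a * ?a \<le> C3' * dv * (sqrt (2 * s2) * L2_set v P) * (sqrt (2 * s2) * L2_set v P)"
        using C3'_nonneg L.dev_nonneg dev a order_trans[OF L.dev_nonneg dev]
        by (intro mult_mono mult_nonneg_nonneg) (auto simp: sum_nonneg)
      also have "\<dots> = (C3' * dv * (2 * real s2)) * (L2_set v P)\<^sup>2"
        by (simp add: power2_eq_square algebra_simps flip: real_sqrt_mult)
      \<comment> \<open>Only the factor \<open>2 * s2\<close> arises here. It is enlarged to the
        cone constant so that the same hypothesis \<open>N2\<close> serves both this step and the
        lasso bound.\<close>
      also have "\<dots> \<le> (C3' * dv * ((2 * (1 + b))\<^sup>2 * (2 * real s2))) * (L2_set v P)\<^sup>2"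
      proof -
        have "1\<^sup>2 \<le> (2 * (1 + b))\<^sup>2" using b1 by (intro power_mono) auto
        then have "1 * (2 * real s2) \<le> (2 * (1 + b))\<^sup>2 * (2 * real s2)" by (intro mult_right_mono) auto
        then show ?thesis using C3'_nonneg order_trans[OF L.dev_nonneg dev]
          by (intro mult_right_mono mult_left_mono mult_nonneg_nonneg) auto
      qed
      also have "\<dots> \<le> \<rho> / 2 * (L2_set v P)\<^sup>2" using N2 by (intro mult_right_mono) auto
      finally show ?thesis by (simp add: power2_L2_set)
    qed
    ultimately show ?thesis by argo
  qed
  \<comment> \<open>Applied with eigenvalue \<rho>/2, the value that survives at the preliminary
    estimate.\<close>
  obtain \<theta>s where \<theta>s: "\<And>p. p \<in> P - S \<Longrightarrow> \<theta>s p = 0" "\<And>p. p \<in> S \<Longrightarrow> L.grad ?\<theta> \<theta>s p = 0"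
    "\<rho> / 2 * L2_set (\<lambda>p. \<theta>s p - ?tr p) P \<le> L2_set (L.grad ?\<theta> ?tr) S"
    by (rule L.oracle_critical_point[where S = S and \<rho> = "\<rho> / 2" and \<theta> = ?\<theta>])
       (use S_sub truth_zero[OF k] nd \<rho> in \<open>auto simp: hss'\<close>)
  define v where "v p = \<theta>s p - ?tr p" for p
  have v0: "v p = 0" if "p \<in> P - S" for p
    using \<theta>s(1)[OF that] truth_zero[OF k that] by (simp add: v_def)
  have G0: "\<bar>G k ?tr p - true_score D a k p\<bar> \<le> Err" if p: "p \<in> P" for p
  proof -
    have "\<bar>L.grad ?\<theta> ?tr p - true_score D a k p\<bar> \<le> C2' * ep + 3 * C3' * (L.dev ?\<theta>)\<^sup>2"
      using L.grad_approx[OF p, of ?\<theta>] by (simp add: L.grad_def score eps)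
    also have "\<dots> \<le> Err" unfolding Err_def
      using C3'_nonneg L.dev_nonneg dev by (intro add_left_mono mult_left_mono power_mono) auto
    finally show ?thesis by (simp add: grad)
  qed
  have b1': "(L2_set v P)\<^sup>2 \<le> 4 / \<rho>\<^sup>2 * (2 * (\<Sum>p\<in>S. (true_score D a k p)\<^sup>2) + 4 * real s2 * Err\<^sup>2)"
  proof -
    have "\<rho> / 2 * L2_set v P \<le> L2_set (G k ?tr) S"
      using \<theta>s(3) by (simp add: v_def[abs_def] grad[abs_def])
    then have "(\<rho> / 2 * L2_set v P)\<^sup>2 \<le> (L2_set (G k ?tr) S)\<^sup>2"
      using \<rho> by (intro power_mono) auto
    also have "\<dots> = (\<Sum>p\<in>S. (G k ?tr p)\<^sup>2)" by (rule power2_L2_set)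
    also have "\<dots> \<le> (\<Sum>p\<in>S. 2 * (true_score D a k p)\<^sup>2 + 2 * Err\<^sup>2)"
    proof (rule sum_mono)
      fix p assume "p \<in> S"
      then have "\<bar>G k ?tr p\<bar> \<le> \<bar>true_score D a k p\<bar> + Err" using G0[of p] S_sub by fastforce
      then have "\<bar>G k ?tr p\<bar>\<^sup>2 \<le> (\<bar>true_score D a k p\<bar> + Err)\<^sup>2" by (intro power_mono) auto
      also have "\<dots> \<le> 2 * (true_score D a k p)\<^sup>2 + 2 * Err\<^sup>2"
        using sum_squares_bound[of "\<bar>true_score D a k p\<bar>" Err] by (simp add: power2_sum)
      finally show "(G k ?tr p)\<^sup>2 \<le> 2 * (true_score D a k p)\<^sup>2 + 2 * Err\<^sup>2" by simp
    qed
    also have "\<dots> = 2 * (\<Sum>p\<in>S. (true_score D a k p)\<^sup>2) + real (card S) * (2 * Err\<^sup>2)"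
      by (simp add: sum.distrib sum_distrib_left)
    also have "real (card S) * (2 * Err\<^sup>2) \<le> real (2 * s2) * (2 * Err\<^sup>2)"
    proof (intro mult_right_mono)
      have "card S \<le> card S2" by (rule card_mono) (use S_S2 in \<open>auto simp: S2_def\<close>)
      then show "real (card S) \<le> real (2 * s2)" by (simp add: card_S2)
    qed simp
    finally have "\<rho>\<^sup>2 / 4 * (L2_set v P)\<^sup>2 \<le> 2 * (\<Sum>p\<in>S. (true_score D a k p)\<^sup>2) + 4 * real s2 * Err\<^sup>2"
      by (simp add: power_mult_distrib power_divide)
    then show ?thesis using \<rho> by (simp add: field_simps)
  qed
  have noise: "\<bar>G k \<theta>s p\<bar> \<le> (Cs + Err) + (Crow + C3' * dv * sqrt (2 * s2)) * L2_set v P"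
    if p: "p \<in> P - S" for p
  proof -
    have pP: "p \<in> P" using p by simp
    have 1: "\<bar>G k ?tr p\<bar> \<le> Cs + Err" using G0[OF pP] Cs[OF k, of p] pP by (fastforce simp: P_def)
    have 2: "G k \<theta>s p - G k ?tr p = (\<Sum>q\<in>P. loc_hess D k (At k) (Bt k) p q * v q)"
      using L.grad_diff[of ?\<theta> \<theta>s p ?tr] by (simp add: grad hss' v_def)
    have 3: "\<bar>(\<Sum>q\<in>P. loc_hess D k (At k) (Bt k) p q * v q) - (\<Sum>q\<in>P. true_hess D a (idx D k) p q * v q)\<bar>
        \<le> C3' * L.dev ?\<theta> * (\<Sum>q\<in>P. \<bar>v q\<bar>)"
      using L.hss_row_approx[OF pP, of ?\<theta> v] by (simp add: hss hss')
    have "C3' * L.dev ?\<theta> * (\<Sum>q\<in>P. \<bar>v q\<bar>) \<le> C3' * dv * (sqrt (2 * s2) * L2_set v P)"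
      using C3'_nonneg L.dev_nonneg dev S_cone(3)[of v] v0 order_trans[OF L.dev_nonneg dev]
      by (intro mult_mono mult_nonneg_nonneg) (auto simp: sum_nonneg)
    moreover have "\<bar>\<Sum>q\<in>P. true_hess D a (idx D k) p q * v q\<bar> \<le> Crow * L2_set v P"
      by (rule row_bound[OF k p v0])
    moreover have "(Crow + C3' * dv * sqrt (2 * s2)) * L2_set v P
        = Crow * L2_set v P + C3' * dv * (sqrt (2 * s2) * L2_set v P)" by (simp add: algebra_simps)
    ultimately show ?thesis using 1 2 3 by linarith
  qed
  show "\<exists>\<theta>s. (\<forall>p\<in>P - S. \<theta>s p = 0) \<and> (\<forall>p\<in>S. G k \<theta>s p = 0)
      \<and> (L2_set (\<lambda>p. \<theta>s p - ?tr p) P)\<^sup>2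
         \<le> 4 / \<rho>\<^sup>2 * (2 * (\<Sum>p\<in>S. (true_score D a k p)\<^sup>2) + 4 * real s2 * Err\<^sup>2)
      \<and> (\<forall>p\<in>P - S. \<bar>G k \<theta>s p\<bar> \<le> (Cs + Err)
           + (Crow + C3' * dv * sqrt (2 * s2)) * L2_set (\<lambda>p. \<theta>s p - ?tr p) P)"
    using \<theta>s b1' noise by (intro exI[of _ \<theta>s]) (auto simp: grad v_def[abs_def])
qed

text \<open>The penalty weights are frozen at the preliminary estimate, so the objective is a
  concave quadratic minus a weighted group norm; the nonconvexity of SCAD itself never
  appears.\<close>

definition \<mu> :: "nat \<Rightarrow> real" where
  "\<mu> = stack (ncov D) (\<lambda>j. scad_deriv l4 (L2_set (\<lambda>k. At k j) {1..nobs D}))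
     (\<lambda>j. scad_deriv l4s (centred_norm (nobs D) (\<lambda>k. At k j)))"

definition F :: "(nat \<Rightarrow> nat \<Rightarrow> real) \<Rightarrow> real" where
  "F \<Theta> = (\<Sum>k=1..nobs D. \<Sum>p\<in>P. (\<Theta> k p - big_vec D At Bt k p) * loc_score D k (At k) (Bt k) p)
      + 1 / 2 * (\<Sum>k=1..nobs D. \<Sum>p\<in>P. \<Sum>q\<in>P. (\<Theta> k p - big_vec D At Bt k p)
          * loc_hess D k (At k) (Bt k) p q * (\<Theta> k q - big_vec D At Bt k q))
      - (\<Sum>p\<in>P. \<mu> p * L2_set (\<lambda>k. \<Theta> k p) {1..nobs D})"

lemma scad_obj_eq: "scad_obj D At Bt l4 l4s (A, B) = big_lik D At Bt + F (big_vec D A B)"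
proof -
  have "(\<Sum>p\<in>P. \<mu> p * L2_set (\<lambda>k. big_vec D A B k p) {1..nobs D})
      = (\<Sum>p\<in>P. \<mu> p * stack (ncov D) (\<lambda>j. L2_set (\<lambda>k. A k j) {1..nobs D})
          (\<lambda>j. L2_set (\<lambda>k. bw D * B k j) {1..nobs D}) p)"
    by (intro sum.cong) (auto simp: big_vec_def stack_def)
  then show ?thesis
    by (simp add: scad_obj_def quad_lik_def Let_def quad_form_def F_def P_def \<mu>_def sum_stack)
qed

text \<open>The error bound \<open>R\<close> for each observation becomes \<open>sqrt n * R\<close>
  for a group. By \<open>N4\<close> the signal groups, of size at least \<open>bd * sqrt n\<close>,
  stay beyond 3.7 times the tuning parameter, where the SCAD derivative is zero. By
  \<open>N5\<close> the noise groups stay below the tuning parameter, where it is constant.\<close>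

lemma weights:
  assumes N1: "Cs + C2' * ep + 3 * C3' * ep\<^sup>2 \<le> min l1 l2 / 4"
    and N2: "C3' * dv * ((2 * (1 + b))\<^sup>2 * (2 * real s2)) \<le> \<rho> / 2"
    and N4: "3.7 * max l4 l4s + sqrt (nobs D) * R \<le> bd * sqrt (nobs D)"
    and N5: "sqrt (nobs D) * R \<le> min l4 l4s"
  shows "p \<in> S \<Longrightarrow> \<mu> p = 0" "p \<in> P - S \<Longrightarrow> min l4 l4s \<le> \<mu> p"
proof -
  let ?n = "nobs D"
  have diff: "L2_set (\<lambda>k. At k j - A0 k j) {1..?n} \<le> sqrt ?n * R" if j: "j \<in> {1..ncov D}" for j
  proof -
    have "\<bar>At k j - A0 k j\<bar> \<le> R" if k: "k \<in> {1..?n}" for k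
    proof -
      have jP: "j \<in> P" using j by (auto simp: P_def)
      have "\<bar>At k j - A0 k j\<bar> = \<bar>big_vec D At Bt k j - big_vec D A0 B0 k j\<bar>"
        using j by (simp add: big_vec_def stack_lo)
      also have "\<dots> \<le> L2_set (\<lambda>p. \<bar>big_vec D At Bt k p - big_vec D A0 B0 k p\<bar>) P"
        by (rule member_le_L2_set[OF finP jP])
      also have "\<dots> \<le> R" using prelim_rate(1)[OF N1 N2 k] by (simp add: L2_set_def)
      finally show ?thesis .
    qed
    then have "L2_set (\<lambda>k. \<bar>At k j - A0 k j\<bar>) {1..?n} \<le> L2_set (\<lambda>_. R) {1..?n}"
      by (intro L2_set_mono) auto
    then show ?thesis using R_nonneg by (simp add: L2_set_constant L2_set_def[of "\<lambda>k. \<bar>_ k\<bar>"]) (simp add: L2_set_def)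
  qed
  have diff': "L2_set (\<lambda>k. A0 k j - At k j) {1..?n} \<le> sqrt ?n * R" if "j \<in> {1..ncov D}" for j
    using diff[OF that] by (simp add: L2_set_def power2_commute)
  show "\<mu> p = 0" if p: "p \<in> S"
  proof (cases "p \<le> ncov D")
    case True
    then have j: "p \<in> {1..s2}" "p \<in> {1..ncov D}" using p s by (auto simp: S_def P_def noise_idx_def)
    have "bd * sqrt ?n \<le> L2_set (\<lambda>k. A0 k p) {1..?n}" using signal(1)[OF j(1)] by (simp add: A0_def)
    also have "\<dots> \<le> L2_set (\<lambda>k. At k p) {1..?n} + L2_set (\<lambda>k. A0 k p - At k p) {1..?n}"
      by (rule L2_set_diff_triangle)
    finally have "3.7 * l4 \<le> L2_set (\<lambda>k. At k p) {1..?n}" using diff'[OF j(2)] N4 by linarith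
    then show ?thesis using True l by (simp add: \<mu>_def stack_def scad_deriv_large)
  next
    case False
    define j where "j = p - ncov D"
    have j: "j \<in> {1..s1}" "j \<in> {1..ncov D}" using p s False by (auto simp: S_def P_def noise_idx_def j_def)
    have "bd * sqrt ?n \<le> centred_norm ?n (\<lambda>k. A0 k j)" using signal(2)[OF j(1)] by (simp add: A0_def)
    also have "\<dots> \<le> centred_norm ?n (\<lambda>k. At k j) + L2_set (\<lambda>k. A0 k j - At k j) {1..?n}"
      by (rule centred_norm_triangle)
    finally have "3.7 * l4s \<le> centred_norm ?n (\<lambda>k. At k j)" using diff'[OF j(2)] N4 by linarith
    then show ?thesis using False l by (simp add: \<mu>_def stack_def scad_deriv_large j_def)
  qed
  show "min l4 l4s \<le> \<mu> p" if p: "p \<in> P - S"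
  proof (cases "p \<le> ncov D")
    case True
    then have j: "p \<in> {s2 + 1..ncov D}" "p \<in> {1..ncov D}" using p by (auto simp: S_def P_def noise_idx_def)
    have "L2_set (\<lambda>k. A0 k p) {1..?n} = 0"
      using zero[OF j(1) U] by (intro L2_set_0') (simp add: A0_def)
    then have "L2_set (\<lambda>k. At k p) {1..?n} \<le> l4"
      using L2_set_diff_triangle[of "\<lambda>k. At k p" "{1..?n}" "\<lambda>k. A0 k p"] diff[OF j(2)] N5 by linarith
    then show ?thesis using True by (simp add: \<mu>_def stack_def scad_deriv_small)
  next
    case False
    define j where "j = p - ncov D"
    have j: "j \<in> {s1 + 1..ncov D}" "j \<in> {1..ncov D}" using p s False by (auto simp: S_def P_def noise_idx_def j_def)
    obtain c where "\<And>u. u \<in> {0..1} \<Longrightarrow> a j u = c" using const(2)[OF j(1)] by blast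
    then have "centred_norm ?n (\<lambda>k. A0 k j) = 0"
      using U by (intro centred_norm_const[where c = c]) (simp add: A0_def)
    then have "centred_norm ?n (\<lambda>k. At k j) \<le> l4s"
      using centred_norm_triangle[of ?n "\<lambda>k. At k j" "\<lambda>k. A0 k j"] diff[OF j(2)] N5 by linarith
    then show ?thesis using False by (simp add: \<mu>_def stack_def scad_deriv_small j_def)
  qed
qed

text \<open>With zero weights on the signal groups the oracle problem decouples over the
  observations, so the local critical points can be chosen separately and assembled. The penalty
  couples observations only through noise groups, and these are handled by the strict inequality
  \<open>N3\<close>.\<close>

lemma oracle_max:
  assumes N0: "0 \<le> Crow"
    and N1: "Cs + C2' * ep + 3 * C3' * ep\<^sup>2 \<le> min l1 l2 / 4"
    and N2: "C3' * dv * ((2 * (1 + b))\<^sup>2 * (2 * real s2)) \<le> \<rho> / 2"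
    and N3: "sqrt (nobs D) * (Cs + Err) + (Crow + C3' * dv * sqrt (2 * s2)) * sqrt VV < min l4 l4s"
    and N4: "3.7 * max l4 l4s + sqrt (nobs D) * R \<le> bd * sqrt (nobs D)"
    and N5: "sqrt (nobs D) * R \<le> min l4 l4s"
  obtains A B where "(A, B) \<in> oracle_arrays (nobs D) (ncov D) s1 s2"
    and "\<And>q. q \<in> arrays (nobs D) (ncov D) \<times> arrays (nobs D) (ncov D) \<Longrightarrow>
      scad_obj D At Bt l4 l4s q \<le> scad_obj D At Bt l4 l4s (A, B)"
    and "\<And>q. q \<in> arrays (nobs D) (ncov D) \<times> arrays (nobs D) (ncov D) \<Longrightarrow>
      scad_obj D At Bt l4 l4s (A, B) \<le> scad_obj D At Bt l4 l4s q \<Longrightarrow> q = (A, B)"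
    and "(array_norm (nobs D) (ncov D) (\<lambda>k j. A k j - A0 k j))\<^sup>2 \<le> VV"
    and "(bw D)\<^sup>2 * (array_norm (nobs D) (ncov D) (\<lambda>k j. B k j - B0 k j))\<^sup>2 \<le> VV"
proof -
  let ?n = "nobs D" and ?d = "ncov D"
  have "\<forall>k\<in>{1..?n}. \<exists>\<theta>s. (\<forall>p\<in>P - S. \<theta>s p = 0) \<and> (\<forall>p\<in>S. G k \<theta>s p = 0)
      \<and> (L2_set (\<lambda>p. \<theta>s p - big_vec D A0 B0 k p) P)\<^sup>2
         \<le> 4 / \<rho>\<^sup>2 * (2 * (\<Sum>p\<in>S. (true_score D a k p)\<^sup>2) + 4 * real s2 * Err\<^sup>2)
      \<and> (\<forall>p\<in>P - S. \<bar>G k \<theta>s p\<bar> \<le> (Cs + Err)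
           + (Crow + C3' * dv * sqrt (2 * s2)) * L2_set (\<lambda>p. \<theta>s p - big_vec D A0 B0 k p) P)"
    by (intro ballI ex_k[OF N1 N2])
  then obtain \<Theta>s where \<Theta>s: "\<And>k p. k \<in> {1..?n} \<Longrightarrow> p \<in> P - S \<Longrightarrow> \<Theta>s k p = 0"
      "\<And>k p. k \<in> {1..?n} \<Longrightarrow> p \<in> S \<Longrightarrow> G k (\<Theta>s k) p = 0"
      "\<And>k. k \<in> {1..?n} \<Longrightarrow> (L2_set (\<lambda>p. \<Theta>s k p - big_vec D A0 B0 k p) P)\<^sup>2
         \<le> 4 / \<rho>\<^sup>2 * (2 * (\<Sum>p\<in>S. (true_score D a k p)\<^sup>2) + 4 * real s2 * Err\<^sup>2)"
      "\<And>k p. k \<in> {1..?n} \<Longrightarrow> p \<in> P - S \<Longrightarrow> \<bar>G k (\<Theta>s k) p\<bar> \<le> (Cs + Err)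
           + (Crow + C3' * dv * sqrt (2 * s2)) * L2_set (\<lambda>p. \<Theta>s k p - big_vec D A0 B0 k p) P"
    by (subst (asm) bchoice_iff) blast
  define v where "v k = L2_set (\<lambda>p. \<Theta>s k p - big_vec D A0 B0 k p) P" for k
  have VV: "(\<Sum>k=1..?n. (v k)\<^sup>2) \<le> VV"
  proof -
    have "(\<Sum>k=1..?n. (v k)\<^sup>2)
        \<le> (\<Sum>k=1..?n. 4 / \<rho>\<^sup>2 * (2 * (\<Sum>p\<in>S. (true_score D a k p)\<^sup>2) + 4 * real s2 * Err\<^sup>2))"
      unfolding v_def by (intro sum_mono \<Theta>s(3))
    also have "\<dots> = 4 / \<rho>\<^sup>2 * (2 * (\<Sum>k=1..?n. \<Sum>p\<in>S. (true_score D a k p)\<^sup>2) + 4 * real ?n * real s2 * Err\<^sup>2)"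
      by (simp only: sum_distrib_left[symmetric] sum.distrib) simp
    also have "\<dots> \<le> VV" unfolding VV_def
      using Csq by (intro mult_left_mono add_right_mono) (auto simp: S_def P_def)
    finally show ?thesis .
  qed
  \<comment> \<open>Across the observations the uniform part of the gradient contributes
    \<open>sqrt n\<close> times its bound. The oracle errors contribute their joint norm, at most
    \<open>sqrt VV\<close>; bounding each of them separately would lose this.\<close>
  have noise: "L2_set (\<lambda>k. G k (\<Theta>s k) p) {1..?n} < \<mu> p" if p: "p \<in> P - S" for p
  proof -
    let ?c = "Crow + C3' * dv * sqrt (2 * s2)"
    have c0: "0 \<le> ?c" using N0 C3'_nonneg order_trans[OF ep_nonneg ep_le_dv] by simp
    have "0 \<le> \<bar>true_score D a 1 1\<bar>" by simp
    also have "\<dots> \<le> Cs" using n s by (intro Cs) auto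
    finally have Cs0: "0 \<le> Cs" .
    have "L2_set (\<lambda>k. G k (\<Theta>s k) p) {1..?n} = L2_set (\<lambda>k. \<bar>G k (\<Theta>s k) p\<bar>) {1..?n}"
      by (simp add: L2_set_def)
    also have "\<dots> \<le> L2_set (\<lambda>k. (Cs + Err) + ?c * v k) {1..?n}"
      using \<Theta>s(4)[OF _ p] by (intro L2_set_mono) (auto simp: v_def)
    also have "\<dots> \<le> L2_set (\<lambda>k. Cs + Err) {1..?n} + L2_set (\<lambda>k. ?c * v k) {1..?n}"
      by (rule L2_set_triangle_ineq)
    also have "L2_set (\<lambda>k. Cs + Err) {1..?n} = sqrt ?n * (Cs + Err)"
      using Cs0 Err_nonneg by (simp add: L2_set_constant)
    also have "L2_set (\<lambda>k. ?c * v k) {1..?n} = ?c * L2_set v {1..?n}"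
      using L2_set_right_distrib[OF c0, of v] by simp
    also have "L2_set v {1..?n} \<le> sqrt VV" unfolding L2_set_def by (intro real_sqrt_le_mono VV)
    finally have "L2_set (\<lambda>k. G k (\<Theta>s k) p) {1..?n} < min l4 l4s"
      using N3 c0 by (simp add: mult_left_mono)
    also have "\<dots> \<le> \<mu> p" by (rule weights(2)[OF N1 N2 N4 N5 p])
    finally show ?thesis .
  qed
  have sym: "loc_hess D k (At k) (Bt k) p q = loc_hess D k (At k) (Bt k) q p" for k p q
    by (simp add: loc_hess_def hess_eq mult_ac)
  have nd: "(\<Sum>p\<in>P. \<Sum>q\<in>P. v p * loc_hess D k (At k) (Bt k) p q * v q) < 0"
    if k: "k \<in> {1..?n}" and v: "\<And>p. p \<in> P - S \<Longrightarrow> v p = 0" and p: "p \<in> P" "v p \<noteq> 0" for k v p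
  proof -
    have "0 < (\<Sum>p\<in>P. (v p)\<^sup>2)" using p finP
      by (metis (no_types, lifting) less_le not_sum_power2_lt_zero power2_eq_iff_nonneg sum_nonneg sum_nonneg_eq_0_iff zero_eq_power2 zero_le_power2)
    then have "0 < \<rho> / 2 * (\<Sum>p\<in>P. (v p)\<^sup>2)" using \<rho> by simp
    also have "\<dots> \<le> - (\<Sum>p\<in>P. \<Sum>q\<in>P. v p * loc_hess D k (At k) (Bt k) p q * v q)"
      by (rule nd_k[OF N1 N2 k v])
    finally show ?thesis by simp
  qed
  note kkt = kkt_unique_max[OF finite_atLeastAtMost finP S_sub sym \<Theta>s(2)[unfolded G_def]
      weights(1)[OF N1 N2 N4 N5] noise[unfolded G_def] \<Theta>s(1) nsd_k[OF N1 N2] nd]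
  have max: "F \<Theta> \<le> F \<Theta>s" for \<Theta> unfolding F_def by (rule kkt(1))
  have uniq: "\<Theta> k p = \<Theta>s k p" if "F \<Theta>s \<le> F \<Theta>" "k \<in> {1..?n}" "p \<in> P" for \<Theta> k p
    by (rule kkt(2)[where \<Theta> = \<Theta>]) (use that[unfolded F_def] in auto)
  define A where "A = (\<lambda>k\<in>{1..?n}. \<lambda>j\<in>{1..?d}. \<Theta>s k j)"
  define B where "B = (\<lambda>k\<in>{1..?n}. \<lambda>j\<in>{1..?d}. \<Theta>s k (?d + j) / bw D)"
  have AB: "big_vec D A B k p = \<Theta>s k p" if "k \<in> {1..?n}" "p \<in> P" for k p
    using that h by (auto simp: big_vec_def stack_def A_def B_def P_def)
  have F_cong: "F \<Theta> = F \<Theta>'" if "\<And>k p. k \<in> {1..?n} \<Longrightarrow> p \<in> P \<Longrightarrow> \<Theta> k p = \<Theta>' k p" for \<Theta> \<Theta>'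
    unfolding F_def using that
    by (intro arg_cong2[where f = "(-)"] arg_cong2[where f = "(+)"] arg_cong2[where f = "(*)"] refl
        sum.cong L2_set_cong) auto
  have FAB: "F (big_vec D A B) = F \<Theta>s" by (rule F_cong[OF AB])
  have AB_arrays: "A \<in> arrays ?n ?d" "B \<in> arrays ?n ?d"
    by (auto simp: A_def B_def arrays_def vecs_def)
  have split: "(v k)\<^sup>2 = (\<Sum>j=1..?d. (A k j - A0 k j)\<^sup>2) + (bw D)\<^sup>2 * (\<Sum>j=1..?d. (B k j - B0 k j)\<^sup>2)"
    if k: "k \<in> {1..?n}" for k
  proof -
    have "(v k)\<^sup>2 = (\<Sum>p\<in>P. (big_vec D A B k p - big_vec D A0 B0 k p)\<^sup>2)"
      unfolding v_def power2_L2_set using AB[OF k] by (intro sum.cong) auto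
    also have "\<dots> = (\<Sum>j=1..?d. (A k j - A0 k j)\<^sup>2) + (\<Sum>j=1..?d. (bw D * B k j - bw D * B0 k j)\<^sup>2)"
      unfolding P_def sum_double
      by (intro arg_cong2[where f = "(+)"] sum.cong) (auto simp: big_vec_def stack_lo stack_hi)
    also have "(\<Sum>j=1..?d. (bw D * B k j - bw D * B0 k j)\<^sup>2) = (bw D)\<^sup>2 * (\<Sum>j=1..?d. (B k j - B0 k j)\<^sup>2)"
      by (simp add: sum_distrib_left power_mult_distrib flip: right_diff_distrib)
    finally show ?thesis .
  qed
  have norm: "(array_norm ?n ?d X)\<^sup>2 = (\<Sum>k=1..?n. \<Sum>j=1..?d. (X k j)\<^sup>2)" for X
    unfolding array_norm_def power2_L2_set by (subst sum.cartesian_product) (auto intro!: sum.cong)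
  have tot: "(\<Sum>k=1..?n. \<Sum>j=1..?d. (A k j - A0 k j)\<^sup>2)
      + (bw D)\<^sup>2 * (\<Sum>k=1..?n. \<Sum>j=1..?d. (B k j - B0 k j)\<^sup>2) = (\<Sum>k=1..?n. (v k)\<^sup>2)"
    by (simp add: split sum.distrib sum_distrib_left cong: sum.cong_simp)
  show ?thesis
  proof (rule that[of A B])
    show "(A, B) \<in> oracle_arrays ?n ?d s1 s2"
    proof -
      have "A k j = 0" if "k \<in> {1..?n}" "j \<in> {s2 + 1..?d}" for k j
        using that \<Theta>s(1)[of k j] by (auto simp: A_def S_def P_def noise_idx_def)
      moreover have "B k j = 0" if "k \<in> {1..?n}" "j \<in> {s1 + 1..?d}" for k j
        using that \<Theta>s(1)[of k "?d + j"] by (auto simp: B_def S_def P_def noise_idx_def)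
      ultimately show ?thesis using AB_arrays by (auto simp: oracle_arrays_def)
    qed
    fix q assume q: "q \<in> arrays ?n ?d \<times> arrays ?n ?d"
    obtain A' B' where q_eq: "q = (A', B')" by (cases q)
    show "scad_obj D At Bt l4 l4s q \<le> scad_obj D At Bt l4 l4s (A, B)"
      unfolding q_eq scad_obj_eq FAB using max by simp
    assume "scad_obj D At Bt l4 l4s (A, B) \<le> scad_obj D At Bt l4 l4s q"
    then have "F \<Theta>s \<le> F (big_vec D A' B')" unfolding q_eq scad_obj_eq FAB by simp
    then have eq: "big_vec D A' B' k p = big_vec D A B k p" if "k \<in> {1..?n}" "p \<in> P" for k p
      using uniq[of "big_vec D A' B'" k p] AB that by simp
    have "A' k j = A k j" "B' k j = B k j" if "k \<in> {1..?n}" "j \<in> {1..?d}" for k j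
      using eq[OF that(1), of j] eq[OF that(1), of "?d + j"] that h
      by (auto simp: big_vec_def stack_lo stack_hi P_def)
    \<comment> \<open>Agreement on the relevant indices becomes equality of functions because arrays
      are extensional.\<close>
    moreover have "X = X'" if X: "X \<in> arrays ?n ?d" "X' \<in> arrays ?n ?d"
      and eq: "\<And>k j. k \<in> {1..?n} \<Longrightarrow> j \<in> {1..?d} \<Longrightarrow> X k j = X' k j" for X X'
    proof (rule PiE_ext[OF X[unfolded arrays_def]])
      fix k assume k: "k \<in> {1..?n}"
      have "X k \<in> vecs ?d" "X' k \<in> vecs ?d" using X k by (auto simp: arrays_def)
      then show "X k = X' k" unfolding vecs_def by (rule PiE_ext) (rule eq[OF k])
    qed
    ultimately show "q = (A, B)" using q AB_arrays unfolding q_eq by auto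
  next
    show "(array_norm ?n ?d (\<lambda>k j. A k j - A0 k j))\<^sup>2 \<le> VV"
      unfolding norm using tot VV by (smt (verit) mult_nonneg_nonneg sum_nonneg zero_le_power2)
    show "(bw D)\<^sup>2 * (array_norm ?n ?d (\<lambda>k j. B k j - B0 k j))\<^sup>2 \<le> VV"
      unfolding norm using tot VV by (smt (verit) sum_nonneg zero_le_power2)
  qed
qed

end

section \<open>Probability bounds through measurable subevents\<close>

text \<open>A common finite-sample form behind \<open>wp_to_1\<close> and \<open>bigO_P\<close>. It
  passes to finite intersections and to weaker events without asking whether the event itself is
  measurable.\<close>

definition inner_prob_ge :: "'w measure \<Rightarrow> real \<Rightarrow> ('w \<Rightarrow> bool) \<Rightarrow> bool" where
  "inner_prob_ge M c Q \<longleftrightarrow> (\<exists>E\<in>sets M. c \<le> measure M E \<and> (\<forall>\<omega>\<in>E. Q \<omega>))"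

lemma inner_prob_ge_mono:
  assumes "inner_prob_ge M c Q" "c' \<le> c" "\<And>\<omega>. \<omega> \<in> space M \<Longrightarrow> Q \<omega> \<Longrightarrow> Q' \<omega>"
  shows "inner_prob_ge M c' Q'"
  using assms unfolding inner_prob_ge_def by (meson order_trans sets.sets_into_space subsetD)

lemma (in prob_space) inner_prob_ge_conj:
  assumes "inner_prob_ge M (1 - c) Q" "inner_prob_ge M (1 - c') Q'"
  shows "inner_prob_ge M (1 - (c + c')) (\<lambda>\<omega>. Q \<omega> \<and> Q' \<omega>)"
proof -
  obtain E where E: "E \<in> events" "1 - c \<le> prob E" "\<And>\<omega>. \<omega> \<in> E \<Longrightarrow> Q \<omega>"
    using assms(1) by (auto simp: inner_prob_ge_def)
  obtain F where F: "F \<in> events" "1 - c' \<le> prob F" "\<And>\<omega>. \<omega> \<in> F \<Longrightarrow> Q' \<omega>"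
    using assms(2) by (auto simp: inner_prob_ge_def)
  have "prob (E \<union> F) + prob (E \<inter> F) = prob E + prob F"
    using measure_Un3[of E M F] E(1) F(1) by (simp add: fmeasurable_eq_sets)
  moreover have "prob (E \<union> F) \<le> 1" by (rule prob_le_1)
  ultimately have "1 - (c + c') \<le> prob (E \<inter> F)" using E(2) F(2) by linarith
  then show ?thesis unfolding inner_prob_ge_def using E F by (intro bexI[of _ "E \<inter> F"]) auto
qed

lemma (in prob_space) inner_prob_ge_AE:
  assumes "AE \<omega> in M. Q \<omega>"
  shows "inner_prob_ge M 1 Q"
proof -
  obtain E where "E \<in> events" "prob E = 1" "\<And>\<omega>. \<omega> \<in> E \<Longrightarrow> Q \<omega>"
    by (rule AE_E_prob[OF assms]) auto
  then show ?thesis unfolding inner_prob_ge_def by (intro bexI[of _ E]) auto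
qed

lemma (in prob_space) inner_prob_ge_union_bound:
  assumes "finite S" "\<And>s. s \<in> S \<Longrightarrow> A s \<in> events" "\<And>s. s \<in> S \<Longrightarrow> prob (A s) \<le> c"
  shows "inner_prob_ge M (1 - real (card S) * c) (\<lambda>\<omega>. \<forall>s\<in>S. \<omega> \<notin> A s)"
proof -
  have "prob (\<Union>s\<in>S. A s) \<le> (\<Sum>s\<in>S. prob (A s))"
    using assms by (intro finite_measure_subadditive_finite) auto
  also have "\<dots> \<le> real (card S) * c" using assms(3) by (rule sum_bounded_above)
  finally have "1 - real (card S) * c \<le> prob (space M - (\<Union>s\<in>S. A s))"
    using assms by (subst prob_compl) auto
  then show ?thesis unfolding inner_prob_ge_def
    using assms by (intro bexI[of _ "space M - (\<Union>s\<in>S. A s)"]) auto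
qed

text \<open>In the backward direction one sequence of events must serve every \<epsilon>. Events
  that nearly attain the supremum of the inner probabilities do.\<close>

lemma wp_to_1_iff:
  assumes M: "\<And>n. prob_space (M n)"
  shows "wp_to_1 M Q \<longleftrightarrow> (\<forall>\<epsilon>>0. \<forall>\<^sub>F n in sequentially. inner_prob_ge (M n) (1 - \<epsilon>) (Q n))"
proof
  assume "wp_to_1 M Q"
  then obtain E where E: "\<And>n. E n \<in> sets (M n)" "\<And>n \<omega>. \<omega> \<in> E n \<Longrightarrow> Q n \<omega>"
    and lim: "(\<lambda>n. measure (M n) (E n)) \<longlonglongrightarrow> 1"
    unfolding wp_to_1_def by blast
  show "\<forall>\<epsilon>>0. \<forall>\<^sub>F n in sequentially. inner_prob_ge (M n) (1 - \<epsilon>) (Q n)"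
  proof (intro allI impI)
    fix \<epsilon> :: real assume "\<epsilon> > 0"
    then have "\<forall>\<^sub>F n in sequentially. 1 - \<epsilon> < measure (M n) (E n)"
      by (intro order_tendstoD(1)[OF lim]) simp
    then show "\<forall>\<^sub>F n in sequentially. inner_prob_ge (M n) (1 - \<epsilon>) (Q n)"
      by eventually_elim (use E in \<open>auto simp: inner_prob_ge_def intro!: bexI less_imp_le\<close>)
  qed
next
  assume R: "\<forall>\<epsilon>>0. \<forall>\<^sub>F n in sequentially. inner_prob_ge (M n) (1 - \<epsilon>) (Q n)"
  define W where "W n = {E \<in> sets (M n). \<forall>\<omega>\<in>E. Q n \<omega>}" for n
  define s where "s n = (SUP E\<in>W n. measure (M n) E)" for n
  have ne: "W n \<noteq> {}" for n by (auto simp: W_def)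
  have bdd: "bdd_above (measure (M n) ` W n)" for n
    using prob_space.prob_le_1[OF M] by (intro bdd_aboveI2[where M = 1]) auto
  \<comment> \<open>The supremum need not be attained; a slack that vanishes with \<open>n\<close>
    is harmless in the limit.\<close>
  have "\<exists>E\<in>W n. s n - 1 / real (Suc n) < measure (M n) E" for n
    using less_cSUP_iff[OF ne[of n] bdd[of n], of "s n - 1 / real (Suc n)"] by (simp add: s_def)
  then obtain E where E: "\<And>n. E n \<in> W n" "\<And>n. s n - 1 / real (Suc n) < measure (M n) (E n)"
    by metis
  have "(\<lambda>n. measure (M n) (E n)) \<longlonglongrightarrow> 1"
  proof (rule tendstoI)
    fix \<epsilon> :: real assume \<epsilon>: "\<epsilon> > 0"
    have "\<forall>\<^sub>F n in sequentially. inner_prob_ge (M n) (1 - \<epsilon> / 2) (Q n)" using R \<epsilon> by simp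
    moreover have "\<forall>\<^sub>F n in sequentially. 1 / real (Suc n) < \<epsilon> / 2"
      using \<epsilon> by (intro order_tendstoD(2)[OF LIMSEQ_inverse_real_of_nat[unfolded inverse_eq_divide]]) simp
    ultimately show "\<forall>\<^sub>F n in sequentially. dist (measure (M n) (E n)) 1 < \<epsilon>"
    proof eventually_elim
      case (elim n)
      then obtain F where "F \<in> W n" "1 - \<epsilon> / 2 \<le> measure (M n) F"
        by (auto simp: inner_prob_ge_def W_def)
      then have "1 - \<epsilon> / 2 \<le> s n" unfolding s_def using cSUP_upper[OF _ bdd] order_trans by blast
      moreover have "measure (M n) (E n) \<le> 1" using prob_space.prob_le_1[OF M] .
      ultimately show ?case using E(2)[of n] elim(2) by (simp add: dist_real_def)
    qed
  qed
  then show "wp_to_1 M Q" unfolding wp_to_1_def using E(1) by (auto simp: W_def)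
qed

section \<open>Local sums of independent observations\<close>

lemma (in prob_space) indep_var_nn_integral_le:
  assumes ind: "indep_var S X T Y" and F[measurable]: "F \<in> borel_measurable (S \<Otimes>\<^sub>M T)"
    and le: "\<And>y. y \<in> space T \<Longrightarrow> (\<integral>\<^sup>+\<omega>. F (X \<omega>, y) \<partial>M) \<le> c"
  shows "(\<integral>\<^sup>+\<omega>. F (X \<omega>, Y \<omega>) \<partial>M) \<le> c"
proof -
  have [measurable]: "random_variable S X" "random_variable T Y"
    using indep_var_rv1[OF ind] indep_var_rv2[OF ind] by auto
  interpret X: prob_space "distr M S X" by (rule prob_space_distr) simp
  interpret Y: prob_space "distr M T Y" by (rule prob_space_distr) simp
  interpret XY: pair_prob_space "distr M S X" "distr M T Y" ..
  have "(\<integral>\<^sup>+\<omega>. F (X \<omega>, Y \<omega>) \<partial>M) = (\<integral>\<^sup>+z. F z \<partial>distr M (S \<Otimes>\<^sub>M T) (\<lambda>\<omega>. (X \<omega>, Y \<omega>)))"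
    by (subst nn_integral_distr) auto
  also have "\<dots> = (\<integral>\<^sup>+z. F z \<partial>(distr M S X \<Otimes>\<^sub>M distr M T Y))"
    using ind by (simp add: indep_var_distribution_eq)
  also have "\<dots> = (\<integral>\<^sup>+y. (\<integral>\<^sup>+x. F (x, y) \<partial>distr M S X) \<partial>distr M T Y)"
    by (rule XY.nn_integral_snd[symmetric]) simp
  also have "\<dots> \<le> (\<integral>\<^sup>+y. c \<partial>distr M T Y)"
  proof (rule nn_integral_mono)
    fix y assume "y \<in> space (distr M T Y)"
    then have y[simp]: "y \<in> space T" by simp
    have "(\<integral>\<^sup>+x. F (x, y) \<partial>distr M S X) = (\<integral>\<^sup>+\<omega>. F (X \<omega>, y) \<partial>M)"
      by (subst nn_integral_distr) auto
    then show "(\<integral>\<^sup>+x. F (x, y) \<partial>distr M S X) \<le> c" using le by simp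
  qed
  also have "\<dots> = c" using Y.emeasure_space_1 by simp
  finally show ?thesis .
qed

lemma measurable_case_prod_compose:
  assumes "(\<lambda>(x, y). g x y) \<in> borel_measurable (N \<Otimes>\<^sub>M N')" "f \<in> measurable K N" "f' \<in> measurable K N'"
  shows "(\<lambda>x. g (f x) (f' x)) \<in> borel_measurable K"
  using measurable_compose[OF measurable_Pair[OF assms(2,3)] assms(1)] by simp

lemma exp_le_quadratic: "\<bar>x\<bar> \<le> 1 \<Longrightarrow> exp x \<le> 1 + x + x\<^sup>2" for x :: real
proof (cases "0 \<le> x")
  case False
  define y where "y = - x"
  have y: "0 < y" using False by (simp add: y_def)
  have "exp (- y) = 1 / exp y" by (simp add: exp_minus inverse_eq_divide)
  also have "\<dots> \<le> 1 / (1 + y)" using y by (intro divide_left_mono exp_ge_add_one_self mult_pos_pos) auto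
  also have "\<dots> \<le> 1 - y + y\<^sup>2"
  proof -
    \<comment> \<open>The product is \<open>1 + y^3\<close>.\<close>
    have "1 \<le> (1 - y + y\<^sup>2) * (1 + y)" using y by (simp add: algebra_simps power2_eq_square)
    then show ?thesis using y by (simp add: pos_divide_le_eq)
  qed
  finally show ?thesis by (simp add: y_def)
qed (auto intro: exp_bound)

text \<open>The weight \<open>w\<close> depends on the index of the summand and on the localisation
  point. Its supremum \<open>Bw\<close> is of order \<open>1/h\<close> and its integral
  \<open>Iw\<close> of order 1; keeping them apart makes variances of order \<open>Bw * Iw\<close>
  and not \<open>Bw\<close> squared.\<close>

locale local_sums = prob_space M for M :: "'w measure" +
  fixes N :: "'z measure" and Z :: "nat \<Rightarrow> 'w \<Rightarrow> 'z" and n :: nat and u :: "'z \<Rightarrow> real"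
    and w :: "real \<Rightarrow> real \<Rightarrow> real" and Bw Iw m0 :: real
  assumes indep: "indep_vars (\<lambda>_. N) Z {1..n}"
    and u_meas [measurable]: "u \<in> borel_measurable N"
    and w_meas: "(\<lambda>(s, v). w s v) \<in> borel_measurable (borel \<Otimes>\<^sub>M borel)"
    and w_bound: "\<And>s v. \<bar>w s v\<bar> \<le> Bw" and Bw: "0 < Bw" and Iw: "0 \<le> Iw"
    and w_int: "\<And>v. (\<integral>\<^sup>+s. ennreal \<bar>w s v\<bar> \<partial>lborel) \<le> ennreal Iw"
    and u_range: "\<And>i \<omega>. i \<in> {1..n} \<Longrightarrow> \<omega> \<in> space M \<Longrightarrow> u (Z i \<omega>) \<in> {0..1}"
    and m0: "2 \<le> m0"
begin

declare One_nat_def [simp del]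

section \<open>Moments of the localised weights and truncation\<close>

lemma Z_meas [measurable]: "i \<in> {1..n} \<Longrightarrow> Z i \<in> measurable M N"
  using indep by (auto simp: indep_vars_def)

lemma w_meas' [measurable (raw)]:
  "f \<in> borel_measurable K \<Longrightarrow> g \<in> borel_measurable K \<Longrightarrow> (\<lambda>x. w (f x) (g x)) \<in> borel_measurable K"
  by (rule measurable_case_prod_compose[OF w_meas])

text \<open>Bounded density of the index and bounded conditional moments in a single inequality
  against arbitrary test functions \<psi>. The summand 1 carries the law of the index alone, and
  makes \<open>1 + |t| powr m0\<close> dominate both \<open>|t|\<close> and
  \<open>t^2\<close>.\<close>

definition mom :: "('z \<Rightarrow> real) \<Rightarrow> real \<Rightarrow> bool" where
  "mom \<xi> C \<longleftrightarrow> \<xi> \<in> borel_measurable N \<and> 0 \<le> C \<and> (\<forall>i\<in>{1..n}. \<forall>\<psi>\<in>borel_measurable borel.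
     (\<integral>\<^sup>+\<omega>. ennreal (1 + \<bar>\<xi> (Z i \<omega>)\<bar> powr m0) * \<psi> (u (Z i \<omega>)) \<partial>M) \<le> ennreal C * (\<integral>\<^sup>+s. \<psi> s \<partial>lborel))"

lemma abs_le_powr: "\<bar>t\<bar> \<le> 1 + \<bar>t\<bar> powr m0" "t\<^sup>2 \<le> 1 + \<bar>t\<bar> powr m0" for t :: real
proof -
  have "\<bar>t\<bar> \<le> 1 + \<bar>t\<bar> powr m0 \<and> t\<^sup>2 \<le> 1 + \<bar>t\<bar> powr m0"
  proof (cases "\<bar>t\<bar> \<le> 1")
    case True
    then have "\<bar>t\<bar>\<^sup>2 \<le> 1\<^sup>2" by (intro power_mono) auto
    moreover have "0 \<le> \<bar>t\<bar> powr m0" by simp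
    ultimately show ?thesis using True by (simp del: powr_ge_zero)
  next
    case False
    have "\<bar>t\<bar> powr 1 \<le> \<bar>t\<bar> powr m0" using False m0 by (intro powr_mono) linarith+
    moreover have "\<bar>t\<bar> powr 2 \<le> \<bar>t\<bar> powr m0" using False m0 by (intro powr_mono) linarith+
    ultimately show ?thesis using False by (simp add: powr_numeral)
  qed
  then show "\<bar>t\<bar> \<le> 1 + \<bar>t\<bar> powr m0" "t\<^sup>2 \<le> 1 + \<bar>t\<bar> powr m0" by auto
qed

lemma mom_D:
  assumes "mom \<xi> C" "i \<in> {1..n}" "\<psi> \<in> borel_measurable borel"
  shows "(\<integral>\<^sup>+\<omega>. ennreal (1 + \<bar>\<xi> (Z i \<omega>)\<bar> powr m0) * \<psi> (u (Z i \<omega>)) \<partial>M) \<le> ennreal C * (\<integral>\<^sup>+s. \<psi> s \<partial>lborel)"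
  using assms unfolding mom_def by blast

lemma mom_meas: "mom \<xi> C \<Longrightarrow> \<xi> \<in> borel_measurable N" and mom_nonneg: "mom \<xi> C \<Longrightarrow> 0 \<le> C"
  by (auto simp: mom_def)

lemma mom_w:
  assumes mom: "mom \<xi> C" and i: "i \<in> {1..n}"
  shows "(\<integral>\<^sup>+\<omega>. ennreal ((1 + \<bar>\<xi> (Z i \<omega>)\<bar> powr m0) * \<bar>w (u (Z i \<omega>)) v\<bar>) \<partial>M) \<le> ennreal (C * Iw)"
proof -
  have "(\<integral>\<^sup>+\<omega>. ennreal ((1 + \<bar>\<xi> (Z i \<omega>)\<bar> powr m0) * \<bar>w (u (Z i \<omega>)) v\<bar>) \<partial>M)
      = (\<integral>\<^sup>+\<omega>. ennreal (1 + \<bar>\<xi> (Z i \<omega>)\<bar> powr m0) * ennreal \<bar>w (u (Z i \<omega>)) v\<bar> \<partial>M)"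
    by (intro nn_integral_cong) (simp add: ennreal_mult')
  also have "\<dots> \<le> ennreal C * (\<integral>\<^sup>+s. ennreal \<bar>w s v\<bar> \<partial>lborel)"
    by (rule mom_D[OF mom i]) measurable
  also have "\<dots> \<le> ennreal C * ennreal Iw" by (intro mult_left_mono w_int) simp
  finally show ?thesis using mom_nonneg[OF mom] Iw by (simp add: ennreal_mult)
qed

lemma mom_w_integral:
  assumes mom: "mom \<xi> C" and i: "i \<in> {1..n}"
  shows "integrable M (\<lambda>\<omega>. (1 + \<bar>\<xi> (Z i \<omega>)\<bar> powr m0) * \<bar>w (u (Z i \<omega>)) v\<bar>)"
    "expectation (\<lambda>\<omega>. (1 + \<bar>\<xi> (Z i \<omega>)\<bar> powr m0) * \<bar>w (u (Z i \<omega>)) v\<bar>) \<le> C * Iw"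
proof -
  note [measurable] = mom_meas[OF mom]
  have [measurable]: "Z i \<in> measurable M N" using i by simp
  have "(\<integral>\<^sup>+\<omega>. ennreal ((1 + \<bar>\<xi> (Z i \<omega>)\<bar> powr m0) * \<bar>w (u (Z i \<omega>)) v\<bar>) \<partial>M) < \<infinity>"
    using mom_w[OF mom i, of v] by (rule order.strict_trans1) simp
  then show "integrable M (\<lambda>\<omega>. (1 + \<bar>\<xi> (Z i \<omega>)\<bar> powr m0) * \<bar>w (u (Z i \<omega>)) v\<bar>)"
    by (intro integrableI_nonneg) auto
  then show "expectation (\<lambda>\<omega>. (1 + \<bar>\<xi> (Z i \<omega>)\<bar> powr m0) * \<bar>w (u (Z i \<omega>)) v\<bar>) \<le> C * Iw"
    using mom_w[OF mom i, of v] mom_nonneg[OF mom] Iw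
    by (subst (asm) nn_integral_eq_integral) (auto simp: ennreal_le_iff)
qed

lemma truncation_prob:
  assumes mom: "mom \<xi> C" and i: "i \<in> {1..n}" and T: "0 < T"
  shows "prob {\<omega>\<in>space M. T < \<bar>\<xi> (Z i \<omega>)\<bar>} \<le> C / T powr m0"
proof -
  note [measurable] = mom_meas[OF mom]
  have [measurable]: "Z i \<in> measurable M N" using i by simp
  let ?A = "{\<omega>\<in>space M. T < \<bar>\<xi> (Z i \<omega>)\<bar>}"
  have "emeasure M ?A = (\<integral>\<^sup>+\<omega>. indicator ?A \<omega> \<partial>M)" by simp
  \<comment> \<open>Markov's inequality; the indicator of the unit interval is the test function
    that turns \<open>mom\<close> into an unconditional moment bound.\<close>
  also have "\<dots> \<le> (\<integral>\<^sup>+\<omega>. ennreal (1 / T powr m0) * (ennreal (1 + \<bar>\<xi> (Z i \<omega>)\<bar> powr m0) * indicator {0..1} (u (Z i \<omega>))) \<partial>M)"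
  proof (rule nn_integral_mono)
    fix \<omega> assume \<omega>: "\<omega> \<in> space M"
    show "indicator ?A \<omega> \<le> ennreal (1 / T powr m0) * (ennreal (1 + \<bar>\<xi> (Z i \<omega>)\<bar> powr m0) * indicator {0..1} (u (Z i \<omega>)))"
    proof (cases "T < \<bar>\<xi> (Z i \<omega>)\<bar>")
      case True
      then have "T powr m0 \<le> \<bar>\<xi> (Z i \<omega>)\<bar> powr m0" using T m0 by (intro powr_mono2) auto
      then have "1 \<le> 1 / T powr m0 * (1 + \<bar>\<xi> (Z i \<omega>)\<bar> powr m0)" using T by (simp add: field_simps)
      then have "ennreal 1 \<le> ennreal (1 / T powr m0 * (1 + \<bar>\<xi> (Z i \<omega>)\<bar> powr m0))" by (rule ennreal_leI)
      then show ?thesis using \<omega> True u_range[OF i \<omega>] by (subst (asm) ennreal_mult) auto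
    qed (simp add: \<omega>)
  qed
  also have "\<dots> = ennreal (1 / T powr m0) * (\<integral>\<^sup>+\<omega>. ennreal (1 + \<bar>\<xi> (Z i \<omega>)\<bar> powr m0) * indicator {0..1} (u (Z i \<omega>)) \<partial>M)"
    by (rule nn_integral_cmult) measurable
  also have "\<dots> \<le> ennreal (1 / T powr m0) * (ennreal C * (\<integral>\<^sup>+s. indicator {0..1::real} s \<partial>lborel))"
    by (intro mult_left_mono mom_D[OF mom i]) auto
  also have "\<dots> = ennreal (C / T powr m0)"
    using mom_nonneg[OF mom] by (simp add: ennreal_mult[symmetric])
  finally show ?thesis using mom_nonneg[OF mom] by (simp add: emeasure_eq_measure ennreal_le_iff)
qed

text \<open>Observation \<open>k\<close> enters every summand through the localisation point. Since
  it is independent of the others, it may be replaced by a fixed value, provided that the bound is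
  uniform in this value.\<close>

lemma decouple:
  assumes k: "k \<in> {1..n}" and F: "F \<in> borel_measurable ((\<Pi>\<^sub>M i\<in>{1..n} - {k}. N) \<Otimes>\<^sub>M N)"
    and le: "\<And>z. z \<in> space N \<Longrightarrow> (\<integral>\<^sup>+\<omega>. F (\<lambda>i\<in>{1..n} - {k}. Z i \<omega>, z) \<partial>M) \<le> c"
  shows "(\<integral>\<^sup>+\<omega>. F (\<lambda>i\<in>{1..n} - {k}. Z i \<omega>, Z k \<omega>) \<partial>M) \<le> c"
proof -
  have ind: "indep_var (\<Pi>\<^sub>M i\<in>{1..n} - {k}. N) (\<lambda>\<omega>. \<lambda>i\<in>{1..n} - {k}. Z i \<omega>) (\<Pi>\<^sub>M i\<in>{k}. N) (\<lambda>\<omega>. \<lambda>i\<in>{k}. Z i \<omega>)"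
    using k by (intro indep_var_restrict[OF indep]) auto
  have proj: "(\<lambda>y. y k) \<in> measurable (\<Pi>\<^sub>M i\<in>{k}. N) N"
    by (rule measurable_component_singleton) simp
  have "(\<integral>\<^sup>+\<omega>. (\<lambda>(x, y). F (x, y k)) (\<lambda>i\<in>{1..n} - {k}. Z i \<omega>, \<lambda>i\<in>{k}. Z i \<omega>) \<partial>M) \<le> c"
  proof (rule indep_var_nn_integral_le[OF ind])
    show "(\<lambda>(x, y). F (x, y k)) \<in> borel_measurable ((\<Pi>\<^sub>M i\<in>{1..n} - {k}. N) \<Otimes>\<^sub>M (\<Pi>\<^sub>M i\<in>{k}. N))"
      unfolding split_def
      by (rule measurable_compose[OF measurable_Pair F])
         (auto intro: measurable_compose[OF measurable_snd proj])
    fix y assume "y \<in> space (\<Pi>\<^sub>M i\<in>{k}. N)"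
    then have "y k \<in> space N" by (auto simp: space_PiM)
    then show "(\<integral>\<^sup>+\<omega>. (\<lambda>(x, y). F (x, y k)) (\<lambda>i\<in>{1..n} - {k}. Z i \<omega>, y) \<partial>M) \<le> c"
      using le by simp
  qed
  then show ?thesis by simp
qed

text \<open>After decoupling, the exponential factors are independent and their expectations
  multiply. There are \<open>n - 1\<close> of them; \<open>c \<ge> 0\<close> permits
  \<open>n\<close> in the bound. Markov's inequality for the exponential finishes.\<close>

lemma chernoff:
  assumes k: "k \<in> {1..n}" and g: "(\<lambda>(z, z'). g z z') \<in> borel_measurable (N \<Otimes>\<^sub>M N)" and c: "0 \<le> c"
    and mgf: "\<And>i z'. i \<in> {1..n} \<Longrightarrow> z' \<in> space N \<Longrightarrow> (\<integral>\<^sup>+\<omega>. ennreal (exp (g (Z i \<omega>) z')) \<partial>M) \<le> ennreal (exp c)"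
  shows "prob {\<omega>\<in>space M. t \<le> (\<Sum>i\<in>{1..n} - {k}. g (Z i \<omega>) (Z k \<omega>))} \<le> exp (real n * c - t)"
proof -
  let ?J = "{1..n} - {k}"
  have [measurable]: "Z k \<in> measurable M N" using k by simp
  define S where "S \<omega> = (\<Sum>i\<in>?J. g (Z i \<omega>) (Z k \<omega>))" for \<omega>
  have g'' [measurable]: "(\<lambda>\<omega>. g (Z i \<omega>) (Z k \<omega>)) \<in> borel_measurable M" if "i \<in> ?J" for i
    using that by (intro measurable_case_prod_compose[OF g]) auto
  have [measurable]: "S \<in> borel_measurable M"
    unfolding S_def by (intro borel_measurable_sum g'') auto
  define F where "F = (\<lambda>(x, z). \<Prod>i\<in>?J. ennreal (exp (g (x i) z)))"
  have "(\<integral>\<^sup>+\<omega>. ennreal (exp (S \<omega>)) \<partial>M) = (\<integral>\<^sup>+\<omega>. F (\<lambda>i\<in>?J. Z i \<omega>, Z k \<omega>) \<partial>M)"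
    by (intro nn_integral_cong) (simp add: F_def S_def exp_sum prod_ennreal)
  also have "\<dots> \<le> ennreal (exp (real n * c))"
  proof (rule decouple[OF k])
    have "(\<lambda>p. g (fst p i) (snd p)) \<in> borel_measurable ((\<Pi>\<^sub>M i\<in>?J. N) \<Otimes>\<^sub>M N)" if "i \<in> ?J" for i
      using that by (intro measurable_case_prod_compose[OF g]) measurable
    then show "F \<in> borel_measurable ((\<Pi>\<^sub>M i\<in>?J. N) \<Otimes>\<^sub>M N)"
      unfolding F_def split_def by (intro borel_measurable_prod_ennreal) measurable
    fix z assume z: "z \<in> space N"
    have "indep_vars (\<lambda>_. borel) (\<lambda>i \<omega>. ennreal (exp (g (Z i \<omega>) z))) ?J"
    proof (rule indep_vars_compose2[where Y = "\<lambda>i x. ennreal (exp (g x z))"])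
      show "indep_vars (\<lambda>_. N) Z ?J" by (rule indep_vars_subset[OF indep]) auto
      have "(\<lambda>x. g x z) \<in> borel_measurable N"
        using z by (intro measurable_case_prod_compose[OF g]) auto
      then show "(\<lambda>x. ennreal (exp (g x z))) \<in> borel_measurable N" by measurable
    qed
    then have "(\<integral>\<^sup>+\<omega>. (\<Prod>i\<in>?J. ennreal (exp (g (Z i \<omega>) z))) \<partial>M) = (\<Prod>i\<in>?J. \<integral>\<^sup>+\<omega>. ennreal (exp (g (Z i \<omega>) z)) \<partial>M)"
      by (intro indep_vars_nn_integral) auto
    also have "\<dots> \<le> (\<Prod>i\<in>?J. ennreal (exp c))" by (intro prod_mono_ennreal mgf z) auto
    also have "\<dots> = ennreal (exp (real (card ?J) * c))"
      by (simp add: ennreal_power exp_of_nat_mult)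
    also have "\<dots> \<le> ennreal (exp (real n * c))"
      using k c by (intro ennreal_leI) (simp add: mult_right_mono)
    finally show "(\<integral>\<^sup>+\<omega>. F (\<lambda>i\<in>?J. Z i \<omega>, z) \<partial>M) \<le> ennreal (exp (real n * c))"
      unfolding F_def by (simp cong: prod.cong_simp)
  qed
  finally have E: "(\<integral>\<^sup>+\<omega>. ennreal (exp (S \<omega>)) \<partial>M) \<le> ennreal (exp (real n * c))" .
  have "emeasure M {\<omega>\<in>space M. t \<le> S \<omega>} = emeasure M {\<omega>\<in>space M. 1 \<le> ennreal (exp (- t)) * ennreal (exp (S \<omega>))}"
    by (intro arg_cong[where f = "emeasure M"] Collect_cong)
       (simp add: ennreal_mult[symmetric] exp_add[symmetric] flip: ennreal_1)
  also have "\<dots> \<le> ennreal (exp (- t)) * (\<integral>\<^sup>+\<omega>. ennreal (exp (S \<omega>)) * indicator (space M) \<omega> \<partial>M)"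
    by (intro nn_integral_Markov_inequality) auto
  also have "(\<integral>\<^sup>+\<omega>. ennreal (exp (S \<omega>)) * indicator (space M) \<omega> \<partial>M) = (\<integral>\<^sup>+\<omega>. ennreal (exp (S \<omega>)) \<partial>M)"
    by (intro nn_integral_cong) auto
  also have "ennreal (exp (- t)) * \<dots> \<le> ennreal (exp (- t)) * ennreal (exp (real n * c))"
    by (intro mult_left_mono E) simp
  also have "\<dots> = ennreal (exp (real n * c - t))"
    by (simp add: ennreal_mult[symmetric] exp_add[symmetric])
  finally show ?thesis by (simp add: emeasure_eq_measure ennreal_le_iff S_def)
qed

section \<open>Exponential tails of truncated sums and their union bounds\<close>

definition trunc :: "real \<Rightarrow> real \<Rightarrow> real" where
  "trunc T t = (if \<bar>t\<bar> \<le> T then t else 0)"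

lemma trunc_meas [measurable]: "trunc T \<in> borel_measurable borel"
  unfolding trunc_def[abs_def] by measurable

lemma trunc_abs: "\<bar>trunc T t\<bar> \<le> \<bar>t\<bar>" "0 \<le> T \<Longrightarrow> \<bar>trunc T t\<bar> \<le> T"
  by (auto simp: trunc_def)

text \<open>With tilt \<open>1 / (T * Bw)\<close> each exponent lies in the unit interval, where
  \<open>exp g \<le> 1 + 2 * g\<close>. The generating function then spends two of the three units
  \<open>n * C * Iw\<close> in the threshold, and the third remains in the exponent.\<close>

lemma pos_tail:
  assumes mom: "mom \<xi> C" and k: "k \<in> {1..n}" and T: "0 < T"
  shows "prob {\<omega>\<in>space M. 3 * real n * C * Iw \<le> (\<Sum>i\<in>{1..n} - {k}. \<bar>trunc T (\<xi> (Z i \<omega>)) * w (u (Z i \<omega>)) (u (Z k \<omega>))\<bar>)}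
     \<le> exp (- (real n * C * Iw / (T * Bw)))"
proof -
  note [measurable] = mom_meas[OF mom]
  define \<tau> where "\<tau> = 1 / (T * Bw)"
  have \<tau>: "0 < \<tau>" using T Bw by (simp add: \<tau>_def)
  define g where "g z z' = \<tau> * \<bar>trunc T (\<xi> z) * w (u z) (u z')\<bar>" for z z'
  have g1: "g z z' \<le> 1" for z z'
  proof -
    have "\<bar>trunc T (\<xi> z) * w (u z) (u z')\<bar> \<le> T * Bw"
      unfolding abs_mult using T Bw w_bound by (intro mult_mono trunc_abs) auto
    then show ?thesis using T Bw by (simp add: g_def \<tau>_def pos_divide_le_eq)
  qed
  have g0: "0 \<le> g z z'" for z z' using \<tau> by (simp add: g_def)
  have mgf: "(\<integral>\<^sup>+\<omega>. ennreal (exp (g (Z i \<omega>) z')) \<partial>M) \<le> ennreal (exp (2 * \<tau> * C * Iw))"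
    if i: "i \<in> {1..n}" for i z'
  proof -
    let ?m = "\<lambda>\<omega>. (1 + \<bar>\<xi> (Z i \<omega>)\<bar> powr m0) * \<bar>w (u (Z i \<omega>)) (u z')\<bar>"
    have [measurable]: "Z i \<in> measurable M N" using i by simp
    have "(\<integral>\<^sup>+\<omega>. ennreal (exp (g (Z i \<omega>) z')) \<partial>M) \<le> (\<integral>\<^sup>+\<omega>. 1 + ennreal (2 * \<tau>) * ennreal (?m \<omega>) \<partial>M)"
    proof (rule nn_integral_mono)
      fix \<omega>
      let ?g = "g (Z i \<omega>) z'"
      have "?g\<^sup>2 \<le> ?g" using g0 g1 by (simp add: power2_eq_square mult_left_le)
      then have "exp ?g \<le> 1 + 2 * ?g"
        using exp_bound[OF g0 g1, of "Z i \<omega>" z'] by linarith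
      also have "?g \<le> \<tau> * ?m \<omega>"
        unfolding g_def abs_mult using \<tau> abs_le_powr(1) trunc_abs(1)
        by (intro mult_left_mono mult_right_mono) (auto intro: order_trans)
      finally have "ennreal (exp ?g) \<le> ennreal (1 + 2 * \<tau> * ?m \<omega>)" by (intro ennreal_leI) (simp add: mult.assoc)
      then show "ennreal (exp ?g) \<le> 1 + ennreal (2 * \<tau>) * ennreal (?m \<omega>)"
        using \<tau> by (subst (asm) ennreal_plus) (auto simp: ennreal_mult)
    qed
    also have "\<dots> = 1 + ennreal (2 * \<tau>) * (\<integral>\<^sup>+\<omega>. ennreal (?m \<omega>) \<partial>M)"
      by (subst nn_integral_add) (auto simp: nn_integral_cmult emeasure_space_1)
    also have "\<dots> \<le> 1 + ennreal (2 * \<tau>) * ennreal (C * Iw)"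
      by (intro add_left_mono mult_left_mono mom_w[OF mom i]) simp
    also have "\<dots> = ennreal (1 + 2 * \<tau> * C * Iw)"
      using \<tau> mom_nonneg[OF mom] Iw by (simp add: ennreal_mult[symmetric] mult.assoc flip: ennreal_plus ennreal_1)
    also have "\<dots> \<le> ennreal (exp (2 * \<tau> * C * Iw))" by (intro ennreal_leI exp_ge_add_one_self)
    finally show ?thesis .
  qed
  have "prob {\<omega>\<in>space M. \<tau> * (3 * real n * C * Iw) \<le> (\<Sum>i\<in>{1..n} - {k}. g (Z i \<omega>) (Z k \<omega>))}
      \<le> exp (real n * (2 * \<tau> * C * Iw) - \<tau> * (3 * real n * C * Iw))"
    using \<tau> mom_nonneg[OF mom] Iw by (intro chernoff[OF k] mgf) (auto simp: g_def split_def)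
  also have "{\<omega>\<in>space M. \<tau> * (3 * real n * C * Iw) \<le> (\<Sum>i\<in>{1..n} - {k}. g (Z i \<omega>) (Z k \<omega>))}
      = {\<omega>\<in>space M. 3 * real n * C * Iw \<le> (\<Sum>i\<in>{1..n} - {k}. \<bar>trunc T (\<xi> (Z i \<omega>)) * w (u (Z i \<omega>)) (u (Z k \<omega>))\<bar>)}"
    using \<tau> by (simp add: g_def sum_distrib_left[symmetric] mult.assoc)
  also have "real n * (2 * \<tau> * C * Iw) - \<tau> * (3 * real n * C * Iw) = - (real n * C * Iw / (T * Bw))"
    by (simp add: \<tau>_def algebra_simps)
  finally show ?thesis .
qed

text \<open>From \<open>exp x \<le> 1 + x + x^2\<close>: the linear term has mean zero before
  truncation, and what truncation removes is of order \<open>T powr (1 - m0)\<close> by the moment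
  bound; the quadratic term contributes the variance. The sign \<sigma> covers both tails.\<close>

lemma mean_zero_tail:
  assumes mom: "mom \<xi> C" and k: "k \<in> {1..n}" and T: "0 < T" and \<tau>: "0 < \<tau>" "\<tau> * (T * Bw) \<le> 1"
    and zero: "\<And>i v. i \<in> {1..n} \<Longrightarrow> integrable M (\<lambda>\<omega>. \<xi> (Z i \<omega>) * w (u (Z i \<omega>)) v)"
      "\<And>i v. i \<in> {1..n} \<Longrightarrow> expectation (\<lambda>\<omega>. \<xi> (Z i \<omega>) * w (u (Z i \<omega>)) v) = 0"
    and \<sigma>: "\<bar>\<sigma>\<bar> = 1"
  shows "prob {\<omega>\<in>space M. t \<le> \<sigma> * (\<Sum>i\<in>{1..n} - {k}. trunc T (\<xi> (Z i \<omega>)) * w (u (Z i \<omega>)) (u (Z k \<omega>)))}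
     \<le> exp (real n * ((\<tau> * T powr (1 - m0) + \<tau>\<^sup>2 * Bw) * (C * Iw)) - \<tau> * t)"
proof -
  note [measurable] = mom_meas[OF mom]
  define r where "r = \<tau> * T powr (1 - m0) + \<tau>\<^sup>2 * Bw"
  have r: "0 \<le> r" using \<tau> Bw by (simp add: r_def)
  define g where "g z z' = \<tau> * \<sigma> * (trunc T (\<xi> z) * w (u z) (u z'))" for z z'
  have abs_g: "\<bar>g z z'\<bar> = \<tau> * (\<bar>trunc T (\<xi> z)\<bar> * \<bar>w (u z) (u z')\<bar>)" for z z'
    using \<tau> \<sigma> by (simp add: g_def abs_mult)
  have g1: "\<bar>g z z'\<bar> \<le> 1" for z z'
  proof -
    have "\<bar>trunc T (\<xi> z)\<bar> * \<bar>w (u z) (u z')\<bar> \<le> T * Bw"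
      using T Bw w_bound by (intro mult_mono trunc_abs) auto
    then have "\<tau> * (\<bar>trunc T (\<xi> z)\<bar> * \<bar>w (u z) (u z')\<bar>) \<le> \<tau> * (T * Bw)"
      using \<tau> by (intro mult_left_mono) auto
    then show ?thesis using \<tau>(2) by (simp add: abs_g)
  qed
  have mgf: "(\<integral>\<^sup>+\<omega>. ennreal (exp (g (Z i \<omega>) z')) \<partial>M) \<le> ennreal (exp (r * (C * Iw)))"
    if i: "i \<in> {1..n}" for i z'
  proof -
    let ?w = "\<lambda>\<omega>. w (u (Z i \<omega>)) (u z')"
    let ?m = "\<lambda>\<omega>. (1 + \<bar>\<xi> (Z i \<omega>)\<bar> powr m0) * \<bar>?w \<omega>\<bar>"
    let ?b = "\<lambda>\<omega>. 1 + \<tau> * \<sigma> * (\<xi> (Z i \<omega>) * ?w \<omega>) + r * ?m \<omega>"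
    have [measurable]: "Z i \<in> measurable M N" using i by simp
    have le: "exp (g (Z i \<omega>) z') \<le> ?b \<omega>" for \<omega>
    proof -
      let ?x = "\<xi> (Z i \<omega>)"
      have "exp (g (Z i \<omega>) z') \<le> 1 + g (Z i \<omega>) z' + (g (Z i \<omega>) z')\<^sup>2"
        by (rule exp_le_quadratic[OF g1])
      moreover have "g (Z i \<omega>) z' \<le> \<tau> * \<sigma> * (?x * ?w \<omega>) + \<tau> * T powr (1 - m0) * ?m \<omega>"
      proof (cases "\<bar>?x\<bar> \<le> T")
        case True
        then show ?thesis using \<tau> by (simp add: g_def trunc_def)
      next
        case False
        have "- (\<sigma> * (?x * ?w \<omega>)) \<le> \<bar>\<sigma> * (?x * ?w \<omega>)\<bar>" by linarith
        also have "\<dots> = \<bar>?x\<bar> * \<bar>?w \<omega>\<bar>" using \<sigma> by (simp add: abs_mult)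
        \<comment> \<open>The power \<open>1 - m0\<close> is negative, so beyond the truncation
          level the first factor is at most \<open>T powr (1 - m0)\<close>, while the second is
          integrable.\<close>
        also have "\<bar>?x\<bar> = \<bar>?x\<bar> powr (1 - m0) * \<bar>?x\<bar> powr m0" using False T by (simp flip: powr_add)
        also have "\<dots> \<le> T powr (1 - m0) * (1 + \<bar>?x\<bar> powr m0)"
          using False T m0 by (intro mult_mono powr_mono2') auto
        finally have "- (\<sigma> * (?x * ?w \<omega>)) \<le> T powr (1 - m0) * ?m \<omega>"
          by (simp add: mult_right_mono mult.assoc)
        then have "0 \<le> \<tau> * (\<sigma> * (?x * ?w \<omega>) + T powr (1 - m0) * ?m \<omega>)" using \<tau> by simp
        then show ?thesis using False by (simp add: g_def trunc_def algebra_simps)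
      qed
      moreover have "(g (Z i \<omega>) z')\<^sup>2 \<le> \<tau>\<^sup>2 * Bw * ?m \<omega>"
      proof -
        have "(g (Z i \<omega>) z')\<^sup>2 = \<tau>\<^sup>2 * ((trunc T ?x)\<^sup>2 * (\<bar>?w \<omega>\<bar> * \<bar>?w \<omega>\<bar>))"
          using abs_g[of "Z i \<omega>" z'] by (metis power2_abs power_mult_distrib power2_eq_square)
        also have "\<dots> \<le> \<tau>\<^sup>2 * ((1 + \<bar>?x\<bar> powr m0) * (Bw * \<bar>?w \<omega>\<bar>))"
        proof (intro mult_left_mono mult_mono)
          have "(trunc T ?x)\<^sup>2 \<le> ?x\<^sup>2" using trunc_abs(1) by (simp add: abs_le_square_iff)
          then show "(trunc T ?x)\<^sup>2 \<le> 1 + \<bar>?x\<bar> powr m0" using abs_le_powr(2)[of ?x] by linarith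
        qed (use Bw in \<open>auto simp: w_bound intro: mult_right_mono\<close>)
        finally show ?thesis by (simp add: mult_ac)
      qed
      moreover have "?b \<omega> = 1 + (\<tau> * \<sigma> * (?x * ?w \<omega>) + \<tau> * T powr (1 - m0) * ?m \<omega>) + \<tau>\<^sup>2 * Bw * ?m \<omega>"
        by (simp add: r_def distrib_right)
      ultimately show ?thesis by linarith
    qed
    have int: "integrable M ?b"
      using zero(1)[OF i, of "u z'"] mom_w_integral(1)[OF mom i, of "u z'"] by simp
    have "(\<integral>\<^sup>+\<omega>. ennreal (exp (g (Z i \<omega>) z')) \<partial>M) \<le> (\<integral>\<^sup>+\<omega>. ennreal (?b \<omega>) \<partial>M)"
      by (intro nn_integral_mono ennreal_leI le)
    also have "\<dots> = ennreal (expectation ?b)"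
      using le by (intro nn_integral_eq_integral int AE_I2) (meson exp_ge_zero order_trans)
    also have "expectation ?b = 1 + r * expectation ?m"
      using zero[OF i, of "u z'"] mom_w_integral(1)[OF mom i, of "u z'"] by (simp add: prob_space)
    also have "ennreal \<dots> \<le> ennreal (exp (r * (C * Iw)))"
    proof (intro ennreal_leI)
      have "r * expectation ?m \<le> r * (C * Iw)" by (intro mult_left_mono mom_w_integral(2)[OF mom i] r)
      then show "1 + r * expectation ?m \<le> exp (r * (C * Iw))"
        using exp_ge_add_one_self[of "r * (C * Iw)"] by linarith
    qed
    finally show ?thesis .
  qed
  have "prob {\<omega>\<in>space M. \<tau> * t \<le> (\<Sum>i\<in>{1..n} - {k}. g (Z i \<omega>) (Z k \<omega>))}
      \<le> exp (real n * (r * (C * Iw)) - \<tau> * t)"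
    using r mom_nonneg[OF mom] Iw by (intro chernoff[OF k] mgf) (auto simp: g_def split_def)
  also have "{\<omega>\<in>space M. \<tau> * t \<le> (\<Sum>i\<in>{1..n} - {k}. g (Z i \<omega>) (Z k \<omega>))}
      = {\<omega>\<in>space M. t \<le> \<sigma> * (\<Sum>i\<in>{1..n} - {k}. trunc T (\<xi> (Z i \<omega>)) * w (u (Z i \<omega>)) (u (Z k \<omega>)))}"
    using \<tau> by (simp add: g_def sum_distrib_left[symmetric] mult.assoc)
  finally show ?thesis by (simp add: r_def)
qed

lemma sum_split_k:
  fixes f :: "nat \<Rightarrow> real"
  assumes "k \<in> {1..n}"
  shows "(\<Sum>i=1..n. f i) = f k + (\<Sum>i\<in>{1..n} - {k}. f i)"
  using assms by (intro sum.remove) auto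

lemma term_meas:
  assumes "mom \<xi> C" "i \<in> {1..n}" "k \<in> {1..n}"
  shows "(\<lambda>\<omega>. \<xi> (Z i \<omega>) * w (u (Z i \<omega>)) (u (Z k \<omega>))) \<in> borel_measurable M"
    "(\<lambda>\<omega>. trunc T (\<xi> (Z i \<omega>)) * w (u (Z i \<omega>)) (u (Z k \<omega>))) \<in> borel_measurable M"
proof -
  note [measurable] = mom_meas[OF assms(1)]
  have [measurable]: "Z i \<in> measurable M N" "Z k \<in> measurable M N" using assms by auto
  show "(\<lambda>\<omega>. \<xi> (Z i \<omega>) * w (u (Z i \<omega>)) (u (Z k \<omega>))) \<in> borel_measurable M"
    "(\<lambda>\<omega>. trunc T (\<xi> (Z i \<omega>)) * w (u (Z i \<omega>)) (u (Z k \<omega>))) \<in> borel_measurable M"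
    by measurable
qed

lemma truncation_family:
  assumes S: "finite S" and mom: "\<And>s. s \<in> S \<Longrightarrow> mom (\<xi> s) C" and T: "0 < T"
  shows "inner_prob_ge M (1 - real n * card S * (C / T powr m0))
     (\<lambda>\<omega>. \<forall>s\<in>S. \<forall>i\<in>{1..n}. \<bar>\<xi> s (Z i \<omega>)\<bar> \<le> T)"
proof -
  have "inner_prob_ge M (1 - real (card (S \<times> {1..n})) * (C / T powr m0))
     (\<lambda>\<omega>. \<forall>p\<in>S \<times> {1..n}. \<omega> \<notin> {\<omega>\<in>space M. T < \<bar>\<xi> (fst p) (Z (snd p) \<omega>)\<bar>})"
  proof (rule inner_prob_ge_union_bound)
    fix p assume p: "p \<in> S \<times> {1..n}"
    then have m: "mom (\<xi> (fst p)) C" and i: "snd p \<in> {1..n}" using mom by auto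
    note [measurable] = mom_meas[OF m]
    have [measurable]: "Z (snd p) \<in> measurable M N" using i by simp
    show "{\<omega>\<in>space M. T < \<bar>\<xi> (fst p) (Z (snd p) \<omega>)\<bar>} \<in> events" by measurable
    show "prob {\<omega>\<in>space M. T < \<bar>\<xi> (fst p) (Z (snd p) \<omega>)\<bar>} \<le> C / T powr m0"
      by (rule truncation_prob[OF m i T])
  qed (use S in auto)
  then show ?thesis
    by (rule inner_prob_ge_mono) (auto simp: card_cartesian_product not_less mult_ac)
qed

lemma pos_family:
  assumes S: "finite S" and mom: "\<And>s. s \<in> S \<Longrightarrow> mom (\<xi> s) C" and T: "0 < T"
  shows "inner_prob_ge M (1 - real n * card S * (C / T powr m0 + exp (- (real n * C * Iw / (T * Bw)))))
     (\<lambda>\<omega>. \<forall>s\<in>S. \<forall>k\<in>{1..n}. (\<Sum>i=1..n. \<bar>\<xi> s (Z i \<omega>) * w (u (Z i \<omega>)) (u (Z k \<omega>))\<bar>)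
        \<le> 3 * real n * C * Iw + T * Bw)"
proof -
  let ?A = "\<lambda>p. {\<omega>\<in>space M. 3 * real n * C * Iw \<le> (\<Sum>i\<in>{1..n} - {snd p}.
      \<bar>trunc T (\<xi> (fst p) (Z i \<omega>)) * w (u (Z i \<omega>)) (u (Z (snd p) \<omega>))\<bar>)}"
  let ?q = "exp (- (real n * C * Iw / (T * Bw)))"
  have "inner_prob_ge M (1 - real (card (S \<times> {1..n})) * ?q) (\<lambda>\<omega>. \<forall>p\<in>S \<times> {1..n}. \<omega> \<notin> ?A p)"
  proof (rule inner_prob_ge_union_bound)
    fix p assume p: "p \<in> S \<times> {1..n}"
    then have m: "mom (\<xi> (fst p)) C" and k: "snd p \<in> {1..n}" using mom by auto
    have "(\<lambda>\<omega>. \<Sum>i\<in>{1..n} - {snd p}. \<bar>trunc T (\<xi> (fst p) (Z i \<omega>)) * w (u (Z i \<omega>)) (u (Z (snd p) \<omega>))\<bar>)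
        \<in> borel_measurable M"
      by (intro borel_measurable_sum borel_measurable_abs term_meas[OF m _ k]) auto
    then show "?A p \<in> events" by measurable
    show "prob (?A p) \<le> ?q" by (rule pos_tail[OF m k T])
  qed (use S in auto)
  from inner_prob_ge_conj[OF truncation_family[OF S mom T] this]
  show ?thesis
  proof (rule inner_prob_ge_mono)
    show "1 - real n * card S * (C / T powr m0 + ?q)
      \<le> 1 - (real n * card S * (C / T powr m0) + real (card (S \<times> {1..n})) * ?q)"
      by (simp add: card_cartesian_product algebra_simps)
    fix \<omega> assume \<omega>: "\<omega> \<in> space M" and good: "(\<forall>s\<in>S. \<forall>i\<in>{1..n}. \<bar>\<xi> s (Z i \<omega>)\<bar> \<le> T) \<and> (\<forall>p\<in>S \<times> {1..n}. \<omega> \<notin> ?A p)"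
    show "\<forall>s\<in>S. \<forall>k\<in>{1..n}. (\<Sum>i=1..n. \<bar>\<xi> s (Z i \<omega>) * w (u (Z i \<omega>)) (u (Z k \<omega>))\<bar>) \<le> 3 * real n * C * Iw + T * Bw"
    proof (intro ballI)
      fix s k assume s: "s \<in> S" and k: "k \<in> {1..n}"
      have tr: "trunc T (\<xi> s (Z i \<omega>)) = \<xi> s (Z i \<omega>)" if "i \<in> {1..n}" for i
        using good s that by (simp add: trunc_def)
      have "\<omega> \<notin> ?A (s, k)" using good s k by blast
      then have "(\<Sum>i\<in>{1..n} - {k}. \<bar>trunc T (\<xi> s (Z i \<omega>)) * w (u (Z i \<omega>)) (u (Z k \<omega>))\<bar>) \<le> 3 * real n * C * Iw"
        using \<omega> by simp
      also have "(\<Sum>i\<in>{1..n} - {k}. \<bar>trunc T (\<xi> s (Z i \<omega>)) * w (u (Z i \<omega>)) (u (Z k \<omega>))\<bar>)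
          = (\<Sum>i\<in>{1..n} - {k}. \<bar>\<xi> s (Z i \<omega>) * w (u (Z i \<omega>)) (u (Z k \<omega>))\<bar>)"
        by (intro sum.cong refl) (simp add: tr)
      finally have 1: "(\<Sum>i\<in>{1..n} - {k}. \<bar>\<xi> s (Z i \<omega>) * w (u (Z i \<omega>)) (u (Z k \<omega>))\<bar>) \<le> 3 * real n * C * Iw" .
      \<comment> \<open>The k-th summand is localised at its own index and stays outside the
        decoupling; on the truncation event it is simply bounded by \<open>T * Bw\<close>.\<close>
      have "\<bar>\<xi> s (Z k \<omega>) * w (u (Z k \<omega>)) (u (Z k \<omega>))\<bar> \<le> T * Bw"
        unfolding abs_mult using good s k T by (intro mult_mono w_bound) auto
      with 1 show "(\<Sum>i=1..n. \<bar>\<xi> s (Z i \<omega>) * w (u (Z i \<omega>)) (u (Z k \<omega>))\<bar>) \<le> 3 * real n * C * Iw + T * Bw"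
        by (subst sum_split_k[OF k]) linarith
    qed
  qed
qed

definition mean_zero :: "('z \<Rightarrow> real) \<Rightarrow> bool" where
  "mean_zero \<xi> \<longleftrightarrow> (\<forall>i\<in>{1..n}. \<forall>v. integrable M (\<lambda>\<omega>. \<xi> (Z i \<omega>) * w (u (Z i \<omega>)) v) \<and>
     expectation (\<lambda>\<omega>. \<xi> (Z i \<omega>) * w (u (Z i \<omega>)) v) = 0)"

lemma mean_zero_family:
  assumes S: "finite S" and mom: "\<And>s. s \<in> S \<Longrightarrow> mom (\<xi> s) C" and T: "0 < T"
    and zero: "\<And>s. s \<in> S \<Longrightarrow> mean_zero (\<xi> s)"
    and \<tau>: "0 < \<tau>" "\<tau> * (T * Bw) \<le> 1"
  shows "inner_prob_ge M (1 - real n * card S * (C / T powr m0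
        + 2 * exp (real n * ((\<tau> * T powr (1 - m0) + \<tau>\<^sup>2 * Bw) * (C * Iw)) - \<tau> * t)))
     (\<lambda>\<omega>. \<forall>s\<in>S. \<forall>k\<in>{1..n}. \<bar>\<Sum>i=1..n. \<xi> s (Z i \<omega>) * w (u (Z i \<omega>)) (u (Z k \<omega>))\<bar> \<le> t + T * Bw)"
proof -
  let ?S = "\<lambda>p \<omega>. \<Sum>i\<in>{1..n} - {snd p}. trunc T (\<xi> (fst p) (Z i \<omega>)) * w (u (Z i \<omega>)) (u (Z (snd p) \<omega>))"
  let ?A = "\<lambda>p. {\<omega>\<in>space M. t \<le> 1 * ?S p \<omega>} \<union> {\<omega>\<in>space M. t \<le> - 1 * ?S p \<omega>}"
  let ?q = "exp (real n * ((\<tau> * T powr (1 - m0) + \<tau>\<^sup>2 * Bw) * (C * Iw)) - \<tau> * t)"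
  have "inner_prob_ge M (1 - real (card (S \<times> {1..n})) * (2 * ?q)) (\<lambda>\<omega>. \<forall>p\<in>S \<times> {1..n}. \<omega> \<notin> ?A p)"
  proof (rule inner_prob_ge_union_bound)
    fix p assume p: "p \<in> S \<times> {1..n}"
    then have m: "mom (\<xi> (fst p)) C" and k: "snd p \<in> {1..n}" and s: "fst p \<in> S" using mom by auto
    have [measurable]: "?S p \<in> borel_measurable M"
      by (intro borel_measurable_sum term_meas[OF m _ k]) auto
    have ev: "{\<omega>\<in>space M. t \<le> \<sigma> * ?S p \<omega>} \<in> events" for \<sigma> by measurable
    then show "?A p \<in> events" by blast
    have z: "integrable M (\<lambda>\<omega>. \<xi> (fst p) (Z i \<omega>) * w (u (Z i \<omega>)) v)"
      "expectation (\<lambda>\<omega>. \<xi> (fst p) (Z i \<omega>) * w (u (Z i \<omega>)) v) = 0" if "i \<in> {1..n}" for i v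
      using zero[OF s] that by (auto simp: mean_zero_def)
    have "prob (?A p) \<le> prob {\<omega>\<in>space M. t \<le> 1 * ?S p \<omega>} + prob {\<omega>\<in>space M. t \<le> - 1 * ?S p \<omega>}"
      by (rule measure_Un_le[OF ev ev])
    also have "\<dots> \<le> ?q + ?q"
      by (intro add_mono mean_zero_tail[OF m k T \<tau> z]) auto
    finally show "prob (?A p) \<le> 2 * ?q" by simp
  qed (use S in auto)
  from inner_prob_ge_conj[OF truncation_family[OF S mom T] this]
  show ?thesis
  proof (rule inner_prob_ge_mono)
    show "1 - real n * card S * (C / T powr m0 + 2 * ?q)
      \<le> 1 - (real n * card S * (C / T powr m0) + real (card (S \<times> {1..n})) * (2 * ?q))"
      by (simp add: card_cartesian_product algebra_simps)
    fix \<omega> assume \<omega>: "\<omega> \<in> space M" and good: "(\<forall>s\<in>S. \<forall>i\<in>{1..n}. \<bar>\<xi> s (Z i \<omega>)\<bar> \<le> T) \<and> (\<forall>p\<in>S \<times> {1..n}. \<omega> \<notin> ?A p)"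
    show "\<forall>s\<in>S. \<forall>k\<in>{1..n}. \<bar>\<Sum>i=1..n. \<xi> s (Z i \<omega>) * w (u (Z i \<omega>)) (u (Z k \<omega>))\<bar> \<le> t + T * Bw"
    proof (intro ballI)
      fix s k assume s: "s \<in> S" and k: "k \<in> {1..n}"
      have tr: "trunc T (\<xi> s (Z i \<omega>)) = \<xi> s (Z i \<omega>)" if "i \<in> {1..n}" for i
        using good s that by (simp add: trunc_def)
      have "\<omega> \<notin> ?A (s, k)" using good s k by blast
      then have "\<bar>?S (s, k) \<omega>\<bar> \<le> t" using \<omega> by auto
      also have "?S (s, k) \<omega> = (\<Sum>i\<in>{1..n} - {k}. \<xi> s (Z i \<omega>) * w (u (Z i \<omega>)) (u (Z k \<omega>)))"
        by (intro sum.cong) (auto simp: tr)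
      finally have 1: "\<bar>\<Sum>i\<in>{1..n} - {k}. \<xi> s (Z i \<omega>) * w (u (Z i \<omega>)) (u (Z k \<omega>))\<bar> \<le> t" .
      have "\<bar>\<xi> s (Z k \<omega>) * w (u (Z k \<omega>)) (u (Z k \<omega>))\<bar> \<le> T * Bw"
        unfolding abs_mult using good s k T by (intro mult_mono w_bound) auto
      with 1 show "\<bar>\<Sum>i=1..n. \<xi> s (Z i \<omega>) * w (u (Z i \<omega>)) (u (Z k \<omega>))\<bar> \<le> t + T * Bw"
        by (subst sum_split_k[OF k]) linarith
    qed
  qed
qed

section \<open>Second moments, which avoid the logarithmic factor of the uniform bounds\<close>

lemma square_w_le: "(t * w s v)\<^sup>2 \<le> Bw * ((1 + \<bar>t\<bar> powr m0) * \<bar>w s v\<bar>)"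
proof -
  have "(t * w s v)\<^sup>2 = t\<^sup>2 * (\<bar>w s v\<bar> * \<bar>w s v\<bar>)" by (simp add: power2_eq_square abs_mult_self_eq mult_ac)
  also have "\<dots> \<le> (1 + \<bar>t\<bar> powr m0) * (Bw * \<bar>w s v\<bar>)"
    using Bw by (intro mult_mono abs_le_powr w_bound mult_right_mono) auto
  finally show ?thesis by (simp add: mult_ac)
qed

text \<open>Distinct centred summands are independent, hence orthogonal, so only the diagonal
  survives. In each square one factor \<open>w\<close> is bounded by \<open>Bw\<close> and the other
  is integrated.\<close>

lemma independent_second_moment:
  assumes mom: "mom \<xi> C" and zero: "mean_zero \<xi>" and J: "J \<subseteq> {1..n}"
  shows "(\<integral>\<^sup>+\<omega>. ennreal ((\<Sum>i\<in>J. \<xi> (Z i \<omega>) * w (u (Z i \<omega>)) v)\<^sup>2) \<partial>M) \<le> ennreal (real n * (Bw * (C * Iw)))"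
proof -
  note [measurable] = mom_meas[OF mom]
  have finJ: "finite J" using J finite_subset by blast
  define X where "X i \<omega> = \<xi> (Z i \<omega>) * w (u (Z i \<omega>)) v" for i \<omega>
  have Xint: "integrable M (X i)" and Xz: "expectation (X i) = 0" if "i \<in> J" for i
    using zero that J by (auto simp: mean_zero_def X_def[abs_def])
  have sq: "integrable M (\<lambda>\<omega>. (X i \<omega>)\<^sup>2)" "expectation (\<lambda>\<omega>. (X i \<omega>)\<^sup>2) \<le> Bw * (C * Iw)" if "i \<in> J" for i
  proof -
    have i: "i \<in> {1..n}" using that J by auto
    have [measurable]: "Z i \<in> measurable M N" using i by simp
    note m = mom_w_integral[OF mom i, of v]
    show s: "integrable M (\<lambda>\<omega>. (X i \<omega>)\<^sup>2)"
    proof (rule Bochner_Integration.integrable_bound)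
      show "integrable M (\<lambda>\<omega>. Bw * ((1 + \<bar>\<xi> (Z i \<omega>)\<bar> powr m0) * \<bar>w (u (Z i \<omega>)) v\<bar>))" using m(1) by simp
      show "(\<lambda>\<omega>. (X i \<omega>)\<^sup>2) \<in> borel_measurable M" unfolding X_def by measurable
      show "AE \<omega> in M. norm ((X i \<omega>)\<^sup>2) \<le> norm (Bw * ((1 + \<bar>\<xi> (Z i \<omega>)\<bar> powr m0) * \<bar>w (u (Z i \<omega>)) v\<bar>))"
        using square_w_le Bw unfolding X_def by (intro AE_I2) (smt (verit) real_norm_def zero_le_power2)
    qed
    have "expectation (\<lambda>\<omega>. (X i \<omega>)\<^sup>2) \<le> expectation (\<lambda>\<omega>. Bw * ((1 + \<bar>\<xi> (Z i \<omega>)\<bar> powr m0) * \<bar>w (u (Z i \<omega>)) v\<bar>))"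
      using m(1) square_w_le by (intro integral_mono s) (auto simp: X_def)
    also have "\<dots> \<le> Bw * (C * Iw)" using m(2) Bw by simp
    finally show "expectation (\<lambda>\<omega>. (X i \<omega>)\<^sup>2) \<le> Bw * (C * Iw)" .
  qed
  have cross: "integrable M (\<lambda>\<omega>. X i \<omega> * X j \<omega>) \<and> expectation (\<lambda>\<omega>. X i \<omega> * X j \<omega>) = 0"
    if ij: "i \<in> J" "j \<in> J" "i \<noteq> j" for i j
  proof -
    have "indep_vars (\<lambda>_. borel) X {i, j}"
    proof (rule indep_vars_cong[THEN iffD1, OF refl _ refl indep_vars_compose2[where Y = "\<lambda>i z. \<xi> z * w (u z) v"]])
      show "indep_vars (\<lambda>_. N) Z {i, j}" by (rule indep_vars_subset[OF indep]) (use ij J in auto)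
      show "(\<lambda>z. \<xi> z * w (u z) v) \<in> borel_measurable N" for i :: nat by measurable
    qed (simp add: X_def[abs_def])
    then have "expectation (\<lambda>\<omega>. \<Prod>a\<in>{i, j}. X a \<omega>) = (\<Prod>a\<in>{i, j}. expectation (X a))"
      "integrable M (\<lambda>\<omega>. \<Prod>a\<in>{i, j}. X a \<omega>)"
      using Xint ij by (auto intro!: indep_vars_lebesgue_integral indep_vars_integrable simp del: prod.insert)
    then show ?thesis using ij Xz by simp
  qed
  have int: "integrable M (\<lambda>\<omega>. X i \<omega> * X j \<omega>)" if "i \<in> J" "j \<in> J" for i j
    using cross[OF that] sq(1)[OF that(1)] by (cases "i = j") (auto simp: power2_eq_square)
  have eq: "(\<Sum>i\<in>J. X i \<omega>)\<^sup>2 = (\<Sum>i\<in>J. \<Sum>j\<in>J. X i \<omega> * X j \<omega>)" for \<omega>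
    by (simp add: power2_eq_square sum_product)
  have "expectation (\<lambda>\<omega>. (\<Sum>i\<in>J. X i \<omega>)\<^sup>2) = (\<Sum>i\<in>J. \<Sum>j\<in>J. expectation (\<lambda>\<omega>. X i \<omega> * X j \<omega>))"
    unfolding eq using int by (subst Bochner_Integration.integral_sum) (auto intro!: sum.cong Bochner_Integration.integral_sum)
  also have "\<dots> = (\<Sum>i\<in>J. expectation (\<lambda>\<omega>. (X i \<omega>)\<^sup>2))"
  proof (rule sum.cong[OF refl])
    fix i assume i: "i \<in> J"
    have "(\<Sum>j\<in>J. expectation (\<lambda>\<omega>. X i \<omega> * X j \<omega>)) = (\<Sum>j\<in>{i}. expectation (\<lambda>\<omega>. X i \<omega> * X j \<omega>))"
      using cross i finJ by (intro sum.mono_neutral_right) auto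
    then show "(\<Sum>j\<in>J. expectation (\<lambda>\<omega>. X i \<omega> * X j \<omega>)) = expectation (\<lambda>\<omega>. (X i \<omega>)\<^sup>2)"
      by (simp add: power2_eq_square)
  qed
  also have "\<dots> \<le> real (card J) * (Bw * (C * Iw))" by (rule sum_bounded_above) (rule sq(2))
  also have "\<dots> \<le> real n * (Bw * (C * Iw))"
    using card_mono[OF _ J] mom_nonneg[OF mom] Bw Iw by (intro mult_right_mono) auto
  finally have "expectation (\<lambda>\<omega>. (\<Sum>i\<in>J. X i \<omega>)\<^sup>2) \<le> real n * (Bw * (C * Iw))" .
  moreover have "integrable M (\<lambda>\<omega>. (\<Sum>i\<in>J. X i \<omega>)\<^sup>2)"
    unfolding eq using int by (intro Bochner_Integration.integrable_sum) auto
  ultimately show ?thesis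
    unfolding X_def[symmetric] by (subst nn_integral_eq_integral) (auto intro: ennreal_leI)
qed

text \<open>Decoupling treats the terms other than \<open>k\<close>; the k-th is separated by
  \<open>(x + y)^2 \<le> 2 * x^2 + 2 * y^2\<close>. It costs \<open>Bw\<close> squared, which is
  dominated by \<open>n * Bw\<close> once \<open>n * h\<close> is bounded below.\<close>

lemma second_moment:
  assumes mom: "mom \<xi> C" and zero: "mean_zero \<xi>" and k: "k \<in> {1..n}"
  shows "(\<integral>\<^sup>+\<omega>. ennreal ((\<Sum>i=1..n. \<xi> (Z i \<omega>) * w (u (Z i \<omega>)) (u (Z k \<omega>)))\<^sup>2) \<partial>M)
    \<le> ennreal (2 * (real n * (Bw * (C * Iw))) + 2 * (Bw\<^sup>2 * C))"
proof -
  note [measurable] = mom_meas[OF mom]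
  let ?J = "{1..n} - {k}"
  have [measurable]: "Z k \<in> measurable M N" using k by simp
  let ?t = "\<lambda>i \<omega>. \<xi> (Z i \<omega>) * w (u (Z i \<omega>)) (u (Z k \<omega>))"
  let ?S = "\<lambda>\<omega>. \<Sum>i\<in>?J. ?t i \<omega>"
  have [measurable]: "?S \<in> borel_measurable M" by (intro borel_measurable_sum term_meas[OF mom _ k]) auto
  define F where "F = (\<lambda>(x, z). ennreal ((\<Sum>i\<in>?J. \<xi> (x i) * w (u (x i)) (u z))\<^sup>2))"
  have "(\<integral>\<^sup>+\<omega>. F (\<lambda>i\<in>?J. Z i \<omega>, Z k \<omega>) \<partial>M) \<le> ennreal (real n * (Bw * (C * Iw)))"
  proof (rule decouple[OF k])
    show "F \<in> borel_measurable ((\<Pi>\<^sub>M i\<in>?J. N) \<Otimes>\<^sub>M N)"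
      unfolding F_def split_def by measurable
    fix z
    have "(\<integral>\<^sup>+\<omega>. F (\<lambda>i\<in>?J. Z i \<omega>, z) \<partial>M) = (\<integral>\<^sup>+\<omega>. ennreal ((\<Sum>i\<in>?J. \<xi> (Z i \<omega>) * w (u (Z i \<omega>)) (u z))\<^sup>2) \<partial>M)"
      unfolding F_def by (simp cong: sum.cong_simp)
    also have "\<dots> \<le> ennreal (real n * (Bw * (C * Iw)))"
      by (rule independent_second_moment[OF mom zero]) auto
    finally show "(\<integral>\<^sup>+\<omega>. F (\<lambda>i\<in>?J. Z i \<omega>, z) \<partial>M) \<le> ennreal (real n * (Bw * (C * Iw)))" .
  qed
  also have "(\<integral>\<^sup>+\<omega>. F (\<lambda>i\<in>?J. Z i \<omega>, Z k \<omega>) \<partial>M) = (\<integral>\<^sup>+\<omega>. ennreal ((?S \<omega>)\<^sup>2) \<partial>M)"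
    unfolding F_def by (simp cong: sum.cong_simp)
  finally have 1: "(\<integral>\<^sup>+\<omega>. ennreal ((?S \<omega>)\<^sup>2) \<partial>M) \<le> ennreal (real n * (Bw * (C * Iw)))" .
  have "(\<integral>\<^sup>+\<omega>. ennreal ((?t k \<omega>)\<^sup>2) \<partial>M)
      \<le> (\<integral>\<^sup>+\<omega>. ennreal (Bw\<^sup>2) * (ennreal (1 + \<bar>\<xi> (Z k \<omega>)\<bar> powr m0) * indicator {0..1} (u (Z k \<omega>))) \<partial>M)"
  proof (rule nn_integral_mono)
    fix \<omega> assume \<omega>: "\<omega> \<in> space M"
    let ?w = "\<bar>w (u (Z k \<omega>)) (u (Z k \<omega>))\<bar>"
    have "(?t k \<omega>)\<^sup>2 \<le> Bw * ((1 + \<bar>\<xi> (Z k \<omega>)\<bar> powr m0) * ?w)" by (rule square_w_le)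
    also have "\<dots> \<le> Bw * ((1 + \<bar>\<xi> (Z k \<omega>)\<bar> powr m0) * Bw)"
      using Bw w_bound by (intro mult_left_mono) auto
    finally have "(?t k \<omega>)\<^sup>2 \<le> Bw\<^sup>2 * (1 + \<bar>\<xi> (Z k \<omega>)\<bar> powr m0)" by (simp add: power2_eq_square mult_ac)
    then show "ennreal ((?t k \<omega>)\<^sup>2) \<le> ennreal (Bw\<^sup>2) * (ennreal (1 + \<bar>\<xi> (Z k \<omega>)\<bar> powr m0) * indicator {0..1} (u (Z k \<omega>)))"
      using u_range[OF k \<omega>] by (simp add: ennreal_mult[symmetric] ennreal_leI del: ennreal_plus)
  qed
  also have "\<dots> = ennreal (Bw\<^sup>2) * (\<integral>\<^sup>+\<omega>. ennreal (1 + \<bar>\<xi> (Z k \<omega>)\<bar> powr m0) * indicator {0..1} (u (Z k \<omega>)) \<partial>M)"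
    by (rule nn_integral_cmult) measurable
  also have "\<dots> \<le> ennreal (Bw\<^sup>2) * (ennreal C * (\<integral>\<^sup>+s. indicator {0..1::real} s \<partial>lborel))"
    by (intro mult_left_mono mom_D[OF mom k]) auto
  also have "\<dots> = ennreal (Bw\<^sup>2 * C)" using mom_nonneg[OF mom] by (simp add: ennreal_mult)
  finally have 2: "(\<integral>\<^sup>+\<omega>. ennreal ((?t k \<omega>)\<^sup>2) \<partial>M) \<le> ennreal (Bw\<^sup>2 * C)" .
  have "(\<integral>\<^sup>+\<omega>. ennreal ((\<Sum>i=1..n. ?t i \<omega>)\<^sup>2) \<partial>M) \<le> (\<integral>\<^sup>+\<omega>. 2 * ennreal ((?S \<omega>)\<^sup>2) + 2 * ennreal ((?t k \<omega>)\<^sup>2) \<partial>M)"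
  proof (rule nn_integral_mono)
    fix \<omega>
    have "(?t k \<omega> + ?S \<omega>)\<^sup>2 \<le> 2 * (?S \<omega>)\<^sup>2 + 2 * (?t k \<omega>)\<^sup>2"
      using sum_squares_bound[of "?t k \<omega>" "?S \<omega>"] by (simp add: power2_sum)
    then have "ennreal ((?t k \<omega> + ?S \<omega>)\<^sup>2) \<le> ennreal (2 * (?S \<omega>)\<^sup>2 + 2 * (?t k \<omega>)\<^sup>2)" by (rule ennreal_leI)
    then show "ennreal ((\<Sum>i=1..n. ?t i \<omega>)\<^sup>2) \<le> 2 * ennreal ((?S \<omega>)\<^sup>2) + 2 * ennreal ((?t k \<omega>)\<^sup>2)"
      unfolding sum_split_k[OF k] by (simp add: ennreal_mult)
  qed
  also have "\<dots> = 2 * (\<integral>\<^sup>+\<omega>. ennreal ((?S \<omega>)\<^sup>2) \<partial>M) + 2 * (\<integral>\<^sup>+\<omega>. ennreal ((?t k \<omega>)\<^sup>2) \<partial>M)"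
    using term_meas(1)[OF mom k k] by (simp add: nn_integral_add nn_integral_cmult)
  also have "\<dots> \<le> 2 * ennreal (real n * (Bw * (C * Iw))) + 2 * ennreal (Bw\<^sup>2 * C)"
    by (intro add_mono mult_left_mono 1 2) auto
  also have "\<dots> = ennreal (2 * (real n * (Bw * (C * Iw))) + 2 * (Bw\<^sup>2 * C))"
    using mom_nonneg[OF mom] Bw Iw by (simp add: ennreal_mult)
  finally show ?thesis .
qed

end

section \<open>Rates\<close>

locale rates =
  fixes d s2 :: "nat \<Rightarrow> nat" and h lam1 lam2 lam4 lam4s :: "nat \<Rightarrow> real" and m0 \<tau>1 \<delta>1 :: real
  assumes sizes: "\<And>n. n \<ge> 1 \<Longrightarrow> 1 \<le> s2 n \<and> 1 \<le> d n"
    and pos: "\<And>n. n \<ge> 1 \<Longrightarrow> h n > 0 \<and> lam1 n > 0 \<and> lam2 n > 0 \<and> lam4 n > 0 \<and> lam4s n > 0"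
    and m0: "2 < m0"
    and c5: "0 \<le> \<tau>1" "(\<lambda>n. real (d n)) \<propto> (\<lambda>n. real n powr \<tau>1)"
            "filterlim (\<lambda>n. real n * h n /
               ((real n * real (d n) ^ 3) powr (2 / m0) * ln (1 / h n))) at_top sequentially"
            "0 < \<delta>1" "h \<propto> (\<lambda>n. real n powr (- \<delta>1))"
            "(\<lambda>n. real (s2 n) * (h n)\<^sup>2 + sqrt (ln (1 / h n) / (real n * h n))) \<in> o(lam1)"
            "lam1 \<propto> lam2"
            "(\<lambda>n. real (s2 n) * (lam1 n)\<^sup>2 / (h n)\<^sup>2 + (real (s2 n))\<^sup>2 * lam1 n) \<in> o(\<lambda>_. 1)"
    and c6a: "(\<lambda>n. real (s2 n) * (h n)\<^sup>2) \<propto> (\<lambda>n. (real n * h n) powr (- (1 / 2)))"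
             "lam4 \<sim>[sequentially] lam4s" "lam4 \<in> o(\<lambda>n. sqrt (real n))"
             "(\<lambda>n. (h n) powr (- (1 / 2)) *
                (sqrt (ln (1 / h n)) + sqrt (real (s2 n)) * (1 + lam1 n * sqrt (real n * h n))))
              \<in> o(lam4)"
begin

section \<open>Consequences of the tuning conditions\<close>

definition L :: "nat \<Rightarrow> real" where "L n = ln (1 / h n)"

text \<open>Uniform size of the local scores: the standard deviation of order
  \<open>(n * h) powr (-1/2)\<close>, inflated by the square root of the logarithm that the union
  bound costs.\<close>

definition r :: "nat \<Rightarrow> real" where "r n = sqrt (L n / (real n * h n))"

lemma ge1: "\<forall>\<^sub>F n in sequentially. 1 \<le> n"
  by (rule eventually_ge_at_top)

lemma h_small:
  assumes "0 < e"
  shows "\<forall>\<^sub>F n in sequentially. h n \<le> e"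
proof -
  obtain c1 c2 where c: "\<forall>\<^sub>F n in sequentially. c1 * real n powr (- \<delta>1) \<le> h n \<and> h n \<le> c2 * real n powr (- \<delta>1)"
    using c5(5) by (auto simp: prop_to_def)
  have "(\<lambda>n. real n powr (- \<delta>1)) \<longlonglongrightarrow> 0"
    using c5(4) by (intro tendsto_neg_powr filterlim_real_sequentially) auto
  then have "(\<lambda>n. c2 * real n powr (- \<delta>1)) \<longlonglongrightarrow> 0" by (rule tendsto_mult_right_zero)
  then have "\<forall>\<^sub>F n in sequentially. c2 * real n powr (- \<delta>1) < e" using assms by (rule order_tendstoD(2))
  with c show ?thesis by eventually_elim linarith
qed

lemma L_large: "\<forall>\<^sub>F n in sequentially. c \<le> L n"
  using h_small[of "exp (- c)"] ge1
proof (rule eventually_elim2)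
  show "0 < exp (- c)" by simp
  fix n assume "h n \<le> exp (- c)" "1 \<le> n"
  then have "ln (h n) \<le> - c" using pos[of n] by (simp add: ln_le_cancel_iff[symmetric] del: ln_le_cancel_iff)
  then show "c \<le> L n" using pos[of n] \<open>1 \<le> n\<close> by (simp add: L_def ln_div)
qed

lemma r_lam1: "0 < e \<Longrightarrow> \<forall>\<^sub>F n in sequentially. real (s2 n) * (h n)\<^sup>2 + r n \<le> e * lam1 n"
  using landau_o.smallD[OF c5(6), of e] ge1
  by (rule eventually_elim2) (use pos in \<open>force simp: r_def L_def\<close>)+

lemma s2_lam1: "0 < e \<Longrightarrow> \<forall>\<^sub>F n in sequentially.
    real (s2 n) * (lam1 n)\<^sup>2 / (h n)\<^sup>2 + (real (s2 n))\<^sup>2 * lam1 n \<le> e"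
  using landau_o.smallD[OF c5(8), of e] ge1
  by (rule eventually_elim2) (use pos in \<open>force\<close>)+

lemma lam4_lower: "0 < e \<Longrightarrow> \<forall>\<^sub>F n in sequentially. (h n) powr (- (1 / 2)) *
    (sqrt (L n) + sqrt (real (s2 n)) * (1 + lam1 n * sqrt (real n * h n))) \<le> e * lam4 n"
  using landau_o.smallD[OF c6a(4), of e] ge1
  by (rule eventually_elim2) (use pos in \<open>force simp: L_def\<close>)+

lemma lam4_upper: "0 < e \<Longrightarrow> \<forall>\<^sub>F n in sequentially. lam4 n \<le> e * sqrt (real n)"
  using landau_o.smallD[OF c6a(3), of e] ge1
  by (rule eventually_elim2) (use pos in \<open>force\<close>)+

lemma lam4_lam4s: "\<forall>\<^sub>F n in sequentially. lam4 n / 2 \<le> lam4s n \<and> lam4s n \<le> 2 * lam4 n"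
proof -
  have lim: "((\<lambda>n. if lam4 n = 0 \<and> lam4s n = 0 then 1 else lam4 n / lam4s n) \<longlonglongrightarrow> 1)"
    using c6a(2) by (simp add: asymp_equiv_def)
  have "\<forall>\<^sub>F n in sequentially. 1 / 2 < (if lam4 n = 0 \<and> lam4s n = 0 then 1 else lam4 n / lam4s n)"
    by (rule order_tendstoD(1)[OF lim]) simp
  moreover have "\<forall>\<^sub>F n in sequentially. (if lam4 n = 0 \<and> lam4s n = 0 then 1 else lam4 n / lam4s n) < 2"
    by (rule order_tendstoD(2)[OF lim]) simp
  ultimately show ?thesis using ge1
  proof eventually_elim
    case (elim n)
    then show ?case using pos[of n] by (auto simp: pos_divide_less_eq pos_less_divide_eq split: if_splits)
  qed
qed

lemma lam1_lam2: "\<exists>c\<ge>1. \<forall>\<^sub>F n in sequentially. lam1 n \<le> c * lam2 n \<and> lam2 n \<le> c * lam1 n"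
proof -
  obtain c1 c2 where c: "0 < c1" "c1 \<le> c2"
    "\<forall>\<^sub>F n in sequentially. c1 * lam2 n \<le> lam1 n \<and> lam1 n \<le> c2 * lam2 n"
    using c5(7) by (auto simp: prop_to_def)
  let ?c = "max 1 (max c2 (1 / c1))"
  have "\<forall>\<^sub>F n in sequentially. lam1 n \<le> ?c * lam2 n \<and> lam2 n \<le> ?c * lam1 n"
    using c(3) ge1
  proof eventually_elim
    case (elim n)
    have "c2 * lam2 n \<le> ?c * lam2 n" using pos[of n] elim by (intro mult_right_mono) auto
    moreover have "lam2 n \<le> 1 / c1 * lam1 n" using elim c(1) by (simp add: field_simps)
    moreover have "1 / c1 * lam1 n \<le> ?c * lam1 n" using pos[of n] elim by (intro mult_right_mono) auto
    ultimately show ?case using elim by linarith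
  qed
  then show ?thesis by (intro exI[of _ ?c]) auto
qed

lemma bias_rate: "\<exists>c>0. \<forall>\<^sub>F n in sequentially. real (s2 n) * (h n)\<^sup>2 \<le> c / sqrt (real n * h n)"
proof -
  obtain c1 c2 where c: "0 < c1" "c1 \<le> c2"
    "\<forall>\<^sub>F n in sequentially. c1 * (real n * h n) powr (- (1 / 2)) \<le> real (s2 n) * (h n)\<^sup>2 \<and>
       real (s2 n) * (h n)\<^sup>2 \<le> c2 * (real n * h n) powr (- (1 / 2))"
    using c6a(1) by (auto simp: prop_to_def)
  have "\<forall>\<^sub>F n in sequentially. real (s2 n) * (h n)\<^sup>2 \<le> c2 / sqrt (real n * h n)"
    using c(3) ge1
  proof eventually_elim
    case (elim n)
    have "(real n * h n) powr (- (1 / 2)) = 1 / sqrt (real n * h n)"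
      using pos[of n] elim(2) by (simp add: powr_minus powr_half_sqrt inverse_eq_divide)
    then show ?case using elim by simp
  qed
  then show ?thesis using c by (intro exI[of _ c2]) auto
qed

text \<open>The five conjuncts are the hypotheses \<open>N1\<close> to \<open>N5\<close> of
  \<open>oracle_max\<close>, with \<open>A * r n\<close> in place of \<open>Cs\<close>,
  \<open>C9 * s2 n / h n\<close> in place of \<open>Csq\<close>, and \<open>c2\<close>,
  \<open>c3\<close> in place of the Hessian and cubic moment bounds. All of these have constants
  free of \<open>n\<close>.\<close>

lemma deterministic_rates:
  fixes Ca \<kappa> c2 c3 A \<rho> bd Crow C9 \<delta> :: real
  defines "b \<equiv> \<lambda>n. max (lam1 n / lam2 n) (lam2 n / lam1 n) + \<delta>"
  defines "ep \<equiv> \<lambda>n. real (s2 n) * Ca * \<kappa>\<^sup>2 * (h n)\<^sup>2"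
  defines "R \<equiv> \<lambda>n. 8 * max (lam1 n) (lam2 n) * (2 * (1 + b n) + 1) * sqrt (2 * s2 n) / \<rho>"
  defines "dv \<equiv> \<lambda>n. ep n + 2 * (1 + b n) * sqrt (2 * s2 n) * R n"
  defines "Err \<equiv> \<lambda>n. c2 * ep n + 3 * c3 * (dv n)\<^sup>2"
  defines "VV \<equiv> \<lambda>n. (4 / \<rho>\<^sup>2) * (2 * (C9 * real (s2 n) / h n) + 4 * real n * real (s2 n) * (Err n)\<^sup>2)"
  assumes Ca: "0 \<le> Ca" and c2: "0 \<le> c2" and c3: "0 \<le> c3" and A: "0 \<le> A" and \<rho>: "0 < \<rho>" and bd: "0 < bd"
    and Crow: "0 \<le> Crow" and C9: "0 \<le> C9" and \<delta>: "0 < \<delta>"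
  shows "\<forall>\<^sub>F n in sequentially. A * r n + c2 * ep n + 3 * c3 * (ep n)\<^sup>2 \<le> min (lam1 n) (lam2 n) / 4
      \<and> c3 * dv n * ((2 * (1 + b n))\<^sup>2 * (2 * real (s2 n))) \<le> \<rho> / 2
      \<and> sqrt n * (A * r n + Err n) + (Crow + c3 * dv n * sqrt (2 * s2 n)) * sqrt (VV n) < min (lam4 n) (lam4s n)
      \<and> 3.7 * max (lam4 n) (lam4s n) + sqrt n * R n \<le> bd * sqrt n
      \<and> sqrt n * R n \<le> min (lam4 n) (lam4s n)" (is ?main)
    and "\<exists>CV. \<forall>\<^sub>F n in sequentially. VV n \<le> CV * (real (s2 n) / h n)" (is ?VV)
proof -
  obtain cl where cl: "1 \<le> cl" "\<forall>\<^sub>F n in sequentially. lam1 n \<le> cl * lam2 n \<and> lam2 n \<le> cl * lam1 n"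
    using lam1_lam2 by blast
  obtain cb where cb: "0 < cb" "\<forall>\<^sub>F n in sequentially. real (s2 n) * (h n)\<^sup>2 \<le> cb / sqrt (real n * h n)"
    using bias_rate by blast
  \<comment> \<open>\<open>CR\<close>, \<open>CD\<close>, \<open>CE\<close>, \<open>CV\<close> are
    the constants for which \<open>R\<close>, \<open>dv\<close>, \<open>Err\<close>,
    \<open>VV\<close> are bounded by multiples of \<open>lam1 * sqrt s2\<close>,
    \<open>s2 * lam1\<close>, \<open>1 / sqrt (n * h)\<close> and \<open>s2 / h\<close>.
    \<open>K1\<close>, \<open>K2\<close>, \<open>K3\<close> collect the constants of the first three
    inequalities.\<close>
  define B where "B = cl + \<delta>"
  define ca where "ca = Ca * \<kappa>\<^sup>2"
  define CR where "CR = 8 * cl * (2 * (1 + B) + 1) * sqrt 2 / \<rho>"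
  define CD where "CD = ca + 2 * (1 + B) * sqrt 2 * CR"
  define CE where "CE = (c2 * ca + 3 * c3 * CD\<^sup>2) * cb"
  define CV where "CV = (4 / \<rho>\<^sup>2) * (2 * C9 + 4 * CE\<^sup>2)"
  define K1 where "K1 = A + c2 * ca + 3 * c3 * ca\<^sup>2"
  define K2 where "K2 = c3 * CD * ((2 * (1 + B))\<^sup>2 * 2)"
  define K3 where "K3 = A + CE + (Crow + c3 * CD * sqrt 2) * sqrt CV"
  have B: "1 \<le> B" using cl \<delta> by (simp add: B_def)
  have ca: "0 \<le> ca" using Ca by (simp add: ca_def)
  have CR: "0 \<le> CR" using cl B \<rho> by (simp add: CR_def)
  have CD: "0 \<le> CD" using ca CR B by (simp add: CD_def)
  have CE: "0 \<le> CE" using c2 c3 ca cb by (simp add: CE_def)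
  have CV: "0 \<le> CV" using C9 by (simp add: CV_def)
  have K: "0 \<le> K1" "0 \<le> K2" "0 \<le> K3"
    using A c2 c3 ca CD B CE Crow CV by (auto simp: K1_def K2_def K3_def)
  have basic: "\<forall>\<^sub>F n in sequentially. b n \<le> B \<and> 0 \<le> b n \<and> ep n \<le> ca * (real (s2 n) * (h n)\<^sup>2) \<and> 0 \<le> ep n
      \<and> real (s2 n) * (h n)\<^sup>2 \<le> 1 \<and> R n \<le> CR * (lam1 n * sqrt (s2 n)) \<and> 0 \<le> R n
      \<and> dv n \<le> CD * (real (s2 n) * lam1 n) \<and> 0 \<le> dv n \<and> 0 \<le> Err n \<and> Err n \<le> CE / sqrt (real n * h n)
      \<and> VV n \<le> CV * (real (s2 n) / h n) \<and> 0 \<le> VV n"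
    using cl(2) cb(2) ge1 r_lam1[OF zero_less_one] s2_lam1[OF zero_less_one] L_large[of 1]
  proof eventually_elim
    case (elim n)
    define s where "s = real (s2 n)"
    have s: "1 \<le> s" using sizes[OF elim(3)] by (simp add: s_def)
    have p: "0 < h n" "0 < lam1 n" "0 < lam2 n" using pos[OF elim(3)] by auto
    have n: "0 < real n" using elim(3) by simp
    have r0: "0 \<le> r n" using elim(6) p by (simp add: r_def)
    have "lam1 n / lam2 n \<le> cl" "lam2 n / lam1 n \<le> cl" using elim(1) p by (auto simp: pos_divide_le_eq)
    then have b: "b n \<le> B" "0 \<le> b n" using p \<delta> by (auto simp: b_def B_def max_def)
    have ep: "ep n \<le> ca * (s * (h n)\<^sup>2)" "0 \<le> ep n"
      using Ca by (auto simp: ep_def ca_def s_def mult_ac)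
    have sh: "s * (h n)\<^sup>2 \<le> lam1 n" using elim(4) r0 by (simp add: s_def)
    have nn: "0 \<le> s\<^sup>2 * lam1 n" "0 \<le> s * (lam1 n)\<^sup>2 / (h n)\<^sup>2" using p s by auto
    have slam: "s\<^sup>2 * lam1 n \<le> 1" "s * (lam1 n)\<^sup>2 / (h n)\<^sup>2 \<le> 1"
      using elim(5)[folded s_def] nn by linarith+
    have "1 * lam1 n \<le> s\<^sup>2 * lam1 n" using s p by (intro mult_right_mono) auto
    then have lam: "lam1 n \<le> 1" using slam by simp
    have R: "R n \<le> CR * (lam1 n * sqrt s)" "0 \<le> R n"
    proof -
      have "max (lam1 n) (lam2 n) \<le> cl * lam1 n"
        using elim(1) mult_right_mono[OF cl(1), of "lam1 n"] p by simp
      then have "8 * max (lam1 n) (lam2 n) * (2 * (1 + b n) + 1) * sqrt (2 * s)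
          \<le> 8 * (cl * lam1 n) * (2 * (1 + B) + 1) * sqrt (2 * s)"
        using b p cl s by (intro mult_mono mult_nonneg_nonneg) auto
      then have "R n \<le> 8 * (cl * lam1 n) * (2 * (1 + B) + 1) * sqrt (2 * s) / \<rho>"
        unfolding R_def using \<rho> by (intro divide_right_mono) (auto simp: s_def)
      also have "\<dots> = CR * (lam1 n * sqrt s)" by (simp add: CR_def real_sqrt_mult)
      finally show "R n \<le> CR * (lam1 n * sqrt s)" .
      show "0 \<le> R n" using p b \<rho> by (auto simp: R_def)
    qed
    have dv: "dv n \<le> CD * (s * lam1 n)" "0 \<le> dv n"
    proof -
      have "2 * (1 + b n) * sqrt (2 * s) * R n \<le> 2 * (1 + B) * sqrt (2 * s) * (CR * (lam1 n * sqrt s))"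
        using b R B s by (intro mult_mono mult_nonneg_nonneg) auto
      also have "\<dots> = 2 * (1 + B) * sqrt 2 * CR * ((sqrt s * sqrt s) * lam1 n)"
        by (simp only: real_sqrt_mult mult_ac)
      also have "sqrt s * sqrt s = s" using s by simp
      finally have 1: "2 * (1 + b n) * sqrt (2 * s) * R n \<le> 2 * (1 + B) * sqrt 2 * CR * (s * lam1 n)" .
      have "ep n \<le> ca * (s * lam1 n)"
      proof -
        have "1 * lam1 n \<le> s * lam1 n" using s p by (intro mult_right_mono) auto
        then have "s * (h n)\<^sup>2 \<le> s * lam1 n" using sh by simp
        then show ?thesis using ep(1) mult_left_mono[OF _ ca] order_trans by blast
      qed
      with 1 show "dv n \<le> CD * (s * lam1 n)" by (simp add: dv_def CD_def s_def distrib_right)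
      show "0 \<le> dv n" using ep R b by (simp add: dv_def)
    qed
    have Err: "0 \<le> Err n" "Err n \<le> CE / sqrt (real n * h n)"
    proof -
      show "0 \<le> Err n" using c2 c3 ep by (simp add: Err_def)
      have "(dv n)\<^sup>2 \<le> (CD * (s * lam1 n))\<^sup>2" using dv by (intro power_mono) auto
      \<comment> \<open>The factorisation that brings the squared l1 error down to the bias rate:
        the first factor is bounded because \<open>s2 * lam1^2 / h^2\<close> tends to zero.\<close>
      also have "\<dots> = CD\<^sup>2 * ((s * (lam1 n)\<^sup>2 / (h n)\<^sup>2) * (s * (h n)\<^sup>2))"
        using p by (simp add: power_mult_distrib power2_eq_square)
      also have "\<dots> \<le> CD\<^sup>2 * (1 * (s * (h n)\<^sup>2))"
        using slam s by (intro mult_left_mono mult_right_mono) auto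
      finally have "Err n \<le> c2 * (ca * (s * (h n)\<^sup>2)) + 3 * c3 * (CD\<^sup>2 * (s * (h n)\<^sup>2))"
        unfolding Err_def using c2 c3 ep by (intro add_mono mult_left_mono) auto
      also have "\<dots> = (c2 * ca + 3 * c3 * CD\<^sup>2) * (s * (h n)\<^sup>2)" by (simp add: algebra_simps)
      also have "\<dots> \<le> (c2 * ca + 3 * c3 * CD\<^sup>2) * (cb / sqrt (real n * h n))"
        using elim(2) c2 c3 ca by (intro mult_left_mono) (auto simp: s_def)
      finally show "Err n \<le> CE / sqrt (real n * h n)" by (simp add: CE_def)
    qed
    have "VV n \<le> CV * (s / h n)"
    proof -
      have "(Err n)\<^sup>2 \<le> (CE / sqrt (real n * h n))\<^sup>2" using Err by (intro power_mono) auto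
      also have "\<dots> = CE\<^sup>2 / (real n * h n)" using p n by (simp add: power_divide)
      finally have "4 * real n * s * (Err n)\<^sup>2 \<le> 4 * real n * s * (CE\<^sup>2 / (real n * h n))"
        using s n by (intro mult_left_mono) auto
      also have "\<dots> = 4 * CE\<^sup>2 * (s / h n)" using n by simp
      finally have "4 * real n * s * (Err n)\<^sup>2 \<le> 4 * CE\<^sup>2 * (s / h n)" .
      moreover have "(2 * C9 + 4 * CE\<^sup>2) * (s / h n) = 2 * (C9 * s / h n) + 4 * CE\<^sup>2 * (s / h n)"
        by (simp add: distrib_right add_divide_distrib)
      ultimately have "2 * (C9 * s / h n) + 4 * real n * s * (Err n)\<^sup>2 \<le> (2 * C9 + 4 * CE\<^sup>2) * (s / h n)"
        by linarith
      from mult_left_mono[OF this, of "4 / \<rho>\<^sup>2"] show ?thesis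
        by (simp only: VV_def CV_def s_def mult.assoc) simp
    qed
    moreover have "0 \<le> VV n" using C9 p by (simp add: VV_def)
    ultimately show ?case using b ep R dv Err sh lam by (simp add: s_def)
  qed
  then show ?VV by (intro exI[of _ CV]) (auto elim: eventually_mono)
  \<comment> \<open>Thresholds read off backwards: \<open>?e1\<close> from the first inequality,
    \<open>?e2\<close> from the second and half of the fourth, \<open>?e3\<close> from the third and
    the fifth, \<open>?e4\<close> from the other half of the fourth.\<close>
  let ?e1 = "1 / (4 * (K1 + 1) * cl)"
  let ?e2 = "min (\<rho> / (2 * (K2 + 1))) (bd / (2 * (CR + 1)))"
  let ?e3 = "1 / (4 * (K3 + 1) + 4 * (CR + 1))"
  let ?e4 = "bd / 16"
  have e: "0 < ?e1" "0 < ?e2" "0 < ?e3" "0 < ?e4" using K cl CR \<rho> bd by auto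
  show ?main
    using basic cl(2) ge1 r_lam1[OF e(1)] s2_lam1[OF e(2)] s2_lam1[OF zero_less_one] lam4_lower[OF e(3)]
      lam4_upper[OF e(4)] lam4_lam4s L_large[of 1]
  proof eventually_elim
    case (elim n)
    define s where "s = real (s2 n)"
    note bs = elim(1)[folded s_def]
    have s: "1 \<le> s" using sizes[OF elim(3)] by (simp add: s_def)
    have p: "0 < h n" "0 < lam1 n" "0 < lam2 n" "0 < lam4 n" "0 < lam4s n" using pos[OF elim(3)] by auto
    have n: "0 < real n" using elim(3) by simp
    have r0: "0 \<le> r n" using elim(10) p by (simp add: r_def)
    have sh0: "0 \<le> s * (h n)\<^sup>2" using s by simp
    have nn: "0 \<le> s * (lam1 n)\<^sup>2 / (h n)\<^sup>2" using p s by auto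
    have slam: "s\<^sup>2 * lam1 n \<le> ?e2" "s\<^sup>2 * lam1 n \<le> 1"
      using elim(5,6)[folded s_def] nn by linarith+
    define hh where "hh = (h n) powr (- (1 / 2))"
    have hh: "hh = 1 / sqrt (h n)" using p by (simp add: hh_def powr_minus powr_half_sqrt inverse_eq_divide)
    have hh0: "0 < hh" using p by (simp add: hh)
    have low: "hh * (sqrt (L n) + sqrt s * (1 + lam1 n * sqrt (real n * h n))) \<le> ?e3 * lam4 n"
      using elim(7) by (simp add: hh_def s_def)
    have min4: "lam4 n / 2 \<le> min (lam4 n) (lam4s n)" using elim(9) p by auto
    have N1: "A * r n + c2 * ep n + 3 * c3 * (ep n)\<^sup>2 \<le> min (lam1 n) (lam2 n) / 4"
    proof -
      have "(ep n)\<^sup>2 \<le> (ca * (s * (h n)\<^sup>2))\<^sup>2" using bs by (intro power_mono) auto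
      also have "\<dots> = ca\<^sup>2 * ((s * (h n)\<^sup>2) * (s * (h n)\<^sup>2))" by (simp add: power2_eq_square mult_ac)
      also have "\<dots> \<le> ca\<^sup>2 * (1 * (s * (h n)\<^sup>2))" using bs sh0 by (intro mult_left_mono mult_right_mono) auto
      finally have "A * r n + c2 * ep n + 3 * c3 * (ep n)\<^sup>2
          \<le> A * r n + c2 * (ca * (s * (h n)\<^sup>2)) + 3 * c3 * (ca\<^sup>2 * (s * (h n)\<^sup>2))"
        using bs c2 c3 A by (intro add_mono mult_left_mono order_refl) auto
      also have "\<dots> \<le> K1 * (s * (h n)\<^sup>2 + r n)"
        using A c2 c3 ca r0 sh0 by (simp add: K1_def distrib_left distrib_right mult.assoc)
      also have "\<dots> \<le> K1 * (?e1 * lam1 n)" using elim(4) K by (intro mult_left_mono) (auto simp: s_def)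
      also have "\<dots> = K1 / (K1 + 1) * (lam1 n / cl / 4)" by simp
      also have "\<dots> \<le> 1 * (lam1 n / cl / 4)" using K p cl by (intro mult_right_mono) auto
      also have "\<dots> \<le> min (lam1 n) (lam2 n) / 4"
      proof -
        have "lam1 n / cl \<le> lam2 n" using elim(2) cl by (simp add: pos_divide_le_eq mult.commute)
        moreover have "lam1 n / cl \<le> lam1 n / 1" using cl p by (intro divide_left_mono) auto
        ultimately show ?thesis by simp
      qed
      finally show ?thesis .
    qed
    have N2: "c3 * dv n * ((2 * (1 + b n))\<^sup>2 * (2 * s)) \<le> \<rho> / 2"
    proof -
      have "(2 * (1 + b n))\<^sup>2 \<le> (2 * (1 + B))\<^sup>2" using bs by (intro power_mono) auto
      then have "c3 * dv n * ((2 * (1 + b n))\<^sup>2 * (2 * s)) \<le> c3 * (CD * (s * lam1 n)) * ((2 * (1 + B))\<^sup>2 * (2 * s))"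
        using bs c3 s p CD by (intro mult_mono mult_nonneg_nonneg) auto
      also have "\<dots> = K2 * (s\<^sup>2 * lam1 n)" by (simp add: K2_def power2_eq_square)
      also have "\<dots> \<le> K2 * (\<rho> / (2 * (K2 + 1)))" using K slam by (intro mult_left_mono) auto
      also have "\<dots> = K2 / (K2 + 1) * (\<rho> / 2)" by simp
      also have "\<dots> \<le> 1 * (\<rho> / 2)" using K \<rho> by (intro mult_right_mono) auto
      finally show ?thesis by simp
    qed
    have Rs: "R n \<le> CR * (bd / (2 * (CR + 1)))"
    proof -
      have "sqrt s \<le> s\<^sup>2"
      proof -
        have "sqrt s \<le> sqrt (s\<^sup>2)" using s by (intro real_sqrt_le_mono) (simp add: power2_eq_square)
        then show ?thesis using s by (simp add: power2_eq_square order_trans[of _ s])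
      qed
      then have "lam1 n * sqrt s \<le> s\<^sup>2 * lam1 n" using p by (simp add: mult.commute)
      also have "\<dots> \<le> bd / (2 * (CR + 1))" using slam by simp
      finally show ?thesis using bs mult_left_mono[OF _ CR] order_trans by blast
    qed
    have N4: "3.7 * max (lam4 n) (lam4s n) + sqrt n * R n \<le> bd * sqrt n"
    proof -
      \<comment> \<open>The bound is \<open>bd * sqrt n / 8\<close>, and 3.7/8 is below 1/2; the
        other half of \<open>bd * sqrt n\<close> absorbs the preliminary error.\<close>
      have "max (lam4 n) (lam4s n) \<le> 2 * (bd / 16 * sqrt n)" using elim(8,9) p by auto
      moreover have "sqrt n * R n \<le> bd / 2 * sqrt n"
      proof -
        have "CR * (bd / (2 * (CR + 1))) = CR / (CR + 1) * (bd / 2)" by simp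
        also have "\<dots> \<le> 1 * (bd / 2)" using CR bd by (intro mult_right_mono) auto
        finally have "R n \<le> bd / 2" using Rs by linarith
        then have "sqrt n * R n \<le> sqrt n * (bd / 2)" by (intro mult_left_mono) auto
        then show ?thesis by (simp add: mult.commute)
      qed
      moreover have "0 \<le> bd * sqrt n" using bd by simp
      ultimately show ?thesis by simp
    qed
    have e3: "c * ?e3 \<le> 1 / 4" if "c \<le> K3 + CR" "0 \<le> c" for c
    proof -
      have "0 < 4 * (K3 + 1) + 4 * (CR + 1)" using K CR by simp
      then show ?thesis using that by (simp add: pos_divide_le_eq)
    qed
    have N5: "sqrt n * R n \<le> min (lam4 n) (lam4s n)"
    proof -
      have "sqrt n * R n \<le> sqrt n * (CR * (lam1 n * sqrt s))" using bs by (intro mult_left_mono) auto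
      also have "\<dots> = CR * (hh * (sqrt s * (lam1 n * sqrt (real n * h n))))"
        using p by (simp add: hh real_sqrt_mult)
      also have "\<dots> \<le> CR * (hh * (sqrt (L n) + sqrt s * (1 + lam1 n * sqrt (real n * h n))))"
        using CR hh0 elim(10) s by (intro mult_left_mono) (auto simp: distrib_left)
      also have "\<dots> \<le> CR * (?e3 * lam4 n)" by (intro mult_left_mono low CR)
      also have "\<dots> = (CR * ?e3) * lam4 n" by simp
      also have "\<dots> \<le> 1 / 4 * lam4 n" using e3[of CR] K CR p by (intro mult_right_mono) auto
      finally show ?thesis using min4 p by simp
    qed
    have N3: "sqrt n * (A * r n + Err n) + (Crow + c3 * dv n * sqrt (2 * s)) * sqrt (VV n) < min (lam4 n) (lam4s n)"
    proof -
      \<comment> \<open>Common scale of the three contributions: multiplied by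
        \<open>sqrt n\<close>, the score is of order \<open>sqrt L / sqrt h\<close> and the Newton
        error of order \<open>1 / sqrt h\<close>, while \<open>sqrt VV\<close> is of order
        \<open>sqrt (s2 / h)\<close>. It is the lower bound imposed on \<open>lam4\<close>.\<close>
      let ?x = "hh * (sqrt (L n) + sqrt s)"
      have 1: "sqrt n * (A * r n) \<le> A * ?x"
      proof -
        have "sqrt n * r n = hh * sqrt (L n)"
          using n p by (simp add: r_def hh real_sqrt_divide real_sqrt_mult)
        then have "sqrt n * (A * r n) = A * (hh * sqrt (L n))" by simp
        also have "\<dots> \<le> A * ?x" using A hh0 s by (intro mult_left_mono) auto
        finally show ?thesis .
      qed
      have 2: "sqrt n * Err n \<le> CE * ?x"
      proof -
        have "sqrt n * Err n \<le> sqrt n * (CE / sqrt (real n * h n))" using bs by (intro mult_left_mono) auto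
        also have "\<dots> = CE * (hh * 1)" using n p by (simp add: hh real_sqrt_mult)
        also have "\<dots> \<le> CE * ?x" using CE hh0 s elim(10) by (intro mult_left_mono) (auto simp: add_increasing)
        finally show ?thesis .
      qed
      have 3: "(Crow + c3 * dv n * sqrt (2 * s)) * sqrt (VV n) \<le> (Crow + c3 * CD * sqrt 2) * sqrt CV * ?x"
      proof -
        \<comment> \<open>The Lipschitz correction of a Hessian row stays bounded because
          \<open>s2^2 * lam1\<close> does; thus it does not spoil the order of
          \<open>Crow\<close>.\<close>
        have e1: "c3 * dv n * sqrt (2 * s) \<le> c3 * CD * sqrt 2"
        proof -
          have "c3 * dv n * sqrt (2 * s) \<le> c3 * (CD * (s * lam1 n)) * (sqrt 2 * s)"
          proof -
            have "sqrt s \<le> s" using s by (intro real_le_lsqrt) (auto simp: power2_eq_square)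
            then show ?thesis
              using bs c3 s p CD by (intro mult_mono mult_nonneg_nonneg) (auto simp: real_sqrt_mult)
          qed
          also have "\<dots> = c3 * CD * sqrt 2 * (s\<^sup>2 * lam1 n)" by (simp add: power2_eq_square)
          also have "\<dots> \<le> c3 * CD * sqrt 2 * 1" using c3 CD slam by (intro mult_left_mono) auto
          finally show ?thesis by simp
        qed
        have e2: "sqrt (VV n) \<le> sqrt CV * ?x"
        proof -
          have "sqrt (VV n) \<le> sqrt (CV * (s / h n))" using bs by (intro real_sqrt_le_mono) auto
          also have "\<dots> = sqrt CV * (hh * sqrt s)" by (simp add: hh real_sqrt_mult real_sqrt_divide)
          also have "\<dots> \<le> sqrt CV * ?x" using CV hh0 elim(10) by (intro mult_left_mono) auto
          finally show ?thesis .
        qed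
        have "(Crow + c3 * dv n * sqrt (2 * s)) * sqrt (VV n) \<le> (Crow + c3 * CD * sqrt 2) * (sqrt CV * ?x)"
          using Crow c3 CD CV bs hh0 elim(10) s by (intro mult_mono[OF add_left_mono[OF e1] e2]) auto
        then show ?thesis by (simp only: mult.assoc)
      qed
      have "sqrt n * (A * r n + Err n) + (Crow + c3 * dv n * sqrt (2 * s)) * sqrt (VV n) \<le> K3 * ?x"
        using 1 2 3 by (simp add: K3_def distrib_left distrib_right)
      also have "\<dots> \<le> K3 * (hh * (sqrt (L n) + sqrt s * (1 + lam1 n * sqrt (real n * h n))))"
        using K hh0 s p by (intro mult_left_mono) (auto simp: distrib_left)
      also have "\<dots> \<le> K3 * (?e3 * lam4 n)" by (intro mult_left_mono low K)
      also have "\<dots> = (K3 * ?e3) * lam4 n" by simp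
      also have "\<dots> \<le> 1 / 4 * lam4 n" using e3[of K3] K CR p by (intro mult_right_mono) auto
      finally show ?thesis using min4 p by linarith
    qed
    show ?case using N1 N2 N3 N4 N5 by (simp add: s_def)
  qed
qed

text \<open>Truncation level. Let \<open>q = n * d^3\<close>, and let \<open>Q\<close> be the ratio
  that \<open>c5\<close> sends to infinity, so \<open>T = q powr (1/m0) * Q powr (1/4)\<close>. The
  union bound over truncations needs \<open>q / T powr m0\<close>, which is
  \<open>Q powr (-m0/4)\<close>, to vanish; the exponential tails need \<open>T * r\<close>, which
  is \<open>Q powr (-1/4)\<close>, to vanish. The exponent 1/4 shares the slack between the
  two.\<close>

definition T :: "nat \<Rightarrow> real" where
  "T n = (real n * real (d n) ^ 3) powr (1 / m0) *
     (real n * h n / ((real n * real (d n) ^ 3) powr (2 / m0) * L n)) powr (1 / 4)"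

lemma T_facts:
  assumes e: "0 < e"
  shows "\<forall>\<^sub>F n in sequentially. 0 < T n \<and> T n * r n \<le> e \<and> real n * real (d n) ^ 3 / T n powr m0 \<le> e
     \<and> T n powr (1 - m0) \<le> 1 / sqrt (real n)"
proof -
  define e' where "e' = min e 1"
  have e': "0 < e'" "e' \<le> e" "e' \<le> 1" using e by (auto simp: e'_def)
  \<comment> \<open>The fourth power undoes the exponent -1/4 of \<open>Q\<close>.\<close>
  define c where "c = (1 / e') powr 4"
  have c: "1 \<le> c" using e' by (simp add: c_def ge_one_powr_ge_zero)
  have "\<forall>\<^sub>F n in sequentially. c \<le> real n * h n / ((real n * real (d n) ^ 3) powr (2 / m0) * ln (1 / h n))"
    using c5(3) by (simp add: filterlim_at_top)
  then show ?thesis using ge1 L_large[of 1]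
  proof eventually_elim
    case (elim n)
    define q where "q = real n * real (d n) ^ 3"
    define Q where "Q = real n * h n / (q powr (2 / m0) * L n)"
    have p: "0 < h n" using pos[OF elim(2)] by simp
    have d: "1 \<le> real (d n)" using sizes[OF elim(2)] by simp
    have n1: "1 \<le> real n" using elim(2) by simp
    have "1 \<le> real (d n) ^ 3" using d by simp
    then have "real n * 1 \<le> q" unfolding q_def using n1 by (intro mult_left_mono) auto
    then have q: "real n \<le> q" "0 < q" using n1 by auto
    have Q: "c \<le> Q" using elim(1) by (simp add: Q_def q_def L_def)
    have Q1: "1 \<le> Q" "0 < Q" using Q c by auto
    have T: "T n = q powr (1 / m0) * Q powr (1 / 4)" by (simp add: T_def Q_def q_def)
    have T0: "0 < T n" unfolding T using q Q1 by simp
    have Q4: "Q powr (- (1 / 4)) \<le> e'"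
    proof -
      have "Q powr (- (1 / 4)) \<le> c powr (- (1 / 4))" using Q c by (intro powr_mono2') auto
      also have "\<dots> = (1 / e') powr (- 1)" unfolding c_def powr_powr by simp
      also have "\<dots> = e'" using e' by (simp add: powr_minus)
      finally show ?thesis .
    qed
    have Tr: "T n * r n = Q powr (- (1 / 4))"
    proof -
      have "r n = sqrt (1 / (q powr (2 / m0) * Q))"
        using p n1 q elim(3) by (simp add: r_def Q_def field_simps)
      also have "\<dots> = (q powr (2 / m0) * Q) powr (- (1 / 2))"
        using q Q1 by (simp add: powr_minus powr_half_sqrt real_sqrt_divide inverse_eq_divide)
      also have "\<dots> = q powr (- (1 / m0)) * Q powr (- (1 / 2))"
        using q Q1 by (simp add: powr_mult powr_powr)
      finally have "T n * r n = (q powr (1 / m0) * q powr (- (1 / m0))) * (Q powr (1 / 4) * Q powr (- (1 / 2)))"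
        by (simp add: T mult_ac)
      also have "\<dots> = Q powr (- (1 / 4))" using q Q1 by (simp flip: powr_add)
      finally show ?thesis .
    qed
    have "q / T n powr m0 \<le> e'"
    proof -
      have "T n powr m0 = q * Q powr (m0 / 4)"
        using q Q1 m0 by (simp add: T powr_mult powr_powr)
      then have "q / T n powr m0 = Q powr (- (m0 / 4))" using q by (simp add: powr_minus inverse_eq_divide)
      also have "\<dots> = (Q powr (- (1 / 4))) powr m0" using Q1 by (simp add: powr_powr)
      also have "\<dots> \<le> e' powr m0" using Q4 m0 by (intro powr_mono2) auto
      also have "\<dots> \<le> e' powr 1" using e' m0 by (intro powr_mono') auto
      finally show ?thesis using e' by simp
    qed
    moreover have "T n powr (1 - m0) \<le> 1 / sqrt (real n)"
    proof -
      have "q powr (1 / m0) * 1 \<le> T n" unfolding T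
        using q Q1 by (intro mult_left_mono ge_one_powr_ge_zero) auto
      then have "T n powr (1 - m0) \<le> (q powr (1 / m0)) powr (1 - m0)"
        using q m0 by (intro powr_mono2') auto
      also have "\<dots> = q powr (1 / m0 - 1)" using m0 by (simp add: powr_powr diff_divide_distrib right_diff_distrib)
      \<comment> \<open>Here \<open>m0 > 2\<close> is used: it gives
        \<open>1/m0 - 1 \<le> -1/2\<close>. This makes the mean removed by truncation small enough
        for the tail bound.\<close>
      also have "\<dots> \<le> q powr (- (1 / 2))" using q n1 m0 by (intro powr_mono) (auto simp: field_simps)
      also have "\<dots> \<le> real n powr (- (1 / 2))" using q n1 by (intro powr_mono2') auto
      also have "\<dots> = 1 / sqrt (real n)" using n1 by (simp add: powr_minus powr_half_sqrt inverse_eq_divide)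
      finally show ?thesis .
    qed
    ultimately show ?case using T0 Tr Q4 e' by (simp add: q_def)
  qed
qed

text \<open>The exponent \<open>A0\<close> makes \<open>exp (- A0 * L n)\<close>, a power of the bandwidth, beat the union bound.\<close>

definition A0 :: real where "A0 = (2 + 3 * \<tau>1) / \<delta>1"

lemma A0_pos: "0 < A0" using c5 by (simp add: A0_def)

text \<open>The exponential is \<open>h powr A0\<close>, of order
  \<open>n powr (-(2 + 3 * \<tau>1))\<close>, while \<open>n * d^3\<close> is of order
  \<open>n powr (1 + 3 * \<tau>1)\<close>; a factor \<open>1/n\<close> remains.\<close>

lemma union_rate:
  assumes e: "0 < e"
  shows "\<forall>\<^sub>F n in sequentially. real n * real (d n) ^ 3 * exp (- (A0 * L n)) \<le> e"
proof -
  obtain c1 c2 where c: "0 < c1" "c1 \<le> c2"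
    "\<forall>\<^sub>F n in sequentially. c1 * real n powr (- \<delta>1) \<le> h n \<and> h n \<le> c2 * real n powr (- \<delta>1)"
    using c5(5) by (auto simp: prop_to_def)
  obtain c3 c4 where c': "0 < c3" "c3 \<le> c4"
    "\<forall>\<^sub>F n in sequentially. c3 * real n powr \<tau>1 \<le> real (d n) \<and> real (d n) \<le> c4 * real n powr \<tau>1"
    using c5(2) by (auto simp: prop_to_def)
  have c2: "0 < c2" "0 < c4" using c c' by auto
  let ?C = "c4 ^ 3 * c2 powr A0"
  have "(\<lambda>n. ?C * inverse (real n)) \<longlonglongrightarrow> ?C * 0"
    by (intro tendsto_mult tendsto_const lim_inverse_n)
  then have "\<forall>\<^sub>F n in sequentially. ?C * inverse (real n) < e"
    using e by (intro order_tendstoD(2)[of _ "?C * 0"]) auto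
  with c(3) c'(3) ge1 show ?thesis
  proof eventually_elim
    case (elim n)
    have n: "0 < real n" using elim(3) by simp
    have p: "0 < h n" using pos[OF elim(3)] by simp
    have "exp (- (A0 * L n)) = h n powr A0" using p by (simp add: L_def powr_def ln_div)
    also have "\<dots> \<le> (c2 * real n powr (- \<delta>1)) powr A0"
      using elim p A0_pos by (intro powr_mono2) auto
    also have "\<dots> = c2 powr A0 * real n powr (- (2 + 3 * \<tau>1))"
      using c2 c5(4) by (simp add: powr_mult powr_powr A0_def)
    finally have 1: "exp (- (A0 * L n)) \<le> c2 powr A0 * real n powr (- (2 + 3 * \<tau>1))" .
    have "real (d n) ^ 3 \<le> (c4 * real n powr \<tau>1) ^ 3" using elim by (intro power_mono) auto
    also have "\<dots> = c4 ^ 3 * real n powr (3 * \<tau>1)"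
    proof -
      have "(real n powr \<tau>1) ^ 3 = real n powr (3 * \<tau>1)" by (simp add: power3_eq_cube flip: powr_add)
      then show ?thesis by (simp add: power_mult_distrib)
    qed
    finally have "real n * real (d n) ^ 3 * exp (- (A0 * L n))
        \<le> real n * (c4 ^ 3 * real n powr (3 * \<tau>1)) * (c2 powr A0 * real n powr (- (2 + 3 * \<tau>1)))"
      using n c2 1 by (intro mult_mono mult_nonneg_nonneg) auto
    also have "\<dots> = ?C * (real n powr 1 * real n powr (3 * \<tau>1) * real n powr (- (2 + 3 * \<tau>1)))"
      using n by (simp add: mult_ac)
    also have "real n powr 1 * real n powr (3 * \<tau>1) * real n powr (- (2 + 3 * \<tau>1)) = real n powr (- 1)"
      by (simp only: powr_add[symmetric]) (simp add: algebra_simps)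
    also have "\<dots> = inverse (real n)" using n by (simp add: powr_minus)
    finally show ?case using elim(4) by linarith
  qed
qed

lemma r_small:
  assumes "0 < e"
  shows "\<forall>\<^sub>F n in sequentially. r n \<le> e"
  using r_lam1[OF assms] s2_lam1[OF zero_less_one] ge1
proof eventually_elim
  case (elim n)
  have s: "1 \<le> real (s2 n)" using sizes[OF elim(3)] by simp
  have p: "0 < h n" "0 < lam1 n" using pos[OF elim(3)] by auto
  have "0 \<le> real (s2 n) * (lam1 n)\<^sup>2 / (h n)\<^sup>2" using p s by auto
  then have "(real (s2 n))\<^sup>2 * lam1 n \<le> 1" using elim(2) by linarith
  moreover have "1 * lam1 n \<le> (real (s2 n))\<^sup>2 * lam1 n" using s p by (intro mult_right_mono) auto
  ultimately have "lam1 n \<le> 1" by simp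
  then have "e * lam1 n \<le> e" using assms by simp
  moreover have "0 \<le> real (s2 n) * (h n)\<^sup>2" by simp
  ultimately show ?case using elim(1) by linarith
qed

text \<open>The Chernoff parameter equals \<open>h * r\<close> and balances the two effects: the
  variance cost \<open>n * tilt^2 / h\<close> and the gain \<open>n * tilt * r\<close> are both
  equal to \<open>L\<close>.\<close>

definition tilt :: "nat \<Rightarrow> real" where "tilt n = sqrt (h n * L n / real n)"

text \<open>In units of \<open>L\<close>, the generating function costs at most
  \<open>(1 + B0) * (C * Iw)\<close> and the threshold \<open>A * r\<close> gains \<open>A\<close>.
  The definition of \<open>A\<close> leaves the net exponent \<open>- A0 * L\<close>, the one that
  \<open>union_rate\<close> can absorb.\<close>

lemma stochastic_rates:
  assumes e: "0 < e" and C: "0 < C" and I: "0 < Iw" and Bw: "0 < B0"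
  defines "A \<equiv> A0 + (1 + B0) * (C * Iw)"
  shows "\<forall>\<^sub>F n in sequentially. 0 < T n \<and> 0 < tilt n
      \<and> real n * real (d n) ^ 3 * (C / T n powr m0 + exp (- (real n * C * Iw / (T n * (B0 / h n))))) \<le> e
      \<and> T n * (B0 / h n) / real n \<le> 1 \<and> T n * (B0 / h n) / real n \<le> B0 * r n
      \<and> tilt n * (T n * (B0 / h n)) \<le> 1
      \<and> real n * real (d n) ^ 3 * (C / T n powr m0 + 2 * exp (real n * ((tilt n * T n powr (1 - m0)
           + (tilt n)\<^sup>2 * (B0 / h n)) * (C * Iw)) - tilt n * (real n * A * r n))) \<le> e"
proof -
  \<comment> \<open>The entries give, in order, \<open>T * r \<le> 1\<close>, the admissibility of
    the tilt, the truncation probability, and the tail of the nonnegative sums.\<close>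
  let ?e1 = "min 1 (min (1 / B0) (min (e / (2 * C)) (C * Iw / (A0 * B0))))"
  have e1: "0 < ?e1" using e C I Bw A0_pos by auto
  have e4: "0 < e / 4" using e by simp
  show ?thesis
    using T_facts[OF e1] union_rate[OF e4] r_small[OF zero_less_one] ge1 L_large[of 1] h_small[OF zero_less_one]
  proof eventually_elim
    case (elim n)
    have n: "0 < real n" using elim(4) by simp
    have p: "0 < h n" using pos[OF elim(4)] by simp
    note L1 = elim(5)
    have r: "0 < r n" "r n \<le> 1" using n p L1 elim(3) by (auto simp: r_def)
    have r2: "(r n)\<^sup>2 = L n / (real n * h n)" using n p L1 by (simp add: r_def)
    have T: "0 < T n" "T n * r n \<le> ?e1" "real n * real (d n) ^ 3 / T n powr m0 \<le> ?e1"
      "T n powr (1 - m0) \<le> 1 / sqrt (real n)" using elim(1) by auto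
    have Tr: "T n * r n \<le> 1" "T n * r n * B0 \<le> 1" "T n * r n * (A0 * B0) \<le> C * Iw"
      using T(2) Bw A0_pos C I by (auto simp: pos_le_divide_eq)
    have tilt: "0 < tilt n" using n p L1 by (simp add: tilt_def)
    have tilt_r: "tilt n = h n * r n"
    proof -
      have "h n * r n = sqrt ((h n)\<^sup>2 * (L n / (real n * h n)))" using p by (simp only: r_def real_sqrt_mult real_sqrt_abs abs_of_pos)
      also have "(h n)\<^sup>2 * (L n / (real n * h n)) = h n * L n / real n" using p by (simp add: power2_eq_square)
      finally show ?thesis by (simp add: tilt_def)
    qed
    have nh: "1 / (real n * h n) = (r n)\<^sup>2 / L n" using L1 by (simp add: r2)
    have "(r n)\<^sup>2 / L n \<le> (r n)\<^sup>2 / 1" using L1 by (intro divide_left_mono) auto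
    then have nh_r: "1 / (real n * h n) \<le> (r n)\<^sup>2" using nh by simp
    have TB: "T n * (B0 / h n) / real n \<le> B0 * r n"
    proof -
      have "T n * (B0 / h n) / real n = T n * B0 * (1 / (real n * h n))" by simp
      also have "\<dots> \<le> T n * B0 * (r n)\<^sup>2" using T Bw by (intro mult_left_mono nh_r) auto
      also have "\<dots> = (T n * r n) * (B0 * r n)" by (simp add: power2_eq_square)
      also have "\<dots> \<le> 1 * (B0 * r n)" using Tr Bw r by (intro mult_right_mono) auto
      finally show ?thesis by simp
    qed
    have TB1: "T n * (B0 / h n) / real n \<le> 1"
    proof -
      have "T n * (B0 / h n) / real n = T n * B0 * (1 / (real n * h n))" by simp
      also have "\<dots> \<le> T n * B0 * (r n)\<^sup>2" using T Bw by (intro mult_left_mono nh_r) auto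
      also have "\<dots> = (T n * r n * B0) * r n" by (simp add: power2_eq_square)
      also have "\<dots> \<le> 1 * 1" using Tr Bw r T by (intro mult_mono) auto
      finally show ?thesis by simp
    qed
    have tTB: "tilt n * (T n * (B0 / h n)) \<le> 1"
      using Tr(2) p by (simp add: tilt_r mult_ac)
    have CT: "real n * real (d n) ^ 3 * (C / T n powr m0) \<le> e / 2"
    proof -
      have "real n * real (d n) ^ 3 * (C / T n powr m0) = C * (real n * real (d n) ^ 3 / T n powr m0)" by simp
      also have "\<dots> \<le> C * (e / (2 * C))" using T(3) C by (intro mult_left_mono) auto
      finally show ?thesis using C by simp
    qed
    have E1: "exp (- (real n * C * Iw / (T n * (B0 / h n)))) \<le> exp (- (A0 * L n))"
    proof -
      have "A0 * L n * (T n * (B0 / h n)) = real n * (T n * r n * (A0 * B0)) * r n"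
        using n p r2 by (simp add: power2_eq_square field_simps)
      also have "\<dots> = real n * (T n * r n * (A0 * B0) * r n)" by (simp only: mult.assoc)
      also have "\<dots> \<le> real n * (C * Iw * 1)"
      proof (intro mult_left_mono)
        show "T n * r n * (A0 * B0) * r n \<le> C * Iw * 1"
          using C I r by (intro mult_mono[OF Tr(3)]) auto
      qed simp
      finally have "A0 * L n * (T n * (B0 / h n)) \<le> real n * C * Iw" by (simp only: mult.assoc mult_1_right)
      moreover have "0 < T n * (B0 / h n)" using T Bw p by simp
      ultimately have "A0 * L n \<le> real n * C * Iw / (T n * (B0 / h n))" by (simp only: pos_le_divide_eq)
      then show ?thesis by simp
    qed
    have E2: "real n * ((tilt n * T n powr (1 - m0) + (tilt n)\<^sup>2 * (B0 / h n)) * (C * Iw)) - tilt n * (real n * A * r n)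
        \<le> - (A0 * L n)"
    proof -
      have tr: "tilt n * (real n * r n) = L n"
      proof -
        have "tilt n * (real n * r n) = real n * h n * (r n)\<^sup>2" by (simp add: tilt_r power2_eq_square)
        then show ?thesis using n p by (simp add: r2)
      qed
      have t2: "real n * ((tilt n)\<^sup>2 * (B0 / h n)) = B0 * L n"
        using n p L1 by (simp add: tilt_def)
      have t1: "real n * (tilt n * T n powr (1 - m0)) \<le> L n"
      proof -
        have "real n * (tilt n * T n powr (1 - m0)) \<le> real n * (tilt n * (1 / sqrt (real n)))"
          using n tilt T(4) by (intro mult_left_mono) auto
        also have "\<dots> = sqrt (h n * L n)"
          using n by (simp add: tilt_def real_sqrt_divide real_div_sqrt field_simps)
        also have "\<dots> \<le> sqrt (L n * L n)"
          using elim(6) L1 p by (intro real_sqrt_le_mono mult_right_mono) auto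
        finally show ?thesis using L1 by simp
      qed
      have "real n * ((tilt n * T n powr (1 - m0) + (tilt n)\<^sup>2 * (B0 / h n)) * (C * Iw))
          = (real n * (tilt n * T n powr (1 - m0)) + real n * ((tilt n)\<^sup>2 * (B0 / h n))) * (C * Iw)"
        by (simp add: algebra_simps)
      also have "\<dots> \<le> (L n + B0 * L n) * (C * Iw)"
        unfolding t2 using t1 C I by (intro mult_right_mono add_right_mono) auto
      finally have "real n * ((tilt n * T n powr (1 - m0) + (tilt n)\<^sup>2 * (B0 / h n)) * (C * Iw))
          \<le> (1 + B0) * (C * Iw) * L n" by (simp add: algebra_simps)
      moreover have "tilt n * (real n * A * r n) = A * L n" using tr by (metis mult.assoc mult.left_commute)
      ultimately show ?thesis by (simp add: A_def algebra_simps)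
    qed
    let ?nd = "real n * real (d n) ^ 3"
    have nd0: "0 \<le> ?nd" by simp
    have F1: "?nd * (C / T n powr m0 + exp (- (real n * C * Iw / (T n * (B0 / h n))))) \<le> e"
      using CT mult_left_mono[OF E1 nd0] elim(2) e by (simp add: distrib_left)
    have F2: "?nd * (C / T n powr m0 + 2 * exp (real n * ((tilt n * T n powr (1 - m0)
           + (tilt n)\<^sup>2 * (B0 / h n)) * (C * Iw)) - tilt n * (real n * A * r n))) \<le> e"
    proof -
      have "?nd * exp (real n * ((tilt n * T n powr (1 - m0)
           + (tilt n)\<^sup>2 * (B0 / h n)) * (C * Iw)) - tilt n * (real n * A * r n)) \<le> ?nd * exp (- (A0 * L n))"
        using E2 by (intro mult_left_mono nd0) simp
      moreover have "?nd * (x + 2 * y) = ?nd * x + 2 * (?nd * y)" for x y by (simp add: distrib_left)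
      ultimately show ?thesis using CT elim(2) by (simp only:)
    qed
    show ?case using T(1) tilt F1 F2 TB TB1 tTB by blast
  qed
qed

end

section \<open>The sample\<close>

text \<open>The derivative is the limit of jointly measurable difference quotients along
  \<open>1 / Suc i\<close>. Outside \<open>Y\<close> differentiability is not known, so both the
  quotients and the limit are set to zero there.\<close>

lemma borel_measurable_deriv_on:
  fixes L :: "real \<Rightarrow> real \<Rightarrow> real"
  assumes meas: "(\<lambda>(s, t). L s t) \<in> borel_measurable (borel \<Otimes>\<^sub>M borel)" and Y: "Y \<in> sets borel"
    and diff: "\<And>t s. t \<in> Y \<Longrightarrow> (\<lambda>r. L r t) differentiable (at s)"
  shows "(\<lambda>(s, t). if t \<in> Y then deriv (\<lambda>r. L r t) s else 0) \<in> borel_measurable (borel \<Otimes>\<^sub>M borel)"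
proof (rule borel_measurable_LIMSEQ_real)
  let ?f = "\<lambda>i (s, t). if t \<in> Y then (L (s + 1 / real (Suc i)) t - L s t) / (1 / real (Suc i)) else 0"
  have null: "filterlim (\<lambda>i. 1 / real (Suc i)) (at 0) sequentially"
    using LIMSEQ_inverse_real_of_nat by (auto simp: filterlim_at inverse_eq_divide)
  show "(\<lambda>i. ?f i p) \<longlonglongrightarrow> (\<lambda>(s, t). if t \<in> Y then deriv (\<lambda>r. L r t) s else 0) p" for p
  proof (cases p)
    case (Pair s t)
    show ?thesis
    proof (cases "t \<in> Y")
      case True
      have "DERIV (\<lambda>r. L r t) s :> deriv (\<lambda>r. L r t) s"
        using diff[OF True] by (simp add: DERIV_deriv_iff_real_differentiable)
      then have "(\<lambda>e. (L (s + e) t - L s t) / e) \<midarrow>0\<rightarrow> deriv (\<lambda>r. L r t) s" by (simp add: DERIV_def)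
      from filterlim_compose[OF this null] show ?thesis by (simp add: Pair True)
    qed (simp add: Pair)
  qed
  fix i
  have [measurable]: "Y \<in> sets borel" by (rule Y)
  have [measurable]: "(\<lambda>p. L (fst p + 1 / real (Suc i)) (snd p)) \<in> borel_measurable (borel \<Otimes>\<^sub>M borel)"
    "(\<lambda>p. L (fst p) (snd p)) \<in> borel_measurable (borel \<Otimes>\<^sub>M borel)"
    by (rule measurable_case_prod_compose[OF meas]; measurable)+
  show "?f i \<in> borel_measurable (borel \<Otimes>\<^sub>M borel)"
    unfolding split_def by measurable
qed

lemma subalgebra_sigma_of:
  assumes "f \<in> measurable M N"
  shows "subalgebra M (sigma_of M f N)"
  unfolding subalgebra_def sigma_of_def
  using measurable_space[OF assms]
  by (auto simp: sets_vimage_algebra2 intro: measurable_sets[OF assms])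

text \<open>One row of the triangular array with \<open>n\<close> fixed. The later probability
  bounds are explicit in \<open>n\<close>, \<open>d\<close>, \<open>h\<close> and in the constants
  \<open>Cm\<close>, \<open>cU\<close>, \<kappa>, \<open>Kmax\<close>, which the final argument
  chooses once for all rows.\<close>

locale sample = prob_space M for M :: "'w measure" +
  fixes n d s1 s2 :: nat and U :: "nat \<Rightarrow> 'w \<Rightarrow> real" and x :: "nat \<Rightarrow> nat \<Rightarrow> 'w \<Rightarrow> real"
    and y :: "nat \<Rightarrow> 'w \<Rightarrow> real" and Y :: "real set" and L :: "real \<Rightarrow> real \<Rightarrow> real"
    and a :: "nat \<Rightarrow> real \<Rightarrow> real" and K fU :: "real \<Rightarrow> real" and h m0 Cm cU \<kappa> Kmax :: real
    and Mf :: "(real \<times> (nat \<Rightarrow> real)) \<times> real \<Rightarrow> real" and W :: "nat \<Rightarrow> 'w \<Rightarrow> real \<times> (nat \<Rightarrow> real)"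
    and Q1 Q2 :: "nat \<Rightarrow> 'w \<Rightarrow> real" and D :: "'w \<Rightarrow> fitdata"
  assumes W_eq: "W = (\<lambda>i \<omega>. (U i \<omega>, \<lambda>j\<in>{1..d}. x i j \<omega>))"
    and Q1_eq: "Q1 = (\<lambda>i \<omega>. q1 L (\<Sum>j=1..d. a j (U i \<omega>) * x i j \<omega>) (y i \<omega>))"
    and Q2_eq: "Q2 = (\<lambda>i \<omega>. q2 L (\<Sum>j=1..d. a j (U i \<omega>) * x i j \<omega>) (y i \<omega>))"
    and D_eq: "D = (\<lambda>\<omega>. \<lparr>nobs = n, ncov = d, bw = h, kern = K, ll = L,
                 idx = (\<lambda>i. U i \<omega>), cov = (\<lambda>i j. x i j \<omega>), resp = (\<lambda>i. y i \<omega>)\<rparr>)"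
    and n: "1 \<le> n" and s: "1 \<le> s1" "s1 < s2" "s2 < d"
    and indep_obs: "indep_vars (\<lambda>_. obs_space d) (\<lambda>i \<omega>. (W i \<omega>, y i \<omega>)) {1..n}"
    and U_range: "\<And>i \<omega>. i \<in> {1..n} \<Longrightarrow> \<omega> \<in> space M \<Longrightarrow> U i \<omega> \<in> {0..1}"
    and y_range: "\<And>i \<omega>. i \<in> {1..n} \<Longrightarrow> \<omega> \<in> space M \<Longrightarrow> y i \<omega> \<in> Y"
    and Y_meas: "Y \<in> sets borel"
    and L_meas: "(\<lambda>(s, t). L s t) \<in> borel_measurable (borel \<Otimes>\<^sub>M borel)"
    and L_diff: "\<And>t s. t \<in> Y \<Longrightarrow> (\<lambda>r. L r t) differentiable (at s)"
                "\<And>t s. t \<in> Y \<Longrightarrow> (\<lambda>r. q1 L r t) differentiable (at s)"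
    and Q1_mean: "\<And>i. i \<in> {1..n} \<Longrightarrow> integrable M (Q1 i) \<and>
        (AE \<omega> in M. real_cond_exp M (sigma_of M (W i) (covariate_space d)) (Q1 i) \<omega> = 0)"
    and mom1: "\<And>i j. i \<in> {1..n} \<Longrightarrow> j \<in> {1..d} \<Longrightarrow> AE \<omega> in M.
        nn_cond_exp M (sigma_of M (U i) borel) (\<lambda>\<omega>'. ennreal (\<bar>Q1 i \<omega>' * x i j \<omega>'\<bar> powr m0)) \<omega> \<le> ennreal Cm"
    and mom2: "\<And>i j k. i \<in> {1..n} \<Longrightarrow> j \<in> {1..d} \<Longrightarrow> k \<in> {1..d} \<Longrightarrow> AE \<omega> in M.
        nn_cond_exp M (sigma_of M (U i) borel)
          (\<lambda>\<omega>'. ennreal (\<bar>Q2 i \<omega>' * x i j \<omega>' * x i k \<omega>'\<bar> powr m0)) \<omega> \<le> ennreal Cm"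
    and mom3: "\<And>i j k l. i \<in> {1..n} \<Longrightarrow> j \<in> {1..d} \<Longrightarrow> k \<in> {1..d} \<Longrightarrow> l \<in> {1..d} \<Longrightarrow> AE \<omega> in M.
        nn_cond_exp M (sigma_of M (U i) borel)
          (\<lambda>\<omega>'. ennreal (\<bar>x i j \<omega>' * x i k \<omega>' * x i l \<omega>' * Mf (W i \<omega>', y i \<omega>')\<bar> powr m0)) \<omega> \<le> ennreal Cm"
    and Cm: "0 \<le> Cm"
    and Mf_meas: "Mf \<in> borel_measurable (obs_space d)"
    and dens: "\<And>i. i \<in> {1..n} \<Longrightarrow> distributed M lborel (U i) (\<lambda>u. ennreal (fU u) * indicator {0..1} u)"
    and fU_le: "\<And>u. u \<in> {0..1} \<Longrightarrow> fU u \<le> cU" and cU: "0 < cU"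
    and K_cont: "continuous_on UNIV K" and K_nonneg: "\<And>z. 0 \<le> K z" and K_int: "(LINT z|lborel. K z) = 1"
    and K_supp: "\<And>z. K z \<noteq> 0 \<Longrightarrow> \<bar>z\<bar> \<le> \<kappa>" and K_max: "\<And>z. K z \<le> Kmax" and \<kappa>: "1 \<le> \<kappa>"
    and Kmax: "0 < Kmax" and h: "0 < h" and m0: "2 < m0"
    and a_cont: "\<And>j. j \<in> {1..d} \<Longrightarrow> continuous_on {0..1} (a j)"
begin

declare One_nat_def [simp del]

section \<open>Observations, kernel weights and their measurability\<close>

definition Zo :: "nat \<Rightarrow> 'w \<Rightarrow> (real \<times> (nat \<Rightarrow> real)) \<times> real" where
  "Zo i \<omega> = (W i \<omega>, y i \<omega>)"

definition uo :: "(real \<times> (nat \<Rightarrow> real)) \<times> real \<Rightarrow> real" where "uo z = fst (fst z)"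

text \<open>The value \<open>l = 0\<close> gives the weight of a level coordinate of the score,
  \<open>l = 1\<close> that of a slope coordinate; the scaled distance is counted as part of the
  weight, not of the observable.\<close>

definition kw :: "nat \<Rightarrow> real \<Rightarrow> real \<Rightarrow> real" where
  "kw l r v = ((r - v) / h) ^ l * (K ((r - v) / h) / h)"

abbreviation "Bw \<equiv> \<kappa> * Kmax / h"

text \<open>The factor \<open>1 + Cm\<close> bounds the conditional mean of
  \<open>1 + |t| powr m0\<close>, and \<open>cU\<close> bounds the density of the index.\<close>

definition Cmom :: real where "Cmom = (1 + Cm) * cU"

lemma Zo_meas [measurable]: "i \<in> {1..n} \<Longrightarrow> Zo i \<in> measurable M (obs_space d)"
  using indep_obs by (auto simp: indep_vars_def Zo_def[abs_def])

lemma uo_meas [measurable]: "uo \<in> borel_measurable (obs_space d)"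
  unfolding uo_def[abs_def] obs_space_def covariate_space_def by measurable

lemma uo_Zo [simp]: "uo (Zo i \<omega>) = U i \<omega>" unfolding uo_def Zo_def by (simp add: W_eq)

lemma U_meas [measurable]: "i \<in> {1..n} \<Longrightarrow> U i \<in> borel_measurable M"
  using measurable_compose[OF Zo_meas uo_meas] by simp

lemma W_meas [measurable]: "i \<in> {1..n} \<Longrightarrow> W i \<in> measurable M (covariate_space d)"
  using measurable_compose[OF Zo_meas, of i fst "covariate_space d"]
  by (simp add: obs_space_def Zo_def)

lemma xo_meas [measurable]: "j \<in> {1..d} \<Longrightarrow> (\<lambda>z. snd (fst z) j) \<in> borel_measurable (obs_space d)"
  unfolding obs_space_def covariate_space_def
  by (rule measurable_compose[OF _ measurable_component_singleton[of j "{1..d}" "\<lambda>_. borel"]]) measurable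

lemma xo_Zo [simp]: "j \<in> {1..d} \<Longrightarrow> snd (fst (Zo i \<omega>)) j = x i j \<omega>" unfolding Zo_def by (simp add: W_eq)

lemma K_meas [measurable]: "K \<in> borel_measurable borel"
  using K_cont by (rule borel_measurable_continuous_onI)

lemma kw_meas [measurable]: "(\<lambda>(r, v). kw l r v) \<in> borel_measurable (borel \<Otimes>\<^sub>M borel)"
  unfolding kw_def split_def by measurable

lemma kw_abs: "l \<le> 1 \<Longrightarrow> \<bar>kw l r v\<bar> \<le> \<kappa> * (K ((r - v) / h) / h)"
proof -
  assume l: "l \<le> 1"
  show ?thesis
  proof (cases "K ((r - v) / h) = 0")
    case False
    have "\<bar>(r - v) / h\<bar> ^ l \<le> \<kappa>"
    proof (cases "l = 0")
      case False
      then have "l = 1" using l by simp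
      then show ?thesis using K_supp[OF \<open>K ((r - v) / h) \<noteq> 0\<close>] by simp
    qed (use \<kappa> in simp)
    moreover have k: "0 \<le> K ((r - v) / h) / h" using h K_nonneg by simp
    ultimately show ?thesis
      unfolding kw_def abs_mult power_abs abs_of_nonneg[OF k] by (intro mult_right_mono)
  qed (use h in \<open>simp add: kw_def\<close>)
qed

lemma K_nn_integral: "(\<integral>\<^sup>+r. ennreal (K ((r - v) / h) / h) \<partial>lborel) = 1"
proof -
  \<comment> \<open>A non-integrable function has Bochner integral 0, so the value 1 already forces
    integrability.\<close>
  have int: "integrable lborel K"
    using K_int not_integrable_integral_eq[of lborel K] by fastforce
  have "1 = (\<integral>\<^sup>+r. ennreal (K r) \<partial>lborel)"
    using nn_integral_eq_integral[OF int] K_nonneg K_int by simp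
  also have "\<dots> = ennreal \<bar>1 / h\<bar> * (\<integral>\<^sup>+r. ennreal (K (- v / h + (1 / h) * r)) \<partial>lborel)"
    using h by (intro nn_integral_real_affine) auto
  also have "\<dots> = (\<integral>\<^sup>+r. ennreal \<bar>1 / h\<bar> * ennreal (K (- v / h + (1 / h) * r)) \<partial>lborel)"
    by (rule nn_integral_cmult[symmetric]) measurable
  also have "\<dots> = (\<integral>\<^sup>+r. ennreal (K ((r - v) / h) / h) \<partial>lborel)"
  proof (intro nn_integral_cong)
    fix r
    have "- v / h + 1 / h * r = (r - v) / h" by (simp add: diff_divide_distrib)
    then show "ennreal \<bar>1 / h\<bar> * ennreal (K (- v / h + (1 / h) * r)) = ennreal (K ((r - v) / h) / h)"
      using h K_nonneg by (simp add: ennreal_mult[symmetric])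
  qed
  finally show ?thesis by simp
qed

lemma local_sums_kw:
  assumes l: "l \<le> 1"
  shows "local_sums M (obs_space d) Zo n uo (kw l) Bw \<kappa> m0"
proof
  show "indep_vars (\<lambda>_. obs_space d) Zo {1..n}" using indep_obs by (simp add: Zo_def[abs_def])
  show "\<bar>kw l r v\<bar> \<le> Bw" for r v
  proof -
    have "\<kappa> * (K ((r - v) / h) / h) \<le> \<kappa> * (Kmax / h)"
      using \<kappa> h K_max by (intro mult_left_mono divide_right_mono) auto
    then show ?thesis using kw_abs[OF l, of r v] by simp
  qed
  show "(\<integral>\<^sup>+r. ennreal \<bar>kw l r v\<bar> \<partial>lborel) \<le> ennreal \<kappa>" for v
  proof -
    have "(\<integral>\<^sup>+r. ennreal \<bar>kw l r v\<bar> \<partial>lborel) \<le> (\<integral>\<^sup>+r. ennreal \<kappa> * ennreal (K ((r - v) / h) / h) \<partial>lborel)"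
      using kw_abs[OF l] \<kappa> K_nonneg h
      by (intro nn_integral_mono) (simp add: ennreal_mult[symmetric] ennreal_leI)
    also have "\<dots> = ennreal \<kappa> * (\<integral>\<^sup>+r. ennreal (K ((r - v) / h) / h) \<partial>lborel)"
      by (rule nn_integral_cmult) measurable
    finally show ?thesis by (simp add: K_nn_integral)
  qed
  show "uo (Zo i \<omega>) \<in> {0..1}" if "i \<in> {1..n}" "\<omega> \<in> space M" for i \<omega>
    using U_range[OF that] by simp
qed (use \<kappa> Kmax h m0 uo_meas kw_meas in auto)

text \<open>The coefficients are continuous only on the unit interval; the indicator makes \<open>pr\<close> Borel.
  Likewise \<open>q1f\<close>, \<open>q2f\<close> below vanish off \<open>Y\<close>, where the derivatives need not exist.\<close>

definition pr :: "(real \<times> (nat \<Rightarrow> real)) \<times> real \<Rightarrow> real" where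
  "pr z = (\<Sum>j=1..d. (indicator {0..1} (uo z) *\<^sub>R a j (uo z)) * snd (fst z) j)"

lemma pr_meas [measurable]: "pr \<in> borel_measurable (obs_space d)"
proof -
  have "(\<lambda>z. indicator {0..1} (uo z) *\<^sub>R a j (uo z)) \<in> borel_measurable (obs_space d)" if "j \<in> {1..d}" for j
    by (rule measurable_compose[OF uo_meas borel_measurable_continuous_on_indicator[OF _ a_cont[OF that]]]) simp
  then show ?thesis unfolding pr_def[abs_def]
    by (intro borel_measurable_sum borel_measurable_times xo_meas) auto
qed

lemma pr_Zo: "i \<in> {1..n} \<Longrightarrow> \<omega> \<in> space M \<Longrightarrow> pr (Zo i \<omega>) = (\<Sum>j=1..d. a j (U i \<omega>) * x i j \<omega>)"
  using U_range[of i \<omega>] unfolding pr_def by (intro sum.cong) auto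

definition q1f :: "real \<Rightarrow> real \<Rightarrow> real" where "q1f r t = (if t \<in> Y then q1 L r t else 0)"
definition q2f :: "real \<Rightarrow> real \<Rightarrow> real" where "q2f r t = (if t \<in> Y then q2 L r t else 0)"

lemma q1f_meas: "(\<lambda>(r, t). q1f r t) \<in> borel_measurable (borel \<Otimes>\<^sub>M borel)"
  using borel_measurable_deriv_on[OF L_meas Y_meas L_diff(1)] unfolding q1f_def q1_def .

lemma q2f_meas: "(\<lambda>(r, t). q2f r t) \<in> borel_measurable (borel \<Otimes>\<^sub>M borel)"
proof -
  have eq: "(\<lambda>r. q1f r t) = (\<lambda>r. q1 L r t)" if "t \<in> Y" for t using that by (simp add: q1f_def)
  have "(\<lambda>(r, t). if t \<in> Y then deriv (\<lambda>r. q1f r t) r else 0) \<in> borel_measurable (borel \<Otimes>\<^sub>M borel)"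
    by (rule borel_measurable_deriv_on[OF q1f_meas Y_meas]) (use L_diff(2) eq in simp)
  also have "(\<lambda>(r, t). if t \<in> Y then deriv (\<lambda>r. q1f r t) r else 0) = (\<lambda>(r, t). q2f r t)"
    by (auto simp: q2f_def q2_def eq fun_eq_iff)
  finally show ?thesis .
qed

text \<open>Observables behind the score, the Hessian and the cubic remainder: families of size
  \<open>d\<close>, \<open>d^2\<close> and \<open>d^3\<close>. The last accounts for the factor
  \<open>d^3\<close> in the union bound.\<close>

definition \<xi>1 :: "nat \<Rightarrow> (real \<times> (nat \<Rightarrow> real)) \<times> real \<Rightarrow> real" where
  "\<xi>1 j z = q1f (pr z) (snd z) * snd (fst z) j"

definition \<xi>2 :: "nat \<times> nat \<Rightarrow> (real \<times> (nat \<Rightarrow> real)) \<times> real \<Rightarrow> real" where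
  "\<xi>2 p z = q2f (pr z) (snd z) * snd (fst z) (fst p) * snd (fst z) (snd p)"

definition \<xi>3 :: "nat \<times> nat \<times> nat \<Rightarrow> (real \<times> (nat \<Rightarrow> real)) \<times> real \<Rightarrow> real" where
  "\<xi>3 p z = snd (fst z) (fst p) * snd (fst z) (fst (snd p)) * snd (fst z) (snd (snd p)) * Mf z"

lemma yo_meas [measurable]: "snd \<in> borel_measurable (obs_space d)"
  unfolding obs_space_def by measurable

lemma q1o_meas [measurable]: "(\<lambda>z. q1f (pr z) (snd z)) \<in> borel_measurable (obs_space d)"
  by (rule measurable_case_prod_compose[OF q1f_meas]) measurable

lemma q2o_meas [measurable]: "(\<lambda>z. q2f (pr z) (snd z)) \<in> borel_measurable (obs_space d)"
  by (rule measurable_case_prod_compose[OF q2f_meas]) measurable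

lemma \<xi>_meas:
  "j \<in> {1..d} \<Longrightarrow> \<xi>1 j \<in> borel_measurable (obs_space d)"
  "p \<in> {1..d} \<times> {1..d} \<Longrightarrow> \<xi>2 p \<in> borel_measurable (obs_space d)"
  "q \<in> {1..d} \<times> {1..d} \<times> {1..d} \<Longrightarrow> \<xi>3 q \<in> borel_measurable (obs_space d)"
proof -
  note [measurable] = xo_meas Mf_meas
  assume j: "j \<in> {1..d}" then show "\<xi>1 j \<in> borel_measurable (obs_space d)"
    unfolding \<xi>1_def[abs_def] by measurable
next
  assume "p \<in> {1..d} \<times> {1..d}"
  then have [measurable]: "(\<lambda>z. snd (fst z) (fst p)) \<in> borel_measurable (obs_space d)"
    "(\<lambda>z. snd (fst z) (snd p)) \<in> borel_measurable (obs_space d)" by (auto intro!: xo_meas)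
  show "\<xi>2 p \<in> borel_measurable (obs_space d)" unfolding \<xi>2_def[abs_def] by measurable
next
  note [measurable] = Mf_meas
  assume "q \<in> {1..d} \<times> {1..d} \<times> {1..d}"
  then have [measurable]: "(\<lambda>z. snd (fst z) (fst q)) \<in> borel_measurable (obs_space d)"
    "(\<lambda>z. snd (fst z) (fst (snd q))) \<in> borel_measurable (obs_space d)"
    "(\<lambda>z. snd (fst z) (snd (snd q))) \<in> borel_measurable (obs_space d)" by (auto intro!: xo_meas)
  show "\<xi>3 q \<in> borel_measurable (obs_space d)" unfolding \<xi>3_def[abs_def] by measurable
qed

lemma Q_Zo:
  assumes "i \<in> {1..n}" "\<omega> \<in> space M"
  shows "q1f (pr (Zo i \<omega>)) (snd (Zo i \<omega>)) = Q1 i \<omega>" "q2f (pr (Zo i \<omega>)) (snd (Zo i \<omega>)) = Q2 i \<omega>"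
  using y_range[OF assms] pr_Zo[OF assms] by (simp_all add: q1f_def q2f_def Q1_eq Q2_eq Zo_def)

lemma \<xi>_Zo:
  assumes "i \<in> {1..n}" "\<omega> \<in> space M"
  shows "j \<in> {1..d} \<Longrightarrow> \<xi>1 j (Zo i \<omega>) = Q1 i \<omega> * x i j \<omega>"
    "j \<in> {1..d} \<Longrightarrow> k \<in> {1..d} \<Longrightarrow> \<xi>2 (j, k) (Zo i \<omega>) = Q2 i \<omega> * x i j \<omega> * x i k \<omega>"
    "j \<in> {1..d} \<Longrightarrow> k \<in> {1..d} \<Longrightarrow> l \<in> {1..d} \<Longrightarrow>
       \<xi>3 (j, k, l) (Zo i \<omega>) = x i j \<omega> * x i k \<omega> * x i l \<omega> * Mf (W i \<omega>, y i \<omega>)"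
  using Q_Zo[OF assms] by (simp_all add: \<xi>1_def \<xi>2_def \<xi>3_def) (simp add: Zo_def)

text \<open>The test function of the index is measurable for the conditioning sigma-algebra, so the
  power may be replaced by its conditional expectation, at most \<open>Cm\<close>. The density bound
  then passes to Lebesgue measure.\<close>

lemma conditional_moment:
  assumes meas: "\<xi> \<in> borel_measurable (obs_space d)" and i: "i \<in> {1..n}" and \<psi>: "\<psi> \<in> borel_measurable borel"
    and cond: "AE \<omega> in M. nn_cond_exp M (sigma_of M (U i) borel) (\<lambda>\<omega>'. ennreal (\<bar>\<xi> (Zo i \<omega>')\<bar> powr m0)) \<omega> \<le> ennreal Cm"
  shows "(\<integral>\<^sup>+\<omega>. ennreal (1 + \<bar>\<xi> (Zo i \<omega>)\<bar> powr m0) * \<psi> (U i \<omega>) \<partial>M) \<le> ennreal Cmom * (\<integral>\<^sup>+r. \<psi> r \<partial>lborel)"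
proof -
  note [measurable] = meas \<psi>
  have [measurable]: "Zo i \<in> measurable M (obs_space d)" "U i \<in> borel_measurable M" using i by auto
  let ?F = "sigma_of M (U i) borel"
  let ?f = "\<lambda>\<omega>. ennreal (\<bar>\<xi> (Zo i \<omega>)\<bar> powr m0)"
  have sub: "subalgebra M ?F" by (rule subalgebra_sigma_of) simp
  interpret F: finite_measure_subalgebra M ?F by unfold_locales (rule sub)
  have UF: "(\<lambda>\<omega>. \<psi> (U i \<omega>)) \<in> borel_measurable ?F"
    unfolding sigma_of_def by (rule measurable_compose[OF measurable_vimage_algebra1 \<psi>]) simp
  have U_le: "(\<integral>\<^sup>+\<omega>. \<psi> (U i \<omega>) \<partial>M) \<le> ennreal cU * (\<integral>\<^sup>+r. \<psi> r \<partial>lborel)"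
  proof -
    have "(\<integral>\<^sup>+\<omega>. \<psi> (U i \<omega>) \<partial>M) = (\<integral>\<^sup>+r. (ennreal (fU r) * indicator {0..1} r) * \<psi> r \<partial>lborel)"
      by (rule distributed_nn_integral[OF dens[OF i], symmetric]) simp
    also have "\<dots> \<le> (\<integral>\<^sup>+r. ennreal cU * \<psi> r \<partial>lborel)"
      using fU_le by (intro nn_integral_mono mult_right_mono) (auto simp: indicator_def ennreal_leI)
    also have "\<dots> = ennreal cU * (\<integral>\<^sup>+r. \<psi> r \<partial>lborel)" by (rule nn_integral_cmult) simp
    finally show ?thesis .
  qed
  have "(\<integral>\<^sup>+\<omega>. ennreal (1 + \<bar>\<xi> (Zo i \<omega>)\<bar> powr m0) * \<psi> (U i \<omega>) \<partial>M)
      = (\<integral>\<^sup>+\<omega>. \<psi> (U i \<omega>) + \<psi> (U i \<omega>) * ?f \<omega> \<partial>M)"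
    by (intro nn_integral_cong) (auto simp: algebra_simps)
  also have "\<dots> = (\<integral>\<^sup>+\<omega>. \<psi> (U i \<omega>) \<partial>M) + (\<integral>\<^sup>+\<omega>. \<psi> (U i \<omega>) * ?f \<omega> \<partial>M)"
    by (rule nn_integral_add) measurable
  also have "\<dots> \<le> (\<integral>\<^sup>+\<omega>. \<psi> (U i \<omega>) \<partial>M) + ennreal Cm * (\<integral>\<^sup>+\<omega>. \<psi> (U i \<omega>) \<partial>M)"
  proof (rule add_left_mono)
    have "(\<integral>\<^sup>+\<omega>. \<psi> (U i \<omega>) * ?f \<omega> \<partial>M) = (\<integral>\<^sup>+\<omega>. \<psi> (U i \<omega>) * nn_cond_exp M ?F ?f \<omega> \<partial>M)"
      by (rule F.nn_cond_exp_intg[symmetric, OF UF]) measurable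
    also have "\<dots> \<le> (\<integral>\<^sup>+\<omega>. ennreal Cm * \<psi> (U i \<omega>) \<partial>M)"
    proof (rule nn_integral_mono_AE)
      show "AE \<omega> in M. \<psi> (U i \<omega>) * nn_cond_exp M ?F ?f \<omega> \<le> ennreal Cm * \<psi> (U i \<omega>)"
        using cond by eventually_elim (subst mult.commute, rule mult_right_mono, simp_all)
    qed
    also have "\<dots> = ennreal Cm * (\<integral>\<^sup>+\<omega>. \<psi> (U i \<omega>) \<partial>M)" by (rule nn_integral_cmult) measurable
    finally show "(\<integral>\<^sup>+\<omega>. \<psi> (U i \<omega>) * ?f \<omega> \<partial>M) \<le> ennreal Cm * (\<integral>\<^sup>+\<omega>. \<psi> (U i \<omega>) \<partial>M)" .
  qed
  also have "\<dots> = ennreal (1 + Cm) * (\<integral>\<^sup>+\<omega>. \<psi> (U i \<omega>) \<partial>M)"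
    using Cm by (simp add: distrib_right)
  also have "\<dots> \<le> ennreal (1 + Cm) * (ennreal cU * (\<integral>\<^sup>+r. \<psi> r \<partial>lborel))"
    by (intro mult_left_mono U_le) simp
  also have "\<dots> = ennreal Cmom * (\<integral>\<^sup>+r. \<psi> r \<partial>lborel)"
    using Cm cU by (simp add: Cmom_def ennreal_mult mult.assoc del: ennreal_plus)
  finally show ?thesis .
qed

lemma Cmom_pos: "0 < Cmom" using Cm cU by (simp add: Cmom_def)

text \<open>The moment conditions speak of \<open>Q1\<close>, \<open>Q2\<close> and the covariates,
  the local sums of functions of the observation. The two agree on the space of \<open>M\<close>
  only, which is enough for conditional expectations.\<close>

lemma nn_cond_exp_cong':
  assumes "\<And>\<omega>. \<omega> \<in> space M \<Longrightarrow> f \<omega> = g \<omega>" and i: "i \<in> {1..n}"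
    and "f \<in> borel_measurable M"
    and "AE \<omega> in M. nn_cond_exp M (sigma_of M (U i) borel) g \<omega> \<le> c"
  shows "AE \<omega> in M. nn_cond_exp M (sigma_of M (U i) borel) f \<omega> \<le> c"
proof -
  have U[measurable]: "U i \<in> borel_measurable M" using i by simp
  have sub: "subalgebra M (sigma_of M (U i) borel)"
    by (rule subalgebra_sigma_of) simp
  interpret F: finite_measure_subalgebra M "sigma_of M (U i) borel" by unfold_locales (rule sub)
  have g: "g \<in> borel_measurable M" using assms(1,3) measurable_cong[of M f g] by blast
  have "AE \<omega> in M. nn_cond_exp M (sigma_of M (U i) borel) f \<omega> = nn_cond_exp M (sigma_of M (U i) borel) g \<omega>"
    by (rule F.nn_cond_exp_cong[OF AE_I2]) (use assms g in auto)
  with assms(4) show ?thesis by eventually_elim simp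
qed

lemma moments:
  shows "j \<in> {1..d} \<Longrightarrow> local_sums.mom M (obs_space d) Zo n uo m0 (\<xi>1 j) Cmom"
    "p \<in> {1..d} \<times> {1..d} \<Longrightarrow> local_sums.mom M (obs_space d) Zo n uo m0 (\<xi>2 p) Cmom"
    "q \<in> {1..d} \<times> {1..d} \<times> {1..d} \<Longrightarrow> local_sums.mom M (obs_space d) Zo n uo m0 (\<xi>3 q) Cmom"
proof -
  interpret S: local_sums M "obs_space d" Zo n uo "kw 0" Bw \<kappa> m0 by (rule local_sums_kw) simp
  have gen: "S.mom \<xi> Cmom" if "\<xi> \<in> borel_measurable (obs_space d)"
    "\<And>i. i \<in> {1..n} \<Longrightarrow> AE \<omega> in M. nn_cond_exp M (sigma_of M (U i) borel) (\<lambda>\<omega>'. ennreal (\<bar>\<xi> (Zo i \<omega>')\<bar> powr m0)) \<omega> \<le> ennreal Cm" for \<xi>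
    unfolding S.mom_def using that Cmom_pos conditional_moment by simp
  have m: "(\<lambda>\<omega>. ennreal (\<bar>\<xi> (Zo i \<omega>)\<bar> powr m0)) \<in> borel_measurable M"
    if "\<xi> \<in> borel_measurable (obs_space d)" "i \<in> {1..n}" for \<xi> i
  proof -
    have "(\<lambda>\<omega>. \<xi> (Zo i \<omega>)) \<in> borel_measurable M" by (rule measurable_compose[OF Zo_meas[OF that(2)] that(1)])
    then show ?thesis by measurable
  qed
  show "S.mom (\<xi>1 j) Cmom" if j: "j \<in> {1..d}"
    by (rule gen[OF \<xi>_meas(1)[OF j]], rule nn_cond_exp_cong'[OF _ _ m mom1[OF _ j]])
       (use \<xi>_Zo(1)[OF _ _ j] \<xi>_meas(1)[OF j] in auto)
  show "S.mom (\<xi>2 p) Cmom" if p: "p \<in> {1..d} \<times> {1..d}"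
  proof -
    obtain j k where jk: "p = (j, k)" "j \<in> {1..d}" "k \<in> {1..d}" using p by auto
    show ?thesis
      by (rule gen[OF \<xi>_meas(2)[OF p]], rule nn_cond_exp_cong'[OF _ _ m mom2[OF _ jk(2,3)]])
         (use \<xi>_Zo(2)[OF _ _ jk(2,3)] \<xi>_meas(2)[OF p] jk(1) in auto)
  qed
  show "S.mom (\<xi>3 q) Cmom" if q: "q \<in> {1..d} \<times> {1..d} \<times> {1..d}"
  proof -
    obtain j k r where jk: "q = (j, k, r)" "j \<in> {1..d}" "k \<in> {1..d}" "r \<in> {1..d}" using q by auto
    show ?thesis
      by (rule gen[OF \<xi>_meas(3)[OF q]], rule nn_cond_exp_cong'[OF _ _ m mom3[OF _ jk(2,3,4)]])
         (use \<xi>_Zo(3)[OF _ _ jk(2,3,4)] \<xi>_meas(3)[OF q] jk(1) in auto)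
  qed
qed

text \<open>The covariate and the kernel weight are functions of \<open>W i\<close>, so they can be
  taken out of the conditional expectation of \<open>Q1 i\<close> given \<open>W i\<close>, which is
  zero.\<close>

lemma score_mean_zero:
  assumes l: "l \<le> 1" and j: "j \<in> {1..d}"
  shows "local_sums.mean_zero M Zo n uo (kw l) (\<xi>1 j)"
proof -
  interpret S: local_sums M "obs_space d" Zo n uo "kw l" Bw \<kappa> m0 by (rule local_sums_kw[OF l])
  note [measurable] = \<xi>_meas(1)[OF j]
  show ?thesis unfolding S.mean_zero_def
  proof (intro ballI allI)
    fix i v assume i: "i \<in> {1..n}"
    have [measurable]: "Zo i \<in> measurable M (obs_space d)" "W i \<in> measurable M (covariate_space d)" using i by auto
    let ?F = "sigma_of M (W i) (covariate_space d)"
    let ?w = "\<lambda>\<omega>. kw l (U i \<omega>) v"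
    have sub: "subalgebra M ?F" by (rule subalgebra_sigma_of) simp
    interpret F: finite_measure_subalgebra M ?F by unfold_locales (rule sub)
    have int: "integrable M (\<lambda>\<omega>. \<xi>1 j (Zo i \<omega>) * kw l (uo (Zo i \<omega>)) v)"
    proof (rule Bochner_Integration.integrable_bound[OF S.mom_w_integral(1)[OF moments(1)[OF j] i, of v]])
      show "(\<lambda>\<omega>. \<xi>1 j (Zo i \<omega>) * kw l (uo (Zo i \<omega>)) v) \<in> borel_measurable M" by measurable
      show "AE \<omega> in M. norm (\<xi>1 j (Zo i \<omega>) * kw l (uo (Zo i \<omega>)) v)
          \<le> norm ((1 + \<bar>\<xi>1 j (Zo i \<omega>)\<bar> powr m0) * \<bar>kw l (uo (Zo i \<omega>)) v\<bar>)"
        using S.abs_le_powr(1) by (intro AE_I2) (simp add: abs_mult mult_right_mono)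
    qed
    have eq: "\<xi>1 j (Zo i \<omega>) * kw l (uo (Zo i \<omega>)) v = (x i j \<omega> * ?w \<omega>) * Q1 i \<omega>" if "\<omega> \<in> space M" for \<omega>
      using \<xi>_Zo(1)[OF i that j] by simp
    have fF: "(\<lambda>\<omega>. x i j \<omega> * ?w \<omega>) \<in> borel_measurable ?F"
    proof -
      have [measurable]: "(\<lambda>r. snd r j) \<in> borel_measurable (covariate_space d)"
        unfolding covariate_space_def
        by (rule measurable_compose[OF _ measurable_component_singleton[OF j, of "\<lambda>_. borel"]]) measurable
      have [measurable]: "fst \<in> borel_measurable (covariate_space d)" unfolding covariate_space_def by measurable
      have "(\<lambda>r. snd r j * kw l (fst r) v) \<in> borel_measurable (covariate_space d)" by measurable
      from measurable_compose[OF measurable_vimage_algebra1 this, of "W i" "space M"]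
      have "(\<lambda>\<omega>. snd (W i \<omega>) j * kw l (fst (W i \<omega>)) v) \<in> borel_measurable ?F"
        unfolding sigma_of_def using measurable_space[OF W_meas[OF i]] by auto
      then show ?thesis using j by (simp add: W_eq)
    qed
    have int': "integrable M (\<lambda>\<omega>. (x i j \<omega> * ?w \<omega>) * Q1 i \<omega>)"
      using int eq by (subst (asm) Bochner_Integration.integrable_cong[OF refl]) auto
    have Q1m: "Q1 i \<in> borel_measurable M" using Q1_mean[OF i] by auto
    have "expectation (\<lambda>\<omega>. \<xi>1 j (Zo i \<omega>) * kw l (uo (Zo i \<omega>)) v) = expectation (\<lambda>\<omega>. (x i j \<omega> * ?w \<omega>) * Q1 i \<omega>)"
      using eq by (intro Bochner_Integration.integral_cong) auto
    also have "\<dots> = expectation (\<lambda>\<omega>. (x i j \<omega> * ?w \<omega>) * real_cond_exp M ?F (Q1 i) \<omega>)"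
      by (rule F.real_cond_exp_intg(2)[OF int' fF Q1m, symmetric])
    also have "\<dots> = expectation (\<lambda>\<omega>. 0)"
    proof (rule integral_cong_AE)
      show "AE \<omega> in M. (x i j \<omega> * ?w \<omega>) * real_cond_exp M ?F (Q1 i) \<omega> = 0"
        using Q1_mean[OF i] by (auto elim: eventually_mono)
      show "(\<lambda>\<omega>. (x i j \<omega> * ?w \<omega>) * real_cond_exp M ?F (Q1 i) \<omega>) \<in> borel_measurable M"
        by (intro borel_measurable_times borel_measurable_subalgebra[OF _ _ fF] borel_measurable_cond_exp2)
           (use sub in \<open>auto simp: subalgebra_def\<close>)
    qed simp
    finally show "integrable M (\<lambda>\<omega>. \<xi>1 j (Zo i \<omega>) * kw l (uo (Zo i \<omega>)) v) \<and>
        expectation (\<lambda>\<omega>. \<xi>1 j (Zo i \<omega>) * kw l (uo (Zo i \<omega>)) v) = 0" using int by simp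
  qed
qed

section \<open>Events for the score, the Hessian and the cubic remainder\<close>

lemma D_simps [simp]: "nobs (D \<omega>) = n" "ncov (D \<omega>) = d" "bw (D \<omega>) = h" "kern (D \<omega>) = K" "ll (D \<omega>) = L"
  "idx (D \<omega>) i = U i \<omega>" "cov (D \<omega>) i j = x i j \<omega>" "resp (D \<omega>) i = y i \<omega>"
  by (simp_all add: D_eq)

lemma true_pred_D: "true_pred (D \<omega>) a i = (\<Sum>j=1..d. a j (U i \<omega>) * x i j \<omega>)"
  by (simp add: true_pred_def)

lemma wt_D: "wt (D \<omega>) v i = kw 0 (U i \<omega>) v / real n"
  by (simp add: wt_def Kh_def kw_def)

lemma score_D:
  assumes \<omega>: "\<omega> \<in> space M" and p: "p \<in> {1..2 * d}"
  shows "true_score (D \<omega>) a k p = (\<Sum>i=1..n. \<xi>1 (if p \<le> d then p else p - d) (Zo i \<omega>)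
    * kw (if p \<le> d then 0 else 1) (uo (Zo i \<omega>)) (uo (Zo k \<omega>))) / real n"
proof -
  have "true_score (D \<omega>) a k p = (\<Sum>i=1..n. (\<xi>1 (if p \<le> d then p else p - d) (Zo i \<omega>)
    * kw (if p \<le> d then 0 else 1) (uo (Zo i \<omega>)) (uo (Zo k \<omega>))) / real n)"
    unfolding true_score_def
  proof (simp only: D_simps, rule sum.cong[OF refl])
    fix i assume i: "i \<in> {1..n}"
    have q: "q1 L (true_pred (D \<omega>) a i) (y i \<omega>) = Q1 i \<omega>" by (simp add: Q1_eq true_pred_D)
    show "wt (D \<omega>) (U k \<omega>) i * q1 L (true_pred (D \<omega>) a i) (y i \<omega>) * design (D \<omega>) (U k \<omega>) i p
      = (\<xi>1 (if p \<le> d then p else p - d) (Zo i \<omega>)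
          * kw (if p \<le> d then 0 else 1) (uo (Zo i \<omega>)) (uo (Zo k \<omega>))) / real n"
    proof (cases "p \<le> d")
      case True
      then have "p \<in> {1..d}" using p by auto
      then show ?thesis using True \<xi>_Zo(1)[OF i \<omega>] unfolding q
        by (simp add: wt_D design_def stack_def)
    next
      case False
      then have "p - d \<in> {1..d}" using p by auto
      then show ?thesis using False \<xi>_Zo(1)[OF i \<omega>] unfolding q
        by (simp add: wt_D design_def stack_def kw_def mult_ac)
    qed
  qed
  then show ?thesis by (simp add: sum_divide_distrib)
qed

text \<open>The factor 2 in front of the probability counts the two kernel weights, one for the
  level half and one for the slope half of the score.\<close>

lemma score_event:
  assumes T: "0 < T" and \<tau>: "0 < \<tau>" "\<tau> * (T * Bw) \<le> 1"
  shows "inner_prob_ge M (1 - 2 * (real n * real d ^ 3 * (Cmom / T powr m0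
        + 2 * exp (real n * ((\<tau> * T powr (1 - m0) + \<tau>\<^sup>2 * Bw) * (Cmom * \<kappa>)) - \<tau> * t))))
     (\<lambda>\<omega>. \<forall>k\<in>{1..n}. \<forall>p\<in>{1..2 * d}. \<bar>true_score (D \<omega>) a k p\<bar> \<le> (t + T * Bw) / real n)"
proof -
  let ?q = "Cmom / T powr m0
        + 2 * exp (real n * ((\<tau> * T powr (1 - m0) + \<tau>\<^sup>2 * Bw) * (Cmom * \<kappa>)) - \<tau> * t)"
  have q: "0 \<le> ?q" using Cmom_pos by simp
  \<comment> \<open>Only \<open>d\<close> sums occur, but the bound is relaxed to \<open>d^3\<close>
    so that one rate serves all three events.\<close>
  have d: "real d \<le> real d ^ 3" using s by (intro self_le_power) auto
  have *: "inner_prob_ge M (1 - real n * real d ^ 3 * ?q)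
     (\<lambda>\<omega>. \<forall>j\<in>{1..d}. \<forall>k\<in>{1..n}. \<bar>\<Sum>i=1..n. \<xi>1 j (Zo i \<omega>) * kw l (uo (Zo i \<omega>)) (uo (Zo k \<omega>))\<bar> \<le> t + T * Bw)"
    if l: "l \<le> 1" for l
  proof -
    interpret S: local_sums M "obs_space d" Zo n uo "kw l" Bw \<kappa> m0 by (rule local_sums_kw[OF l])
    have "inner_prob_ge M (1 - real n * real (card {1..d}) * ?q)
     (\<lambda>\<omega>. \<forall>j\<in>{1..d}. \<forall>k\<in>{1..n}. \<bar>\<Sum>i=1..n. \<xi>1 j (Zo i \<omega>) * kw l (uo (Zo i \<omega>)) (uo (Zo k \<omega>))\<bar> \<le> t + T * Bw)"
      by (rule S.mean_zero_family[OF _ moments(1) T score_mean_zero[OF l] \<tau>]) auto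
    then show ?thesis
    proof (rule inner_prob_ge_mono)
      show "1 - real n * real d ^ 3 * ?q \<le> 1 - real n * real (card {1..d}) * ?q"
        using d q by (simp add: mult_right_mono mult_left_mono)
    qed
  qed
  have "inner_prob_ge M (1 - (real n * real d ^ 3 * ?q + real n * real d ^ 3 * ?q))
    (\<lambda>\<omega>. (\<forall>j\<in>{1..d}. \<forall>k\<in>{1..n}. \<bar>\<Sum>i=1..n. \<xi>1 j (Zo i \<omega>) * kw 0 (uo (Zo i \<omega>)) (uo (Zo k \<omega>))\<bar> \<le> t + T * Bw)
       \<and> (\<forall>j\<in>{1..d}. \<forall>k\<in>{1..n}. \<bar>\<Sum>i=1..n. \<xi>1 j (Zo i \<omega>) * kw 1 (uo (Zo i \<omega>)) (uo (Zo k \<omega>))\<bar> \<le> t + T * Bw))"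
    by (intro inner_prob_ge_conj *) auto
  then show ?thesis
  proof (rule inner_prob_ge_mono)
    fix \<omega> assume \<omega>: "\<omega> \<in> space M"
      and good: "(\<forall>j\<in>{1..d}. \<forall>k\<in>{1..n}. \<bar>\<Sum>i=1..n. \<xi>1 j (Zo i \<omega>) * kw 0 (uo (Zo i \<omega>)) (uo (Zo k \<omega>))\<bar> \<le> t + T * Bw)
       \<and> (\<forall>j\<in>{1..d}. \<forall>k\<in>{1..n}. \<bar>\<Sum>i=1..n. \<xi>1 j (Zo i \<omega>) * kw 1 (uo (Zo i \<omega>)) (uo (Zo k \<omega>))\<bar> \<le> t + T * Bw)"
    show "\<forall>k\<in>{1..n}. \<forall>p\<in>{1..2 * d}. \<bar>true_score (D \<omega>) a k p\<bar> \<le> (t + T * Bw) / real n"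
    proof (intro ballI)
      fix k p assume k: "k \<in> {1..n}" and p: "p \<in> {1..2 * d}"
      have "\<bar>\<Sum>i=1..n. \<xi>1 (if p \<le> d then p else p - d) (Zo i \<omega>)
          * kw (if p \<le> d then 0 else 1) (uo (Zo i \<omega>)) (uo (Zo k \<omega>))\<bar> \<le> t + T * Bw"
      proof (cases "p \<le> d")
        case True
        then have "p \<in> {1..d}" using p by auto
        then show ?thesis using good k unfolding if_P[OF True] by blast
      next
        case False
        then have "p - d \<in> {1..d}" using p by auto
        then show ?thesis using good k unfolding if_not_P[OF False] by blast
      qed
      then show "\<bar>true_score (D \<omega>) a k p\<bar> \<le> (t + T * Bw) / real n"
        unfolding score_D[OF \<omega> p] using n by (simp only: abs_divide) (simp add: divide_right_mono)
    qed
  qed simp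
qed

lemma hessian_event:
  assumes T: "0 < T"
  shows "inner_prob_ge M (1 - real n * real d ^ 3 * (Cmom / T powr m0 + exp (- (real n * Cmom * \<kappa> / (T * Bw)))))
     (\<lambda>\<omega>. \<forall>k\<in>{1..n}. \<forall>j\<in>{1..d}. \<forall>j'\<in>{1..d}. (\<Sum>i=1..n. wt (D \<omega>) (U k \<omega>) i
        * \<bar>q2 L (true_pred (D \<omega>) a i) (y i \<omega>)\<bar> * \<bar>x i j \<omega>\<bar> * \<bar>x i j' \<omega>\<bar>) \<le> (3 * real n * Cmom * \<kappa> + T * Bw) / real n)"
proof -
  interpret S: local_sums M "obs_space d" Zo n uo "kw 0" Bw \<kappa> m0 by (rule local_sums_kw) simp
  let ?q = "Cmom / T powr m0 + exp (- (real n * Cmom * \<kappa> / (T * Bw)))"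
  have q: "0 \<le> ?q" using Cmom_pos by simp
  have d: "real (card ({1..d} \<times> {1..d})) \<le> real d ^ 3"
  proof -
    have "real d ^ 2 \<le> real d ^ 3" using s by (intro power_increasing) auto
    then show ?thesis by (simp add: card_cartesian_product power2_eq_square)
  qed
  have "inner_prob_ge M (1 - real n * real (card ({1..d} \<times> {1..d})) * ?q)
     (\<lambda>\<omega>. \<forall>p\<in>{1..d} \<times> {1..d}. \<forall>k\<in>{1..n}. (\<Sum>i=1..n. \<bar>\<xi>2 p (Zo i \<omega>) * kw 0 (uo (Zo i \<omega>)) (uo (Zo k \<omega>))\<bar>)
        \<le> 3 * real n * Cmom * \<kappa> + T * Bw)"
    by (rule S.pos_family[OF _ moments(2) T]) auto
  then show ?thesis
  proof (rule inner_prob_ge_mono)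
    show "1 - real n * real d ^ 3 * ?q \<le> 1 - real n * real (card ({1..d} \<times> {1..d})) * ?q"
      using d q by (simp only: diff_left_mono mult_right_mono mult_left_mono of_nat_0_le_iff)
    fix \<omega> assume \<omega>: "\<omega> \<in> space M"
      and good: "\<forall>p\<in>{1..d} \<times> {1..d}. \<forall>k\<in>{1..n}. (\<Sum>i=1..n. \<bar>\<xi>2 p (Zo i \<omega>) * kw 0 (uo (Zo i \<omega>)) (uo (Zo k \<omega>))\<bar>)
        \<le> 3 * real n * Cmom * \<kappa> + T * Bw"
    show "\<forall>k\<in>{1..n}. \<forall>j\<in>{1..d}. \<forall>j'\<in>{1..d}. (\<Sum>i=1..n. wt (D \<omega>) (U k \<omega>) i
        * \<bar>q2 L (true_pred (D \<omega>) a i) (y i \<omega>)\<bar> * \<bar>x i j \<omega>\<bar> * \<bar>x i j' \<omega>\<bar>) \<le> (3 * real n * Cmom * \<kappa> + T * Bw) / real n"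
    proof (intro ballI)
      fix k j j' assume k: "k \<in> {1..n}" and j: "j \<in> {1..d}" "j' \<in> {1..d}"
      have "(\<Sum>i=1..n. wt (D \<omega>) (U k \<omega>) i * \<bar>q2 L (true_pred (D \<omega>) a i) (y i \<omega>)\<bar> * \<bar>x i j \<omega>\<bar> * \<bar>x i j' \<omega>\<bar>)
          = (\<Sum>i=1..n. \<bar>\<xi>2 (j, j') (Zo i \<omega>) * kw 0 (uo (Zo i \<omega>)) (uo (Zo k \<omega>))\<bar> / real n)"
      proof (rule sum.cong[OF refl])
        fix i assume i: "i \<in> {1..n}"
        have "0 \<le> kw 0 (U i \<omega>) (U k \<omega>)" using K_nonneg h by (simp add: kw_def)
        then show "wt (D \<omega>) (U k \<omega>) i * \<bar>q2 L (true_pred (D \<omega>) a i) (y i \<omega>)\<bar> * \<bar>x i j \<omega>\<bar> * \<bar>x i j' \<omega>\<bar>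
            = \<bar>\<xi>2 (j, j') (Zo i \<omega>) * kw 0 (uo (Zo i \<omega>)) (uo (Zo k \<omega>))\<bar> / real n"
          using \<xi>_Zo(2)[OF i \<omega> j] by (simp add: wt_D true_pred_D Q2_eq abs_mult mult_ac)
      qed
      also have "\<dots> = (\<Sum>i=1..n. \<bar>\<xi>2 (j, j') (Zo i \<omega>) * kw 0 (uo (Zo i \<omega>)) (uo (Zo k \<omega>))\<bar>) / real n"
        by (rule sum_divide_distrib[symmetric])
      also have "\<dots> \<le> (3 * real n * Cmom * \<kappa> + T * Bw) / real n"
      proof (rule divide_right_mono)
        show "(\<Sum>i=1..n. \<bar>\<xi>2 (j, j') (Zo i \<omega>) * kw 0 (uo (Zo i \<omega>)) (uo (Zo k \<omega>))\<bar>) \<le> 3 * real n * Cmom * \<kappa> + T * Bw"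
          using good j k by blast
      qed simp
      finally show "(\<Sum>i=1..n. wt (D \<omega>) (U k \<omega>) i * \<bar>q2 L (true_pred (D \<omega>) a i) (y i \<omega>)\<bar> * \<bar>x i j \<omega>\<bar> * \<bar>x i j' \<omega>\<bar>)
        \<le> (3 * real n * Cmom * \<kappa> + T * Bw) / real n" .
    qed
  qed
qed

lemma third_event:
  assumes T: "0 < T"
  shows "inner_prob_ge M (1 - real n * real d ^ 3 * (Cmom / T powr m0 + exp (- (real n * Cmom * \<kappa> / (T * Bw)))))
     (\<lambda>\<omega>. \<forall>k\<in>{1..n}. \<forall>j\<in>{1..d}. \<forall>j'\<in>{1..d}. \<forall>j''\<in>{1..d}. (\<Sum>i=1..n. wt (D \<omega>) (U k \<omega>) i
        * \<bar>Mf (W i \<omega>, y i \<omega>)\<bar> * \<bar>x i j \<omega>\<bar> * \<bar>x i j' \<omega>\<bar> * \<bar>x i j'' \<omega>\<bar>) \<le> (3 * real n * Cmom * \<kappa> + T * Bw) / real n)"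
proof -
  interpret S: local_sums M "obs_space d" Zo n uo "kw 0" Bw \<kappa> m0 by (rule local_sums_kw) simp
  let ?q = "Cmom / T powr m0 + exp (- (real n * Cmom * \<kappa> / (T * Bw)))"
  have d: "real (card ({1..d} \<times> {1..d} \<times> {1..d})) = real d ^ 3"
    by (simp add: card_cartesian_product power3_eq_cube)
  have "inner_prob_ge M (1 - real n * real (card ({1..d} \<times> {1..d} \<times> {1..d})) * ?q)
     (\<lambda>\<omega>. \<forall>p\<in>{1..d} \<times> {1..d} \<times> {1..d}. \<forall>k\<in>{1..n}. (\<Sum>i=1..n. \<bar>\<xi>3 p (Zo i \<omega>) * kw 0 (uo (Zo i \<omega>)) (uo (Zo k \<omega>))\<bar>)
        \<le> 3 * real n * Cmom * \<kappa> + T * Bw)"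
    by (rule S.pos_family[OF _ moments(3) T]) auto
  then show ?thesis unfolding d
  proof (rule inner_prob_ge_mono[OF _ order_refl])
    fix \<omega> assume \<omega>: "\<omega> \<in> space M"
      and good: "\<forall>p\<in>{1..d} \<times> {1..d} \<times> {1..d}. \<forall>k\<in>{1..n}. (\<Sum>i=1..n. \<bar>\<xi>3 p (Zo i \<omega>) * kw 0 (uo (Zo i \<omega>)) (uo (Zo k \<omega>))\<bar>)
        \<le> 3 * real n * Cmom * \<kappa> + T * Bw"
    show "\<forall>k\<in>{1..n}. \<forall>j\<in>{1..d}. \<forall>j'\<in>{1..d}. \<forall>j''\<in>{1..d}. (\<Sum>i=1..n. wt (D \<omega>) (U k \<omega>) i
        * \<bar>Mf (W i \<omega>, y i \<omega>)\<bar> * \<bar>x i j \<omega>\<bar> * \<bar>x i j' \<omega>\<bar> * \<bar>x i j'' \<omega>\<bar>) \<le> (3 * real n * Cmom * \<kappa> + T * Bw) / real n"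
    proof (intro ballI)
      fix k j j' j'' assume k: "k \<in> {1..n}" and j: "j \<in> {1..d}" "j' \<in> {1..d}" "j'' \<in> {1..d}"
      have "(\<Sum>i=1..n. wt (D \<omega>) (U k \<omega>) i * \<bar>Mf (W i \<omega>, y i \<omega>)\<bar> * \<bar>x i j \<omega>\<bar> * \<bar>x i j' \<omega>\<bar> * \<bar>x i j'' \<omega>\<bar>)
          = (\<Sum>i=1..n. \<bar>\<xi>3 (j, j', j'') (Zo i \<omega>) * kw 0 (uo (Zo i \<omega>)) (uo (Zo k \<omega>))\<bar> / real n)"
      proof (rule sum.cong[OF refl])
        fix i assume i: "i \<in> {1..n}"
        have "0 \<le> kw 0 (U i \<omega>) (U k \<omega>)" using K_nonneg h by (simp add: kw_def)
        then show "wt (D \<omega>) (U k \<omega>) i * \<bar>Mf (W i \<omega>, y i \<omega>)\<bar> * \<bar>x i j \<omega>\<bar> * \<bar>x i j' \<omega>\<bar> * \<bar>x i j'' \<omega>\<bar>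
            = \<bar>\<xi>3 (j, j', j'') (Zo i \<omega>) * kw 0 (uo (Zo i \<omega>)) (uo (Zo k \<omega>))\<bar> / real n"
          using \<xi>_Zo(3)[OF i \<omega> j] by (simp add: wt_D abs_mult mult_ac)
      qed
      also have "\<dots> = (\<Sum>i=1..n. \<bar>\<xi>3 (j, j', j'') (Zo i \<omega>) * kw 0 (uo (Zo i \<omega>)) (uo (Zo k \<omega>))\<bar>) / real n"
        by (rule sum_divide_distrib[symmetric])
      also have "\<dots> \<le> (3 * real n * Cmom * \<kappa> + T * Bw) / real n"
      proof (rule divide_right_mono)
        show "(\<Sum>i=1..n. \<bar>\<xi>3 (j, j', j'') (Zo i \<omega>) * kw 0 (uo (Zo i \<omega>)) (uo (Zo k \<omega>))\<bar>) \<le> 3 * real n * Cmom * \<kappa> + T * Bw"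
          using good j k by blast
      qed simp
      finally show "(\<Sum>i=1..n. wt (D \<omega>) (U k \<omega>) i * \<bar>Mf (W i \<omega>, y i \<omega>)\<bar> * \<bar>x i j \<omega>\<bar> * \<bar>x i j' \<omega>\<bar> * \<bar>x i j'' \<omega>\<bar>)
        \<le> (3 * real n * Cmom * \<kappa> + T * Bw) / real n" .
    qed
  qed
qed

text \<open>The oracle rate carries no logarithm, so the uniform score bound is too weak for it.
  Markov's inequality for the sum of squares over at most \<open>2 * s2\<close> coordinates per
  observation gives the right order at a fixed probability level.\<close>

lemma mean_square_score_event:
  assumes \<epsilon>: "0 < \<epsilon>"
  defines "V \<equiv> 2 * real s2 * ((2 * (real n * (Bw * (Cmom * \<kappa>))) + 2 * (Bw\<^sup>2 * Cmom)) / real n)"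
  shows "inner_prob_ge M (1 - \<epsilon>) (\<lambda>\<omega>. (\<Sum>k=1..n. \<Sum>p\<in>{1..2 * d} - noise_idx d s1 s2. (true_score (D \<omega>) a k p)\<^sup>2) \<le> V / \<epsilon>)"
proof -
  let ?S = "{1..2 * d} - noise_idx d s1 s2"
  let ?v = "2 * (real n * (Bw * (Cmom * \<kappa>))) + 2 * (Bw\<^sup>2 * Cmom)"
  have v: "0 \<le> ?v" using Cmom_pos \<kappa> Kmax h by simp
  let ?sc = "\<lambda>k p \<omega>. \<Sum>i=1..n. \<xi>1 (if p \<le> d then p else p - d) (Zo i \<omega>)
    * kw (if p \<le> d then 0 else 1) (uo (Zo i \<omega>)) (uo (Zo k \<omega>))"
  have mom: "(\<integral>\<^sup>+\<omega>. ennreal ((?sc k p \<omega>)\<^sup>2) \<partial>M) \<le> ennreal ?v" and meas: "?sc k p \<in> borel_measurable M"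
    if k: "k \<in> {1..n}" and p: "p \<in> {1..2 * d}" for k p
  proof -
    define j where "j = (if p \<le> d then p else p - d)"
    define l :: nat where "l = (if p \<le> d then 0 else 1)"
    have j: "j \<in> {1..d}" using p by (auto simp: j_def)
    have l: "l \<le> 1" by (simp add: l_def)
    interpret S: local_sums M "obs_space d" Zo n uo "kw l" Bw \<kappa> m0 by (rule local_sums_kw[OF l])
    show "(\<integral>\<^sup>+\<omega>. ennreal ((?sc k p \<omega>)\<^sup>2) \<partial>M) \<le> ennreal ?v"
      using S.second_moment[OF moments(1)[OF j] score_mean_zero[OF l j] k] unfolding j_def l_def .
    have "(\<lambda>\<omega>. \<Sum>i=1..n. \<xi>1 j (Zo i \<omega>) * kw l (uo (Zo i \<omega>)) (uo (Zo k \<omega>))) \<in> borel_measurable M"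
      by (intro borel_measurable_sum S.term_meas(1)[OF moments(1)[OF j] _ k]) auto
    then show "?sc k p \<in> borel_measurable M" unfolding j_def l_def .
  qed
  define X where "X \<omega> = (\<Sum>k=1..n. \<Sum>p\<in>?S. (?sc k p \<omega> / real n)\<^sup>2)" for \<omega>
  have X_meas [measurable]: "X \<in> borel_measurable M"
    unfolding X_def by (intro borel_measurable_sum borel_measurable_power borel_measurable_divide meas) auto
  have X0: "0 \<le> X \<omega>" for \<omega> unfolding X_def by (intro sum_nonneg) auto
  have card_S: "card ?S \<le> 2 * s2"
  proof -
    have "?S \<subseteq> {1..s2} \<union> {d + 1..d + s2}" using s by (auto simp: noise_idx_def)
    then have "card ?S \<le> card ({1..s2} \<union> {d + 1..d + s2})" by (intro card_mono) auto
    also have "\<dots> \<le> card {1..s2} + card {d + 1..d + s2}" by (rule card_Un_le)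
    finally show ?thesis by simp
  qed
  have "(\<integral>\<^sup>+\<omega>. ennreal (X \<omega>) \<partial>M) = (\<Sum>k=1..n. \<Sum>p\<in>?S. \<integral>\<^sup>+\<omega>. ennreal ((?sc k p \<omega> / real n)\<^sup>2) \<partial>M)"
  proof -
    have "(\<integral>\<^sup>+\<omega>. ennreal (X \<omega>) \<partial>M) = (\<integral>\<^sup>+\<omega>. (\<Sum>k=1..n. \<Sum>p\<in>?S. ennreal ((?sc k p \<omega> / real n)\<^sup>2)) \<partial>M)"
      unfolding X_def by (intro nn_integral_cong) (simp add: sum_nonneg flip: sum_ennreal)
    also have "\<dots> = (\<Sum>k=1..n. \<integral>\<^sup>+\<omega>. (\<Sum>p\<in>?S. ennreal ((?sc k p \<omega> / real n)\<^sup>2)) \<partial>M)"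
      by (intro nn_integral_sum borel_measurable_sum measurable_compose[OF _ measurable_ennreal]
          borel_measurable_power borel_measurable_divide meas) auto
    also have "\<dots> = (\<Sum>k=1..n. \<Sum>p\<in>?S. \<integral>\<^sup>+\<omega>. ennreal ((?sc k p \<omega> / real n)\<^sup>2) \<partial>M)"
      by (intro sum.cong refl nn_integral_sum measurable_compose[OF _ measurable_ennreal]
          borel_measurable_power borel_measurable_divide meas) auto
    finally show ?thesis .
  qed
  also have "\<dots> \<le> (\<Sum>k=1..n. \<Sum>p\<in>?S. ennreal (?v / (real n)\<^sup>2))"
  proof (intro sum_mono)
    fix k p assume k: "k \<in> {1..n}" and p: "p \<in> ?S"
    have m: "(\<lambda>\<omega>. ennreal ((?sc k p \<omega>)\<^sup>2)) \<in> borel_measurable M"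
      by (intro measurable_compose[OF _ measurable_ennreal] borel_measurable_power meas k) (use p in auto)
    have "(\<integral>\<^sup>+\<omega>. ennreal ((?sc k p \<omega> / real n)\<^sup>2) \<partial>M) = (\<integral>\<^sup>+\<omega>. ennreal (1 / (real n)\<^sup>2) * ennreal ((?sc k p \<omega>)\<^sup>2) \<partial>M)"
      by (intro nn_integral_cong) (simp add: power_divide ennreal_mult[symmetric])
    also have "\<dots> = ennreal (1 / (real n)\<^sup>2) * (\<integral>\<^sup>+\<omega>. ennreal ((?sc k p \<omega>)\<^sup>2) \<partial>M)"
      by (rule nn_integral_cmult[OF m])
    also have "\<dots> \<le> ennreal (1 / (real n)\<^sup>2) * ennreal ?v"
      using p by (intro mult_left_mono mom k) auto
    also have "\<dots> = ennreal (?v / (real n)\<^sup>2)" using v by (simp add: ennreal_mult[symmetric])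
    finally show "(\<integral>\<^sup>+\<omega>. ennreal ((?sc k p \<omega> / real n)\<^sup>2) \<partial>M) \<le> ennreal (?v / (real n)\<^sup>2)" .
  qed
  also have "\<dots> = ennreal (real n * (real (card ?S) * (?v / (real n)\<^sup>2)))"
  proof -
    define c where "c = ?v / (real n)\<^sup>2"
    have "0 \<le> c" using v by (simp add: c_def)
    then show ?thesis unfolding c_def[symmetric] by (simp add: ennreal_of_nat_eq_real_of_nat ennreal_mult)
  qed
  also have "\<dots> \<le> ennreal (real n * (real (2 * s2) * (?v / (real n)\<^sup>2)))"
  proof (intro ennreal_leI mult_left_mono mult_right_mono)
    show "real (card ?S) \<le> real (2 * s2)" using card_S by (rule of_nat_mono)
  qed (use v in auto)
  also have "real n * (real (2 * s2) * (?v / (real n)\<^sup>2)) = V" using n by (simp add: V_def power2_eq_square)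
  finally have EX: "(\<integral>\<^sup>+\<omega>. ennreal (X \<omega>) \<partial>M) \<le> ennreal V" .
  have V: "0 < V" using s n Cmom_pos \<kappa> Kmax h by (simp add: V_def add_pos_nonneg)
  \<comment> \<open>Markov's inequality at level \<open>V / \<epsilon>\<close>, in scaled
    form.\<close>
  have "emeasure M {\<omega>\<in>space M. 1 \<le> ennreal (\<epsilon> / V) * ennreal (X \<omega>)}
      \<le> ennreal (\<epsilon> / V) * (\<integral>\<^sup>+\<omega>. ennreal (X \<omega>) * indicator (space M) \<omega> \<partial>M)"
    by (intro nn_integral_Markov_inequality) auto
  also have "(\<integral>\<^sup>+\<omega>. ennreal (X \<omega>) * indicator (space M) \<omega> \<partial>M) = (\<integral>\<^sup>+\<omega>. ennreal (X \<omega>) \<partial>M)"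
    by (intro nn_integral_cong) auto
  also have "ennreal (\<epsilon> / V) * (\<integral>\<^sup>+\<omega>. ennreal (X \<omega>) \<partial>M) \<le> ennreal (\<epsilon> / V) * ennreal V" by (intro mult_left_mono EX) simp
  also have "\<dots> = ennreal \<epsilon>" using V \<epsilon> by (simp add: ennreal_mult[symmetric])
  finally have "prob {\<omega>\<in>space M. 1 \<le> ennreal (\<epsilon> / V) * ennreal (X \<omega>)} \<le> \<epsilon>"
    using \<epsilon> by (simp add: emeasure_eq_measure ennreal_le_iff)
  moreover have ev: "{\<omega>\<in>space M. 1 \<le> ennreal (\<epsilon> / V) * ennreal (X \<omega>)} \<in> events" by measurable
  ultimately have "1 - \<epsilon> \<le> prob (space M - {\<omega>\<in>space M. 1 \<le> ennreal (\<epsilon> / V) * ennreal (X \<omega>)})"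
    by (subst prob_compl) auto
  moreover have "(\<Sum>k=1..n. \<Sum>p\<in>?S. (true_score (D \<omega>) a k p)\<^sup>2) \<le> V / \<epsilon>"
    if \<omega>: "\<omega> \<in> space M - {\<omega>\<in>space M. 1 \<le> ennreal (\<epsilon> / V) * ennreal (X \<omega>)}" for \<omega>
  proof -
    have "ennreal (\<epsilon> / V) * ennreal (X \<omega>) < ennreal 1" using \<omega> by (auto simp: not_le)
    then have "ennreal (\<epsilon> / V * X \<omega>) < ennreal 1" using X0 V \<epsilon> by (subst (asm) ennreal_mult[symmetric]) auto
    then have "\<epsilon> / V * X \<omega> < 1" using ennreal_less_iff[of "\<epsilon> / V * X \<omega>" 1] X0 V \<epsilon> by simp
    then have "X \<omega> \<le> V / \<epsilon>" using V \<epsilon> by (simp add: field_simps)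
    moreover have "(\<Sum>k=1..n. \<Sum>p\<in>?S. (true_score (D \<omega>) a k p)\<^sup>2) = X \<omega>"
      unfolding X_def using \<omega> by (intro sum.cong refl) (simp only: score_D DiffD1)
    ultimately show ?thesis by simp
  qed
  ultimately show ?thesis unfolding inner_prob_ge_def using ev by (intro bexI[of _ "space M - {\<omega>\<in>space M. 1 \<le> ennreal (\<epsilon> / V) * ennreal (X \<omega>)}"]) auto
qed

end

section \<open>The oracle property\<close>

text \<open>The distance bound for \<open>z\<close> is kept because the theorem is applied a second
  time, to the derivative between \<open>z\<close> and \<open>v\<close>.\<close>

lemma unit_interval_mvt:
  assumes f: "f differentiable_on {0..1}" and uv: "u \<in> {0..1}" "v \<in> {0..1}"
  obtains z where "z \<in> {0..1}" "\<bar>z - v\<bar> \<le> \<bar>u - v\<bar>" "f u - f v = D1 f z * (u - v)"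
proof -
  have der: "(f has_derivative (\<lambda>t. D1 f z * t)) (at z within {0..1})" if "z \<in> {0..1}" for z
  proof -
    have "(f has_vector_derivative D1 f z) (at z within {0..1})"
      using f that unfolding D1_def differentiable_on_def by (simp add: vector_derivative_works)
    then show ?thesis by (simp add: has_vector_derivative_def mult.commute)
  qed
  have mvt: "\<exists>z\<in>{p<..<q}. f q - f p = D1 f z * (q - p)" if "p < q" "p \<in> {0..1}" "q \<in> {0..1}" for p q
    using that by (intro mvt_simple) (auto intro!: has_derivative_subset[OF der])
  show ?thesis
  proof (cases u v rule: linorder_cases)
    case less
    obtain z where "z \<in> {u<..<v}" "f v - f u = D1 f z * (v - u)" using mvt[OF less uv] by blast
    then show ?thesis using uv by (intro that[of z]) (auto simp: algebra_simps)
  next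
    case equal
    then show ?thesis using uv by (intro that[of u]) auto
  next
    case greater
    obtain z where "z \<in> {v<..<u}" "f u - f v = D1 f z * (u - v)" using mvt[OF greater uv(2,1)] by blast
    then show ?thesis using uv by (intro that[of z]) auto
  qed
qed

text \<open>Two applications of the mean value theorem. They give the constant \<open>C\<close>
  where a Taylor formula would give \<open>C/2\<close>, which is irrelevant for rates.\<close>

lemma C2_unit_taylor:
  assumes f: "C2_unit f" and C: "\<And>z. z \<in> {0..1} \<Longrightarrow> \<bar>D1 (D1 f) z\<bar> \<le> C"
    and uv: "u \<in> {0..1}" "v \<in> {0..1}"
  shows "\<bar>f u - f v - D1 f v * (u - v)\<bar> \<le> C * (u - v)\<^sup>2"
proof -
  have diff: "f differentiable_on {0..1}" "D1 f differentiable_on {0..1}" using f by (auto simp: C2_unit_def)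
  obtain z where z: "z \<in> {0..1}" "\<bar>z - v\<bar> \<le> \<bar>u - v\<bar>" "f u - f v = D1 f z * (u - v)"
    by (rule unit_interval_mvt[OF diff(1) uv])
  obtain t where t: "t \<in> {0..1}" "D1 f z - D1 f v = D1 (D1 f) t * (z - v)"
    by (rule unit_interval_mvt[OF diff(2) z(1) uv(2)])
  have "f u - f v - D1 f v * (u - v) = (D1 f z - D1 f v) * (u - v)" using z(3) by (simp add: algebra_simps)
  then have "\<bar>f u - f v - D1 f v * (u - v)\<bar> = \<bar>D1 (D1 f) t\<bar> * \<bar>z - v\<bar> * \<bar>u - v\<bar>"
    by (simp add: t(2) abs_mult)
  also have "\<dots> \<le> C * \<bar>u - v\<bar> * \<bar>u - v\<bar>"
    using C[OF t(1)] z(2) order_trans[OF abs_ge_zero C[OF t(1)]] by (intro mult_mono mult_nonneg_nonneg) auto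
  finally show ?thesis by (simp add: power2_eq_square mult.assoc)
qed

text \<open>Endpoints of the unit interval are limit points of it, so the derivative within the
  interval is unique there too and \<open>D1\<close> takes the expected value.\<close>

lemma D1_const:
  assumes "\<And>v. v \<in> {0..1} \<Longrightarrow> f v = c" and u: "u \<in> {0..1}"
  shows "D1 f u = 0"
proof -
  have "((\<lambda>_. c) has_vector_derivative 0) (at u within {0..1})" by (rule has_vector_derivative_const)
  then have "(f has_vector_derivative 0) (at u within {0..1})"
    by (rule has_vector_derivative_transform[OF u, rotated]) (use assms(1) in auto)
  then show ?thesis unfolding D1_def
    using u vector_derivative_within_cbox[of 0 1 u f 0] by (simp add: cbox_interval)
qed

section \<open>Unique maximisers, extremal values and kernel constants\<close>

lemma is_arg_max_unique:
  fixes f :: "'a \<Rightarrow> real"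
  assumes p: "p \<in> S" "S \<subseteq> S'" and max: "\<forall>q\<in>S'. f q \<le> f p"
    and uniq: "\<forall>q\<in>S'. f p \<le> f q \<longrightarrow> q = p"
  shows "is_arg_max f (\<lambda>q. q \<in> S) q \<longleftrightarrow> q = p" "is_arg_max f (\<lambda>q. q \<in> S') q \<longleftrightarrow> q = p"
  using assms unfolding is_arg_max_linorder by (blast intro: order_antisym)+

lemma Max_le_D:
  fixes f :: "'a \<Rightarrow> 'b::linorder"
  assumes "Max (f ` S) \<le> c" "finite S" "s \<in> S"
  shows "f s \<le> c"
  using assms by (meson Max_ge finite_imageI imageI order_trans)

lemma ereal_abs_leD: "\<bar>x\<bar> \<le> c \<Longrightarrow> x \<le> c" for x c :: ereal
  by (cases x; cases c) auto

lemma Min_ge_D: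
  fixes f :: "'a \<Rightarrow> 'b::linorder"
  assumes "c \<le> Min (f ` S)" "finite S" "s \<in> S"
  shows "c \<le> f s"
  using assms by (meson Min_le finite_imageI imageI order_trans)

lemma kernel_constants:
  fixes K :: "real \<Rightarrow> real"
  assumes cont: "continuous_on UNIV K" and supp: "compact (closure {z. K z \<noteq> 0})"
  obtains \<kappa> Kmax where "1 \<le> \<kappa>" "\<And>z. K z \<noteq> 0 \<Longrightarrow> \<bar>z\<bar> \<le> \<kappa>" "0 < Kmax" "\<And>z. K z \<le> Kmax"
proof -
  obtain b where b: "\<And>z. z \<in> closure {z. K z \<noteq> 0} \<Longrightarrow> norm z \<le> b"
    using compact_imp_bounded[OF supp] by (auto simp: bounded_iff)
  have "bounded (K ` closure {z. K z \<noteq> 0})"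
    using continuous_on_subset[OF cont] by (intro compact_imp_bounded compact_continuous_image supp) auto
  then obtain B where B: "\<And>z. z \<in> closure {z. K z \<noteq> 0} \<Longrightarrow> norm (K z) \<le> B"
    unfolding bounded_iff by blast
  have cl: "z \<in> closure {z. K z \<noteq> 0}" if "K z \<noteq> 0" for z
    by (rule subsetD[OF closure_subset]) (simp add: that)
  show ?thesis
  \<comment> \<open>Raising the radius to at least 1 lets it dominate both the zeroth and the first
    power of the scaled distance.\<close>
  proof (rule that[of "max 1 b" "max 1 B"])
    show "\<bar>z\<bar> \<le> max 1 b" if "K z \<noteq> 0" for z using b[OF cl[OF that]] by simp
    show "K z \<le> max 1 B" for z
    proof (cases "K z = 0")
      case False
      then show ?thesis using B[OF cl[OF False]] by simp
    qed simp
  qed auto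
qed

theorem theorem3p1:
  fixes M :: "nat \<Rightarrow> 'w measure"
    and U :: "nat \<Rightarrow> nat \<Rightarrow> 'w \<Rightarrow> real"
    and x :: "nat \<Rightarrow> nat \<Rightarrow> nat \<Rightarrow> 'w \<Rightarrow> real"
    and y :: "nat \<Rightarrow> nat \<Rightarrow> 'w \<Rightarrow> real"
    and Y :: "real set" and \<nu> :: "real measure"
    and ell :: "real \<Rightarrow> real \<Rightarrow> real" and g :: "real \<Rightarrow> real" and means :: "real set"
    and L :: "real \<Rightarrow> real \<Rightarrow> real"
    and a :: "nat \<Rightarrow> nat \<Rightarrow> real \<Rightarrow> real"
    and d s1 s2 :: "nat \<Rightarrow> nat"
    and K fU :: "real \<Rightarrow> real"
    and h lam1 lam2 lam4 lam4s b :: "nat \<Rightarrow> real"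
    and m0 \<delta> \<tau>1 \<delta>1 \<rho>1 \<rho>2 bd :: real
    and D :: "nat \<Rightarrow> 'w \<Rightarrow> fitdata"
    and W :: "nat \<Rightarrow> nat \<Rightarrow> 'w \<Rightarrow> real \<times> (nat \<Rightarrow> real)"
    and Q1 Q2 :: "nat \<Rightarrow> nat \<Rightarrow> 'w \<Rightarrow> real"
    and At Bt A0 B0 :: "nat \<Rightarrow> 'w \<Rightarrow> nat \<Rightarrow> nat \<Rightarrow> real"
  \<comment> \<open>notation\<close>
  assumes L_eq: "L = (\<lambda>s t. ell (inv_into means g s) t)"
    and D_eq: "D = (\<lambda>n \<omega>. \<lparr>nobs = n, ncov = d n, bw = h n, kern = K, ll = L,
                 idx = (\<lambda>i. U n i \<omega>), cov = (\<lambda>i j. x n i j \<omega>), resp = (\<lambda>i. y n i \<omega>)\<rparr>)"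
    and W_eq: "W = (\<lambda>n i \<omega>. (U n i \<omega>, \<lambda>j\<in>{1..d n}. x n i j \<omega>))"
    and Q1_eq: "Q1 = (\<lambda>n i \<omega>. q1 L (\<Sum>j=1..d n. a n j (U n i \<omega>) * x n i j \<omega>) (y n i \<omega>))"
    and Q2_eq: "Q2 = (\<lambda>n i \<omega>. q2 L (\<Sum>j=1..d n. a n j (U n i \<omega>) * x n i j \<omega>) (y n i \<omega>))"
    and A0_eq: "A0 = (\<lambda>n \<omega> k j. a n j (U n k \<omega>))"
    and B0_eq: "B0 = (\<lambda>n \<omega> k j. D1 (a n j) (U n k \<omega>))"
  \<comment> \<open>i.i.d. sample\<close>
    and prob: "\<And>n. prob_space (M n)"
    and indep: "\<And>n. n \<ge> 1 \<Longrightarrow>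
        prob_space.indep_vars (M n) (\<lambda>_. obs_space (d n)) (\<lambda>i \<omega>. (W n i \<omega>, y n i \<omega>)) {1..n}"
    and ident: "\<And>n i. n \<ge> 1 \<Longrightarrow> i \<in> {1..n} \<Longrightarrow>
        distr (M n) (obs_space (d n)) (\<lambda>\<omega>. (W n i \<omega>, y n i \<omega>)) =
        distr (M n) (obs_space (d n)) (\<lambda>\<omega>. (W n 1 \<omega>, y n 1 \<omega>))"
    and U_range: "\<And>n i \<omega>. n \<ge> 1 \<Longrightarrow> i \<in> {1..n} \<Longrightarrow> \<omega> \<in> space (M n) \<Longrightarrow> U n i \<omega> \<in> {0..1}"
    and y_range: "\<And>n i \<omega>. n \<ge> 1 \<Longrightarrow> i \<in> {1..n} \<Longrightarrow> \<omega> \<in> space (M n) \<Longrightarrow> y n i \<omega> \<in> Y"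
    and d_lim: "filterlim d at_top sequentially"
  \<comment> \<open>generalised semi-varying coefficient model\<close>
    and resp_meas: "response_measure Y \<nu>"
    and link: "bij_betw g means UNIV"
    and L_meas: "(\<lambda>(s, t). L s t) \<in> borel_measurable (borel \<Otimes>\<^sub>M borel)"
    and L_diff: "\<And>t s. t \<in> Y \<Longrightarrow> (\<lambda>r. L r t) differentiable (at s)"
                "\<And>t s. t \<in> Y \<Longrightarrow> (\<lambda>r. q1 L r t) differentiable (at s)"
    and y_int: "\<And>n i. n \<ge> 1 \<Longrightarrow> i \<in> {1..n} \<Longrightarrow> integrable (M n) (y n i)"
    and mean: "\<And>n i. n \<ge> 1 \<Longrightarrow> i \<in> {1..n} \<Longrightarrow>
        (AE \<omega> in M n.
           real_cond_exp (M n) (sigma_of (M n) (W n i) (covariate_space (d n))) (y n i) \<omega> \<in> means \<and>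
           g (real_cond_exp (M n) (sigma_of (M n) (W n i) (covariate_space (d n))) (y n i) \<omega>)
             = (\<Sum>j=1..d n. a n j (U n i \<omega>) * x n i j \<omega>))"
    and cond_dens: "\<And>n i S. n \<ge> 1 \<Longrightarrow> i \<in> {1..n} \<Longrightarrow> S \<in> sets borel \<Longrightarrow>
        (AE \<omega> in M n.
           nn_cond_exp (M n) (sigma_of (M n) (W n i) (covariate_space (d n)))
             (\<lambda>\<omega>'. indicator S (y n i \<omega>')) \<omega>
           = (\<integral>\<^sup>+t\<in>S. ennreal (exp (ell
               (real_cond_exp (M n) (sigma_of (M n) (W n i) (covariate_space (d n))) (y n i) \<omega>)
               t)) \<partial>\<nu>))"
    and sizes: "\<And>n. n \<ge> 1 \<Longrightarrow> 1 \<le> s1 n \<and> s1 n < s2 n \<and> s2 n < d n"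
    and s2_small: "(\<lambda>n. real (s2 n)) \<in> o(\<lambda>n. real n)" "(\<lambda>n. real (s2 n)) \<in> o(\<lambda>n. real (d n))"
    and varying: "\<And>n j. n \<ge> 1 \<Longrightarrow> j \<in> {1..s1 n} \<Longrightarrow> \<not> (a n j) constant_on {0..1}"
    and const: "\<And>n j. n \<ge> 1 \<Longrightarrow> j \<in> {s1 n + 1..s2 n} \<Longrightarrow> \<exists>c. c \<noteq> 0 \<and> (\<forall>u\<in>{0..1}. a n j u = c)"
    and zero: "\<And>n j. n \<ge> 1 \<Longrightarrow> j \<in> {s2 n + 1..d n} \<Longrightarrow> (\<forall>u\<in>{0..1}. a n j u = 0)"
  \<comment> \<open>tuning parameters and preliminary estimator\<close>
    and pos: "\<And>n. n \<ge> 1 \<Longrightarrow> h n > 0 \<and> lam1 n > 0 \<and> lam2 n > 0 \<and> lam4 n > 0 \<and> lam4s n > 0"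
    and prelim: "wp_to_1 M (\<lambda>n \<omega>. \<forall>k\<in>{1..n}.
        is_arg_max (prelim_obj (D n \<omega>) (lam1 n) (lam2 n) k)
          (\<lambda>p. p \<in> vecs (d n) \<times> vecs (d n)) (At n \<omega> k, Bt n \<omega> k))"
  \<comment> \<open>condition (1)\<close>
    and c1: "continuous_on UNIV K" "\<And>z. K (- z) = K z" "\<And>z. K z \<ge> 0"
            "(LINT z|lborel. K z) = 1" "compact (closure {z. K z \<noteq> 0})"
  \<comment> \<open>condition (2a)\<close>
    and m0: "m0 > 2"
    and c2a_mean: "\<And>n i. n \<ge> 1 \<Longrightarrow> i \<in> {1..n} \<Longrightarrow> integrable (M n) (Q1 n i) \<and>
        (AE \<omega> in M n.
           real_cond_exp (M n) (sigma_of (M n) (W n i) (covariate_space (d n))) (Q1 n i) \<omega> = 0)"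
    and c2a_cont: "\<And>n i. n \<ge> 1 \<Longrightarrow> i \<in> {1..n} \<Longrightarrow>
        (\<exists>\<phi>. continuous_on {0..1} \<phi> \<and>
          (AE \<omega> in M n.
             nn_cond_exp (M n) (sigma_of (M n) (U n i) borel) (\<lambda>\<omega>'. ennreal ((Q1 n i \<omega>')\<^sup>2)) \<omega>
             = ennreal (\<phi> (U n i \<omega>))))"
    and c2a_mom: "\<exists>C. \<forall>n\<ge>1. \<forall>i\<in>{1..n}. AE \<omega> in M n.
        (MAX j\<in>{1..d n}. nn_cond_exp (M n) (sigma_of (M n) (U n i) borel)
           (\<lambda>\<omega>'. ennreal (\<bar>Q1 n i \<omega>' * x n i j \<omega>'\<bar> powr m0)) \<omega>)
        + (MAX (j, k)\<in>{1..d n} \<times> {1..d n}. nn_cond_exp (M n) (sigma_of (M n) (U n i) borel)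
           (\<lambda>\<omega>'. ennreal (\<bar>Q2 n i \<omega>' * x n i j \<omega>' * x n i k \<omega>'\<bar> powr m0)) \<omega>)
        \<le> ennreal C"
  \<comment> \<open>condition (2b)\<close>
    and c2b_neg: "\<And>s t. t \<in> Y \<Longrightarrow> q2 L s t < 0"
    and c2b_lip: "\<exists>Mf C. \<forall>n\<ge>1.
        Mf n \<in> borel_measurable (obs_space (d n)) \<and>
        (\<forall>i\<in>{1..n}.
          (AE \<omega> in M n. Mf n (W n i \<omega>, y n i \<omega>) > 0 \<and>
             (\<forall>\<delta>'. \<bar>q2 L ((\<Sum>j=1..d n. a n j (U n i \<omega>) * x n i j \<omega>) + \<delta>') (y n i \<omega>)
                     - q2 L (\<Sum>j=1..d n. a n j (U n i \<omega>) * x n i j \<omega>) (y n i \<omega>)\<bar>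
                    \<le> Mf n (W n i \<omega>, y n i \<omega>) * \<bar>\<delta>'\<bar>)) \<and>
          (AE \<omega> in M n.
             (MAX (j, k, l)\<in>{1..d n} \<times> {1..d n} \<times> {1..d n}.
                nn_cond_exp (M n) (sigma_of (M n) (U n i) borel)
                  (\<lambda>\<omega>'. ennreal (\<bar>x n i j \<omega>' * x n i k \<omega>' * x n i l \<omega>'
                                  * Mf n (W n i \<omega>', y n i \<omega>')\<bar> powr m0)) \<omega>)
             \<le> ennreal C))"
  \<comment> \<open>condition (2c)\<close>
    and \<delta>: "\<delta> > 0" and b_eq: "b = (\<lambda>n. max (lam1 n / lam2 n) (lam2 n / lam1 n) + \<delta>)"
    and c2c: "0 < \<rho>1" "\<rho>1 \<le> \<rho>2"
        "wp_to_1 M (\<lambda>n \<omega>.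
           ereal \<rho>1 \<le> (INF u\<in>{0..1}. INF v\<in>Omega0 (d n) (s2 n) (b n).
              ereal (quad_form (2 * d n) (\<lambda>p q. - true_hess (D n \<omega>) (a n) u p q) v)) \<and>
           (SUP u\<in>{0..1}. SUP v\<in>Omega0 (d n) (s2 n) (b n).
              ereal (quad_form (2 * d n) (\<lambda>p q. - true_hess (D n \<omega>) (a n) u p q) v)) \<le> ereal \<rho>2)"
  \<comment> \<open>condition (3)\<close>
    and c3: "\<And>n i. n \<ge> 1 \<Longrightarrow> i \<in> {1..n} \<Longrightarrow>
               distributed (M n) lborel (U n i) (\<lambda>u. ennreal (fU u) * indicator {0..1} u)"
            "C2_unit fU"
            "\<exists>c1 c2. 0 < c1 \<and> (\<forall>u\<in>{0..1}. c1 \<le> fU u \<and> fU u \<le> c2)"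
  \<comment> \<open>condition (4)\<close>
    and c4: "\<And>n j. n \<ge> 1 \<Longrightarrow> j \<in> {1..d n} \<Longrightarrow> C2_unit (a n j)"
            "\<exists>C. \<forall>n\<ge>1. \<forall>j\<in>{1..d n}. \<forall>u\<in>{0..1}. \<bar>D1 (D1 (a n j)) u\<bar> \<le> C"
  \<comment> \<open>condition (5)\<close>
    and c5: "0 \<le> \<tau>1" "(\<lambda>n. real (d n)) \<propto> (\<lambda>n. real n powr \<tau>1)"
            "filterlim (\<lambda>n. real n * h n /
               ((real n * real (d n) ^ 3) powr (2 / m0) * ln (1 / h n))) at_top sequentially"
            "0 < \<delta>1" "\<delta>1 < 1" "h \<propto> (\<lambda>n. real n powr (- \<delta>1))"
            "(\<lambda>n. real (s2 n) * (h n)\<^sup>2 + sqrt (ln (1 / h n) / (real n * h n))) \<in> o(lam1)"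
            "lam1 \<propto> lam2"
            "(\<lambda>n. real (s2 n) * (lam1 n)\<^sup>2 / (h n)\<^sup>2 + (real (s2 n))\<^sup>2 * lam1 n) \<in> o(\<lambda>_. 1)"
  \<comment> \<open>condition (6a)\<close>
    and c6a: "(\<lambda>n. real (s2 n) * (h n)\<^sup>2) \<propto> (\<lambda>n. (real n * h n) powr (- (1 / 2)))"
             "lam4 \<sim>[sequentially] lam4s" "lam4 \<in> o(\<lambda>n. sqrt (real n))"
             "(\<lambda>n. (h n) powr (- (1 / 2)) *
                (sqrt (ln (1 / h n)) + sqrt (real (s2 n)) * (1 + lam1 n * sqrt (real n * h n))))
              \<in> o(lam4)"
  \<comment> \<open>condition (6b)\<close>
    and c6b_signal: "bd > 0"
        "wp_to_1 M (\<lambda>n \<omega>.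
           (MIN j\<in>{1..s2 n}. L2_set (\<lambda>k. A0 n \<omega> k j) {1..n}) \<ge> bd * sqrt (real n) \<and>
           (MIN j\<in>{1..s1 n}. centred_norm n (\<lambda>k. A0 n \<omega> k j)) \<ge> bd * sqrt (real n))"
    and c6b_rows: "bigO_P M (\<lambda>n \<omega>.
           SUP k\<in>noise_idx (d n) (s1 n) (s2 n). SUP u\<in>{0..1}.
             SUP w\<in>oracle_sphere (d n) (s1 n) (s2 n).
               ereal \<bar>\<Sum>q=1..2 * d n. true_hess (D n \<omega>) (a n) u k q * w q\<bar>) (\<lambda>_. 1)"
  shows "wp_to_1 M (\<lambda>n \<omega>.
           (\<exists>!p. is_arg_max (scad_obj (D n \<omega>) (At n \<omega>) (Bt n \<omega>) (lam4 n) (lam4s n))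
                   (\<lambda>p. p \<in> arrays n (d n) \<times> arrays n (d n)) p) \<and>
           (\<exists>!p. is_arg_max (scad_obj (D n \<omega>) (At n \<omega>) (Bt n \<omega>) (lam4 n) (lam4s n))
                   (\<lambda>p. p \<in> oracle_arrays n (d n) (s1 n) (s2 n)) p) \<and>
           scad_est (D n \<omega>) (At n \<omega>) (Bt n \<omega>) (lam4 n) (lam4s n)
             = oracle_est (D n \<omega>) (s1 n) (s2 n) (At n \<omega>) (Bt n \<omega>) (lam4 n) (lam4s n)) \<and>
         bigO_P M (\<lambda>n \<omega>. ereal (1 / real n * (array_norm n (d n) (\<lambda>k j.
             fst (oracle_est (D n \<omega>) (s1 n) (s2 n) (At n \<omega>) (Bt n \<omega>) (lam4 n) (lam4s n)) k j
             - A0 n \<omega> k j))\<^sup>2))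
           (\<lambda>n. real (s2 n) / (real n * h n)) \<and>
         bigO_P M (\<lambda>n \<omega>. ereal (1 / real n * (array_norm n (d n) (\<lambda>k j.
             snd (oracle_est (D n \<omega>) (s1 n) (s2 n) (At n \<omega>) (Bt n \<omega>) (lam4 n) (lam4s n)) k j
             - B0 n \<omega> k j))\<^sup>2))
           (\<lambda>n. real (s2 n) / (real n * (h n) ^ 3))"
proof -
  obtain \<kappa> Kmax where \<kappa>: "1 \<le> \<kappa>" "\<And>z. K z \<noteq> 0 \<Longrightarrow> \<bar>z\<bar> \<le> \<kappa>" and Kmax: "0 < Kmax" "\<And>z. K z \<le> Kmax"
    using kernel_constants[OF c1(1,5)] by blast
  obtain Ca' where Ca': "\<And>n j u. n \<ge> 1 \<Longrightarrow> j \<in> {1..d n} \<Longrightarrow> u \<in> {0..1} \<Longrightarrow> \<bar>D1 (D1 (a n j)) u\<bar> \<le> Ca'"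
    using c4(2) by blast
  define Ca where "Ca = max 0 Ca'"
  have Ca: "0 \<le> Ca" "\<And>n j u. n \<ge> 1 \<Longrightarrow> j \<in> {1..d n} \<Longrightarrow> u \<in> {0..1} \<Longrightarrow> \<bar>D1 (D1 (a n j)) u\<bar> \<le> Ca"
    using Ca' by (auto simp: Ca_def intro: order_trans[OF _ max.cobounded2])
  obtain cU' cU where cU': "0 < cU'" "\<And>u. u \<in> {0..1} \<Longrightarrow> cU' \<le> fU u \<and> fU u \<le> cU"
    using c3(3) by blast
  have cU: "0 < cU" using cU'(1) cU'(2)[of 0] by auto
  obtain Cm1 where Cm1: "\<And>n i. n \<ge> 1 \<Longrightarrow> i \<in> {1..n} \<Longrightarrow> AE \<omega> in M n.
        (MAX j\<in>{1..d n}. nn_cond_exp (M n) (sigma_of (M n) (U n i) borel)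
           (\<lambda>\<omega>'. ennreal (\<bar>Q1 n i \<omega>' * x n i j \<omega>'\<bar> powr m0)) \<omega>)
        + (MAX (j, k)\<in>{1..d n} \<times> {1..d n}. nn_cond_exp (M n) (sigma_of (M n) (U n i) borel)
           (\<lambda>\<omega>'. ennreal (\<bar>Q2 n i \<omega>' * x n i j \<omega>' * x n i k \<omega>'\<bar> powr m0)) \<omega>)
        \<le> ennreal Cm1"
    using c2a_mom by blast
  obtain Mf Cm2 where Mf: "\<And>n. n \<ge> 1 \<Longrightarrow> Mf n \<in> borel_measurable (obs_space (d n))"
      "\<And>n i. n \<ge> 1 \<Longrightarrow> i \<in> {1..n} \<Longrightarrow> AE \<omega> in M n. Mf n (W n i \<omega>, y n i \<omega>) > 0 \<and>
             (\<forall>\<delta>'. \<bar>q2 L ((\<Sum>j=1..d n. a n j (U n i \<omega>) * x n i j \<omega>) + \<delta>') (y n i \<omega>)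
                     - q2 L (\<Sum>j=1..d n. a n j (U n i \<omega>) * x n i j \<omega>) (y n i \<omega>)\<bar>
                    \<le> Mf n (W n i \<omega>, y n i \<omega>) * \<bar>\<delta>'\<bar>)"
      "\<And>n i. n \<ge> 1 \<Longrightarrow> i \<in> {1..n} \<Longrightarrow> AE \<omega> in M n.
             (MAX (j, k, l)\<in>{1..d n} \<times> {1..d n} \<times> {1..d n}.
                nn_cond_exp (M n) (sigma_of (M n) (U n i) borel)
                  (\<lambda>\<omega>'. ennreal (\<bar>x n i j \<omega>' * x n i k \<omega>' * x n i l \<omega>'
                                  * Mf n (W n i \<omega>', y n i \<omega>')\<bar> powr m0)) \<omega>)
             \<le> ennreal Cm2"
    using c2b_lip by blast
  \<comment> \<open>\<open>ennreal\<close> sends negative constants to 0, so the maximum with 0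
    changes none of the bounds.\<close>
  define Cm where "Cm = max 0 (max Cm1 Cm2)"
  have Cm: "0 \<le> Cm" "ennreal Cm1 \<le> ennreal Cm" "ennreal Cm2 \<le> ennreal Cm"
    by (auto simp: Cm_def intro!: ennreal_leI)
  have Y_borel: "Y \<in> sets borel"
    using resp_meas by (auto simp: response_measure_def intro: sets.countable)
  have samp: "sample (M n) n (d n) (s1 n) (s2 n) (U n) (x n) (y n) Y L (a n) K fU (h n) m0 Cm cU \<kappa> Kmax
      (Mf n) (W n) (Q1 n) (Q2 n) (D n)" if n: "1 \<le> n" for n
  proof -
    interpret prob_space "M n" by (rule prob)
    show ?thesis
    proof
      show "W n = (\<lambda>i \<omega>. (U n i \<omega>, \<lambda>j\<in>{1..d n}. x n i j \<omega>))" by (simp add: W_eq)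
      show "Q1 n = (\<lambda>i \<omega>. q1 L (\<Sum>j=1..d n. a n j (U n i \<omega>) * x n i j \<omega>) (y n i \<omega>))"
        unfolding Q1_eq ..
      show "Q2 n = (\<lambda>i \<omega>. q2 L (\<Sum>j=1..d n. a n j (U n i \<omega>) * x n i j \<omega>) (y n i \<omega>))"
        unfolding Q2_eq ..
      show "D n = (\<lambda>\<omega>. \<lparr>nobs = n, ncov = d n, bw = h n, kern = K, ll = L,
                 idx = (\<lambda>i. U n i \<omega>), cov = (\<lambda>i j. x n i j \<omega>), resp = (\<lambda>i. y n i \<omega>)\<rparr>)"
        unfolding D_eq ..
      show "1 \<le> n" by (rule n)
      show "1 \<le> s1 n" "s1 n < s2 n" "s2 n < d n" using sizes[OF n] by auto
      show "indep_vars (\<lambda>_. obs_space (d n)) (\<lambda>i \<omega>. (W n i \<omega>, y n i \<omega>)) {1..n}" by (rule indep[OF n])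
      show "\<And>i \<omega>. i \<in> {1..n} \<Longrightarrow> \<omega> \<in> space (M n) \<Longrightarrow> U n i \<omega> \<in> {0..1}" by (rule U_range[OF n])
      show "\<And>i \<omega>. i \<in> {1..n} \<Longrightarrow> \<omega> \<in> space (M n) \<Longrightarrow> y n i \<omega> \<in> Y" by (rule y_range[OF n])
      show "Y \<in> sets borel" by (rule Y_borel)
      show "(\<lambda>(s, t). L s t) \<in> borel_measurable (borel \<Otimes>\<^sub>M borel)" by (rule L_meas)
      show "\<And>t s. t \<in> Y \<Longrightarrow> (\<lambda>r. L r t) differentiable (at s)" by (rule L_diff(1))
      show "\<And>t s. t \<in> Y \<Longrightarrow> (\<lambda>r. q1 L r t) differentiable (at s)" by (rule L_diff(2))
      show "\<And>i. i \<in> {1..n} \<Longrightarrow> integrable (M n) (Q1 n i) \<and>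
        (AE \<omega> in M n. real_cond_exp (M n) (sigma_of (M n) (W n i) (covariate_space (d n))) (Q1 n i) \<omega> = 0)"
        by (rule c2a_mean[OF n])
      show "0 \<le> Cm" by (rule Cm)
      show "Mf n \<in> borel_measurable (obs_space (d n))" by (rule Mf(1)[OF n])
      show "\<And>i. i \<in> {1..n} \<Longrightarrow> distributed (M n) lborel (U n i) (\<lambda>u. ennreal (fU u) * indicator {0..1} u)"
        by (rule c3(1)[OF n])
      show "\<And>u. u \<in> {0..1} \<Longrightarrow> fU u \<le> cU" using cU'(2) by blast
      show "0 < cU" by (rule cU)
      show "continuous_on UNIV K" "\<And>z. 0 \<le> K z" "(LINT z|lborel. K z) = 1" by (rule c1)+
      show "\<And>z. K z \<noteq> 0 \<Longrightarrow> \<bar>z\<bar> \<le> \<kappa>" "\<And>z. K z \<le> Kmax" "1 \<le> \<kappa>" "0 < Kmax" by (fact \<kappa> Kmax)+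
      show "0 < h n" using pos[OF n] by simp
      show "2 < m0" by (rule m0)
      show "\<And>j. j \<in> {1..d n} \<Longrightarrow> continuous_on {0..1} (a n j)"
        using c4(1)[OF n] by (auto simp: C2_unit_def intro: differentiable_imp_continuous_on)
    next
      fix i j assume i: "i \<in> {1..n}" and j: "j \<in> {1..d n}"
      show "AE \<omega> in M n. nn_cond_exp (M n) (sigma_of (M n) (U n i) borel)
          (\<lambda>\<omega>'. ennreal (\<bar>Q1 n i \<omega>' * x n i j \<omega>'\<bar> powr m0)) \<omega> \<le> ennreal Cm"
        using Cm1[OF n i]
      proof eventually_elim
        case (elim \<omega>)
        have "(MAX j\<in>{1..d n}. nn_cond_exp (M n) (sigma_of (M n) (U n i) borel)
           (\<lambda>\<omega>'. ennreal (\<bar>Q1 n i \<omega>' * x n i j \<omega>'\<bar> powr m0)) \<omega>) \<le> ennreal Cm1"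
          using elim by (rule order_trans[rotated]) simp
        from Max_le_D[OF this _ j] have "nn_cond_exp (M n) (sigma_of (M n) (U n i) borel)
           (\<lambda>\<omega>'. ennreal (\<bar>Q1 n i \<omega>' * x n i j \<omega>'\<bar> powr m0)) \<omega> \<le> ennreal Cm1"
          by simp
        then show ?case using Cm(2) by (rule order_trans)
      qed
    next
      fix i j k assume i: "i \<in> {1..n}" and j: "j \<in> {1..d n}" and k: "k \<in> {1..d n}"
      show "AE \<omega> in M n. nn_cond_exp (M n) (sigma_of (M n) (U n i) borel)
          (\<lambda>\<omega>'. ennreal (\<bar>Q2 n i \<omega>' * x n i j \<omega>' * x n i k \<omega>'\<bar> powr m0)) \<omega> \<le> ennreal Cm"
        using Cm1[OF n i]
      proof eventually_elim
        case (elim \<omega>)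
        have "(MAX (j, k)\<in>{1..d n} \<times> {1..d n}. nn_cond_exp (M n) (sigma_of (M n) (U n i) borel)
           (\<lambda>\<omega>'. ennreal (\<bar>Q2 n i \<omega>' * x n i j \<omega>' * x n i k \<omega>'\<bar> powr m0)) \<omega>) \<le> ennreal Cm1"
          using elim by (rule order_trans[rotated]) simp
        from Max_le_D[OF this, of "(j, k)"] have "nn_cond_exp (M n) (sigma_of (M n) (U n i) borel)
           (\<lambda>\<omega>'. ennreal (\<bar>Q2 n i \<omega>' * x n i j \<omega>' * x n i k \<omega>'\<bar> powr m0)) \<omega> \<le> ennreal Cm1"
          using j k by simp
        then show ?case using Cm(2) by (rule order_trans)
      qed
    next
      fix i j k l assume i: "i \<in> {1..n}" and j: "j \<in> {1..d n}" and k: "k \<in> {1..d n}" and l: "l \<in> {1..d n}"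
      show "AE \<omega> in M n. nn_cond_exp (M n) (sigma_of (M n) (U n i) borel)
          (\<lambda>\<omega>'. ennreal (\<bar>x n i j \<omega>' * x n i k \<omega>' * x n i l \<omega>' * Mf n (W n i \<omega>', y n i \<omega>')\<bar> powr m0)) \<omega> \<le> ennreal Cm"
        using Mf(3)[OF n i]
      proof eventually_elim
        case (elim \<omega>)
        from Max_le_D[OF elim, of "(j, k, l)"] have "nn_cond_exp (M n) (sigma_of (M n) (U n i) borel)
          (\<lambda>\<omega>'. ennreal (\<bar>x n i j \<omega>' * x n i k \<omega>' * x n i l \<omega>' * Mf n (W n i \<omega>', y n i \<omega>')\<bar> powr m0)) \<omega> \<le> ennreal Cm2"
          using j k l by simp
        then show ?case using Cm(3) by (rule order_trans)
      qed
    qed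
  qed
  interpret rt: rates d s2 h lam1 lam2 lam4 lam4s m0 \<tau>1 \<delta>1
  proof
    show "1 \<le> s2 n \<and> 1 \<le> d n" if "n \<ge> 1" for n using sizes[OF that] by auto
  qed (fact pos m0 c5 c6a)+
  \<comment> \<open>\<open>B0' / h\<close> is the supremum of the kernel weights and
    \<open>Cmo\<close> the moment constant of every row. \<open>A\<close> is the threshold from
    \<open>stochastic_rates\<close> with integral bound \<kappa>; the score level is
    \<open>A + B0'\<close> because the k-th summand adds at most \<open>B0' * r\<close>.\<close>
  define B0' where "B0' = \<kappa> * Kmax"
  define Cmo where "Cmo = (1 + Cm) * cU"
  define A where "A = rt.A0 + (1 + B0') * (Cmo * \<kappa>)"
  \<comment> \<open>The tail bound for nonnegative sums gives \<open>3 * Cmo * \<kappa>\<close>; the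
    1 is for the k-th summand.\<close>
  define C2x where "C2x = 3 * Cmo * \<kappa> + 1"
  have B0': "0 < B0'" using \<kappa> Kmax by (simp add: B0'_def)
  have Cmo: "0 < Cmo" using Cm cU by (simp add: Cmo_def)
  have \<kappa>0: "0 < \<kappa>" using \<kappa> by simp
  have A: "0 \<le> A" using rt.A0_pos B0' Cmo \<kappa>0 by (simp add: A_def)
  have C2x: "0 \<le> C2x" using Cmo \<kappa>0 by (simp add: C2x_def)
  \<comment> \<open>The constants in \<open>G1\<close> to \<open>G7\<close> are fixed, and these
    events have probability tending to one. \<open>H1\<close> and \<open>H2\<close> are kept apart:
    their constants depend on the probability level.\<close>
  define G1 where "G1 n \<omega> \<longleftrightarrow> (\<forall>k\<in>{1..n}. \<forall>p\<in>{1..2 * d n}. \<bar>true_score (D n \<omega>) (a n) k p\<bar> \<le> (A + B0') * rt.r n)" for n \<omega>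
  define G2 where "G2 n \<omega> \<longleftrightarrow> (\<forall>k\<in>{1..n}. \<forall>j\<in>{1..d n}. \<forall>j'\<in>{1..d n}. (\<Sum>i=1..n. wt (D n \<omega>) (U n k \<omega>) i
        * \<bar>q2 L (true_pred (D n \<omega>) (a n) i) (y n i \<omega>)\<bar> * \<bar>x n i j \<omega>\<bar> * \<bar>x n i j' \<omega>\<bar>) \<le> C2x)" for n \<omega>
  define G3 where "G3 n \<omega> \<longleftrightarrow> (\<forall>k\<in>{1..n}. \<forall>j\<in>{1..d n}. \<forall>j'\<in>{1..d n}. \<forall>j''\<in>{1..d n}. (\<Sum>i=1..n. wt (D n \<omega>) (U n k \<omega>) i
        * \<bar>Mf n (W n i \<omega>, y n i \<omega>)\<bar> * \<bar>x n i j \<omega>\<bar> * \<bar>x n i j' \<omega>\<bar> * \<bar>x n i j'' \<omega>\<bar>) \<le> C2x)" for n \<omega>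
  define G4 where "G4 n \<omega> \<longleftrightarrow> (\<forall>i\<in>{1..n}. Mf n (W n i \<omega>, y n i \<omega>) > 0 \<and>
             (\<forall>\<delta>'. \<bar>q2 L ((\<Sum>j=1..d n. a n j (U n i \<omega>) * x n i j \<omega>) + \<delta>') (y n i \<omega>)
                     - q2 L (\<Sum>j=1..d n. a n j (U n i \<omega>) * x n i j \<omega>) (y n i \<omega>)\<bar>
                    \<le> Mf n (W n i \<omega>, y n i \<omega>) * \<bar>\<delta>'\<bar>))" for n \<omega>
  define G5 where "G5 n \<omega> \<longleftrightarrow> (\<forall>k\<in>{1..n}. is_arg_max (prelim_obj (D n \<omega>) (lam1 n) (lam2 n) k)
          (\<lambda>p. p \<in> vecs (d n) \<times> vecs (d n)) (At n \<omega> k, Bt n \<omega> k))" for n \<omega>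
  define G6 where "G6 n \<omega> \<longleftrightarrow> (\<forall>u\<in>{0..1}. \<forall>v\<in>Omega0 (d n) (s2 n) (b n).
      \<rho>1 \<le> quad_form (2 * d n) (\<lambda>p q. - true_hess (D n \<omega>) (a n) u p q) v)" for n \<omega>
  define G7 where "G7 n \<omega> \<longleftrightarrow> (\<forall>j\<in>{1..s2 n}. bd * sqrt (real n) \<le> L2_set (\<lambda>k. A0 n \<omega> k j) {1..n}) \<and>
      (\<forall>j\<in>{1..s1 n}. bd * sqrt (real n) \<le> centred_norm n (\<lambda>k. A0 n \<omega> k j))" for n \<omega>
  define H1 where "H1 C n \<omega> \<longleftrightarrow> (\<forall>k\<in>noise_idx (d n) (s1 n) (s2 n). \<forall>u\<in>{0..1}. \<forall>w\<in>oracle_sphere (d n) (s1 n) (s2 n).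
      \<bar>\<Sum>q=1..2 * d n. true_hess (D n \<omega>) (a n) u k q * w q\<bar> \<le> C)" for C n \<omega>
  define H2 where "H2 C n \<omega> \<longleftrightarrow> (\<Sum>k=1..n. \<Sum>p\<in>{1..2 * d n} - noise_idx (d n) (s1 n) (s2 n).
      (true_score (D n \<omega>) (a n) k p)\<^sup>2) \<le> C * real (s2 n) / h n" for C n \<omega>
  define obj where "obj n \<omega> = scad_obj (D n \<omega>) (At n \<omega>) (Bt n \<omega>) (lam4 n) (lam4s n)" for n \<omega>
  \<comment> \<open>The conclusion is phrased with an explicit maximiser, so that no choice operator
    is involved before uniqueness is known.\<close>
  define Concl where "Concl C n \<omega> \<longleftrightarrow> (\<exists>A B. (A, B) \<in> oracle_arrays n (d n) (s1 n) (s2 n)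
      \<and> (\<forall>q\<in>arrays n (d n) \<times> arrays n (d n). obj n \<omega> q \<le> obj n \<omega> (A, B))
      \<and> (\<forall>q\<in>arrays n (d n) \<times> arrays n (d n). obj n \<omega> (A, B) \<le> obj n \<omega> q \<longrightarrow> q = (A, B))
      \<and> (array_norm n (d n) (\<lambda>k j. A k j - A0 n \<omega> k j))\<^sup>2 \<le> C * (real (s2 n) / h n)
      \<and> (h n)\<^sup>2 * (array_norm n (d n) (\<lambda>k j. B k j - B0 n \<omega> k j))\<^sup>2 \<le> C * (real (s2 n) / h n))" for C n \<omega>
  have D_sel: "nobs (D n \<omega>) = n" "ncov (D n \<omega>) = d n" "bw (D n \<omega>) = h n" "kern (D n \<omega>) = K" "ll (D n \<omega>) = L"
    "idx (D n \<omega>) = (\<lambda>i. U n i \<omega>)" "cov (D n \<omega>) = (\<lambda>i j. x n i j \<omega>)" "resp (D n \<omega>) = (\<lambda>i. y n i \<omega>)" for n \<omega>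
    by (simp_all add: D_eq)
  have tp: "true_pred (D n \<omega>) (a n) i = (\<Sum>j=1..d n. a n j (U n i \<omega>) * x n i j \<omega>)" for n \<omega> i
    by (simp add: true_pred_def D_sel)
  \<comment> \<open>The purely deterministic half: \<open>CV\<close> and the threshold for
    \<open>n\<close> depend on \<open>Crow\<close> and \<open>C9\<close> only, not on the sample
    point.\<close>
  have key: "\<exists>CV. \<forall>\<^sub>F n in sequentially. \<forall>\<omega>\<in>space (M n). G1 n \<omega> \<and> G2 n \<omega> \<and> G3 n \<omega> \<and> G4 n \<omega> \<and> G5 n \<omega>
      \<and> G6 n \<omega> \<and> G7 n \<omega> \<and> H1 Crow n \<omega> \<and> H2 C9 n \<omega> \<longrightarrow> Concl CV n \<omega>"
    if Crow: "0 \<le> Crow" and C9: "0 \<le> C9" for Crow C9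
  proof -
    have AB: "0 \<le> A + B0'" and k2: "0 \<le> \<kappa>\<^sup>2 * C2x" and k3: "0 \<le> \<kappa> ^ 3 * C2x"
      using A B0' C2x \<kappa>0 by auto
    note dr = rt.deterministic_rates[OF Ca(1) k2 k3 AB c2c(1) c6b_signal(1) Crow C9 \<delta>, of \<kappa>]
    obtain CV where CV: "\<forall>\<^sub>F n in sequentially. (4 / \<rho>1\<^sup>2) * (2 * (C9 * real (s2 n) / h n) + 4 * real n * real (s2 n) *
        (\<kappa>\<^sup>2 * C2x * (real (s2 n) * Ca * \<kappa>\<^sup>2 * (h n)\<^sup>2) + 3 * (\<kappa> ^ 3 * C2x) *
        (real (s2 n) * Ca * \<kappa>\<^sup>2 * (h n)\<^sup>2 + 2 * (1 + b n) * sqrt (2 * s2 n) *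
        (8 * max (lam1 n) (lam2 n) * (2 * (1 + b n) + 1) * sqrt (2 * s2 n) / \<rho>1))\<^sup>2)\<^sup>2) \<le> CV * (real (s2 n) / h n)"
      using dr(2) unfolding b_eq by blast
    have "\<forall>\<^sub>F n in sequentially. \<forall>\<omega>\<in>space (M n). G1 n \<omega> \<and> G2 n \<omega> \<and> G3 n \<omega> \<and> G4 n \<omega> \<and> G5 n \<omega>
      \<and> G6 n \<omega> \<and> G7 n \<omega> \<and> H1 Crow n \<omega> \<and> H2 C9 n \<omega> \<longrightarrow> Concl CV n \<omega>"
      using CV dr(1) rt.ge1
    proof eventually_elim
      case (elim n)
      show ?case
      proof (intro ballI impI)
        fix \<omega> assume \<omega>: "\<omega> \<in> space (M n)" and good: "G1 n \<omega> \<and> G2 n \<omega> \<and> G3 n \<omega> \<and> G4 n \<omega> \<and> G5 n \<omega>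
          \<and> G6 n \<omega> \<and> G7 n \<omega> \<and> H1 Crow n \<omega> \<and> H2 C9 n \<omega>"
        have n: "1 \<le> n" by (rule elim(3))
        note sz = sizes[OF n]
        interpret F: scad_fit "D n \<omega>" "a n" "\<lambda>i. Mf n (W n i \<omega>, y n i \<omega>)" "At n \<omega>" "Bt n \<omega>" "s1 n" "s2 n"
          "lam1 n" "lam2 n" "lam4 n" "lam4s n" "b n" \<kappa> Ca C2x C2x "(A + B0') * rt.r n"
          "C9 * real (s2 n) / h n" Crow \<rho>1 bd
        proof (unfold_locales, unfold D_sel tp)
          show "0 < h n" "0 < lam1 n" "0 < lam2 n" "0 < lam4 n" "0 < lam4s n" using pos[OF n] by auto
          show "1 \<le> n" "1 \<le> \<kappa>" "0 \<le> Ca" "0 < \<rho>1" by (fact n \<kappa> Ca c2c)+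
          show "1 \<le> s1 n" "s1 n < s2 n" "s2 n < d n" using sz by auto
          show "U n i \<omega> \<in> {0..1}" if "i \<in> {1..n}" for i by (rule U_range[OF n that \<omega>])
          show "((\<lambda>r. L r (y n i \<omega>)) has_real_derivative q1 L t (y n i \<omega>)) (at t)" if "i \<in> {1..n}" for i t
            using L_diff(1)[OF y_range[OF n that \<omega>]] by (simp add: q1_def DERIV_deriv_iff_real_differentiable)
          show "((\<lambda>r. q1 L r (y n i \<omega>)) has_real_derivative q2 L t (y n i \<omega>)) (at t)" if "i \<in> {1..n}" for i t
            using L_diff(2)[OF y_range[OF n that \<omega>]] by (simp add: q2_def DERIV_deriv_iff_real_differentiable)
          show "q2 L t (y n i \<omega>) < 0" if "i \<in> {1..n}" for i t by (rule c2b_neg[OF y_range[OF n that \<omega>]])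
          show "0 \<le> Mf n (W n i \<omega>, y n i \<omega>)" if "i \<in> {1..n}" for i
            using good that by (auto simp: G4_def intro: less_imp_le)
          show "\<bar>q2 L ((\<Sum>j=1..d n. a n j (U n i \<omega>) * x n i j \<omega>) + t) (y n i \<omega>)
                - q2 L (\<Sum>j=1..d n. a n j (U n i \<omega>) * x n i j \<omega>) (y n i \<omega>)\<bar> \<le> Mf n (W n i \<omega>, y n i \<omega>) * \<bar>t\<bar>"
            if "i \<in> {1..n}" for i t
            using good that unfolding G4_def by blast
          show "\<And>z. 0 \<le> K z" by (rule c1(3))
          show "\<And>z. K z \<noteq> 0 \<Longrightarrow> \<bar>z\<bar> \<le> \<kappa>" by (rule \<kappa>(2))
          show "\<bar>a n j u - a n j v - D1 (a n j) v * (u - v)\<bar> \<le> Ca * (u - v)\<^sup>2"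
            if "j \<in> {1..d n}" "u \<in> {0..1}" "v \<in> {0..1}" for j u v
            by (rule C2_unit_taylor[OF c4(1)[OF n that(1)] Ca(2)[OF n that(1)] that(2,3)])
          have cst: "\<exists>c. \<forall>u\<in>{0..1}. a n j u = c" if "j \<in> {s1 n + 1..d n}" for j
          proof (cases "j \<le> s2 n")
            case True
            then show ?thesis using const[OF n, of j] that by auto
          next
            case False
            then show ?thesis using zero[OF n, of j] that by auto
          qed
          then show "\<exists>c. \<forall>u\<in>{0..1}. a n j u = c" if "j \<in> {s1 n + 1..d n}" for j using that .
          show "D1 (a n j) u = 0" if "j \<in> {s1 n + 1..d n}" "u \<in> {0..1}" for j u
            using cst[OF that(1)] D1_const[OF _ that(2)] by blast
          show "a n j u = 0" if "j \<in> {s2 n + 1..d n}" "u \<in> {0..1}" for j u using zero[OF n that(1)] that(2) by blast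
          show "(\<Sum>i=1..n. wt (D n \<omega>) (U n k \<omega>) i * \<bar>q2 L (\<Sum>j=1..d n. a n j (U n i \<omega>) * x n i j \<omega>) (y n i \<omega>)\<bar>
            * \<bar>x n i j \<omega>\<bar> * \<bar>x n i j' \<omega>\<bar>) \<le> C2x" if "k \<in> {1..n}" "j \<in> {1..d n}" "j' \<in> {1..d n}" for k j j'
            using good that unfolding G2_def tp by blast
          show "(\<Sum>i=1..n. wt (D n \<omega>) (U n k \<omega>) i * Mf n (W n i \<omega>, y n i \<omega>) * \<bar>x n i j \<omega>\<bar> * \<bar>x n i j' \<omega>\<bar> * \<bar>x n i j'' \<omega>\<bar>) \<le> C2x"
            if "k \<in> {1..n}" "j \<in> {1..d n}" "j' \<in> {1..d n}" "j'' \<in> {1..d n}" for k j j' j''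
          proof -
            have "Mf n (W n i \<omega>, y n i \<omega>) = \<bar>Mf n (W n i \<omega>, y n i \<omega>)\<bar>" if "i \<in> {1..n}" for i
            proof -
              have "0 < Mf n (W n i \<omega>, y n i \<omega>)" using good that unfolding G4_def by blast
              then show ?thesis by simp
            qed
            then have "(\<Sum>i=1..n. wt (D n \<omega>) (U n k \<omega>) i * Mf n (W n i \<omega>, y n i \<omega>) * \<bar>x n i j \<omega>\<bar> * \<bar>x n i j' \<omega>\<bar> * \<bar>x n i j'' \<omega>\<bar>)
              = (\<Sum>i=1..n. wt (D n \<omega>) (U n k \<omega>) i * \<bar>Mf n (W n i \<omega>, y n i \<omega>)\<bar> * \<bar>x n i j \<omega>\<bar> * \<bar>x n i j' \<omega>\<bar> * \<bar>x n i j'' \<omega>\<bar>)"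
              by (intro sum.cong refl) simp
            then show ?thesis using good that unfolding G3_def by auto
          qed
          show "is_arg_max (prelim_obj (D n \<omega>) (lam1 n) (lam2 n) k) (\<lambda>p. p \<in> vecs (d n) \<times> vecs (d n)) (At n \<omega> k, Bt n \<omega> k)"
            if "k \<in> {1..n}" for k using good that by (auto simp: G5_def)
          show "max (lam1 n / lam2 n) (lam2 n / lam1 n) \<le> b n" using \<delta> by (simp add: b_eq)
          show "\<rho>1 \<le> quad_form (2 * d n) (\<lambda>p q. - true_hess (D n \<omega>) (a n) u p q) v"
            if "u \<in> {0..1}" "v \<in> Omega0 (d n) (s2 n) (b n)" for u v using good that by (auto simp: G6_def)
          show "\<bar>true_score (D n \<omega>) (a n) k p\<bar> \<le> (A + B0') * rt.r n" if "k \<in> {1..n}" "p \<in> {1..2 * d n}" for k p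
            using good that by (auto simp: G1_def)
          show "(\<Sum>k=1..n. \<Sum>p\<in>{1..2 * d n} - noise_idx (d n) (s1 n) (s2 n). (true_score (D n \<omega>) (a n) k p)\<^sup>2) \<le> C9 * real (s2 n) / h n"
            using good by (simp add: H2_def)
          show "\<bar>\<Sum>q=1..2 * d n. true_hess (D n \<omega>) (a n) u k q * w q\<bar> \<le> Crow"
            if "k \<in> noise_idx (d n) (s1 n) (s2 n)" "u \<in> {0..1}" "w \<in> oracle_sphere (d n) (s1 n) (s2 n)" for k u w
            using good that by (auto simp: H1_def)
          show "bd * sqrt (real n) \<le> L2_set (\<lambda>k. a n j (U n k \<omega>)) {1..n}" if "j \<in> {1..s2 n}" for j
            using good that by (auto simp: G7_def A0_eq)
          show "bd * sqrt (real n) \<le> centred_norm n (\<lambda>k. a n j (U n k \<omega>))" if "j \<in> {1..s1 n}" for j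
            using good that by (auto simp: G7_def A0_eq)
        qed
        note defs = F.VV_def F.Err_def F.dv_def F.R_def F.ep_def F.C2'_def F.C3'_def D_sel
        have VV: "F.VV \<le> CV * (real (s2 n) / h n)" using elim(1) unfolding defs .
        have N: "(A + B0') * rt.r n + F.C2' * F.ep + 3 * F.C3' * F.ep\<^sup>2 \<le> min (lam1 n) (lam2 n) / 4"
          "F.C3' * F.dv * ((2 * (1 + b n))\<^sup>2 * (2 * real (s2 n))) \<le> \<rho>1 / 2"
          "sqrt (nobs (D n \<omega>)) * ((A + B0') * rt.r n + F.Err) + (Crow + F.C3' * F.dv * sqrt (2 * s2 n)) * sqrt F.VV < min (lam4 n) (lam4s n)"
          "3.7 * max (lam4 n) (lam4s n) + sqrt (nobs (D n \<omega>)) * F.R \<le> bd * sqrt (nobs (D n \<omega>))"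
          "sqrt (nobs (D n \<omega>)) * F.R \<le> min (lam4 n) (lam4s n)"
          using elim(2) unfolding defs unfolding b_eq by blast+
        have AB0: "F.A0 = A0 n \<omega>" "F.B0 = B0 n \<omega>"
          by (simp_all add: fun_eq_iff F.A0_def F.B0_def A0_eq B0_eq D_sel)
        obtain A' B' where res: "(A', B') \<in> oracle_arrays n (d n) (s1 n) (s2 n)"
          "\<And>q. q \<in> arrays n (d n) \<times> arrays n (d n) \<Longrightarrow> obj n \<omega> q \<le> obj n \<omega> (A', B')"
          "\<And>q. q \<in> arrays n (d n) \<times> arrays n (d n) \<Longrightarrow> obj n \<omega> (A', B') \<le> obj n \<omega> q \<Longrightarrow> q = (A', B')"
          "(array_norm n (d n) (\<lambda>k j. A' k j - A0 n \<omega> k j))\<^sup>2 \<le> F.VV"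
          "(h n)\<^sup>2 * (array_norm n (d n) (\<lambda>k j. B' k j - B0 n \<omega> k j))\<^sup>2 \<le> F.VV"
          using F.oracle_max[OF Crow N] unfolding D_sel(1-3) AB0 obj_def by blast
        show "Concl CV n \<omega>" unfolding Concl_def
          using res(1,2,3) order_trans[OF res(4) VV] order_trans[OF res(5) VV] by blast
      qed
    qed
    then show ?thesis by blast
  qed
  \<comment> \<open>The probabilistic half, in which \<open>Crow\<close> and \<open>C9\<close> are
    chosen after \<epsilon>.\<close>
  have high: "\<exists>Crow C9. 0 \<le> Crow \<and> 0 \<le> C9 \<and> (\<forall>\<^sub>F n in sequentially. inner_prob_ge (M n) (1 - \<epsilon>)
      (\<lambda>\<omega>. G1 n \<omega> \<and> G2 n \<omega> \<and> G3 n \<omega> \<and> G4 n \<omega> \<and> G5 n \<omega> \<and> G6 n \<omega> \<and> G7 n \<omega> \<and> H1 Crow n \<omega> \<and> H2 C9 n \<omega>))"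
    if \<epsilon>: "0 < \<epsilon>" for \<epsilon> :: real
  proof -
    \<comment> \<open>Budget: the score costs two units because of its two kernel weights,
      \<open>G2\<close>, \<open>G3\<close>, \<open>G5\<close>, \<open>G6\<close>, \<open>G7\<close>,
      \<open>H1\<close> and \<open>H2\<close> cost one each, and \<open>G4\<close> holds almost
      surely.\<close>
    define e where "e = \<epsilon> / 9"
    have e: "0 < e" using \<epsilon> by (simp add: e_def)
    obtain C where C: "\<forall>\<^sub>F n in sequentially. \<exists>E\<in>sets (M n). measure (M n) E \<ge> 1 - e \<and> (\<forall>\<omega>\<in>E.
        \<bar>SUP k\<in>noise_idx (d n) (s1 n) (s2 n). SUP u\<in>{0..1}. SUP w\<in>oracle_sphere (d n) (s1 n) (s2 n).
               ereal \<bar>\<Sum>q=1..2 * d n. true_hess (D n \<omega>) (a n) u k q * w q\<bar>\<bar> \<le> ereal (C * 1))"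
      using c6b_rows e unfolding bigO_P_def by blast
    define Crow where "Crow = max 0 C"
    define C9 where "C9 = (4 * (B0' * (Cmo * \<kappa>)) + 4 * (B0'\<^sup>2 * Cmo)) / e"
    have C9: "0 \<le> C9" using B0' Cmo \<kappa>0 e by (simp add: C9_def)
    note wp = wp_to_1_iff[OF prob, THEN iffD1, rule_format, OF _ e]
    have "\<forall>\<^sub>F n in sequentially. inner_prob_ge (M n) (1 - \<epsilon>)
      (\<lambda>\<omega>. G1 n \<omega> \<and> G2 n \<omega> \<and> G3 n \<omega> \<and> G4 n \<omega> \<and> G5 n \<omega> \<and> G6 n \<omega> \<and> G7 n \<omega> \<and> H1 Crow n \<omega> \<and> H2 C9 n \<omega>)"
      using C wp[OF prelim] wp[OF c2c(3)] wp[OF c6b_signal(2)] rt.ge1 rt.stochastic_rates[OF e Cmo \<kappa>0 B0']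
        rt.r_small[OF zero_less_one] rt.L_large[of 1]
    proof eventually_elim
      case (elim n)
      note n = elim(5)
      note sz = sizes[OF n]
      interpret S: sample "M n" n "d n" "s1 n" "s2 n" "U n" "x n" "y n" Y L "a n" K fU "h n" m0 Cm cU \<kappa> Kmax
        "Mf n" "W n" "Q1 n" "Q2 n" "D n" by (rule samp[OF n])
      have hn: "0 < h n" using pos[OF n] by simp
      have Cm_eq: "S.Cmom = Cmo" by (simp add: S.Cmom_def Cmo_def)
      have Bw: "\<kappa> * Kmax / h n = B0' / h n" by (simp add: B0'_def)
      let ?T = "rt.T n"
      have T: "0 < ?T" "0 < rt.tilt n" "rt.tilt n * (?T * (B0' / h n)) \<le> 1" "?T * (B0' / h n) / real n \<le> 1"
        "?T * (B0' / h n) / real n \<le> B0' * rt.r n" using elim(6) by auto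
      let ?nd = "real n * real (d n) ^ 3"
      have p1: "?nd * (Cmo / ?T powr m0 + exp (- (real n * Cmo * \<kappa> / (?T * (B0' / h n))))) \<le> e"
        using elim(6) by auto
      have p2: "?nd * (Cmo / ?T powr m0 + 2 * exp (real n * ((rt.tilt n * ?T powr (1 - m0)
           + (rt.tilt n)\<^sup>2 * (B0' / h n)) * (Cmo * \<kappa>)) - rt.tilt n * (real n * A * rt.r n))) \<le> e"
        using elim(6) unfolding A_def by auto
      have g1: "inner_prob_ge (M n) (1 - 2 * e) (G1 n)"
      proof (rule inner_prob_ge_mono[OF S.score_event[OF T(1,2) T(3)[folded Bw], where t = "real n * A * rt.r n"]])
        fix \<omega> assume *: "\<forall>k\<in>{1..n}. \<forall>p\<in>{1..2 * d n}. \<bar>true_score (D n \<omega>) (a n) k p\<bar>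
          \<le> (real n * A * rt.r n + ?T * (\<kappa> * Kmax / h n)) / real n"
        have "(real n * A * rt.r n + ?T * (\<kappa> * Kmax / h n)) / real n = A * rt.r n + ?T * (B0' / h n) / real n"
          using n unfolding Bw by (simp add: add_divide_distrib)
        also have "\<dots> \<le> (A + B0') * rt.r n" using T(5) by (simp add: distrib_right)
        finally show "G1 n \<omega>" using * unfolding G1_def by (meson order_trans)
      qed (use p2 in \<open>simp add: Cm_eq Bw\<close>)
      have bnd: "(3 * real n * Cmo * \<kappa> + ?T * (B0' / h n)) / real n \<le> C2x"
        using T(4) n by (simp add: C2x_def add_divide_distrib)
      have g2: "inner_prob_ge (M n) (1 - e) (G2 n)"
      proof (rule inner_prob_ge_mono[OF S.hessian_event[OF T(1)]])
        fix \<omega> assume "\<forall>k\<in>{1..n}. \<forall>j\<in>{1..d n}. \<forall>j'\<in>{1..d n}. (\<Sum>i=1..n. wt (D n \<omega>) (U n k \<omega>) i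
          * \<bar>q2 L (true_pred (D n \<omega>) (a n) i) (y n i \<omega>)\<bar> * \<bar>x n i j \<omega>\<bar> * \<bar>x n i j' \<omega>\<bar>)
          \<le> (3 * real n * S.Cmom * \<kappa> + ?T * (\<kappa> * Kmax / h n)) / real n"
        then show "G2 n \<omega>" using bnd unfolding G2_def Cm_eq Bw by (meson order_trans)
      qed (use p1 in \<open>simp add: Cm_eq Bw\<close>)
      have g3: "inner_prob_ge (M n) (1 - e) (G3 n)"
      proof (rule inner_prob_ge_mono[OF S.third_event[OF T(1)]])
        fix \<omega> assume "\<forall>k\<in>{1..n}. \<forall>j\<in>{1..d n}. \<forall>j'\<in>{1..d n}. \<forall>j''\<in>{1..d n}. (\<Sum>i=1..n. wt (D n \<omega>) (U n k \<omega>) i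
          * \<bar>Mf n (W n i \<omega>, y n i \<omega>)\<bar> * \<bar>x n i j \<omega>\<bar> * \<bar>x n i j' \<omega>\<bar> * \<bar>x n i j'' \<omega>\<bar>)
          \<le> (3 * real n * S.Cmom * \<kappa> + ?T * (\<kappa> * Kmax / h n)) / real n"
        then show "G3 n \<omega>" using bnd unfolding G3_def Cm_eq Bw by (meson order_trans)
      qed (use p1 in \<open>simp add: Cm_eq Bw\<close>)
      have "AE \<omega> in M n. G4 n \<omega>" unfolding G4_def by (intro AE_finite_allI Mf(2)[OF n]) auto
      then have g4: "inner_prob_ge (M n) (1 - 0) (G4 n)" using S.inner_prob_ge_AE by simp
      have g5: "inner_prob_ge (M n) (1 - e) (G5 n)" using elim(2) unfolding G5_def .
      have g6: "inner_prob_ge (M n) (1 - e) (G6 n)"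
      proof (rule inner_prob_ge_mono[OF elim(3)])
        fix \<omega> assume "ereal \<rho>1 \<le> (INF u\<in>{0..1}. INF v\<in>Omega0 (d n) (s2 n) (b n).
              ereal (quad_form (2 * d n) (\<lambda>p q. - true_hess (D n \<omega>) (a n) u p q) v)) \<and>
           (SUP u\<in>{0..1}. SUP v\<in>Omega0 (d n) (s2 n) (b n).
              ereal (quad_form (2 * d n) (\<lambda>p q. - true_hess (D n \<omega>) (a n) u p q) v)) \<le> ereal \<rho>2"
        then show "G6 n \<omega>" unfolding G6_def by (auto simp: le_INF_iff)
      qed simp
      have g7: "inner_prob_ge (M n) (1 - e) (G7 n)"
      proof (rule inner_prob_ge_mono[OF elim(4)])
        fix \<omega> assume *: "(MIN j\<in>{1..s2 n}. L2_set (\<lambda>k. A0 n \<omega> k j) {1..n}) \<ge> bd * sqrt (real n) \<and>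
           (MIN j\<in>{1..s1 n}. centred_norm n (\<lambda>k. A0 n \<omega> k j)) \<ge> bd * sqrt (real n)"
        show "G7 n \<omega>" unfolding G7_def
        proof (intro conjI ballI)
          fix j assume "j \<in> {1..s2 n}"
          then show "bd * sqrt (real n) \<le> L2_set (\<lambda>k. A0 n \<omega> k j) {1..n}"
            by (intro Min_ge_D[OF conjunct1[OF *]]) auto
        next
          fix j assume "j \<in> {1..s1 n}"
          then show "bd * sqrt (real n) \<le> centred_norm n (\<lambda>k. A0 n \<omega> k j)"
            by (intro Min_ge_D[OF conjunct2[OF *]]) auto
        qed
      qed simp
      have h1: "inner_prob_ge (M n) (1 - e) (H1 Crow n)"
      proof -
        have "inner_prob_ge (M n) (1 - e) (\<lambda>\<omega>. \<bar>SUP k\<in>noise_idx (d n) (s1 n) (s2 n). SUP u\<in>{0..1}. SUP w\<in>oracle_sphere (d n) (s1 n) (s2 n).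
               ereal \<bar>\<Sum>q=1..2 * d n. true_hess (D n \<omega>) (a n) u k q * w q\<bar>\<bar> \<le> ereal (C * 1))"
          using elim(1) by (auto simp: inner_prob_ge_def)
        then show ?thesis
        proof (rule inner_prob_ge_mono)
          fix \<omega> assume *: "\<bar>SUP k\<in>noise_idx (d n) (s1 n) (s2 n). SUP u\<in>{0..1}. SUP w\<in>oracle_sphere (d n) (s1 n) (s2 n).
               ereal \<bar>\<Sum>q=1..2 * d n. true_hess (D n \<omega>) (a n) u k q * w q\<bar>\<bar> \<le> ereal (C * 1)"
          have "(SUP k\<in>noise_idx (d n) (s1 n) (s2 n). SUP u\<in>{0..1}. SUP w\<in>oracle_sphere (d n) (s1 n) (s2 n).
               ereal \<bar>\<Sum>q=1..2 * d n. true_hess (D n \<omega>) (a n) u k q * w q\<bar>) \<le> ereal C"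
            by (rule order_trans[OF _ *[simplified]]) (rule ereal_abs_leD[OF order_refl])
          then show "H1 Crow n \<omega>" unfolding H1_def Crow_def by (auto simp: SUP_le_iff intro: max.coboundedI2)
        qed simp
      qed
      have h2: "inner_prob_ge (M n) (1 - e) (H2 C9 n)"
      proof (rule inner_prob_ge_mono[OF S.mean_square_score_event[OF e]])
        fix \<omega> assume *: "(\<Sum>k=1..n. \<Sum>p\<in>{1..2 * d n} - noise_idx (d n) (s1 n) (s2 n). (true_score (D n \<omega>) (a n) k p)\<^sup>2)
          \<le> 2 * real (s2 n) * ((2 * (real n * (\<kappa> * Kmax / h n * (S.Cmom * \<kappa>))) + 2 * ((\<kappa> * Kmax / h n)\<^sup>2 * S.Cmom)) / real n) / e"
        \<comment> \<open>From \<open>r \<le> 1\<close> and \<open>L \<ge> 1\<close>. It lets the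
          contribution of the k-th summands, with its additional factor \<open>1 / (n * h)\<close>,
          be absorbed into \<open>C9\<close>.\<close>
        have nh: "1 \<le> real n * h n"
        proof -
          have "rt.L n / (real n * h n) \<le> 1" using elim(7) by (simp add: rt.r_def)
          then have "rt.L n \<le> real n * h n" using hn n by (simp add: pos_divide_le_eq)
          then show ?thesis using elim(8) by linarith
        qed
        have "(2 * (real n * (B0' / h n * (Cmo * \<kappa>))) + 2 * ((B0' / h n)\<^sup>2 * Cmo)) / real n
            = (2 * (B0' * (Cmo * \<kappa>)) + 2 * (B0'\<^sup>2 * Cmo) * (1 / (real n * h n))) / h n"
          using hn n by (simp add: field_simps power2_eq_square)
        also have "\<dots> \<le> (2 * (B0' * (Cmo * \<kappa>)) + 2 * (B0'\<^sup>2 * Cmo) * 1) / h n"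
        proof -
          have "1 / (real n * h n) \<le> 1" using nh by simp
          then show ?thesis using hn Cmo by (intro divide_right_mono add_left_mono mult_left_mono) auto
        qed
        finally have "2 * real (s2 n) * ((2 * (real n * (B0' / h n * (Cmo * \<kappa>))) + 2 * ((B0' / h n)\<^sup>2 * Cmo)) / real n) / e
            \<le> 2 * real (s2 n) * ((2 * (B0' * (Cmo * \<kappa>)) + 2 * (B0'\<^sup>2 * Cmo) * 1) / h n) / e"
          using e by (intro divide_right_mono mult_left_mono) auto
        also have "\<dots> = C9 * real (s2 n) / h n" using e hn by (simp add: C9_def field_simps)
        finally show "H2 C9 n \<omega>" using * unfolding H2_def Cm_eq Bw by linarith
      qed simp
      have "inner_prob_ge (M n) (1 - (2 * e + (e + (e + (0 + (e + (e + (e + (e + e)))))))))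
        (\<lambda>\<omega>. G1 n \<omega> \<and> G2 n \<omega> \<and> G3 n \<omega> \<and> G4 n \<omega> \<and> G5 n \<omega> \<and> G6 n \<omega> \<and> G7 n \<omega> \<and> H1 Crow n \<omega> \<and> H2 C9 n \<omega>)"
        by (intro S.inner_prob_ge_conj g1 g2 g3 g4 g5 g6 g7 h1 h2)
      then show ?case by (rule inner_prob_ge_mono) (auto simp: e_def)
    qed
    then show ?thesis using C9 by (intro exI[of _ Crow] exI[of _ C9]) (auto simp: Crow_def)
  qed
  have main: "\<exists>CV. \<forall>\<^sub>F n in sequentially. inner_prob_ge (M n) (1 - \<epsilon>) (Concl CV n)" if \<epsilon>: "0 < \<epsilon>" for \<epsilon> :: real
  proof -
    obtain Crow C9 where C: "0 \<le> Crow" "0 \<le> C9" "\<forall>\<^sub>F n in sequentially. inner_prob_ge (M n) (1 - \<epsilon>)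
      (\<lambda>\<omega>. G1 n \<omega> \<and> G2 n \<omega> \<and> G3 n \<omega> \<and> G4 n \<omega> \<and> G5 n \<omega> \<and> G6 n \<omega> \<and> G7 n \<omega> \<and> H1 Crow n \<omega> \<and> H2 C9 n \<omega>)"
      using high[OF \<epsilon>] by blast
    obtain CV where "\<forall>\<^sub>F n in sequentially. \<forall>\<omega>\<in>space (M n). G1 n \<omega> \<and> G2 n \<omega> \<and> G3 n \<omega> \<and> G4 n \<omega> \<and> G5 n \<omega>
      \<and> G6 n \<omega> \<and> G7 n \<omega> \<and> H1 Crow n \<omega> \<and> H2 C9 n \<omega> \<longrightarrow> Concl CV n \<omega>" using key[OF C(1,2)] by blast
    with C(3) have "\<forall>\<^sub>F n in sequentially. inner_prob_ge (M n) (1 - \<epsilon>) (Concl CV n)"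
      by eventually_elim (erule inner_prob_ge_mono[OF _ order_refl], blast)
    then show ?thesis by blast
  qed
  define est where "est n \<omega> = oracle_est (D n \<omega>) (s1 n) (s2 n) (At n \<omega>) (Bt n \<omega>) (lam4 n) (lam4s n)" for n \<omega>
  \<comment> \<open>Uniqueness pins down the value that \<open>arg_max\<close> selects, on both
    domains, so the two estimators coincide with the explicit maximiser.\<close>
  have concl: "((\<exists>!p. is_arg_max (obj n \<omega>) (\<lambda>p. p \<in> arrays n (d n) \<times> arrays n (d n)) p) \<and>
           (\<exists>!p. is_arg_max (obj n \<omega>) (\<lambda>p. p \<in> oracle_arrays n (d n) (s1 n) (s2 n)) p) \<and>
           scad_est (D n \<omega>) (At n \<omega>) (Bt n \<omega>) (lam4 n) (lam4s n) = est n \<omega>)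
      \<and> (array_norm n (d n) (\<lambda>k j. fst (est n \<omega>) k j - A0 n \<omega> k j))\<^sup>2 \<le> C * (real (s2 n) / h n)
      \<and> (h n)\<^sup>2 * (array_norm n (d n) (\<lambda>k j. snd (est n \<omega>) k j - B0 n \<omega> k j))\<^sup>2 \<le> C * (real (s2 n) / h n)"
    if concl: "Concl C n \<omega>" for C n \<omega>
  proof -
    obtain A' B' where res: "(A', B') \<in> oracle_arrays n (d n) (s1 n) (s2 n)"
      "\<forall>q\<in>arrays n (d n) \<times> arrays n (d n). obj n \<omega> q \<le> obj n \<omega> (A', B')"
      "\<forall>q\<in>arrays n (d n) \<times> arrays n (d n). obj n \<omega> (A', B') \<le> obj n \<omega> q \<longrightarrow> q = (A', B')"
      "(array_norm n (d n) (\<lambda>k j. A' k j - A0 n \<omega> k j))\<^sup>2 \<le> C * (real (s2 n) / h n)"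
      "(h n)\<^sup>2 * (array_norm n (d n) (\<lambda>k j. B' k j - B0 n \<omega> k j))\<^sup>2 \<le> C * (real (s2 n) / h n)"
      using concl unfolding Concl_def by blast
    have sub: "oracle_arrays n (d n) (s1 n) (s2 n) \<subseteq> arrays n (d n) \<times> arrays n (d n)"
      by (auto simp: oracle_arrays_def)
    note u = is_arg_max_unique[where f = "obj n \<omega>", OF res(1) sub res(2,3)]
    have e: "is_arg_max (obj n \<omega>) (\<lambda>p. p \<in> oracle_arrays n (d n) (s1 n) (s2 n)) = (\<lambda>q. q = (A', B'))"
      "is_arg_max (obj n \<omega>) (\<lambda>p. p \<in> arrays n (d n) \<times> arrays n (d n)) = (\<lambda>q. q = (A', B'))"
      by (intro ext u)+
    have "est n \<omega> = (A', B')" "scad_est (D n \<omega>) (At n \<omega>) (Bt n \<omega>) (lam4 n) (lam4s n) = (A', B')"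
      unfolding est_def oracle_est_def scad_est_def arg_max_def D_sel obj_def[symmetric] by (simp_all add: e)
    then show ?thesis using res(4,5) u by simp
  qed
  \<comment> \<open>\<open>CV\<close> varies with \<epsilon> but is absent from this claim, so the
    probability tends to one although \<open>H1\<close> and \<open>H2\<close> are only available at
    fixed levels.\<close>
  have c1': "wp_to_1 M (\<lambda>n \<omega>. (\<exists>!p. is_arg_max (obj n \<omega>) (\<lambda>p. p \<in> arrays n (d n) \<times> arrays n (d n)) p) \<and>
           (\<exists>!p. is_arg_max (obj n \<omega>) (\<lambda>p. p \<in> oracle_arrays n (d n) (s1 n) (s2 n)) p) \<and>
           scad_est (D n \<omega>) (At n \<omega>) (Bt n \<omega>) (lam4 n) (lam4s n) = est n \<omega>)"
    unfolding wp_to_1_iff[OF prob]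
  proof (intro allI impI)
    fix \<epsilon> :: real assume "0 < \<epsilon>"
    then obtain CV where "\<forall>\<^sub>F n in sequentially. inner_prob_ge (M n) (1 - \<epsilon>) (Concl CV n)" using main by blast
    then show "\<forall>\<^sub>F n in sequentially. inner_prob_ge (M n) (1 - \<epsilon>)
      (\<lambda>\<omega>. (\<exists>!p. is_arg_max (obj n \<omega>) (\<lambda>p. p \<in> arrays n (d n) \<times> arrays n (d n)) p) \<and>
           (\<exists>!p. is_arg_max (obj n \<omega>) (\<lambda>p. p \<in> oracle_arrays n (d n) (s1 n) (s2 n)) p) \<and>
           scad_est (D n \<omega>) (At n \<omega>) (Bt n \<omega>) (lam4 n) (lam4s n) = est n \<omega>)"
      by eventually_elim (erule inner_prob_ge_mono, simp, drule concl, blast)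
  qed
  have c2': "bigO_P M (\<lambda>n \<omega>. ereal (1 / real n * (array_norm n (d n) (\<lambda>k j. fst (est n \<omega>) k j - A0 n \<omega> k j))\<^sup>2))
           (\<lambda>n. real (s2 n) / (real n * h n))"
    unfolding bigO_P_def
  proof (intro allI impI)
    fix \<epsilon> :: real assume "0 < \<epsilon>"
    then obtain CV where "\<forall>\<^sub>F n in sequentially. inner_prob_ge (M n) (1 - \<epsilon>) (Concl CV n)" using main by blast
    then have "\<forall>\<^sub>F n in sequentially. \<exists>E\<in>sets (M n). measure (M n) E \<ge> 1 - \<epsilon> \<and>
        (\<forall>\<omega>\<in>E. \<bar>ereal (1 / real n * (array_norm n (d n) (\<lambda>k j. fst (est n \<omega>) k j - A0 n \<omega> k j))\<^sup>2)\<bar>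
          \<le> ereal (CV * (real (s2 n) / (real n * h n))))" using rt.ge1
    proof eventually_elim
      case (elim n)
      obtain E where E: "E \<in> sets (M n)" "1 - \<epsilon> \<le> measure (M n) E" "\<And>\<omega>. \<omega> \<in> E \<Longrightarrow> Concl CV n \<omega>"
        using elim(1) by (auto simp: inner_prob_ge_def)
      have "\<bar>ereal (1 / real n * (array_norm n (d n) (\<lambda>k j. fst (est n \<omega>) k j - A0 n \<omega> k j))\<^sup>2)\<bar>
          \<le> ereal (CV * (real (s2 n) / (real n * h n)))" if "\<omega> \<in> E" for \<omega>
      proof -
        have "1 / real n * (array_norm n (d n) (\<lambda>k j. fst (est n \<omega>) k j - A0 n \<omega> k j))\<^sup>2
            \<le> 1 / real n * (CV * (real (s2 n) / h n))"
          using concl[OF E(3)[OF that]] by (intro mult_left_mono) auto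
        also have "\<dots> = CV * (real (s2 n) / (real n * h n))" by simp
        finally show ?thesis by simp
      qed
      then show ?case using E by blast
    qed
    then show "\<exists>C. \<forall>\<^sub>F n in sequentially. \<exists>E\<in>sets (M n). measure (M n) E \<ge> 1 - \<epsilon> \<and>
        (\<forall>\<omega>\<in>E. \<bar>ereal (1 / real n * (array_norm n (d n) (\<lambda>k j. fst (est n \<omega>) k j - A0 n \<omega> k j))\<^sup>2)\<bar>
          \<le> ereal (C * (real (s2 n) / (real n * h n))))" by blast
  qed
  have c3': "bigO_P M (\<lambda>n \<omega>. ereal (1 / real n * (array_norm n (d n) (\<lambda>k j. snd (est n \<omega>) k j - B0 n \<omega> k j))\<^sup>2))
           (\<lambda>n. real (s2 n) / (real n * (h n) ^ 3))"
    unfolding bigO_P_def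
  proof (intro allI impI)
    fix \<epsilon> :: real assume "0 < \<epsilon>"
    then obtain CV where "\<forall>\<^sub>F n in sequentially. inner_prob_ge (M n) (1 - \<epsilon>) (Concl CV n)" using main by blast
    then have "\<forall>\<^sub>F n in sequentially. \<exists>E\<in>sets (M n). measure (M n) E \<ge> 1 - \<epsilon> \<and>
        (\<forall>\<omega>\<in>E. \<bar>ereal (1 / real n * (array_norm n (d n) (\<lambda>k j. snd (est n \<omega>) k j - B0 n \<omega> k j))\<^sup>2)\<bar>
          \<le> ereal (CV * (real (s2 n) / (real n * (h n) ^ 3))))" using rt.ge1
    proof eventually_elim
      case (elim n)
      have hn: "0 < h n" using pos[OF elim(2)] by simp
      obtain E where E: "E \<in> sets (M n)" "1 - \<epsilon> \<le> measure (M n) E" "\<And>\<omega>. \<omega> \<in> E \<Longrightarrow> Concl CV n \<omega>"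
        using elim(1) by (auto simp: inner_prob_ge_def)
      have "\<bar>ereal (1 / real n * (array_norm n (d n) (\<lambda>k j. snd (est n \<omega>) k j - B0 n \<omega> k j))\<^sup>2)\<bar>
          \<le> ereal (CV * (real (s2 n) / (real n * (h n) ^ 3)))" if "\<omega> \<in> E" for \<omega>
      proof -
        let ?X = "(array_norm n (d n) (\<lambda>k j. snd (est n \<omega>) k j - B0 n \<omega> k j))\<^sup>2"
        have "(h n)\<^sup>2 * ?X \<le> CV * (real (s2 n) / h n)" using concl[OF E(3)[OF that]] by blast
        \<comment> \<open>Undoing the scaling of the slopes divides by \<open>h^2\<close> and turns
          \<open>h\<close> into \<open>h^3\<close> in the rate.\<close>
        then have "?X \<le> CV * (real (s2 n) / h n) / (h n)\<^sup>2" using hn by (simp add: pos_le_divide_eq mult.commute)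
        then have "1 / real n * ?X \<le> 1 / real n * (CV * (real (s2 n) / h n) / (h n)\<^sup>2)"
          by (intro mult_left_mono) auto
        also have "\<dots> = CV * (real (s2 n) / (real n * (h n) ^ 3))" by (simp add: power3_eq_cube power2_eq_square)
        finally show ?thesis by simp
      qed
      then show ?case using E by blast
    qed
    then show "\<exists>C. \<forall>\<^sub>F n in sequentially. \<exists>E\<in>sets (M n). measure (M n) E \<ge> 1 - \<epsilon> \<and>
        (\<forall>\<omega>\<in>E. \<bar>ereal (1 / real n * (array_norm n (d n) (\<lambda>k j. snd (est n \<omega>) k j - B0 n \<omega> k j))\<^sup>2)\<bar>
          \<le> ereal (C * (real (s2 n) / (real n * (h n) ^ 3))))" by blast
  qed
  show ?thesis using c1' c2' c3' unfolding est_def obj_def by blast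
qed

end
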